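(* Let $\Bbbk$ be a field and let $A$ be a monomial algebra over $\Bbbk$. There is a canonical $A_\infty$-algebra structure $(\mu_n)_{n\geqslant 2}$ on $\mathrm{Ext}_A=\mathrm{Ext}_A(\Bbbk,\Bbbk)$ given as follows. If $n\geqslant 2$ and $\gamma_1^\vee,\ldots,\gamma_n^\vee$ are chains in $\mathrm{Ext}_A$ of lengths $r_1,\ldots,r_n$, respectively, then $$\mu_n(\gamma_1^\vee\otimes\cdots\otimes\gamma_n^\vee)=(-1)^M\gamma^\vee$$ if the concatenation $\gamma=\gamma_1\cdots\gamma_n$ is a chain of length $r=r_1+\cdots+r_n+1$, where $M$ is the integer $$M=\binom{n+1}{2}-1+\sum_{i<j}r_i(r_j+1)+r_1+r .$$ Otherwise, this higher product is zero.
   Context: A monomial algebra is a quotient $A=\Bbbk\langle x_1,\ldots,x_k\rangle/(R)$ of a free algebra on finitely many variables by the ideal generated by a finite set $R$ of monomials; $R$ is taken minimal (no element of $R$ divides another) and its elements have length at least $2$. $A$ is augmented and weight graded by word length. A monomial is normal if no element of $R$ divides it; normal monomials form a basis of $A$, all other monomials are $0$ in $A$. For nonempty normal monomials $u,v$, "$uv=0$ minimally" means that $uv=0$ in $A$ but $uv'\neq 0$ in $A$ for every proper prefix $v'$ of $v$. For $r\geqslant 0$, an $r$-chain (chain of length $r$) is a monomial $u_0u_1\cdots u_r$ with $u_0$ a variable, $u_1,\ldots,u_r$ nonempty normal monomials, and $u_ju_{j+1}=0$ minimally for $j=0,\ldots,r-1$; the factorization and $r$ are determined by the monomial, and the chain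 corresponds to the bar cycle $[u_0|\cdots|u_r]$. The $r$-chains form a basis of $\mathrm{Tor}_A^{r+1}(\Bbbk,\Bbbk)$. $BA$ is the bar construction of $A$ in positive degrees: basis $[a_1|\cdots|a_n]$, $n\geqslant1$, with $a_i$ nonempty normal monomials, in degree $n$, differential $d[a_1|\cdots|a_n]=\sum_{i=1}^{n-1}(-1)^{i-1}[a_1|\cdots|a_ia_{i+1}|\cdots|a_n]$, deconcatenation coproduct. $(-)^\vee$ denotes the graded dual (with respect to homological degree and weight), so $BA^\vee$ is a dga algebra. $\mathrm{Ext}_A$ (in positive degrees) is identified with $\mathrm{Tor}_A^\vee$; for an $r$-chain $\gamma$, $\gamma^\vee\in\mathrm{Ext}_A^{r+1}$ is the element of the basis dual to the basis of chains. An $A_\infty$-algebra structure on $\mathrm{Ext}_A$ is called canonical if it is $A_\infty$-quasi-isomorphic to the dga algebra $BA^\vee$. Sign convention: $A_\infty$-coalgebras have maps $\Delta_n:V\to V^{\otimes n}$ of degree $n-2$ satisfying $\sum_{r+s+t=n}(-1)^{r+st}(1^{\otimes r}\otimes\Delta_s\otimes1^{\otimes t})\Delta_{r+1+t}=0$, and $A_\infty$-algebra structures satisfy the identities obtained by dualizing these with the Koszul sign rule, namely $\sum_{r+s+t=n}(-1)^{r+s+rs}\mu_{r+1+t}(1^{\otimes r}\otimes\mu_s\otimes1^{\otimes t})=0$; here $\mu_1=0$.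
   Formalization: The A∞-algebra identities (and matching morphism identities) are taken with sign (-1)^{r+st} instead of (-1)^{r+s+rs}; with the latter and the displayed M the claim fails in characteristic ≠ 2, e.g. for relations xxyx, yxy, yyx on (x,x,y,x,y). *)

theory Defs
  imports Complex_Main "HOL-Library.Poly_Mapping" "HOL-Library.Function_Algebras"
    "HOL-Library.Sublist"
begin

section \<open>Graded vector spaces inside an ambient vector space\<close>

text \<open>
  A graded vector space is a family \<open>V\<close> of independent subspaces of an ambient vector space with
  scalar multiplication \<open>sc\<close>; the space itself is the (internal) direct sum \<open>total_space sc V\<close>.
\<close>

definition total_space :: "('k::field \<Rightarrow> 'v::ab_group_add \<Rightarrow> 'v) \<Rightarrow> ('i \<Rightarrow> 'v set) \<Rightarrow> 'v set" where
  "total_space sc V = module.span sc (\<Union>i. V i)"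

definition graded_space :: "('k::field \<Rightarrow> 'v::ab_group_add \<Rightarrow> 'v) \<Rightarrow> ('i \<Rightarrow> 'v set) \<Rightarrow> bool" where
  "graded_space sc V \<longleftrightarrow>
     vector_space sc \<and> (\<forall>i. module.subspace sc (V i)) \<and>
     (\<forall>I v. finite I \<and> (\<forall>i\<in>I. v i \<in> V i) \<and> (\<Sum>i\<in>I. v i) = 0 \<longrightarrow> (\<forall>i\<in>I. v i = 0))"

definition linear_on ::
  "('k::field \<Rightarrow> 'v::ab_group_add \<Rightarrow> 'v) \<Rightarrow> ('k \<Rightarrow> 'w::ab_group_add \<Rightarrow> 'w) \<Rightarrow> 'v set \<Rightarrow> ('v \<Rightarrow> 'w) \<Rightarrow> bool"
where
  "linear_on sc sc' S f \<longleftrightarrow>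
     (\<forall>x\<in>S. \<forall>y\<in>S. f (x + y) = f x + f y) \<and> (\<forall>c. \<forall>x\<in>S. f (sc c x) = sc' c (f x))"

definition fun_scale :: "'k::field \<Rightarrow> ('x \<Rightarrow> 'k) \<Rightarrow> ('x \<Rightarrow> 'k)" where
  "fun_scale c \<phi> = (\<lambda>x. c * \<phi> x)"

text \<open>
  Component \<open>i\<close> of the graded dual of the quotient of \<open>total_space sc V\<close> by \<open>B\<close>: functionals on
  \<open>total_space sc V\<close> (extended by \<open>0\<close> outside it, so that equality of functionals is equality of
  functions) which vanish on \<open>B\<close> and on all components of \<open>V\<close> except the \<open>i\<close>-th.
\<close>

definition gdual ::
  "('k::field \<Rightarrow> 'v::ab_group_add \<Rightarrow> 'v) \<Rightarrow> ('i \<Rightarrow> 'v set) \<Rightarrow> 'v set \<Rightarrow> 'i \<Rightarrow> ('v \<Rightarrow> 'k) set"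
where
  "gdual sc V B i =
     {\<phi>. linear_on sc (*) (total_space sc V) \<phi> \<and> (\<forall>x. x \<notin> total_space sc V \<longrightarrow> \<phi> x = 0) \<and>
         (\<forall>x\<in>B. \<phi> x = 0) \<and> (\<forall>j. j \<noteq> i \<longrightarrow> (\<forall>x\<in>V j. \<phi> x = 0))}"


section \<open>A-infinity algebras\<close>

text \<open>
  A linear map on the \<open>n\<close>-th tensor power of \<open>V\<close> is given as a multilinear map on lists of length
  \<open>n\<close>. \<open>homogeneous V ps vs\<close> says that the entries of \<open>vs\<close> are homogeneous of the degrees
  listed in \<open>ps\<close>.
\<close>

definition homogeneous :: "(int \<Rightarrow> 'v set) \<Rightarrow> int list \<Rightarrow> 'v list \<Rightarrow> bool" where
  "homogeneous V ps vs \<longleftrightarrow> list_all2 (\<lambda>p v. v \<in> V p) ps vs"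

definition graded_multilinear ::
  "('k::field \<Rightarrow> 'v::ab_group_add \<Rightarrow> 'v) \<Rightarrow> (int \<Rightarrow> 'v set) \<Rightarrow>
   ('k \<Rightarrow> 'w::ab_group_add \<Rightarrow> 'w) \<Rightarrow> (int \<Rightarrow> 'w set) \<Rightarrow> nat \<Rightarrow> int \<Rightarrow> ('v list \<Rightarrow> 'w) \<Rightarrow> bool"
where
  "graded_multilinear sc V sc' W n e f \<longleftrightarrow>
     (\<forall>ps vs. length vs = n \<and> homogeneous V ps vs \<longrightarrow> f vs \<in> W (sum_list ps + e)) \<and>
     (\<forall>vs i. length vs = n \<and> set vs \<subseteq> total_space sc V \<and> i < n \<longrightarrow>
        linear_on sc sc' (total_space sc V) (\<lambda>v. f (vs[i := v])))"

text \<open>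
  \<open>\<Sum> (-1)\<^bsup>r+st\<^esup> f\<^sub>r\<^sub>+\<^sub>1\<^sub>+\<^sub>t (1\<^bsup>\<otimes>r\<^esup> \<otimes> m\<^sub>s \<otimes> 1\<^bsup>\<otimes>t\<^esup>)\<close>, summed over \<open>r + s + t = n\<close> with \<open>s \<ge> 1\<close>, on
  homogeneous elements \<open>vs\<close> of degrees \<open>ps\<close>, \<open>n = length vs\<close>. Since \<open>m\<^sub>s\<close> has degree
  \<open>2 - s\<close>, the Koszul rule contributes the second sign.
\<close>

definition stasheff_sum ::
  "('k::field \<Rightarrow> 'w::ab_group_add \<Rightarrow> 'w) \<Rightarrow> (nat \<Rightarrow> 'v list \<Rightarrow> 'w) \<Rightarrow> (nat \<Rightarrow> 'v list \<Rightarrow> 'v) \<Rightarrow>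
   int list \<Rightarrow> 'v list \<Rightarrow> 'w"
where
  "stasheff_sum sc f m ps vs =
     (\<Sum>s\<in>{1..length vs}. \<Sum>r\<in>{0..length vs - s}.
        let t = length vs - s - r in
        sc ((-1) ^ (r + s * t) * (-1) powi ((2 - int s) * sum_list (take r ps)))
           (f (r + 1 + t) (take r vs @ [m s (take s (drop r vs))] @ drop (r + s) vs)))"

definition A_inf_algebra ::
  "('k::field \<Rightarrow> 'v::ab_group_add \<Rightarrow> 'v) \<Rightarrow> (int \<Rightarrow> 'v set) \<Rightarrow> (nat \<Rightarrow> 'v list \<Rightarrow> 'v) \<Rightarrow> bool"
where
  "A_inf_algebra sc V m \<longleftrightarrow>
     graded_space sc V \<and>
     (\<forall>n\<ge>1. graded_multilinear sc V sc V n (2 - int n) (m n)) \<and>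
     (\<forall>ps vs. vs \<noteq> [] \<and> homogeneous V ps vs \<longrightarrow> stasheff_sum sc m m ps vs = 0)"

fun blocks :: "nat list \<Rightarrow> 'v list \<Rightarrow> 'v list list" where
  "blocks [] vs = []"
| "blocks (i # is) vs = take i vs # blocks is (drop i vs)"

text \<open>
  \<open>\<Sum> (-1)\<^bsup>\<sigma>\<^esup> m'\<^sub>k (f\<^bsub>i1\<^esub> \<otimes> \<dots> \<otimes> f\<^bsub>ik\<^esub>)\<close> over the compositions \<open>i1 + \<dots> + ik = n\<close>, with
  \<open>\<sigma> = (k-1)(i1-1) + (k-2)(i2-1) + \<dots>\<close>. Since \<open>f\<^sub>i\<close> has degree \<open>1 - i\<close>, moving each
  \<open>f\<^sub>i\<close> past the arguments of the blocks to its left contributes the second, Koszul sign.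
\<close>

definition morphism_sum ::
  "('k::field \<Rightarrow> 'w::ab_group_add \<Rightarrow> 'w) \<Rightarrow> (nat \<Rightarrow> 'w list \<Rightarrow> 'w) \<Rightarrow> (nat \<Rightarrow> 'v list \<Rightarrow> 'w) \<Rightarrow>
   int list \<Rightarrow> 'v list \<Rightarrow> 'w"
where
  "morphism_sum sc m' f ps vs =
     (\<Sum>is\<in>{is. sum_list is = length vs \<and> 0 \<notin> set is}.
        let k = length is in
        sc ((-1) ^ (\<Sum>a<k. (k - 1 - a) * (is ! a - 1)) *
            (-1) powi (\<Sum>b<k. (1 - int (is ! b)) * sum_list (take (sum_list (take b is)) ps)))
           (m' k (map (\<lambda>bl. f (length bl) bl) (blocks is vs))))"

definition A_inf_morphism ::
  "('k::field \<Rightarrow> 'v::ab_group_add \<Rightarrow> 'v) \<Rightarrow> (int \<Rightarrow> 'v set) \<Rightarrow> (nat \<Rightarrow> 'v list \<Rightarrow> 'v) \<Rightarrow>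
   ('k \<Rightarrow> 'w::ab_group_add \<Rightarrow> 'w) \<Rightarrow> (int \<Rightarrow> 'w set) \<Rightarrow> (nat \<Rightarrow> 'w list \<Rightarrow> 'w) \<Rightarrow>
   (nat \<Rightarrow> 'v list \<Rightarrow> 'w) \<Rightarrow> bool"
where
  "A_inf_morphism sc V m sc' W m' f \<longleftrightarrow>
     (\<forall>n\<ge>1. graded_multilinear sc V sc' W n (1 - int n) (f n)) \<and>
     (\<forall>ps vs. vs \<noteq> [] \<and> homogeneous V ps vs \<longrightarrow>
        stasheff_sum sc' f m ps vs = morphism_sum sc' m' f ps vs)"

text \<open>The last two conditions say that \<open>f\<^sub>1\<close> is injective and surjective on cohomology.\<close>

definition A_inf_quasi_iso ::
  "('k::field \<Rightarrow> 'v::ab_group_add \<Rightarrow> 'v) \<Rightarrow> (int \<Rightarrow> 'v set) \<Rightarrow> (nat \<Rightarrow> 'v list \<Rightarrow> 'v) \<Rightarrow>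
   ('k \<Rightarrow> 'w::ab_group_add \<Rightarrow> 'w) \<Rightarrow> (int \<Rightarrow> 'w set) \<Rightarrow> (nat \<Rightarrow> 'w list \<Rightarrow> 'w) \<Rightarrow>
   (nat \<Rightarrow> 'v list \<Rightarrow> 'w) \<Rightarrow> bool"
where
  "A_inf_quasi_iso sc V m sc' W m' f \<longleftrightarrow>
     A_inf_morphism sc V m sc' W m' f \<and>
     (\<forall>p. \<forall>v\<in>V p. m 1 [v] = 0 \<and> (\<exists>w\<in>W (p - 1). f 1 [v] = m' 1 [w]) \<longrightarrow>
        (\<exists>u\<in>V (p - 1). v = m 1 [u])) \<and>
     (\<forall>p. \<forall>w\<in>W p. m' 1 [w] = 0 \<longrightarrow>
        (\<exists>v\<in>V p. m 1 [v] = 0 \<and> (\<exists>u\<in>W (p - 1). w = f 1 [v] + m' 1 [u])))"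

text \<open>
  Over a field an A-infinity quasi-isomorphism in one direction exists iff one in the other
  direction does, so no direction is preferred.
\<close>

definition A_inf_quasi_isomorphic ::
  "('k::field \<Rightarrow> 'v::ab_group_add \<Rightarrow> 'v) \<Rightarrow> (int \<Rightarrow> 'v set) \<Rightarrow> (nat \<Rightarrow> 'v list \<Rightarrow> 'v) \<Rightarrow>
   ('k \<Rightarrow> 'w::ab_group_add \<Rightarrow> 'w) \<Rightarrow> (int \<Rightarrow> 'w set) \<Rightarrow> (nat \<Rightarrow> 'w list \<Rightarrow> 'w) \<Rightarrow> bool"
where
  "A_inf_quasi_isomorphic sc V m sc' W m' \<longleftrightarrow>
     A_inf_algebra sc V m \<and> A_inf_algebra sc' W m' \<and>
     ((\<exists>f. A_inf_quasi_iso sc V m sc' W m' f) \<or> (\<exists>g. A_inf_quasi_iso sc' W m' sc V m g))"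


section \<open>Monomial algebras and chains\<close>

text \<open>Monomials are words over the set \<open>X\<close> of variables.\<close>

definition monomial_presentation :: "'a set \<Rightarrow> 'a list set \<Rightarrow> bool" where
  "monomial_presentation X R \<longleftrightarrow>
     finite X \<and> finite R \<and> R \<subseteq> lists X \<and> (\<forall>u\<in>R. 2 \<le> length u) \<and>
     (\<forall>u\<in>R. \<forall>v\<in>R. sublist u v \<longrightarrow> u = v)"

text \<open>
  The normal monomials are a basis of the monomial algebra \<open>A = k\<langle>X\<rangle>/(R)\<close>; the product of two
  of them is their concatenation if this is normal, and \<open>0\<close> otherwise.
\<close>

definition normal_mono :: "'a set \<Rightarrow> 'a list set \<Rightarrow> 'a list \<Rightarrow> bool" where
  "normal_mono X R w \<longleftrightarrow> w \<in> lists X \<and> (\<forall>u\<in>R. \<not> sublist u w)"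

definition zero_minimally :: "'a set \<Rightarrow> 'a list set \<Rightarrow> 'a list \<Rightarrow> 'a list \<Rightarrow> bool" where
  "zero_minimally X R u v \<longleftrightarrow>
     \<not> normal_mono X R (u @ v) \<and> (\<forall>v'. strict_prefix v' v \<longrightarrow> normal_mono X R (u @ v'))"

definition chain_factors :: "'a set \<Rightarrow> 'a list set \<Rightarrow> 'a list list \<Rightarrow> bool" where
  "chain_factors X R us \<longleftrightarrow>
     us \<noteq> [] \<and> (\<exists>x\<in>X. hd us = [x]) \<and> (\<forall>u\<in>set (tl us). u \<noteq> [] \<and> normal_mono X R u) \<and>
     (\<forall>j. Suc j < length us \<longrightarrow> zero_minimally X R (us ! j) (us ! Suc j))"

definition is_chain :: "'a set \<Rightarrow> 'a list set \<Rightarrow> nat \<Rightarrow> 'a list \<Rightarrow> bool" where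
  "is_chain X R r w \<longleftrightarrow> (\<exists>us. chain_factors X R us \<and> length us = Suc r \<and> concat us = w)"


section \<open>The bar construction, Tor and Ext\<close>

text \<open>
  The basis element \<open>[a\<^sub>1|\<dots>|a\<^sub>n]\<close> of the bar construction is the list of the words \<open>a\<^sub>i\<close>.
  \<open>bar X R (n, l)\<close> is the component of homological degree \<open>n\<close> and weight \<open>l\<close>.
\<close>

definition bar_word :: "'a set \<Rightarrow> 'a list set \<Rightarrow> 'a list list \<Rightarrow> bool" where
  "bar_word X R w \<longleftrightarrow> w \<noteq> [] \<and> (\<forall>a\<in>set w. a \<noteq> [] \<and> normal_mono X R a)"

definition pm_scale :: "'k::field \<Rightarrow> ('b \<Rightarrow>\<^sub>0 'k) \<Rightarrow> ('b \<Rightarrow>\<^sub>0 'k)" where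
  "pm_scale c x = Poly_Mapping.map ((*) c) x"

definition bar :: "'a set \<Rightarrow> 'a list set \<Rightarrow> nat \<times> nat \<Rightarrow> ('a list list \<Rightarrow>\<^sub>0 'k::field) set" where
  "bar X R = (\<lambda>(n, l). {x. \<forall>w\<in>Poly_Mapping.keys x.
                bar_word X R w \<and> length w = n \<and> length (concat w) = l})"

definition bar_d_word :: "'a set \<Rightarrow> 'a list set \<Rightarrow> 'a list list \<Rightarrow> ('a list list \<Rightarrow>\<^sub>0 'k::field)" where
  "bar_d_word X R w =
     (\<Sum>i<length w - 1.
        if normal_mono X R (w ! i @ w ! Suc i)
        then Poly_Mapping.single (take i w @ [w ! i @ w ! Suc i] @ drop (i + 2) w) ((-1) ^ i)
        else 0)"

definition bar_d ::
  "'a set \<Rightarrow> 'a list set \<Rightarrow> ('a list list \<Rightarrow>\<^sub>0 'k::field) \<Rightarrow> ('a list list \<Rightarrow>\<^sub>0 'k)"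
where
  "bar_d X R x =
     (\<Sum>w\<in>Poly_Mapping.keys x. pm_scale (Poly_Mapping.lookup x w) (bar_d_word X R w))"

definition bar_cycles ::
  "'a set \<Rightarrow> 'a list set \<Rightarrow> nat \<times> nat \<Rightarrow> ('a list list \<Rightarrow>\<^sub>0 'k::field) set"
where
  "bar_cycles X R i = {x \<in> bar X R i. bar_d X R x = 0}"

definition bar_boundaries :: "'a set \<Rightarrow> 'a list set \<Rightarrow> ('a list list \<Rightarrow>\<^sub>0 'k::field) set" where
  "bar_boundaries X R = bar_d X R ` total_space pm_scale (bar X R)"

type_synonym ('a, 'k) cochain = "('a list list \<Rightarrow>\<^sub>0 'k) \<Rightarrow> 'k"

definition bar_dual :: "'a set \<Rightarrow> 'a list set \<Rightarrow> int \<Rightarrow> ('a, 'k::field) cochain set" where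
  "bar_dual X R p =
     module.span fun_scale (\<Union>(n, l)\<in>{(n, l). int n = p}. gdual pm_scale (bar X R) {} (n, l))"

text \<open>
  Ext is the graded dual of Tor, the homology of the bar construction: its elements are the
  functionals on cycles that vanish on boundaries.
\<close>

definition Ext :: "'a set \<Rightarrow> 'a list set \<Rightarrow> int \<Rightarrow> ('a, 'k::field) cochain set" where
  "Ext X R p =
     module.span fun_scale
       (\<Union>(n, l)\<in>{(n, l). int n = p}. gdual pm_scale (bar_cycles X R) (bar_boundaries X R) (n, l))"

text \<open>
  The element of Ext dual to the chain \<open>w\<close> with respect to the basis of Tor given by the classes
  of the bar cycles \<open>[u\<^sub>0|\<dots>|u\<^sub>r]\<close> of all chains.
\<close>

definition chain_dual :: "'a set \<Rightarrow> 'a list set \<Rightarrow> 'a list \<Rightarrow> ('a, 'k::field) cochain" where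
  "chain_dual X R w =
     (THE \<phi>. \<phi> \<in> total_space fun_scale (Ext X R) \<and>
        (\<forall>us. chain_factors X R us \<longrightarrow>
           \<phi> (Poly_Mapping.single us 1) = (if concat us = w then 1 else 0)))"


section \<open>The dga algebra dual to the bar construction\<close>

definition bar_functional ::
  "'a set \<Rightarrow> 'a list set \<Rightarrow> ('a list list \<Rightarrow> 'k) \<Rightarrow> ('a, 'k::field) cochain"
where
  "bar_functional X R F = (\<lambda>x. if x \<in> total_space pm_scale (bar X R)
     then \<Sum>w\<in>Poly_Mapping.keys x. Poly_Mapping.lookup x w * F w else 0)"

text \<open>
  Dual maps carry the Koszul sign: the differential is \<open>\<phi> \<mapsto> (-1)\<^bsup>|\<phi>|\<^esup> \<phi> \<circ> d\<close> and the product
  is dual to deconcatenation under \<open>(\<phi> \<otimes> \<psi>)(x \<otimes> y) = (-1)\<^bsup>|\<psi>||x|\<^esup> \<phi>(x) \<psi>(y)\<close>. On a bar word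
  of degree \<open>n\<close> only \<open>|\<phi>| = n - 1\<close>, respectively \<open>|x| = j\<close> and \<open>|\<psi>| = n - j\<close>, contribute,
  which gives the signs below.
\<close>

definition bar_dual_diff ::
  "'a set \<Rightarrow> 'a list set \<Rightarrow> ('a, 'k::field) cochain \<Rightarrow> ('a, 'k) cochain"
where
  "bar_dual_diff X R \<phi> =
     bar_functional X R (\<lambda>w. (-1) ^ (length w - 1) * \<phi> (bar_d_word X R w))"

definition bar_dual_prod ::
  "'a set \<Rightarrow> 'a list set \<Rightarrow> ('a, 'k::field) cochain \<Rightarrow> ('a, 'k) cochain \<Rightarrow> ('a, 'k) cochain"
where
  "bar_dual_prod X R \<phi> \<psi> = bar_functional X R
     (\<lambda>w. \<Sum>j\<in>{1..<length w}. (-1) ^ ((length w - j) * j) *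
        (\<phi> (Poly_Mapping.single (take j w) 1) * \<psi> (Poly_Mapping.single (drop j w) 1)))"

definition bar_dual_ops ::
  "'a set \<Rightarrow> 'a list set \<Rightarrow> nat \<Rightarrow> ('a, 'k::field) cochain list \<Rightarrow> ('a, 'k) cochain"
where
  "bar_dual_ops X R n \<phi>s =
     (if n = 1 then bar_dual_diff X R (\<phi>s ! 0)
      else if n = 2 then bar_dual_prod X R (\<phi>s ! 0) (\<phi>s ! 1)
      else 0)"

definition canonical_structure ::
  "'a set \<Rightarrow> 'a list set \<Rightarrow> (nat \<Rightarrow> ('a, 'k::field) cochain list \<Rightarrow> ('a, 'k) cochain) \<Rightarrow> bool"
where
  "canonical_structure X R \<mu> \<longleftrightarrow>
     A_inf_algebra fun_scale (Ext X R) \<mu> \<and>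
     A_inf_quasi_isomorphic fun_scale (Ext X R) \<mu> fun_scale (bar_dual X R) (bar_dual_ops X R)"

text \<open>
  The exponent \<open>M\<close>. It belongs to the \<open>(-1)\<^bsup>r+st\<^esup>\<close> form of the A-infinity identities used above:
  its first summand is the conversion from the \<open>(-1)\<^bsup>r+s+rs\<^esup>\<close> form, obtained by dualizing the
  coalgebra identities with Koszul signs, to this one. With the same \<open>M\<close> the
  \<open>(-1)\<^bsup>r+s+rs\<^esup>\<close> form fails,
  for instance for the relations \<open>xxyx\<close>, \<open>yxy\<close>, \<open>yyx\<close> on the five factors \<open>x, x, y, x, y\<close>.
\<close>

definition sign_exponent :: "nat list \<Rightarrow> nat" where
  "sign_exponent rs =
     (let n = length rs; r = sum_list rs + 1 in
      ((n + 1) choose 2) - 1 + (\<Sum>(i, j)\<in>{(i, j). i < j \<and> j < n}. rs ! i * (rs ! j + 1))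
      + rs ! 0 + r)"

end

theory Submission
  imports Defs
begin

text \<open>
  An A-infinity coalgebra structure on a graded vector space with basis \<open>S\<close> is a derivation of
  square zero on the free algebra over \<open>S\<close>, and a morphism of such structures is a homomorphism
  of free algebras commuting with the derivations. Pairing tensors of functionals with the values
  of a derivation on generators therefore produces an A-infinity algebra, and pairing them with the
  values of a homomorphism produces a morphism (\<open>stasheff_sum_dual\<close>, \<open>morphism_sum_dual\<close>).
  The theorem follows from two derivations and one homomorphism.

  The first derivation is the differential \<open>cobar_d\<close> of the cobar construction of the bar
  construction; its dual is the dga algebra of the bar construction (\<open>bar_dual_ops_op\<close>). The
  second, \<open>chain_d\<close>, lives on the free algebra over the chains: it sends a chain to the signed
  sum of its factorizations into at least two chains whose lengths add up to one less than its
  length. Its dual has the operations of the theorem, because the Koszul signs turn the sign of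
  \<open>chain_d\<close> into the exponent \<open>M\<close> (\<open>dec_sign\<close>).

  The heart of the matter is that \<open>chain_d\<close> squares to zero. Inside a fixed word let \<open>N a\<close> be the
  end of the shortest subword starting at position \<open>a\<close> that is not normal. The map \<open>N\<close> is
  monotone, and the chain starting at \<open>a\<close> has its factors between the positions
  \<open>a, a + 1, N a, N (a + 1), N (N a), \<dots>\<close>, as long as these increase. Factorizations of chains
  are thus paths between orbits of a monotone map, and a path whose lengths add up to two less than
  the length of the whole chain arises in exactly two ways as a factorization of a factorization,
  with opposite signs (\<open>two_merges\<close>).

  The homomorphism \<open>cobar_lift\<close> from the chains to the cobar construction is built by recursion from
  a contraction of the cobar construction on words with product zero (\<open>contraction\<close>). Its linear
  part sends a chain to plus or minus the bar word of its factors (\<open>lookup_cobar_lift_single\<close>).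
  These bar words form a basis of the homology of the bar construction (\<open>bar_homology\<close>,
  \<open>chain_boundary_zero\<close>), by a matching that splits a bar letter behind the first place where a
  bar word ceases to be a chain. So the dual morphism from the bar dual to Ext restricts functionals
  to cycles, up to signs, and is a quasi-isomorphism (\<open>lift_injective\<close>, \<open>lift_surjective\<close>).
\<close>

section \<open>Free algebras and their derivations\<close>

abbreviation keys where "keys \<equiv> Poly_Mapping.keys"
abbreviation lookup where "lookup \<equiv> Poly_Mapping.lookup"
abbreviation single where "single \<equiv> Poly_Mapping.single"

lemma lookup_pm_scale [simp]: "lookup (pm_scale c x) w = c * lookup x w"
  unfolding pm_scale_def by (simp add: Poly_Mapping.map.rep_eq when_def)

interpretation pm: vector_space "pm_scale :: 'k::field \<Rightarrow> ('b \<Rightarrow>\<^sub>0 'k) \<Rightarrow> _"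
  by unfold_locales (auto intro!: poly_mapping_eqI simp: lookup_add algebra_simps)

interpretation field_vs: vector_space "(*) :: 'k::field \<Rightarrow> 'k \<Rightarrow> 'k"
  by unfold_locales (auto simp: algebra_simps)

lemma pm_scale_single [simp]: "pm_scale c (single w b) = single w (c * b)"
  by (rule poly_mapping_eqI) (simp add: lookup_single when_def)

lemma keys_pm_scale: "keys (pm_scale c x) \<subseteq> keys x"
  by (auto simp: in_keys_iff)

lemma pm_scale_mult_left: "pm_scale c x * y = pm_scale c (x * y)" for x :: "('b::monoid_add) \<Rightarrow>\<^sub>0 'k::field"
  unfolding pm_scale_def mult_map_scale_conv_mult by (simp add: mult.assoc)

lemma single_0_commute: "x * single 0 c = single 0 c * x" for x :: "('b::monoid_add) \<Rightarrow>\<^sub>0 'k::field"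
proof (induction x rule: update_induct)
  case const then show ?case by simp
next
  case (update f a b)
  have "Poly_Mapping.update a b f = f + single a b"
    using update by (intro poly_mapping_eqI) (auto simp: lookup_update lookup_add lookup_single when_def in_keys_iff)
  then show ?case using update by (simp add: algebra_simps mult_single)
qed

lemma pm_scale_mult_right: "x * pm_scale c y = pm_scale c (x * y)" for x :: "('b::monoid_add) \<Rightarrow>\<^sub>0 'k::field"
  unfolding pm_scale_def mult_map_scale_conv_mult
  by (simp add: mult.assoc[symmetric] single_0_commute)

text \<open>
  Linear maps out of finitely supported functions are given by their values on the basis;
  \<open>lin_ext\<close> turns such values into a linear map for any scalar multiplication on the target.
\<close>

definition lin_ext :: "('k::field \<Rightarrow> 'v::ab_group_add \<Rightarrow> 'v) \<Rightarrow> ('b \<Rightarrow> 'v) \<Rightarrow> ('b \<Rightarrow>\<^sub>0 'k) \<Rightarrow> 'v" where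
  "lin_ext sc g x = (\<Sum>w\<in>keys x. sc (lookup x w) (g w))"

lemma (in vector_space) lin_ext_superset:
  assumes "finite K" "keys x \<subseteq> K"
  shows "lin_ext scale g x = (\<Sum>w\<in>K. scale (lookup x w) (g w))"
  unfolding lin_ext_def using assms
  by (intro sum.mono_neutral_left) (auto simp: in_keys_iff)

lemma (in vector_space) lin_ext_linear: "Vector_Spaces.linear pm_scale scale (lin_ext scale g)"
proof (unfold Vector_Spaces.linear_iff, intro conjI allI)
  show "vector_space pm_scale" "vector_space scale" by unfold_locales
  fix x y c
  have "lin_ext scale g (x + y) = (\<Sum>w\<in>keys x \<union> keys y. scale (lookup (x + y) w) (g w))"
    by (intro lin_ext_superset) (auto dest: subsetD[OF Poly_Mapping.keys_add])
  also have "\<dots> = lin_ext scale g x + lin_ext scale g y"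
    by (subst (1 2) lin_ext_superset[where K="keys x \<union> keys y"])
       (auto simp: lookup_add scale_left_distrib sum.distrib)
  finally show "lin_ext scale g (x + y) = lin_ext scale g x + lin_ext scale g y" .
  show "lin_ext scale g (pm_scale c x) = scale c (lin_ext scale g x)"
    by (subst (1 2) lin_ext_superset[where K="keys x"])
       (use keys_pm_scale[of c x] in \<open>auto simp: scale_sum_right\<close>)
qed

lemma (in vector_space) lin_ext_single [simp]: "lin_ext scale g (single w c) = scale c (g w)"
  unfolding lin_ext_def by auto

lemma pm_expand: "x = lin_ext pm_scale (\<lambda>w. single w 1) x"
proof (rule poly_mapping_eqI)
  fix k
  have "lookup (lin_ext pm_scale (\<lambda>w. single w 1) x) k = (\<Sum>w\<in>keys x. if w = k then lookup x w else 0)"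
    unfolding lin_ext_def by (auto simp: lookup_sum lookup_single when_def intro!: sum.cong)
  also have "\<dots> = lookup x k" by (auto simp: sum.delta in_keys_iff)
  finally show "lookup x k = lookup (lin_ext pm_scale (\<lambda>w. single w 1) x) k" by simp
qed

lemma linear_expand:
  assumes "Vector_Spaces.linear pm_scale sc f"
  shows "f x = lin_ext sc (\<lambda>w. f (single w 1)) x"
proof -
  interpret f: Vector_Spaces.linear pm_scale sc f by fact
  show ?thesis by (subst pm_expand[of x]) (simp add: lin_ext_def f.sum f.scale del: pm_scale_single)
qed

lemma linear_eq_on_keys:
  assumes "Vector_Spaces.linear pm_scale sc f" "Vector_Spaces.linear pm_scale sc g"
    and "\<And>w. w \<in> keys x \<Longrightarrow> f (single w 1) = g (single w 1)"
  shows "f x = g x"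
  unfolding linear_expand[OF assms(1), of x] linear_expand[OF assms(2), of x] lin_ext_def
  by (auto intro!: sum.cong simp: assms(3))

lemma pm_linearI:
  assumes "\<And>x y. f (x + y) = f x + f y" "\<And>c x. f (pm_scale c x) = pm_scale c (f x)"
  shows "Vector_Spaces.linear pm_scale pm_scale f"
  unfolding Vector_Spaces.linear_iff using assms by (auto intro: pm.vector_space_axioms)

lemma field_linearI:
  assumes "\<And>x y. f (x + y) = f x + f y" "\<And>c x. f (pm_scale c x) = c * f x"
  shows "Vector_Spaces.linear pm_scale (*) f"
  unfolding Vector_Spaces.linear_iff using assms by (auto intro: pm.vector_space_axioms field_vs.vector_space_axioms)

lemma lin_ext_field_add: "lin_ext (*) h (x + y) = lin_ext (*) h x + lin_ext (*) h y"
  and lin_ext_field_scale: "lin_ext (*) h (pm_scale c x) = c * lin_ext (*) h x"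
  using field_vs.lin_ext_linear[of h] unfolding Vector_Spaces.linear_iff by auto

lemma keys_lin_ext: "keys (lin_ext pm_scale g x) \<subseteq> (\<Union>w\<in>keys x. keys (g w))"
  unfolding lin_ext_def using Poly_Mapping.keys_sum keys_pm_scale by fastforce

text \<open>
  With the additive monoid of words as exponents, finitely supported functions and their
  convolution product are the free algebra. The wrapper is needed because lists carry no addition.
\<close>

datatype 'i free_monoid = Word (letters: "'i list")

instantiation free_monoid :: (type) monoid_add
begin
definition "0 = Word []"
definition "u + v = Word (letters u @ letters v)"
instance by standard (auto simp: zero_free_monoid_def plus_free_monoid_def)
end

abbreviation mon :: "'i list \<Rightarrow> ('i free_monoid \<Rightarrow>\<^sub>0 'k::field)" where
  "mon ws \<equiv> single (Word ws) 1"

lemma mon_mult [simp]: "mon us * mon vs = mon (us @ vs)"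
  by (simp add: mult_single plus_free_monoid_def)

lemma mon_mult_assoc [simp]: "mon us * (mon vs * x) = mon (us @ vs) * x"
  by (simp add: mult.assoc[symmetric])

lemma mon_Nil: "mon [] = 1"
  by (metis single_one zero_free_monoid_def)

lemma keys_times: "keys (x * y) \<subseteq> {Word (us @ vs) | us vs. Word us \<in> keys x \<and> Word vs \<in> keys y}"
proof
  fix w assume "w \<in> keys (x * y)"
  then obtain a b where "w = a + b" "a \<in> keys x" "b \<in> keys y"
    using keys_mult[of x y] by blast
  then show "w \<in> {Word (us @ vs) | us vs. Word us \<in> keys x \<and> Word vs \<in> keys y}"
    by (cases a; cases b) (auto simp: plus_free_monoid_def)
qed

text \<open>
  The graded Leibniz rule for a derivation of odd degree, with generators \<open>c\<close> in degree \<open>s c\<close>.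
\<close>

primrec der_list :: "('i \<Rightarrow> nat) \<Rightarrow> ('i \<Rightarrow> 'i free_monoid \<Rightarrow>\<^sub>0 'k::field) \<Rightarrow> 'i list \<Rightarrow> ('i free_monoid \<Rightarrow>\<^sub>0 'k)" where
  "der_list s \<delta> [] = 0"
| "der_list s \<delta> (c # cs) = \<delta> c * mon cs + pm_scale ((-1) ^ s c) (mon [c] * der_list s \<delta> cs)"

definition derivation ::
  "('i \<Rightarrow> nat) \<Rightarrow> ('i \<Rightarrow> 'i free_monoid \<Rightarrow>\<^sub>0 'k::field) \<Rightarrow> ('i free_monoid \<Rightarrow>\<^sub>0 'k) \<Rightarrow> ('i free_monoid \<Rightarrow>\<^sub>0 'k)" where
  "derivation s \<delta> = lin_ext pm_scale (\<lambda>w. der_list s \<delta> (letters w))"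

definition alg_hom ::
  "('i \<Rightarrow> 'j free_monoid \<Rightarrow>\<^sub>0 'k::field) \<Rightarrow> ('i free_monoid \<Rightarrow>\<^sub>0 'k) \<Rightarrow> ('j free_monoid \<Rightarrow>\<^sub>0 'k)" where
  "alg_hom \<Phi> = lin_ext pm_scale (\<lambda>w. prod_list (map \<Phi> (letters w)))"

lemma derivation_linear: "Vector_Spaces.linear pm_scale pm_scale (derivation s \<delta>)"
  unfolding derivation_def by (rule pm.lin_ext_linear)

lemma alg_hom_linear: "Vector_Spaces.linear pm_scale pm_scale (alg_hom \<Phi>)"
  unfolding alg_hom_def by (rule pm.lin_ext_linear)

interpretation der: Vector_Spaces.linear pm_scale pm_scale "derivation s \<delta>" for s \<delta>
  by (rule derivation_linear)

interpretation alg_hom: Vector_Spaces.linear pm_scale pm_scale "alg_hom \<Phi>" for \<Phi>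
  by (rule alg_hom_linear)

lemma derivation_mon [simp]: "derivation s \<delta> (mon ws) = der_list s \<delta> ws"
  by (simp add: derivation_def)

lemma alg_hom_mon [simp]: "alg_hom \<Phi> (mon ws) = prod_list (map \<Phi> ws)"
  by (simp add: alg_hom_def)

lemma der_list_append:
  "der_list s \<delta> (us @ vs) =
     der_list s \<delta> us * mon vs + pm_scale ((-1) ^ sum_list (map s us)) (mon us * der_list s \<delta> vs)"
proof (induction us)
  case Nil then show ?case by (simp add: mon_Nil)
next
  case (Cons c cs)
  show ?case
    by (simp add: Cons pm_scale_mult_left pm_scale_mult_right pm.scale_right_distrib power_add
        distrib_right distrib_left mult.assoc)
qed

lemma mult_linear_right: "Vector_Spaces.linear pm_scale pm_scale f \<Longrightarrow>
   Vector_Spaces.linear pm_scale pm_scale (\<lambda>y. x * f y)" for x :: "('b::monoid_add) \<Rightarrow>\<^sub>0 'k::field"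
  by (rule pm_linearI) (auto simp: Vector_Spaces.linear_iff distrib_left pm_scale_mult_right)

lemma mult_linear_left: "Vector_Spaces.linear pm_scale pm_scale f \<Longrightarrow>
   Vector_Spaces.linear pm_scale pm_scale (\<lambda>x. f x * y)" for y :: "('b::monoid_add) \<Rightarrow>\<^sub>0 'k::field"
  by (rule pm_linearI) (auto simp: Vector_Spaces.linear_iff distrib_right pm_scale_mult_left)

lemma pm_linear_id: "Vector_Spaces.linear pm_scale pm_scale (\<lambda>x. x)"
  by (rule pm_linearI) auto

lemma pm_linear_add: "Vector_Spaces.linear pm_scale pm_scale f \<Longrightarrow> Vector_Spaces.linear pm_scale pm_scale g \<Longrightarrow>
   Vector_Spaces.linear pm_scale pm_scale (\<lambda>x. f x + g x)"
  by (rule pm_linearI) (auto simp: Vector_Spaces.linear_iff pm.scale_right_distrib)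

lemma pm_linear_diff: "Vector_Spaces.linear pm_scale pm_scale f \<Longrightarrow> Vector_Spaces.linear pm_scale pm_scale g \<Longrightarrow>
   Vector_Spaces.linear pm_scale pm_scale (\<lambda>x. f x - g x)"
  by (rule pm_linearI) (auto simp: Vector_Spaces.linear_iff pm.scale_right_diff_distrib)

lemma pm_linear_scale: "Vector_Spaces.linear pm_scale pm_scale f \<Longrightarrow>
   Vector_Spaces.linear pm_scale pm_scale (\<lambda>x. pm_scale c (f x))"
  by (rule pm_linearI) (auto simp: Vector_Spaces.linear_iff pm.scale_right_distrib mult.commute)

lemma pm_linear_compose: "Vector_Spaces.linear pm_scale pm_scale f \<Longrightarrow> Vector_Spaces.linear pm_scale sc g \<Longrightarrow>
   Vector_Spaces.linear pm_scale sc (\<lambda>x. g (f x))"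
  by (auto simp: Vector_Spaces.linear_iff)

lemmas pm_linear_intros = pm_linear_id pm_linear_add pm_linear_diff pm_linear_scale
  mult_linear_left mult_linear_right
  pm_linear_compose[OF _ derivation_linear] pm_linear_compose[OF _ alg_hom_linear]
  derivation_linear alg_hom_linear pm.lin_ext_linear pm_linear_compose[OF _ pm.lin_ext_linear]

lemma alg_hom_mult: "alg_hom \<Phi> (x * y) = alg_hom \<Phi> x * alg_hom \<Phi> y"
proof -
  have "alg_hom \<Phi> (mon us * y) = alg_hom \<Phi> (mon us) * alg_hom \<Phi> y" for us
    by (rule linear_eq_on_keys[where sc = pm_scale and f = "\<lambda>y. alg_hom \<Phi> (mon us * y)"
          and g = "\<lambda>y. alg_hom \<Phi> (mon us) * alg_hom \<Phi> y" and x = y])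
       (intro pm_linear_intros, intro pm_linear_intros,
        metis alg_hom_mon free_monoid.collapse map_append mon_mult prod_list.append)
  then show ?thesis
    by (intro linear_eq_on_keys[where sc = pm_scale and f = "\<lambda>x. alg_hom \<Phi> (x * y)"
          and g = "\<lambda>x. alg_hom \<Phi> x * alg_hom \<Phi> y" and x = x])
       (intro pm_linear_intros, intro pm_linear_intros, metis free_monoid.collapse)
qed

text \<open>
  The Leibniz rule needs a well defined sign for the left factor, hence the common parity \<open>e\<close>
  of its words.
\<close>

lemma derivation_mult:
  assumes "\<And>us. Word us \<in> keys x \<Longrightarrow> (-1 :: 'k::field) ^ sum_list (map s us) = e"
  shows "derivation s \<delta> (x * y) = derivation s \<delta> x * y + pm_scale e (x * derivation s \<delta> y)"
proof -
  have *: "derivation s \<delta> (mon us * y) =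
      derivation s \<delta> (mon us) * y + pm_scale ((-1) ^ sum_list (map s us)) (mon us * derivation s \<delta> y)" for us
    by (rule linear_eq_on_keys[where sc = pm_scale and f = "\<lambda>y. derivation s \<delta> (mon us * y)"
          and g = "\<lambda>y. derivation s \<delta> (mon us) * y +
            pm_scale ((-1) ^ sum_list (map s us)) (mon us * derivation s \<delta> y)" and x = y])
       (intro pm_linear_intros, intro pm_linear_intros, metis derivation_mon der_list_append free_monoid.collapse mon_mult)
  show ?thesis
  proof (rule linear_eq_on_keys[where sc = pm_scale and f = "\<lambda>x. derivation s \<delta> (x * y)"
        and g = "\<lambda>x. derivation s \<delta> x * y + pm_scale e (x * derivation s \<delta> y)" and x = x])
    fix w assume "w \<in> keys x"
    then show "derivation s \<delta> (single w 1 * y) = derivation s \<delta> (single w 1) * y + pm_scale e (single w 1 * derivation s \<delta> y)"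
      using *[of "letters w"] assms[of "letters w"] by simp
  qed (intro pm_linear_intros)+
qed

lemma der_list_sum:
  "der_list s \<delta> ws =
     (\<Sum>i<length ws. pm_scale ((-1) ^ sum_list (map s (take i ws)))
        (mon (take i ws) * \<delta> (ws ! i) * mon (drop (Suc i) ws)))"
proof (induction ws)
  case Nil then show ?case by simp
next
  case (Cons c cs)
  have "der_list s \<delta> (c # cs) = \<delta> c * mon cs + (\<Sum>i<length cs. pm_scale ((-1) ^ s c)
     (mon [c] * pm_scale ((-1) ^ sum_list (map s (take i cs)))
        (mon (take i cs) * \<delta> (cs ! i) * mon (drop (Suc i) cs))))"
    by (simp add: Cons sum_distrib_left pm.scale_sum_right)
  then show ?case
    by (simp add: sum.lessThan_Suc_shift pm_scale_mult_right power_add mon_Nil mult.assoc del: sum.lessThan_Suc)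
qed

section \<open>A-infinity structures dual to derivations of free algebras\<close>

definition sg :: "int \<Rightarrow> 'k::field" where
  "sg z = (if even z then 1 else -1)"

lemma sg_simps: "sg 0 = 1" "sg (a + b) = sg a * sg b" "sg (a - b) = sg a * sg b" "sg (- a) = sg a"
  by (auto simp: sg_def)

lemma sg_square [simp]: "sg z * sg z = 1" "sg z * (sg z * c) = c"
  by (auto simp: sg_def)

lemma minus_one_power_sg: "(-1) ^ n = (sg (int n) :: 'k::field)"
  by (auto simp: sg_def)

lemma minus_one_powi_sg: "(-1) powi z = (sg z :: 'k::field)"
  by (auto simp: sg_def)

lemma sg_eqI: "even (a - b) \<Longrightarrow> sg a = sg b"
  by (auto simp: sg_def)

fun ev_tensor :: "('i \<Rightarrow> 'k::field) list \<Rightarrow> 'i list \<Rightarrow> 'k" where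
  "ev_tensor [] [] = 1"
| "ev_tensor (\<phi> # \<phi>s) (c # cs) = \<phi> c * ev_tensor \<phi>s cs"
| "ev_tensor _ _ = 0"

lemma ev_tensor_length: "length \<phi>s \<noteq> length cs \<Longrightarrow> ev_tensor \<phi>s cs = 0"
  by (induction \<phi>s cs rule: ev_tensor.induct) auto

lemma ev_tensor_append:
  "ev_tensor \<phi>s (us @ vs) = ev_tensor (take (length us) \<phi>s) us * ev_tensor (drop (length us) \<phi>s) vs"
proof (induction us arbitrary: \<phi>s)
  case Nil then show ?case by simp
next
  case (Cons u us) then show ?case by (cases \<phi>s) auto
qed

definition tensor_pair :: "('i \<Rightarrow> 'k::field) list \<Rightarrow> ('i free_monoid \<Rightarrow>\<^sub>0 'k) \<Rightarrow> 'k" where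
  "tensor_pair \<phi>s = lin_ext (*) (\<lambda>w. ev_tensor \<phi>s (letters w))"

lemma tensor_pair_linear: "Vector_Spaces.linear pm_scale (*) (tensor_pair \<phi>s)"
  unfolding tensor_pair_def by (rule field_vs.lin_ext_linear)

interpretation tensor_pair: Vector_Spaces.linear pm_scale "(*)" "tensor_pair \<phi>s" for \<phi>s
  by (rule tensor_pair_linear)

lemma tensor_pair_mon [simp]: "tensor_pair \<phi>s (mon ws) = ev_tensor \<phi>s ws"
  by (simp add: tensor_pair_def)

lemma field_linear_scale: "Vector_Spaces.linear pm_scale (*) f \<Longrightarrow> Vector_Spaces.linear pm_scale (*) (\<lambda>x. c * f x)"
  by (rule field_linearI) (auto simp: Vector_Spaces.linear_iff distrib_left)

lemma field_linear_scale': "Vector_Spaces.linear pm_scale (*) f \<Longrightarrow> Vector_Spaces.linear pm_scale (*) (\<lambda>x. f x * c)"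
  by (rule field_linearI) (auto simp: Vector_Spaces.linear_iff distrib_right)

lemma field_linear_zero: "Vector_Spaces.linear pm_scale (*) (\<lambda>x. 0)"
  by (rule field_linearI) auto

lemma field_linear_sum: "(\<And>j. j \<in> J \<Longrightarrow> Vector_Spaces.linear pm_scale (*) (f j)) \<Longrightarrow>
   Vector_Spaces.linear pm_scale (*) (\<lambda>x. \<Sum>j\<in>J. f j x)"
  by (rule field_linearI) (auto simp: Vector_Spaces.linear_iff sum.distrib sum_distrib_left)

lemmas field_linear_intros = field_linear_zero field_linear_sum field_linear_scale field_linear_scale'
  pm_linear_compose[OF _ tensor_pair_linear] tensor_pair_linear

lemma derivation_single [simp]: "derivation s \<delta> (single v 1) = der_list s \<delta> (letters v)"
  by (simp add: derivation_def)

lemma alg_hom_single [simp]: "alg_hom \<Phi> (single v 1) = prod_list (map \<Phi> (letters v))"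
  by (simp add: alg_hom_def)

lemma tensor_pair_Nil: "Word [] \<notin> keys x \<Longrightarrow> tensor_pair [] x = 0"
  unfolding tensor_pair_def lin_ext_def
  by (rule sum.neutral) (metis ev_tensor_length free_monoid.collapse length_0_conv list.size(3) mult_zero_right)

lemma tensor_pair_mult:
  "tensor_pair \<phi>s (x * y) = (\<Sum>j\<le>length \<phi>s. tensor_pair (take j \<phi>s) x * tensor_pair (drop j \<phi>s) y)"
proof -
  have 1: "tensor_pair \<phi>s (mon us * mon vs) =
      (\<Sum>j\<le>length \<phi>s. tensor_pair (take j \<phi>s) (mon us) * tensor_pair (drop j \<phi>s) (mon vs))" for us vs
  proof -
    have "(\<Sum>j\<le>length \<phi>s. ev_tensor (take j \<phi>s) us * ev_tensor (drop j \<phi>s) vs) =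
        (\<Sum>j\<le>length \<phi>s. if j = length us then ev_tensor (take j \<phi>s) us * ev_tensor (drop j \<phi>s) vs else 0)"
    proof (intro sum.cong refl)
      fix j assume "j \<in> {..length \<phi>s}"
      then show "ev_tensor (take j \<phi>s) us * ev_tensor (drop j \<phi>s) vs =
          (if j = length us then ev_tensor (take j \<phi>s) us * ev_tensor (drop j \<phi>s) vs else 0)"
        using ev_tensor_length[of "take j \<phi>s" us] by auto
    qed
    also have "\<dots> = ev_tensor \<phi>s (us @ vs)"
      using ev_tensor_length[of \<phi>s us] by (auto simp: ev_tensor_append sum.delta ev_tensor_length[of "take (length us) \<phi>s" us])
    finally show ?thesis by simp
  qed
  have 2: "tensor_pair \<phi>s (mon us * y) =
      (\<Sum>j\<le>length \<phi>s. tensor_pair (take j \<phi>s) (mon us) * tensor_pair (drop j \<phi>s) y)" for us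
  proof (rule linear_eq_on_keys[where sc = "(*)" and f = "\<lambda>y. tensor_pair \<phi>s (mon us * y)"
        and g = "\<lambda>y. \<Sum>j\<le>length \<phi>s. tensor_pair (take j \<phi>s) (mon us) * tensor_pair (drop j \<phi>s) y" and x = y])
    fix w show "tensor_pair \<phi>s (mon us * single w 1) =
      (\<Sum>j\<le>length \<phi>s. tensor_pair (take j \<phi>s) (mon us) * tensor_pair (drop j \<phi>s) (single w 1))"
      using 1[of us "letters w"] by simp
  qed (intro field_linear_intros pm_linear_intros)+
  show ?thesis
  proof (rule linear_eq_on_keys[where sc = "(*)" and f = "\<lambda>x. tensor_pair \<phi>s (x * y)"
        and g = "\<lambda>x. \<Sum>j\<le>length \<phi>s. tensor_pair (take j \<phi>s) x * tensor_pair (drop j \<phi>s) y" and x = x])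
    fix w show "tensor_pair \<phi>s (single w 1 * y) =
      (\<Sum>j\<le>length \<phi>s. tensor_pair (take j \<phi>s) (single w 1) * tensor_pair (drop j \<phi>s) y)"
      using 2[of "letters w"] by simp
  qed (intro field_linear_intros pm_linear_intros)+
qed

lemma tensor_pair_sandwich:
  assumes "length us + length vs \<le> length \<phi>s"
  shows "tensor_pair \<phi>s (mon us * x * mon vs) =
    ev_tensor (take (length us) \<phi>s) us *
    tensor_pair (take (length \<phi>s - length us - length vs) (drop (length us) \<phi>s)) x *
    ev_tensor (drop (length \<phi>s - length vs) \<phi>s) vs"
proof (rule linear_eq_on_keys[where sc = "(*)" and f = "\<lambda>x. tensor_pair \<phi>s (mon us * x * mon vs)"
        and g = "\<lambda>x. ev_tensor (take (length us) \<phi>s) us *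
    tensor_pair (take (length \<phi>s - length us - length vs) (drop (length us) \<phi>s)) x *
    ev_tensor (drop (length \<phi>s - length vs) \<phi>s) vs" and x = x])
  fix w :: "'a free_monoid"
  obtain ws where w: "w = Word ws" by (cases w)
  show "tensor_pair \<phi>s (mon us * single w 1 * mon vs) =
      ev_tensor (take (length us) \<phi>s) us *
      tensor_pair (take (length \<phi>s - length us - length vs) (drop (length us) \<phi>s)) (single w 1) *
      ev_tensor (drop (length \<phi>s - length vs) \<phi>s) vs"
  proof (cases "length ws = length \<phi>s - length us - length vs")
    case True
    then have "length us + length ws = length \<phi>s - length vs" using assms by simp
    then show ?thesis using True by (simp add: w ev_tensor_append add.commute)
  next
    case False
    then show ?thesis using assms by (subst (2) w, subst tensor_pair_mon, subst ev_tensor_length)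
      (auto simp: w intro!: ev_tensor_length)
  qed
qed (intro field_linear_intros pm_linear_intros)+

lemma tensor_pair_sandwich_short:
  assumes "length \<phi>s < length us + length vs"
  shows "tensor_pair \<phi>s (mon us * x * mon vs) = 0"
proof (rule linear_eq_on_keys[where sc = "(*)" and f = "\<lambda>x. tensor_pair \<phi>s (mon us * x * mon vs)"
        and g = "\<lambda>x. 0" and x = x])
  fix w :: "'a free_monoid"
  obtain ws where w: "w = Word ws" by (cases w)
  show "tensor_pair \<phi>s (mon us * single w 1 * mon vs) = 0"
    using assms by (auto simp: w intro!: ev_tensor_length)
qed (intro field_linear_intros pm_linear_intros)+

text \<open>
  The parity of moving \<open>n\<close> suspensions into a tensor of \<open>n\<close> elements of degrees \<open>ps\<close>: every element
  is passed by the suspensions belonging to the elements on its right.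
\<close>

fun koszul_weight :: "int list \<Rightarrow> int" where
  "koszul_weight [] = 0"
| "koszul_weight (p # ps) = int (length ps) * p + koszul_weight ps"

lemma koszul_weight_append:
  "koszul_weight (ps @ qs) = koszul_weight ps + int (length qs) * sum_list ps + koszul_weight qs"
  by (induction ps) (auto simp: algebra_simps)

text \<open>
  The operations dual to a map \<open>\<kappa>\<close> into the free algebra. A generator \<open>c\<close> of the free algebra
  has degree \<open>s c\<close>, one less than the degree of the element that it stands for; the weight restores
  these suspensions.
\<close>

definition dual_op ::
  "('i \<Rightarrow> nat) \<Rightarrow> ('j \<Rightarrow> 'i free_monoid \<Rightarrow>\<^sub>0 'k::field) \<Rightarrow> ('i \<Rightarrow> 'k) list \<Rightarrow> 'j \<Rightarrow> 'k" where
  "dual_op s \<kappa> \<phi>s w =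
     lin_ext (*) (\<lambda>v. sg (koszul_weight (map (\<lambda>c. int (s c) + 1) (letters v))) * ev_tensor \<phi>s (letters v)) (\<kappa> w)"

definition homog :: "('i \<Rightarrow> nat) \<Rightarrow> int \<Rightarrow> ('i \<Rightarrow> 'k::field) \<Rightarrow> bool" where
  "homog s p \<phi> \<longleftrightarrow> (\<forall>c. \<phi> c \<noteq> 0 \<longrightarrow> int (s c) + 1 = p)"

lemma homog_ev_tensor:
  assumes "list_all2 (homog s) ps \<phi>s" "ev_tensor \<phi>s cs \<noteq> 0"
  shows "map (\<lambda>c. int (s c) + 1) cs = ps"
  using assms
proof (induction \<phi>s cs arbitrary: ps rule: ev_tensor.induct)
  case (2 \<phi> \<phi>s c cs)
  then obtain p ps' where "ps = p # ps'" "homog s p \<phi>" "list_all2 (homog s) ps' \<phi>s"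
    by (auto simp: list_all2_Cons2)
  then show ?case using 2 by (auto simp: homog_def)
qed auto

lemma dual_op_homog:
  assumes "list_all2 (homog s) ps \<phi>s"
  shows "dual_op s \<kappa> \<phi>s w = sg (koszul_weight ps) * tensor_pair \<phi>s (\<kappa> w)"
proof -
  have *: "sg (koszul_weight (map (\<lambda>c. int (s c) + 1) (letters v))) * ev_tensor \<phi>s (letters v) =
      sg (koszul_weight ps) * ev_tensor \<phi>s (letters v)" for v
    using homog_ev_tensor[OF assms] by (cases "ev_tensor \<phi>s (letters v) = 0") auto
  show ?thesis
    unfolding dual_op_def tensor_pair_def lin_ext_def sum_distrib_left *
    by (simp only: mult.left_commute)
qed

lemma sum_list_suspended: "sum_list (map (\<lambda>c. int (s c) + 1) cs) = int (sum_list (map s cs)) + int (length cs)"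
  by (induction cs) auto

lemma homog_dual_op:
  assumes "list_all2 (homog s) ps \<phi>s"
    and deg: "\<And>cs. Word cs \<in> keys (\<kappa> w) \<Longrightarrow> sum_list (map s cs) + e = s' w"
    and nz: "dual_op s \<kappa> \<phi>s w \<noteq> 0"
  shows "int (s' w) + 1 = sum_list ps + (int e + 1 - int (length \<phi>s))"
proof -
  obtain v where v: "v \<in> keys (\<kappa> w)" "ev_tensor \<phi>s (letters v) \<noteq> 0"
  proof -
    have "\<exists>v\<in>keys (\<kappa> w). ev_tensor \<phi>s (letters v) \<noteq> 0"
    proof (rule ccontr)
      assume "\<not> ?thesis"
      then have "dual_op s \<kappa> \<phi>s w = 0" unfolding dual_op_def lin_ext_def by (intro sum.neutral) auto
      with nz show False by simp
    qed
    then show ?thesis using that by blast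
  qed
  have "map (\<lambda>c. int (s c) + 1) (letters v) = ps" by (rule homog_ev_tensor[OF assms(1) v(2)])
  moreover have "length \<phi>s = length (letters v)" using v(2) ev_tensor_length by metis
  moreover have "sum_list (map s (letters v)) + e = s' w" using deg[of "letters v"] v(1) by simp
  ultimately show ?thesis using sum_list_suspended[of s "letters v"] by auto
qed

lemma reassociate_signs:
  fixes a :: "'k::field"
  assumes "a * b * (c * d) = e * f"
  shows "a * b * (c * (x * (d * y) * z)) = e * (f * (x * y * z))"
proof -
  have "a * b * (c * (x * (d * y) * z)) = (a * b * (c * d)) * (x * y * z)" by (simp only: mult_ac)
  also have "\<dots> = e * f * (x * y * z)" by (simp only: assms)
  finally show ?thesis by (simp only: mult.assoc)
qed

lemma reassociate_block_signs:
  fixes a :: "'k::field"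
  assumes "a * b * c * d = e" "y = c * (d * x)"
  shows "a * b * y = e * x"
proof -
  have "a * b * y = (a * b * c * d) * x" unfolding assms(2) by (simp only: mult.assoc)
  then show ?thesis by (simp only: assms(1))
qed

text \<open>
  The signs \<open>(-1)\<^bsup>r+st\<^esup>\<close>, the Koszul sign of \<open>m\<^sub>s\<close> and the weights of the inner and outer
  operation multiply to the weight of all arguments times the sign with which the derivation passes
  the first \<open>r\<close> letters. What remains is the pairing with one application of the Leibniz rule, so the
  A-infinity identities hold as soon as the derivation squares to zero.
\<close>

lemma stasheff_sum_dual:
  fixes \<phi>s :: "('i \<Rightarrow> 'k::field) list"
  assumes hom: "list_all2 (homog s) ps \<phi>s"
    and nonempty: "\<And>c. Word [] \<notin> keys (\<delta> c)"
    and deg: "\<And>c cs. Word cs \<in> keys (\<delta> c) \<Longrightarrow> sum_list (map s cs) + 1 = s c"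
  shows "(\<Sum>k\<in>{1..length \<phi>s}. \<Sum>r\<in>{0..length \<phi>s - k}.
           let t = length \<phi>s - k - r in
           (-1) ^ (r + k * t) * (-1) powi ((2 - int k) * sum_list (take r ps)) *
           dual_op s \<kappa> (take r \<phi>s @ [dual_op s \<delta> (take k (drop r \<phi>s))] @ drop (r + k) \<phi>s) w) =
         sg (koszul_weight ps) * tensor_pair \<phi>s (derivation s \<delta> (\<kappa> w))"
proof -
  let ?n = "length \<phi>s"
  have lenps: "length ps = ?n" using hom by (auto dest: list_all2_lengthD)
  define T where "T k r cs = (if length cs = ?n - k + 1 then (-1) ^ sum_list (map s (take r cs)) *
      (ev_tensor (take r \<phi>s) (take r cs) * tensor_pair (take k (drop r \<phi>s)) (\<delta> (cs ! r)) *
       ev_tensor (drop (r + k) \<phi>s) (drop (Suc r) cs)) else 0)" for k r and cs :: "'i list"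
  have summand: "(let t = ?n - k - r in
           (-1) ^ (r + k * t) * (-1) powi ((2 - int k) * sum_list (take r ps)) *
           dual_op s \<kappa> (take r \<phi>s @ [dual_op s \<delta> (take k (drop r \<phi>s))] @ drop (r + k) \<phi>s) w) =
      sg (koszul_weight ps) * lin_ext (*) (\<lambda>v. T k r (letters v)) (\<kappa> w)"
    if kr: "k \<in> {1..?n}" "r \<in> {0..?n - k}" for k r
  proof -
    define t where "t = ?n - k - r"
    have n: "?n = r + k + t" "k \<ge> 1" using kr by (auto simp: t_def)
    define P where "P = sum_list (take k (drop r ps))"
    let ?mid = "dual_op s \<delta> (take k (drop r \<phi>s))"
    let ?ps' = "take r ps @ [P + (2 - int k)] @ drop (r + k) ps"
    have hmid: "homog s (P + (2 - int k)) ?mid"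
      unfolding homog_def
    proof (intro allI impI)
      fix c assume "?mid c \<noteq> 0"
      from homog_dual_op[OF _ _ this, of "take k (drop r ps)" 1 s] deg hom n
      show "int (s c) + 1 = P + (2 - int k)" by (simp add: P_def)
    qed
    have hom': "list_all2 (homog s) ?ps' (take r \<phi>s @ [?mid] @ drop (r + k) \<phi>s)"
      using hom hmid by (intro list_all2_appendI) auto
    have mid: "?mid c = sg (koszul_weight (take k (drop r ps))) * tensor_pair (take k (drop r \<phi>s)) (\<delta> c)" for c
      using hom by (intro dual_op_homog) auto
    have ev: "ev_tensor (take r \<phi>s @ [?mid] @ drop (r + k) \<phi>s) cs =
       (if length cs = ?n - k + 1 then ev_tensor (take r \<phi>s) (take r cs) * ?mid (cs ! r) *
          ev_tensor (drop (r + k) \<phi>s) (drop (Suc r) cs) else 0)" for cs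
    proof (cases "length cs = ?n - k + 1")
      case True
      then have cs: "cs = take r cs @ cs ! r # drop (Suc r) cs" and l: "length (take r cs) = r"
        using n by (auto simp: id_take_nth_drop)
      show ?thesis using n True by (subst cs, subst ev_tensor_append) simp
    next
      case False
      then show ?thesis using n by (auto intro!: ev_tensor_length)
    qed
    have ps: "ps = take r ps @ take k (drop r ps) @ drop (r + k) ps"
      by (metis append_take_drop_id drop_drop add.commute)
    have kw1: "koszul_weight ps = koszul_weight (take r ps) + int (k + t) * sum_list (take r ps) +
        (koszul_weight (take k (drop r ps)) + int t * P + koszul_weight (drop (r + k) ps))"
      by (subst ps, subst koszul_weight_append, subst koszul_weight_append)
         (use n lenps in \<open>simp add: P_def\<close>)
    have kw2: "koszul_weight ?ps' = koszul_weight (take r ps) + int (1 + t) * sum_list (take r ps) +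
        (int t * (P + (2 - int k)) + koszul_weight (drop (r + k) ps))"
      by (subst koszul_weight_append) (use n lenps in simp)
    have sgn: "sg (int (r + k * t)) * sg ((2 - int k) * sum_list (take r ps)) *
        (sg (koszul_weight ?ps') * sg (koszul_weight (take k (drop r ps)))) =
        sg (koszul_weight ps) * (sg (sum_list (take r ps) - int r) :: 'k)"
      unfolding sg_simps(2)[symmetric] kw1 kw2
      by (rule sg_eqI) (simp add: algebra_simps)
    have *: "(-1) ^ (r + k * t) * (-1) powi ((2 - int k) * sum_list (take r ps)) *
        (sg (koszul_weight ?ps') * ev_tensor (take r \<phi>s @ [?mid] @ drop (r + k) \<phi>s) cs) =
        sg (koszul_weight ps) * T k r cs" for cs
    proof (cases "length cs = ?n - k + 1 \<and> ev_tensor (take r \<phi>s) (take r cs) \<noteq> 0")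
      case False
      then have "ev_tensor (take r \<phi>s @ [?mid] @ drop (r + k) \<phi>s) cs = 0" "T k r cs = 0"
        unfolding ev by (auto simp: T_def)
      then show ?thesis by (simp only: mult_zero_right)
    next
      case True
      then have "map (\<lambda>c. int (s c) + 1) (take r cs) = take r ps"
        using hom by (intro homog_ev_tensor[where \<phi>s = "take r \<phi>s"]) auto
      then have "sum_list (take r ps) - int r = int (sum_list (map s (take r cs)))"
        using sum_list_suspended[of s "take r cs"] True n by auto
      then have "(-1 :: 'k) ^ sum_list (map s (take r cs)) = sg (sum_list (take r ps) - int r)"
        by (simp add: minus_one_power_sg)
      then have "T k r cs = sg (sum_list (take r ps) - int r) *
          (ev_tensor (take r \<phi>s) (take r cs) * tensor_pair (take k (drop r \<phi>s)) (\<delta> (cs ! r)) *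
           ev_tensor (drop (r + k) \<phi>s) (drop (Suc r) cs))"
        using True by (simp add: T_def)
      then show ?thesis
        using True unfolding ev mid minus_one_power_sg minus_one_powi_sg
        by (simp only: if_True simp_thms reassociate_signs[OF sgn])
    qed
    show ?thesis
      unfolding t_def[symmetric] Let_def dual_op_homog[OF hom'] tensor_pair_def lin_ext_def
        sum_distrib_left
      using * by (intro sum.cong) (auto simp: mult.left_commute t_def[symmetric])
  qed
  have sumT: "(\<Sum>k\<in>{1..?n}. \<Sum>r\<in>{0..?n - k}. T k r cs) = tensor_pair \<phi>s (der_list s \<delta> cs)" for cs
  proof (cases "cs \<noteq> [] \<and> length cs \<le> ?n")
    case False
    have "T k r cs = 0" if "k \<in> {1..?n}" for k r using False that by (auto simp: T_def)
    moreover have "tensor_pair \<phi>s (der_list s \<delta> cs) = 0"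
    proof -
      have "tensor_pair \<phi>s (mon (take i cs) * \<delta> (cs ! i) * mon (drop (Suc i) cs)) = 0" if "i < length cs" for i
      proof (cases "length cs = Suc ?n")
        case True
        then show ?thesis using that
          by (subst tensor_pair_sandwich) (auto simp: tensor_pair_Nil nonempty)
      next
        case F: False
        then show ?thesis using False that by (intro tensor_pair_sandwich_short) auto
      qed
      then show ?thesis
        by (simp add: der_list_sum tensor_pair.sum tensor_pair.scale)
    qed
    ultimately show ?thesis by (metis (no_types, lifting) sum.neutral)
  next
    case True
    define k where "k = Suc ?n - length cs"
    have k: "k \<in> {1..?n}" "length cs = ?n - k + 1" using True by (auto simp: k_def Suc_diff_le) (cases cs; simp)+
    have "(\<Sum>k\<in>{1..?n}. \<Sum>r\<in>{0..?n - k}. T k r cs) = (\<Sum>k'\<in>{1..?n}. if k' = k then \<Sum>r\<in>{0..?n - k}. T k r cs else 0)"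
      using True by (intro sum.cong) (auto simp: T_def k_def intro!: sum.neutral)
    also have "\<dots> = (\<Sum>r\<in>{0..?n - k}. T k r cs)" using k(1) by (simp add: sum.delta)
    also have "\<dots> = (\<Sum>r<length cs. T k r cs)" using k by (intro sum.cong) auto
    also have "\<dots> = tensor_pair \<phi>s (der_list s \<delta> cs)"
      unfolding der_list_sum tensor_pair.sum tensor_pair.scale
    proof (rule sum.cong)
      fix r assume "r \<in> {..<length cs}"
      then have r: "r < length cs" by simp
      have "?n - r - (length cs - Suc r) = k" "?n - (length cs - Suc r) = r + k"
        using r k by auto
      then show "T k r cs = (-1) ^ sum_list (map s (take r cs)) *
          tensor_pair \<phi>s (mon (take r cs) * \<delta> (cs ! r) * mon (drop (Suc r) cs))"
        using r k by (subst tensor_pair_sandwich) (auto simp: T_def)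
    qed simp
    finally show ?thesis .
  qed
  have "(\<Sum>k\<in>{1..?n}. \<Sum>r\<in>{0..?n - k}. lin_ext (*) (\<lambda>v. T k r (letters v)) (\<kappa> w)) =
      lin_ext (*) (\<lambda>v. \<Sum>k\<in>{1..?n}. \<Sum>r\<in>{0..?n - k}. T k r (letters v)) (\<kappa> w)"
    unfolding lin_ext_def sum_distrib_left
    by (rule trans[OF sum.cong[OF refl sum.swap] sum.swap])
  also have "\<dots> = lin_ext (*) (\<lambda>v. tensor_pair \<phi>s (derivation s \<delta> (single v 1))) (\<kappa> w)"
    unfolding sumT by simp
  also have "\<dots> = tensor_pair \<phi>s (derivation s \<delta> (\<kappa> w))"
    by (rule linear_expand[symmetric]) (rule pm_linear_compose[OF derivation_linear tensor_pair_linear])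
  finally have total: "(\<Sum>k\<in>{1..?n}. \<Sum>r\<in>{0..?n - k}. lin_ext (*) (\<lambda>v. T k r (letters v)) (\<kappa> w)) =
      tensor_pair \<phi>s (derivation s \<delta> (\<kappa> w))" .
  show ?thesis
    unfolding total[symmetric] sum_distrib_left by (intro sum.cong refl summand)
qed

lemma compositions_0: "{is :: nat list. sum_list is = 0 \<and> 0 \<notin> set is} = {[]}"
  by (rule set_eqI, case_tac x) auto

lemma finite_compositions: "finite {is :: nat list. sum_list is = n \<and> 0 \<notin> set is}"
proof (rule finite_subset)
  have "length is \<le> sum_list is" if "0 \<notin> set is" for "is" :: "nat list"
    using that by (induction "is") auto
  then show "{is :: nat list. sum_list is = n \<and> 0 \<notin> set is} \<subseteq> {is. set is \<subseteq> {..n} \<and> length is \<le> n}"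
    using member_le_sum_list by fastforce
qed (simp add: finite_lists_length_le)

lemma compositions_Suc:
  assumes "n > 0"
  shows "{is :: nat list. sum_list is = n \<and> 0 \<notin> set is} =
    (\<Union>j\<in>{1..n}. (#) j ` {is. sum_list is = n - j \<and> 0 \<notin> set is})" (is "?L = ?R")
proof
  show "?L \<subseteq> ?R"
  proof
    fix "is" assume i: "is \<in> ?L"
    then obtain j js where "is = j # js" using assms by (cases "is") auto
    then show "is \<in> ?R" using i by (auto intro!: bexI[of _ j])
  qed
qed auto

text \<open>
  Pairing with a product distributes the functionals over the factors in consecutive blocks.
  Empty blocks contribute nothing because the factors have no constant term, so the sum runs over
  compositions.
\<close>

lemma tensor_pair_prod_list:
  assumes "\<And>c. Word [] \<notin> keys (\<Phi> c)"
  shows "(\<Sum>is\<in>{is. sum_list is = length \<phi>s \<and> 0 \<notin> set is}.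
       ev_tensor (map (\<lambda>bl c. tensor_pair bl (\<Phi> c)) (blocks is \<phi>s)) cs) =
     tensor_pair \<phi>s (prod_list (map \<Phi> cs))"
proof (induction cs arbitrary: \<phi>s)
  case Nil
  show ?case
  proof (cases "\<phi>s = []")
    case True
    have "{is :: nat list. sum_list is = 0 \<and> 0 \<notin> set is} = {[]}"
      by (rule compositions_0)
    then show ?thesis using True by (simp add: mon_Nil[symmetric])
  next
    case False
    then have "ev_tensor (map (\<lambda>bl c. tensor_pair bl (\<Phi> c)) (blocks is \<phi>s)) [] = 0"
      if "sum_list is = length \<phi>s" for "is" using that by (cases "is") auto
    then show ?thesis using False
      by (simp add: mon_Nil[symmetric] ev_tensor_length)
  qed
next
  case (Cons c cs)
  show ?case
  proof (cases "\<phi>s = []")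
    case True
    have "{is :: nat list. sum_list is = 0 \<and> 0 \<notin> set is} = {[]}"
      by (rule compositions_0)
    then show ?thesis using True by (simp add: tensor_pair_mult tensor_pair_Nil assms)
  next
    case False
    let ?C = "\<lambda>n. {is :: nat list. sum_list is = n \<and> 0 \<notin> set is}"
    let ?ev = "\<lambda>is \<phi>s cs. ev_tensor (map (\<lambda>bl c. tensor_pair bl (\<Phi> c)) (blocks is \<phi>s)) cs"
    have "(\<Sum>is\<in>?C (length \<phi>s). ?ev is \<phi>s (c # cs)) =
        (\<Sum>j\<in>{1..length \<phi>s}. \<Sum>is\<in>(#) j ` ?C (length \<phi>s - j). ?ev is \<phi>s (c # cs))"
      using False by (subst compositions_Suc, simp, subst sum.UNION_disjoint)
        (auto simp: finite_compositions)
    also have "\<dots> = (\<Sum>j\<in>{1..length \<phi>s}. \<Sum>is\<in>?C (length \<phi>s - j).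
        tensor_pair (take j \<phi>s) (\<Phi> c) * ?ev is (drop j \<phi>s) cs)"
      by (intro sum.cong[OF refl]) (simp add: sum.reindex)
    also have "\<dots> = (\<Sum>j\<in>{1..length \<phi>s}. tensor_pair (take j \<phi>s) (\<Phi> c) *
        tensor_pair (drop j \<phi>s) (prod_list (map \<Phi> cs)))"
      by (intro sum.cong refl) (simp add: sum_distrib_left[symmetric] Cons[symmetric])
    also have "\<dots> = tensor_pair \<phi>s (prod_list (map \<Phi> (c # cs)))"
      by (simp add: tensor_pair_mult)
        (intro sum.mono_neutral_left, auto simp: tensor_pair_Nil assms not_less_eq_eq)
    finally show ?thesis .
  qed
qed

lemma ev_tensor_scale:
  "ev_tensor (map (\<lambda>(e, f) c. sg e * f c) efs) cs = sg (sum_list (map fst efs)) * ev_tensor (map snd efs) cs"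
proof (induction efs arbitrary: cs)
  case Nil then show ?case by (cases cs) (auto simp: sg_simps)
next
  case (Cons a efs) then show ?case by (cases cs; cases a) (auto simp: sg_simps)
qed

fun block_degrees :: "nat list \<Rightarrow> int list \<Rightarrow> int list" where
  "block_degrees [] ps = []"
| "block_degrees (i # is) ps = (sum_list (take i ps) + 1 - int i) # block_degrees is (drop i ps)"

lemma length_block_degrees [simp]: "length (block_degrees is ps) = length is"
  by (induction "is" arbitrary: ps) auto

lemma length_blocks [simp]: "length (blocks is vs) = length is"
  by (induction "is" arbitrary: vs) auto

text \<open>
  By induction on the composition: the two signs of \<open>morphism_sum\<close> compare the weight of the
  arguments with the weights inside the blocks and the weight of the block values.
\<close>

lemma morphism_sign:
  assumes "sum_list is = length ps" "0 \<notin> set is"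
  shows "even (int (\<Sum>a<length is. (length is - 1 - a) * (is ! a - 1)) +
      (\<Sum>b<length is. (1 - int (is ! b)) * sum_list (take (sum_list (take b is)) ps)) +
      koszul_weight (block_degrees is ps) + sum_list (map koszul_weight (blocks is ps)) - koszul_weight ps)"
  using assms
proof (induction "is" arbitrary: ps)
  case Nil then show ?case by simp
next
  case (Cons i "is")
  let ?k = "length is" and ?P = "sum_list (take i ps)"
  have i: "i \<ge> 1" "i \<le> length ps" using Cons.prems by auto
  have len: "length (drop i ps) = sum_list is" using Cons.prems by auto
  have A: "int (\<Sum>a<length (i # is). (length (i # is) - 1 - a) * ((i # is) ! a - 1)) =
      int ?k * (int i - 1) + int (\<Sum>a<?k. (?k - 1 - a) * (is ! a - 1))"
    using i by (simp add: sum.lessThan_Suc_shift of_nat_diff del: sum.lessThan_Suc)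
  have tk: "sum_list (take (i + m) ps) = ?P + sum_list (take m (drop i ps))" for m
    by (simp add: take_add)
  have S: "(\<Sum>b<?k. (1 - int (is ! b))) = int ?k - int (length (drop i ps))"
    unfolding len sum_subtractf by (simp add: sum_list_sum_nth atLeast0LessThan)
  have B: "(\<Sum>b<length (i # is). (1 - int ((i # is) ! b)) * sum_list (take (sum_list (take b (i # is))) ps)) =
      ?P * (int ?k - int (length (drop i ps))) +
      (\<Sum>b<?k. (1 - int (is ! b)) * sum_list (take (sum_list (take b is)) (drop i ps)))"
    unfolding S[symmetric]
    by (simp add: sum.lessThan_Suc_shift tk distrib_left sum.distrib sum_distrib_left mult.commute del: sum.lessThan_Suc)
  have K: "koszul_weight ps = koszul_weight (take i ps) + int (length (drop i ps)) * ?P + koszul_weight (drop i ps)"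
    by (metis append_take_drop_id koszul_weight_append)
  have IH: "even (int (\<Sum>a<?k. (?k - 1 - a) * (is ! a - 1)) +
      (\<Sum>b<?k. (1 - int (is ! b)) * sum_list (take (sum_list (take b is)) (drop i ps))) +
      koszul_weight (block_degrees is (drop i ps)) + sum_list (map koszul_weight (blocks is (drop i ps))) -
      koszul_weight (drop i ps))" (is "even ?E")
    using Cons.prems by (intro Cons.IH) auto
  have "int (\<Sum>a<length (i # is). (length (i # is) - 1 - a) * ((i # is) ! a - 1)) +
      (\<Sum>b<length (i # is). (1 - int ((i # is) ! b)) * sum_list (take (sum_list (take b (i # is))) ps)) +
      koszul_weight (block_degrees (i # is) ps) + sum_list (map koszul_weight (blocks (i # is) ps)) - koszul_weight ps
    = ?E + 2 * (int ?k * ?P - ?P * int (length (drop i ps)))"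
    unfolding A B K by (simp add: algebra_simps)
  then show ?case using IH by presburger
qed

text \<open>
  The counterpart of \<open>stasheff_sum_dual\<close> for homomorphisms: a homomorphism applies \<open>\<Phi>\<close> to every
  letter, which is the sum over all cuttings of the arguments into blocks.
\<close>

lemma morphism_sum_dual:
  fixes \<phi>s :: "('i \<Rightarrow> 'k::field) list"
  assumes hom: "list_all2 (homog s) ps \<phi>s"
    and nonempty: "\<And>c. Word [] \<notin> keys (\<Phi> c)"
    and deg: "\<And>c cs. Word cs \<in> keys (\<Phi> c) \<Longrightarrow> sum_list (map s cs) = s' c"
  shows "(\<Sum>is\<in>{is. sum_list is = length \<phi>s \<and> 0 \<notin> set is}.
           let k = length is in
           (-1) ^ (\<Sum>a<k. (k - 1 - a) * (is ! a - 1)) *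
           (-1) powi (\<Sum>b<k. (1 - int (is ! b)) * sum_list (take (sum_list (take b is)) ps)) *
           dual_op s' \<kappa> (map (\<lambda>bl. dual_op s \<Phi> bl) (blocks is \<phi>s)) w) =
         sg (koszul_weight ps) * tensor_pair \<phi>s (alg_hom \<Phi> (\<kappa> w))"
proof -
  let ?C = "{is :: nat list. sum_list is = length \<phi>s \<and> 0 \<notin> set is}"
  let ?B = "\<lambda>is. map (\<lambda>bl c. tensor_pair bl (\<Phi> c)) (blocks is \<phi>s)"
  have lenps: "length ps = length \<phi>s" using hom by (auto dest: list_all2_lengthD)
  have bl: "list_all2 (homog s') (block_degrees is ps) (map (dual_op s \<Phi>) (blocks is \<phi>s)) \<and>
       map (dual_op s \<Phi>) (blocks is \<phi>s) =
       map (\<lambda>(e, f) c. sg e * f c) (zip (map koszul_weight (blocks is ps)) (map (\<lambda>bl c. tensor_pair bl (\<Phi> c)) (blocks is \<phi>s)))"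
    if "list_all2 (homog s) ps \<phi>s" "sum_list is = length \<phi>s" for "is" and ps and \<phi>s :: "('i \<Rightarrow> 'k) list"
    using that
  proof (induction "is" arbitrary: ps \<phi>s)
    case Nil then show ?case by simp
  next
    case (Cons i "is")
    have h: "list_all2 (homog s) (take i ps) (take i \<phi>s)" "list_all2 (homog s) (drop i ps) (drop i \<phi>s)"
      using Cons.prems(1) by auto
    have l: "length (take i \<phi>s) = i" using Cons.prems by auto
    have 1: "dual_op s \<Phi> (take i \<phi>s) = (\<lambda>c. sg (koszul_weight (take i ps)) * tensor_pair (take i \<phi>s) (\<Phi> c))"
      by (rule ext, rule dual_op_homog[OF h(1)])
    have 2: "homog s' (sum_list (take i ps) + 1 - int i) (dual_op s \<Phi> (take i \<phi>s))"
      unfolding homog_def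
    proof (intro allI impI)
      fix c assume "dual_op s \<Phi> (take i \<phi>s) c \<noteq> 0"
      from homog_dual_op[OF h(1) _ this, of 0 s'] deg l
      show "int (s' c) + 1 = sum_list (take i ps) + 1 - int i" by auto
    qed
    have IH: "list_all2 (homog s') (block_degrees is (drop i ps)) (map (dual_op s \<Phi>) (blocks is (drop i \<phi>s))) \<and>
       map (dual_op s \<Phi>) (blocks is (drop i \<phi>s)) =
       map (\<lambda>(e, f) c. sg e * f c) (zip (map koszul_weight (blocks is (drop i ps))) (map (\<lambda>bl c. tensor_pair bl (\<Phi> c)) (blocks is (drop i \<phi>s))))"
      using Cons.prems h(2) by (intro Cons.IH) auto
    show ?case
    proof
      show "list_all2 (homog s') (block_degrees (i # is) ps) (map (dual_op s \<Phi>) (blocks (i # is) \<phi>s))"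
        using 2 conjunct1[OF IH] by simp
    qed (use conjunct2[OF IH] in \<open>simp add: 1\<close>)
  qed
  have summand: "(let k = length is in
           (-1) ^ (\<Sum>a<k. (k - 1 - a) * (is ! a - 1)) *
           (-1) powi (\<Sum>b<k. (1 - int (is ! b)) * sum_list (take (sum_list (take b is)) ps)) *
           dual_op s' \<kappa> (map (\<lambda>bl. dual_op s \<Phi> bl) (blocks is \<phi>s)) w) =
        sg (koszul_weight ps) * lin_ext (*) (\<lambda>v. ev_tensor (?B is) (letters v)) (\<kappa> w)" if "is \<in> ?C" for "is"
  proof -
    have i: "sum_list is = length \<phi>s" "sum_list is = length ps" "0 \<notin> set is" using that lenps by auto
    define E where "E = sum_list (map koszul_weight (blocks is ps))"
    have ev: "ev_tensor (map (dual_op s \<Phi>) (blocks is \<phi>s)) cs = sg E * ev_tensor (?B is) cs" for cs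
      unfolding conjunct2[OF bl[OF hom i(1)]] ev_tensor_scale E_def by simp
(*MARK*)    have Y: "dual_op s' \<kappa> (map (\<lambda>bl. dual_op s \<Phi> bl) (blocks is \<phi>s)) w =
        sg (koszul_weight (block_degrees is ps)) * (sg E * lin_ext (*) (\<lambda>v. ev_tensor (?B is) (letters v)) (\<kappa> w))"
      unfolding dual_op_homog[OF conjunct1[OF bl[OF hom i(1)]]] tensor_pair_def lin_ext_def ev
        sum_distrib_left by (simp only: mult.left_commute)
    have S: "sg (int (\<Sum>a<length is. (length is - 1 - a) * (is ! a - 1))) *
        sg (\<Sum>b<length is. (1 - int (is ! b)) * sum_list (take (sum_list (take b is)) ps)) *
        sg (koszul_weight (block_degrees is ps)) * sg E = (sg (koszul_weight ps) :: 'k)"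
      unfolding sg_simps(2)[symmetric] E_def by (rule sg_eqI) (use morphism_sign[OF i(2,3)] in simp)
    show ?thesis
      unfolding Let_def minus_one_power_sg minus_one_powi_sg
      by (rule reassociate_block_signs[OF S Y])
  qed
  have "(\<Sum>is\<in>?C. lin_ext (*) (\<lambda>v. ev_tensor (?B is) (letters v)) (\<kappa> w)) =
      lin_ext (*) (\<lambda>v. \<Sum>is\<in>?C. ev_tensor (?B is) (letters v)) (\<kappa> w)"
    unfolding lin_ext_def sum_distrib_left by (rule sum.swap)
  also have "\<dots> = lin_ext (*) (\<lambda>v. tensor_pair \<phi>s (alg_hom \<Phi> (single v 1))) (\<kappa> w)"
    unfolding tensor_pair_prod_list[OF nonempty] by simp
  also have "\<dots> = tensor_pair \<phi>s (alg_hom \<Phi> (\<kappa> w))"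
    by (rule linear_expand[symmetric]) (rule pm_linear_compose[OF alg_hom_linear tensor_pair_linear])
  finally have total: "(\<Sum>is\<in>?C. lin_ext (*) (\<lambda>v. ev_tensor (?B is) (letters v)) (\<kappa> w)) =
      tensor_pair \<phi>s (alg_hom \<Phi> (\<kappa> w))" .
  show ?thesis
    unfolding total[symmetric] sum_distrib_left by (intro sum.cong refl summand)
qed

section \<open>Chains as orbits of a monotone map\<close>

text \<open>
  The positions \<open>a, b, N a, N b, N (N a), \<dots>\<close>. With \<open>b = a + 1\<close> and \<open>N\<close> the end of the shortest
  non-normal subword they separate the factors of the chain that starts at \<open>a\<close>: a factor ends where
  the product with its predecessor first vanishes.
\<close>

fun interleave :: "(nat \<Rightarrow> nat) \<Rightarrow> nat \<Rightarrow> nat \<Rightarrow> nat \<Rightarrow> nat" where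
  "interleave N a b 0 = a"
| "interleave N a b (Suc 0) = b"
| "interleave N a b (Suc (Suc j)) = N (interleave N a b j)"

text \<open>
  The chain of length \<open>r\<close> from \<open>a\<close> to \<open>b\<close>. The increase from index \<open>j\<close> to \<open>j + 1\<close> makes
  the factor with this index nonempty; the last increase goes one index beyond \<open>b\<close> and says that the
  last factor is normal.
\<close>

definition orbit_chain :: "(nat \<Rightarrow> nat) \<Rightarrow> nat \<Rightarrow> nat \<Rightarrow> nat \<Rightarrow> bool" where
  "orbit_chain N r a b \<longleftrightarrow> b = interleave N a (Suc a) (Suc r) \<and>
     (\<forall>j\<le>Suc r. interleave N a (Suc a) j < interleave N a (Suc a) (Suc j))"

lemma interleave_even: "interleave N a b (2 * k) = (N ^^ k) a"
  and interleave_odd: "interleave N a b (Suc (2 * k)) = (N ^^ k) b"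
  by (induction k) auto

lemma interleave_shift: "interleave N a b (j + 2 * k) = (N ^^ k) (interleave N a b j)"
  by (induction k) auto

lemma funpow_apply_add: "(N ^^ h) ((N ^^ k) c) = (N ^^ (h + k)) c"
  by (simp add: funpow_add)

lemma unique_switch:
  fixes lo hi :: nat
  assumes "lo < hi" "Q lo" "\<not> Q hi" "\<And>i. lo \<le> i \<Longrightarrow> i < hi \<Longrightarrow> Q (Suc i) \<Longrightarrow> Q i"
  shows "\<exists>!i. lo \<le> i \<and> i < hi \<and> Q i \<and> \<not> Q (Suc i)"
proof -
  have down: "Q i" if "i \<le> k" "lo \<le> i" "k \<le> hi" "Q k" for i k
    using that
  proof (induction i rule: inc_induct)
    case (step i)
    have "Q (Suc i)" by (rule step.IH) (use step in simp_all)
    then show ?case by (rule assms(4)[rotated 2]) (use step in simp_all)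
  qed
  have "\<exists>i. lo \<le> i \<and> i < hi \<and> Q i \<and> \<not> Q (Suc i)"
  proof (rule ccontr)
    assume "\<not> ?thesis"
    then have up: "\<And>i. lo \<le> i \<Longrightarrow> i < hi \<Longrightarrow> Q i \<Longrightarrow> Q (Suc i)" by blast
    have "lo \<le> i \<Longrightarrow> i \<le> hi \<Longrightarrow> Q i" for i
    proof (induction i rule: dec_induct)
      case (step i) then show ?case by (intro up) simp_all
    qed (rule assms(2))
    then show False using assms(1,3) by simp
  qed
  moreover have "i = k" if "lo \<le> i" "i < hi" "Q i" "\<not> Q (Suc i)" "lo \<le> k" "k < hi" "Q k" "\<not> Q (Suc k)" for i k
  proof (rule linorder_cases[of i k])
    assume "i < k"
    then have "Q (Suc i)" by (intro down[of "Suc i" k]) (use that in simp_all)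
    then show ?thesis using that(4) by simp
  next
    assume "k < i"
    then have "Q (Suc k)" by (intro down[of "Suc k" i]) (use that in simp_all)
    then show ?thesis using that(8) by simp
  qed
  ultimately show ?thesis by blast
qed

text \<open>
  A fixed ambient chain from \<open>a\<close> to \<open>b\<close>, relative to which shorter chains are located.
\<close>

locale whole_chain =
  fixes N :: "nat \<Rightarrow> nat" and a b r :: nat
  assumes mono_N: "mono N" and whole: "orbit_chain N r a b"
begin

definition P :: "nat \<Rightarrow> nat" where "P = interleave N a (Suc a)"

lemma P_simps: "P 0 = a" "P (Suc 0) = Suc a" "P (Suc (Suc j)) = N (P j)"
  by (simp_all add: P_def)

lemma P_end: "P (Suc r) = b"
  using whole by (simp add: orbit_chain_def P_def)

lemma P_step: "j \<le> Suc r \<Longrightarrow> P j < P (Suc j)"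
  using whole by (simp add: orbit_chain_def P_def)

lemma P_funpow: "(N ^^ k) (P j) = P (j + 2 * k)"
  unfolding P_def interleave_shift ..

lemma mono_funpow: "c \<le> d \<Longrightarrow> (N ^^ k) c \<le> (N ^^ k) d"
  using mono_N by (simp add: funpow_mono)

lemma mono_P: "i \<le> j \<Longrightarrow> P i \<le> P j"
proof -
  have "P j \<le> P (Suc j)" for j
  proof (induction j rule: less_induct)
    case (less j)
    show ?case
    proof (cases "j \<le> 1")
      case True then show ?thesis using P_step[of j] by simp
    next
      case False
      then obtain k where "j = Suc (Suc k)" by (metis One_nat_def Suc_le_D not_less_eq_eq nat_le_linear)
      then show ?thesis using less[of k] monoD[OF mono_N] by (simp add: P_simps)
    qed
  qed
  then show "i \<le> j \<Longrightarrow> P i \<le> P j" by (rule lift_Suc_mono_le)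
qed

definition lies :: "nat \<Rightarrow> nat \<Rightarrow> bool" where
  "lies j c \<longleftrightarrow> P j \<le> c \<and> c < P (Suc j)"

lemma lies_unique: "lies i c \<Longrightarrow> lies j c \<Longrightarrow> i = j"
  unfolding lies_def using mono_P by (metis leD le_less_trans less_eq_Suc_le linorder_neqE_nat order_trans)

lemma lies_P: "j \<le> Suc r \<Longrightarrow> lies j (P j)"
  using P_step by (simp add: lies_def)

lemma lies_funpow:
  assumes "lies j c"
  shows "P (j + 2 * k) \<le> (N ^^ k) c" "(N ^^ k) c \<le> (N ^^ k) (Suc c)" "(N ^^ k) (Suc c) \<le> P (Suc (j + 2 * k))"
  using assms mono_funpow[of "P j" c k] mono_funpow[of c "Suc c" k] mono_funpow[of "Suc c" "P (Suc j)" k]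
  by (simp_all add: lies_def P_funpow)

text \<open>
  A chain of even length \<open>2 h\<close> starting at \<open>c\<close> ends at \<open>N\<^sup>h (c + 1)\<close>. By monotonicity the
  position \<open>P (j + 2 h)\<close> bounds it below, so inner chains move along the ambient chain with a speed
  known up to one.
\<close>

lemma inner_chain_even:
  assumes "lies j c" "orbit_chain N (2 * h) c e" "e \<le> b"
  shows "(N ^^ h) c < e" "(N ^^ h) (Suc c) = e" "P (j + 2 * h) < e" "e \<le> P (Suc (j + 2 * h))"
proof -
  have e: "e = (N ^^ h) (Suc c)" using assms(2) by (simp add: orbit_chain_def interleave_odd)
  moreover have "interleave N c (Suc c) (2 * h) < interleave N c (Suc c) (Suc (2 * h))"
    using assms(2) unfolding orbit_chain_def by (meson le_SucI le_refl)
  ultimately show lt: "(N ^^ h) c < e" and "(N ^^ h) (Suc c) = e" by (auto simp: interleave_even interleave_odd)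
  show "P (j + 2 * h) < e" using lies_funpow(1)[OF assms(1), of h] lt by simp
  show "e \<le> P (Suc (j + 2 * h))" using lies_funpow(3)[OF assms(1), of h] e by simp
qed

text \<open>
  For odd length \<open>2 h - 1\<close> the end is \<open>N\<^sup>h c\<close>, which lies one interval further than the length
  suggests.
\<close>

lemma inner_chain_odd:
  assumes "lies j c" "orbit_chain N s c e" "s = 2 * h - 1" "h \<ge> 1"
  shows "(N ^^ h) c = e" "e < (N ^^ h) (Suc c)" "P (j + 2 * h) \<le> e" "e < P (Suc (j + 2 * h))"
proof -
  have s: "Suc s = 2 * h" using assms by simp
  have e: "e = (N ^^ h) c" using assms(2) unfolding orbit_chain_def s by (simp add: interleave_even)
  moreover have "interleave N c (Suc c) (2 * h) < interleave N c (Suc c) (Suc (2 * h))"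
    using assms(2) unfolding orbit_chain_def s by blast
  ultimately show "(N ^^ h) c = e" and lt: "e < (N ^^ h) (Suc c)" by (auto simp: interleave_even interleave_odd)
  show "P (j + 2 * h) \<le> e" using lies_funpow(1)[OF assms(1), of h] e by simp
  show "e < P (Suc (j + 2 * h))" using lies_funpow(3)[OF assms(1), of h] lt by simp
qed

text \<open>
  Only the last inequality of a chain has to be checked. At even indices a tie would be carried by
  the monotone map to a tie of \<open>N\<^sup>h c\<close> and \<open>N\<^sup>h (c + 1)\<close>; at odd ones the ambient chain separates the
  two positions.
\<close>

lemma inner_increasing:
  assumes "lies j c" "(N ^^ h) c < (N ^^ h) (Suc c)" "i < 2 * h" "P (j + 2 * h) \<le> b"
  shows "interleave N c (Suc c) i < interleave N c (Suc c) (Suc i)"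
proof (cases "even i")
  case True
  then obtain k where k: "i = 2 * k" by blast
  then have "h = (h - k) + k" using assms by simp
  then have "(N ^^ (h - k)) ((N ^^ k) c) < (N ^^ (h - k)) ((N ^^ k) (Suc c))"
    using assms(2) by (simp add: funpow_apply_add)
  then show ?thesis
    unfolding k interleave_even interleave_odd using mono_funpow by (meson not_less)
next
  case False
  then obtain k where k: "i = Suc (2 * k)" by (metis oddE Suc_eq_plus1)
  have "Suc (j + 2 * k) \<le> Suc r"
  proof (rule ccontr)
    assume "\<not> ?thesis"
    then have "Suc (Suc r) \<le> j + 2 * h" using assms k by simp
    then have "P (Suc (Suc r)) \<le> b" using mono_P assms(4) by (meson order_trans)
    then show False using P_step[of "Suc r"] P_end by simp
  qed
  then have "P (Suc (j + 2 * k)) < P (Suc (Suc (j + 2 * k)))" by (rule P_step)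
  moreover have "interleave N c (Suc c) i \<le> P (Suc (j + 2 * k))"
    unfolding k interleave_odd by (rule lies_funpow[OF assms(1)])
  moreover have "P (j + 2 * Suc k) \<le> interleave N c (Suc c) (Suc i)"
  proof -
    have "Suc i = 2 * Suc k" using k by simp
    then show ?thesis unfolding \<open>Suc i = 2 * Suc k\<close> interleave_even by (intro lies_funpow[OF assms(1)])
  qed
  ultimately show ?thesis by simp
qed

lemma inner_chain_evenI:
  assumes "lies j c" "(N ^^ h) c < e" "e = (N ^^ h) (Suc c)" "e \<le> b"
  shows "orbit_chain N (2 * h) c e"
proof -
  have Ph: "P (j + 2 * h) < b" using lies_funpow(1)[OF assms(1), of h] assms by simp
  have le: "Suc (j + 2 * h) \<le> Suc r"
    using Ph mono_P[of "Suc r" "j + 2 * h"] unfolding P_end[symmetric] by (meson leD not_less_eq_eq)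
  have "interleave N c (Suc c) i < interleave N c (Suc c) (Suc i)" if "i \<le> Suc (2 * h)" for i
  proof -
    consider "i < 2 * h" | "i = 2 * h" | "i = Suc (2 * h)" using \<open>i \<le> Suc (2 * h)\<close> by linarith
    then show ?thesis
    proof cases
      case 1 then show ?thesis using inner_increasing[OF assms(1), of h] assms Ph by simp
    next
      case 2 then show ?thesis using assms by (simp add: interleave_even interleave_odd)
    next
      case 3
      have "(N ^^ h) (Suc c) \<le> P (Suc (j + 2 * h))" by (rule lies_funpow[OF assms(1)])
      also have "\<dots> < P (j + 2 * Suc h)" using P_step[OF le] by simp
      also have "\<dots> \<le> (N ^^ Suc h) c" by (rule lies_funpow[OF assms(1)])
      finally have "(N ^^ h) (Suc c) < (N ^^ Suc h) c" .
      moreover have "Suc i = 2 * Suc h" using 3 by simp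
      ultimately show ?thesis by (metis 3 interleave_even interleave_odd)
    qed
  qed
  then show ?thesis using assms by (simp add: orbit_chain_def interleave_odd)
qed

lemma inner_chain_oddI:
  assumes "lies j c" "e = (N ^^ h) c" "e < (N ^^ h) (Suc c)" "e \<le> b" "s = 2 * h - 1" "h \<ge> 1"
  shows "orbit_chain N s c e"
proof -
  have s: "Suc s = 2 * h" using assms by simp
  have Ph: "P (j + 2 * h) \<le> b" using lies_funpow(1)[OF assms(1), of h] assms by simp
  have "interleave N c (Suc c) i < interleave N c (Suc c) (Suc i)" if i: "i \<le> 2 * h" for i
  proof -
    consider "i < 2 * h" | "i = 2 * h" using i by linarith
    then show ?thesis
    proof cases
      case 1 then show ?thesis using inner_increasing[OF assms(1) _ _ Ph] assms by simp
    next
      case 2 then show ?thesis using assms by (simp add: interleave_even interleave_odd)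
    qed
  qed
  then show ?thesis unfolding orbit_chain_def s using assms by (simp add: interleave_even)
qed

lemma initial_chain: "orbit_chain N s a e \<Longrightarrow> e = P (Suc s)"
  by (simp add: orbit_chain_def P_def)

lemma initial_chainI: "s \<le> r \<Longrightarrow> orbit_chain N s a (P (Suc s))"
  using P_step by (auto simp: orbit_chain_def P_def)

end


lemma orbit_chain_less: "orbit_chain N s c e \<Longrightarrow> c < e"
proof -
  assume A: "orbit_chain N s c e"
  have "j \<le> s \<Longrightarrow> c < interleave N c (Suc c) (Suc j)" for j
  proof (induction j)
    case (Suc j)
    then have "interleave N c (Suc c) (Suc j) < interleave N c (Suc c) (Suc (Suc j))"
      using A unfolding orbit_chain_def by (meson Suc_le_mono le_SucI)
    then show ?case using Suc by simp
  qed simp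
  from this[of s] show "c < e" using A by (simp add: orbit_chain_def)
qed

text \<open>
  A factorization of the ambient chain into \<open>n\<close> chains: \<open>x i\<close> is the start of the factor with index
  \<open>i\<close> and \<open>\<rho> i\<close> is its length.
\<close>

locale chain_path = whole_chain +
  fixes x \<rho> :: "nat \<Rightarrow> nat" and n :: nat
  assumes x_0: "x 0 = a" and x_n: "x n = b" and n_ge: "2 \<le> n"
    and steps: "i < n \<Longrightarrow> orbit_chain N (\<rho> i) (x i) (x (Suc i))"
begin

definition D :: "nat \<Rightarrow> nat" where "D i = (\<Sum>j<i. \<rho> j)"

lemma D_simps: "D 0 = 0" "D (Suc i) = D i + \<rho> i" by (simp_all add: D_def)

lemma mono_D: "i \<le> j \<Longrightarrow> D i \<le> D j"
  by (rule lift_Suc_mono_le[of D]) (simp_all add: D_simps)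

lemma x_less: "i < j \<Longrightarrow> j \<le> n \<Longrightarrow> x i < x j"
proof (induction j)
  case (Suc j)
  then show ?case using orbit_chain_less[OF steps[of j]] by (cases "i = j") auto
qed simp

lemma x_le_b: "i \<le> n \<Longrightarrow> x i \<le> b"
  using x_less[of i n] x_n by (cases "i = n") auto

text \<open>
  The interval of the ambient chain that contains the start of a factor.
\<close>

definition lv :: "nat \<Rightarrow> nat" where "lv i = (THE j. lies j (x i))"

lemma lies_lv: "i \<le> n \<Longrightarrow> lies (lv i) (x i)"
proof -
  assume i: "i \<le> n"
  have "x i < P (Suc (Suc r))" using x_le_b[OF i] P_step[of "Suc r"] P_end by simp
  then have ex: "\<exists>j. x i < P (Suc j)" by blast
  define j where "j = (LEAST j. x i < P (Suc j))"
  have j: "x i < P (Suc j)" unfolding j_def by (rule LeastI_ex[OF ex])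
  have "P j \<le> x i"
  proof (cases j)
    case 0 then show ?thesis using x_0 x_less[of 0 i] i by (cases i) (auto simp: P_simps)
  next
    case (Suc k) then show ?thesis using not_less_Least[of k "\<lambda>j. x i < P (Suc j)"] by (auto simp: j_def)
  qed
  then have L: "lies j (x i)" using j by (simp add: lies_def)
  then show ?thesis 
    unfolding lv_def by (rule theI[where P = "\<lambda>j. lies j (x i)"]) (erule lies_unique[OF _ L])
qed

lemma lv_eq: "i \<le> n \<Longrightarrow> lies j (x i) \<Longrightarrow> lv i = j"
  using lies_unique lies_lv by blast

text \<open>
  A factor raises the level by its length or by one more. The first is possible only for even
  length; an even factor of the second kind ends on a division point of the ambient chain.
\<close>

lemma lv_step:
  assumes "i < n"
  shows "even (\<rho> i) \<and> lv (Suc i) = lv i + \<rho> i \<and> P (lv (Suc i)) < x (Suc i) \<or>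
         lv (Suc i) = lv i + \<rho> i + 1 \<and> (even (\<rho> i) \<longrightarrow> x (Suc i) = P (lv (Suc i)))"
proof (cases "even (\<rho> i)")
  case True
  then obtain h where h: "\<rho> i = 2 * h" by blast
  have b: "x (Suc i) \<le> b" using assms by (intro x_le_b) simp
  note ic = inner_chain_even[OF lies_lv _ b, of i h] steps[OF assms] h assms
  have lt: "P (lv i + \<rho> i) < x (Suc i)" and le: "x (Suc i) \<le> P (Suc (lv i + \<rho> i))"
    using ic by auto
  show ?thesis
  proof (cases "x (Suc i) < P (Suc (lv i + \<rho> i))")
    case True
    then have "lv (Suc i) = lv i + \<rho> i" using lt assms by (intro lv_eq) (auto simp: lies_def)
    then show ?thesis using lt \<open>even (\<rho> i)\<close> by simp
  next
    case False
    then have e: "x (Suc i) = P (Suc (lv i + \<rho> i))" using le by simp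
    have "lv i + \<rho> i \<le> r"
    proof (rule ccontr)
      assume "\<not> ?thesis"
      then have "P (Suc r) \<le> P (lv i + \<rho> i)" by (intro mono_P) simp
      then show False using lt b P_end by simp
    qed
    then have "lv (Suc i) = Suc (lv i + \<rho> i)" using e assms by (intro lv_eq) (auto intro: lies_P)
    then show ?thesis using e by simp
  qed
next
  case False
  then obtain h where h: "\<rho> i = 2 * h - 1" "h \<ge> 1" "Suc (\<rho> i) = 2 * h"
    by (metis Suc_eq_plus1 diff_Suc_1 evenE even_Suc less_one mult_is_0 nat.simps(3) not_less)
  have "P (lv i + 2 * h) \<le> x (Suc i) \<and> x (Suc i) < P (Suc (lv i + 2 * h))"
    using inner_chain_odd[OF lies_lv steps[OF assms] h(1,2)] assms by auto
  then have "lv (Suc i) = lv i + 2 * h" using assms by (intro lv_eq) (auto simp: lies_def)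
  then show ?thesis using h False by simp
qed

lemma x_1: "x (Suc 0) = P (Suc (\<rho> 0))" and lv_1: "lv (Suc 0) = Suc (\<rho> 0)"
proof -
  show x1: "x (Suc 0) = P (Suc (\<rho> 0))" using initial_chain steps[of 0] n_ge x_0 by simp
  have "\<rho> 0 \<le> r"
  proof (rule ccontr)
    assume "\<not> ?thesis"
    then have "P (Suc (Suc r)) \<le> P (Suc (\<rho> 0))" by (intro mono_P) simp
    then show False using x1 x_le_b[of "Suc 0"] n_ge P_step[of "Suc r"] P_end by simp
  qed
  then show "lv (Suc 0) = Suc (\<rho> 0)" using n_ge x1 by (intro lv_eq) (auto intro: lies_P)
qed

lemma lv_n: "lv n = Suc r"
  using lies_P[of "Suc r"] by (intro lv_eq) (simp_all add: P_end x_n)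

lemma lv_last: "lv n = lv (n - 1) + \<rho> (n - 1) + 1"
  using lv_step[of "n - 1"] n_ge by (auto simp: lv_n P_end x_n)

text \<open>
  The number of factors so far that raised the level by one more than their length. The first
  and the last factor always do, so the total \<open>r + 1 - D n\<close> leaves \<open>r - D n - 1\<close> such factors in the
  middle.
\<close>

definition gap :: "nat \<Rightarrow> nat" where "gap i = lv i - D i"

lemma D_le_lv: "i \<le> n \<Longrightarrow> D i \<le> lv i"
proof (induction i)
  case (Suc i) then show ?case using lv_step[of i] by (auto simp: D_simps)
qed (simp add: D_simps)

lemma gap_step: "i < n \<Longrightarrow> gap (Suc i) = gap i \<and> even (\<rho> i) \<and> P (lv (Suc i)) < x (Suc i) \<or>
    gap (Suc i) = Suc (gap i) \<and> (even (\<rho> i) \<longrightarrow> x (Suc i) = P (lv (Suc i)))"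
  using lv_step[of i] D_le_lv[of i] by (auto simp: gap_def D_simps)

lemma gap_mono: "i \<le> j \<Longrightarrow> j \<le> n \<Longrightarrow> gap i \<le> gap j"
proof (induction j)
  case (Suc j) then show ?case using gap_step[of j] by (cases "i = Suc j") auto
qed simp

lemma gap_1: "gap (Suc 0) = 1"
  by (simp add: gap_def lv_1 D_simps)

lemma gap_last: "gap n = Suc (gap (n - 1))"
proof -
  obtain k where k: "n = Suc k" using n_ge by (cases n) auto
  show ?thesis using lv_last D_le_lv[of k] unfolding k by (simp add: gap_def D_simps)
qed

lemma gap_n: "gap n = Suc r - D n"
  by (simp add: gap_def lv_n)

text \<open>
  In a factorization of the kind that occurs in \<open>chain_d\<close> no factor in the middle raises the
  level by more than its length, so all of these are even.
\<close>

lemma middle_even: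
  assumes "r = Suc (D n)" "0 < i" "Suc i < n"
  shows "even (\<rho> i)"
proof -
  have "gap n = 2" using gap_n assms by simp
  then have "gap (n - 1) = 1" using gap_last by simp
  then have "gap (Suc i) \<le> 1" using gap_mono[of "Suc i" "n - 1"] assms by simp
  moreover have "1 \<le> gap i" using gap_mono[of "Suc 0" i] gap_1 assms by simp
  ultimately show ?thesis using gap_step[of i] assms by auto
qed

text \<open>
  The segments of at least two consecutive factors that are themselves chains of the length
  required for a term of \<open>chain_d\<close>.
\<close>

definition merges :: "(nat \<times> nat) set" where
  "merges = {(i, l). i + 2 \<le> l \<and> l \<le> n \<and> orbit_chain N (D l - D i + 1) (x i) (x l)}"

end

text \<open>
  The lengths add up to two less than the length of the ambient chain. Then exactly one factor in
  the middle, with index \<open>m\<close>, raises the level by one more than its length.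
\<close>

locale double_path = chain_path +
  fixes m :: nat
  assumes r_eq: "r = D n + 2" and m_ge: "1 \<le> m" and m_less: "Suc m < n"
    and lv_left: "\<And>i. 1 \<le> i \<Longrightarrow> i \<le> m \<Longrightarrow> lv i = D i + 1"
    and lv_right: "\<And>i. m < i \<Longrightarrow> i < n \<Longrightarrow> lv i = D i + 2"
begin

definition h :: "nat \<Rightarrow> nat" where "h i = Suc (\<rho> i) div 2"

definition H :: "nat \<Rightarrow> nat \<Rightarrow> nat" where "H i l = (\<Sum>j\<in>{i..<l}. h j)"

text \<open>
  The places reached from \<open>x i\<close> and from its successor after as many steps as the factors between
  \<open>i\<close> and \<open>l\<close> take. A segment is a chain according to how its end compares with these two.
\<close>

definition Y :: "nat \<Rightarrow> nat \<Rightarrow> nat" where "Y i l = (N ^^ H i l) (x i)"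
definition Z :: "nat \<Rightarrow> nat \<Rightarrow> nat" where "Z i l = (N ^^ H i l) (Suc (x i))"

lemma h_even: "even (\<rho> i) \<Longrightarrow> \<rho> i = 2 * h i" and h_odd: "odd (\<rho> i) \<Longrightarrow> \<rho> i = 2 * h i - 1 \<and> h i \<ge> 1 \<and> 2 * h i = Suc (\<rho> i)"
  unfolding h_def by presburger+

lemma h_double: "2 * h i = \<rho> i + (if odd (\<rho> i) then 1 else 0)"
  unfolding h_def by presburger

lemma H_refl [simp]: "H i i = 0" by (simp add: H_def)

lemma H_Suc: "i \<le> l \<Longrightarrow> H i (Suc l) = H i l + h l"
  by (simp add: H_def)

lemma H_left: "i < l \<Longrightarrow> H i l = h i + H (Suc i) l"
  by (simp add: H_def sum.atLeast_Suc_lessThan)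

lemma middle: 
  assumes "1 \<le> i" "Suc i < n" "i \<noteq> m"
  shows "even (\<rho> i)" "P (lv (Suc i)) < x (Suc i)"
proof -
  have "lv (Suc i) = lv i + \<rho> i"
    using assms lv_left[of i] lv_left[of "Suc i"] lv_right[of i] lv_right[of "Suc i"]
    by (cases "i < m") (auto simp: D_simps)
  then show "even (\<rho> i)" "P (lv (Suc i)) < x (Suc i)" using lv_step[of i] assms by auto
qed

lemma step_m: "even (\<rho> m) \<Longrightarrow> x (Suc m) = P (D (Suc m) + 2)"
  using lv_step[of m] lv_left[of m] lv_right[of "Suc m"] m_ge m_less by (auto simp: D_simps)

lemma even_step: "i < n \<Longrightarrow> even (\<rho> i) \<Longrightarrow> x (Suc i) = (N ^^ h i) (Suc (x i)) \<and> (N ^^ h i) (x i) < x (Suc i)"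
proof -
  assume i: "i < n" "even (\<rho> i)"
  have b: "x (Suc i) \<le> b" using i by (intro x_le_b) simp
  have s: "orbit_chain N (2 * h i) (x i) (x (Suc i))" using steps[OF i(1)] by (subst h_even[OF i(2), symmetric])
  have l: "lies (lv i) (x i)" using i by (intro lies_lv) simp
  show ?thesis using inner_chain_even(1,2)[OF l s b] by simp
qed

lemma odd_step: "i < n \<Longrightarrow> odd (\<rho> i) \<Longrightarrow> x (Suc i) = (N ^^ h i) (x i) \<and> x (Suc i) < (N ^^ h i) (Suc (x i))"
proof -
  assume i: "i < n" "odd (\<rho> i)"
  have l: "lies (lv i) (x i)" using i by (intro lies_lv) simp
  have o: "\<rho> i = 2 * h i - 1" "h i \<ge> 1" using h_odd[OF i(2)] by blast+
  show ?thesis using inner_chain_odd(1,2)[OF l steps[OF i(1)] o] by simp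
qed

lemma H_total:
  assumes "1 \<le> i" "i \<le> l" "l \<le> n"
  shows "D i + 2 * H i l = D l + (if i \<le> m \<and> m < l \<and> odd (\<rho> m) then 1 else 0) +
     (if l = n \<and> i < n \<and> odd (\<rho> (n - 1)) then 1 else 0)"
  using assms(2,3)
proof (induction l rule: dec_induct)
  case base then show ?case using assms m_less by auto
next
  case (step l)
  have IH: "D i + 2 * H i l = D l + (if i \<le> m \<and> m < l \<and> odd (\<rho> m) then 1 else 0)"
    using step by simp
  have Hl: "H i (Suc l) = H i l + h l" using step by (intro H_Suc) simp
  have A: "D i + 2 * H i (Suc l) = D l + (if i \<le> m \<and> m < l \<and> odd (\<rho> m) then 1 else 0) +
      (\<rho> l + (if odd (\<rho> l) then 1 else 0))"
    unfolding Hl distrib_left h_double by (simp only: add.assoc[symmetric] IH)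
  show ?case
  proof (cases "Suc l = n")
    case True
    then have nl: "n - Suc 0 = l" and "l \<noteq> m" "i < n" "m < l" using m_less step by auto
    have Dn: "D n = D l + \<rho> l" by (metis True D_simps(2))
    show ?thesis unfolding A using True \<open>l \<noteq> m\<close> \<open>i < n\<close> \<open>m < l\<close> by (auto simp: Dn nl)
  next
    case False
    then have "l \<noteq> m \<Longrightarrow> even (\<rho> l)" using middle(1)[of l] step assms by simp
    then show ?thesis unfolding A using False step by (cases "l = m") (auto simp: D_simps)
  qed
qed

lemma Y_le_Z: "Y i l \<le> Z i l"
  unfolding Y_def Z_def by (rule mono_funpow) simp

lemma Z_eq_Y: "i < l \<Longrightarrow> i < n \<Longrightarrow> even (\<rho> i) \<Longrightarrow> Z i l = Y (Suc i) l"
  unfolding Y_def Z_def using even_step[of i] by (simp add: H_left funpow_apply_add add.commute)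

lemma Y_mono: "1 \<le> i \<Longrightarrow> i \<le> j \<Longrightarrow> j \<le> m \<Longrightarrow> m < l \<Longrightarrow> Y i l \<le> Y j l"
proof (induction j)
  case (Suc j)
  show ?case
  proof (cases "i = Suc j")
    case False
    then have "Y i l \<le> Y j l" using Suc by simp
    also have "\<dots> \<le> Z j l" by (rule Y_le_Z)
    also have "Z j l = Y (Suc j) l" using middle(1)[of j] Suc False m_less by (intro Z_eq_Y) auto
    finally show ?thesis .
  qed simp
qed simp

lemma Y_Suc: "i \<le> l \<Longrightarrow> Y i (Suc l) = (N ^^ h l) (Y i l)" "i \<le> l \<Longrightarrow> Z i (Suc l) = (N ^^ h l) (Z i l)"
  unfolding Y_def Z_def by (simp_all add: H_Suc funpow_apply_add add.commute)

lemma Y_1: "1 \<le> l \<Longrightarrow> l \<le> n \<Longrightarrow> Y 1 l = P (D 1 + 1 + 2 * H 1 l)"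
  unfolding Y_def using x_1 by (simp add: P_funpow D_simps)

lemma merge_even:
  assumes "1 \<le> i" "i \<le> m" "m < l" "l \<le> n" "odd (\<rho> m) \<noteq> (l = n \<and> odd (\<rho> (n - 1)))"
  shows "orbit_chain N (D l - D i + 1) (x i) (x l) \<longleftrightarrow> Y i l < x l \<and> Z i l = x l"
proof -
  have t: "D l - D i + 1 = 2 * H i l" using H_total[of i l] assms mono_D[of i l] m_less by auto
  have li: "lies (lv i) (x i)" and b: "x l \<le> b" using lies_lv[of i] x_le_b assms by auto
  show ?thesis unfolding t Y_def Z_def
    using inner_chain_even[OF li _ b] inner_chain_evenI[OF li _ _ b] by metis
qed

lemma merge_odd:
  assumes "1 \<le> i" "i \<le> m" "m < n" "odd (\<rho> m)" "odd (\<rho> (n - 1))"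
  shows "orbit_chain N (D n - D i + 1) (x i) b \<longleftrightarrow> Y i n = b \<and> b < Z i n"
proof -
  have t: "D n - D i + 1 = 2 * H i n - 1" "H i n \<ge> 1" using H_total[of i n] assms mono_D[of i n] by auto
  have li: "lies (lv i) (x i)" using lies_lv[of i] assms by auto
  show ?thesis unfolding Y_def Z_def
    using inner_chain_odd[OF li _ t] inner_chain_oddI[OF li _ _ le_refl t] by metis
qed

lemma merge_odd':
  assumes "1 \<le> i" "i \<le> m" "m < n" "even (\<rho> m)" "even (\<rho> (n - 1))"
  shows "orbit_chain N (D n - D i + 1) (x i) b \<longleftrightarrow> N (Y i n) = b \<and> b < N (Z i n)"
proof -
  have t: "D n - D i + 1 = 2 * Suc (H i n) - 1" "Suc (H i n) \<ge> 1" using H_total[of i n] assms mono_D[of i n] by auto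
  have li: "lies (lv i) (x i)" using lies_lv[of i] assms by auto
  have f: "N (Y i n) = (N ^^ Suc (H i n)) (x i)" "N (Z i n) = (N ^^ Suc (H i n)) (Suc (x i))"
    by (simp_all add: Y_def Z_def)
  show ?thesis unfolding f
    using inner_chain_odd[OF li _ t] inner_chain_oddI[OF li _ _ le_refl t] by metis
qed

text \<open>
  An initial segment of the ambient chain is determined by its length and ends on a division
  point, so the factor \<open>m\<close> must be its last one.
\<close>

lemma merge_start:
  assumes "2 \<le> l" "l \<le> n" "orbit_chain N (D l - D 0 + 1) (x 0) (x l)"
  shows "l = Suc m" "x l = P (D l + 2)"
proof -
  have xl: "x l = P (D l + 2)" using initial_chain assms(3) x_0 by (simp add: D_simps)
  have "D l + 2 \<le> Suc r" using mono_D[OF assms(2)] r_eq by simp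
  then have lvl: "lv l = D l + 2" using assms xl by (intro lv_eq) (auto intro: lies_P)
  have "l \<noteq> n" using lvl lv_n r_eq by auto
  then have "l < n" using assms by simp
  have "\<not> l \<le> m" using lvl lv_left[of l] assms by auto
  moreover have "\<not> Suc m < l"
  proof
    assume "Suc m < l"
    then have "P (lv l) < x l" using middle(2)[of "l - 1"] assms \<open>l < n\<close> by auto
    then show False using xl lvl by simp
  qed
  ultimately show "l = Suc m" by simp
  show "x l = P (D l + 2)" by (rule xl)
qed

text \<open>
  A segment that merges has to bridge the factor \<open>m\<close>: otherwise the level rises too slowly.
\<close>

lemma merge_inner:
  assumes "1 \<le> i" "i + 2 \<le> l" "l \<le> n" "orbit_chain N (D l - D i + 1) (x i) (x l)"
  shows "i \<le> m" "m < l" "l < n \<Longrightarrow> odd (\<rho> m)"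
proof -
  define t where "t = D l - D i + 1"
  have tD: "D i + t = D l + 1" using mono_D[of i l] assms by (simp add: t_def)
  have li: "lies (lv i) (x i)" and ll: "lies (lv l) (x l)" and b: "x l \<le> b"
    using lies_lv[of i] lies_lv[of l] x_le_b assms by auto
  have ev: "even t \<Longrightarrow> P (lv i + t) < x l"
    using inner_chain_even(3)[OF li _ b] assms(4) unfolding t_def[symmetric] by (metis evenE)
  have od: "odd t \<Longrightarrow> P (Suc (lv i + t)) \<le> x l"
  proof -
    assume "odd t"
    then obtain k where k: "t = 2 * k + 1" by (metis oddE)
    then have "t = 2 * Suc k - 1" "Suc k \<ge> 1" by auto
    then have "P (lv i + 2 * Suc k) \<le> x l"
      using inner_chain_odd(3)[OF li assms(4)[folded t_def]] by blast
    then show ?thesis using k by simp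
  qed
  have up: "x l < P (Suc (lv l))" using ll by (simp add: lies_def)
  have lo: "P (lv i + t) \<le> x l" using ev od mono_P[of "lv i + t" "Suc (lv i + t)"] by (cases "even t") auto
  have lvlt: "lv i + t \<le> lv l"
  proof (rule ccontr)
    assume "\<not> ?thesis"
    then have "P (Suc (lv l)) \<le> P (lv i + t)" by (intro mono_P) simp
    then show False using up lo by simp
  qed
  have lvlt': "lv i + t < lv l" if "odd t"
  proof (rule ccontr)
    assume "\<not> ?thesis"
    then have "P (Suc (lv l)) \<le> P (Suc (lv i + t))" by (intro mono_P) simp
    then show False using up od that by simp
  qed
  show im: "i \<le> m"
  proof (rule ccontr)
    assume "\<not> i \<le> m"
    then have "lv i = D i + 2" using assms by (intro lv_right) auto
    then have "D l + 3 \<le> lv l" using lvlt tD by simp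
    moreover have "lv l = (if l = n then D l + 3 else D l + 2)"
      using lv_n r_eq lv_right[of l] \<open>\<not> i \<le> m\<close> assms by auto
    ultimately have "l = n" "lv l = lv i + t" using \<open>lv i = D i + 2\<close> tD by (auto split: if_splits)
    then show False using lvlt' ev x_n lv_n P_end by (cases "even t") auto
  qed
  then have lvi: "lv i = D i + 1" using assms lv_left by simp
  show ml: "m < l"
  proof (rule ccontr)
    assume "\<not> m < l"
    then have "lv l = D l + 1" using assms lv_left[of l] by simp
    then show False using lvlt tD lvi by simp
  qed
  assume "l < n"
  then have "lv l = D l + 2" using ml lv_right by simp
  then have "even t" using lvlt' lvi tD by fastforce
  then have od: "odd (D l - D i)" by (simp add: t_def)
  have D: "D i + 2 * H i l = D l + (if odd (\<rho> m) then 1 else 0)"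
    using H_total[of i l] assms \<open>l < n\<close> im ml by simp
  show "odd (\<rho> m)"
  proof
    assume "even (\<rho> m)"
    then have "D l - D i = 2 * H i l" using D by simp
    then show False using od by simp
  qed
qed

text \<open>
  If the exceptional factor is even then it ends on a division point. So the factors up to it merge,
  and among the segments up to the end of the word exactly one merges: \<open>Y i n\<close> is monotone in \<open>i\<close>,
  and the merging one sits where it passes the bound.
\<close>

lemma merges_even:
  assumes "even (\<rho> m)"
  shows "\<exists>i. 1 \<le> i \<and> i \<le> m \<and> merges = {(0, Suc m), (i, n)}"
proof -
  have xm: "x (Suc m) = P (D (Suc m) + 2)" by (rule step_m[OF assms])
  have start: "orbit_chain N (D (Suc m) - D 0 + 1) (x 0) (x (Suc m))"
    using initial_chainI[of "D (Suc m) + 1"] mono_D[of "Suc m" n] m_less r_eq xm x_0 by (simp add: D_simps(1))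
  have ZY: "Z i n = Y (Suc i) n" if "1 \<le> i" "i \<le> m" for i
    using middle(1)[of i] assms that m_less by (cases "i = m") (auto intro!: Z_eq_Y)
  have Ymono: "Y i n \<le> Y (Suc i) n" if "1 \<le> i" "i \<le> m" for i
    using Y_le_Z[of i n] ZY[OF that] by simp
  have Ym: "Y (Suc m) n = P (D (Suc m) + 2 + 2 * H (Suc m) n)"
    unfolding Y_def xm by (rule P_funpow)
  have Y1: "Y 1 n = P (D 1 + 1 + 2 * H 1 n)" using n_ge by (intro Y_1) auto
  have "\<exists>!i. 1 \<le> i \<and> i \<le> m \<and> orbit_chain N (D n - D i + 1) (x i) b"
  proof (cases "even (\<rho> (n - 1))")
    case True
    have "\<exists>!i. 1 \<le> i \<and> i < Suc m \<and> N (Y i n) \<le> b \<and> \<not> N (Y (Suc i) n) \<le> b"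
    proof (rule unique_switch)
      have e: "D 1 + 1 + 2 * H 1 n = D n + 1" using H_total[of 1 n] True assms m_less m_ge by simp
      show "N (Y 1 n) \<le> b" unfolding Y1 e using P_simps(3)[of "D n + 1"] r_eq P_end by simp
      have e: "D (Suc m) + 2 + 2 * H (Suc m) n = D n + 2" using H_total[of "Suc m" n] True assms m_less by simp
      show "\<not> N (Y (Suc m) n) \<le> b" unfolding Ym e
        using P_simps(3)[of "D n + 2"] r_eq P_end P_step[of "Suc r"] by simp
      fix i assume "1 \<le> i" "i < Suc m" "N (Y (Suc i) n) \<le> b"
      then show "N (Y i n) \<le> b" using monoD[OF mono_N Ymono[of i]] by simp
    qed (use m_ge in simp)
    moreover have "b \<le> N (Y i n)" if "1 \<le> i" "i \<le> m" for i
    proof -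
      have e: "D 1 + 1 + 2 * H 1 n = D n + 1" using H_total[of 1 n] True assms m_less m_ge by simp
      have "N (Y 1 n) = b" unfolding Y1 e using P_simps(3)[of "D n + 1"] r_eq P_end by simp
      then show ?thesis using monoD[OF mono_N Y_mono[of 1 i n]] that m_less by simp
    qed
    moreover have "orbit_chain N (D n - D i + 1) (x i) b \<longleftrightarrow> N (Y i n) = b \<and> b < N (Y (Suc i) n)"
      if "1 \<le> i" "i \<le> m" for i
      using merge_odd'[of i] that m_less assms True ZY by simp
    ultimately show ?thesis by (metis (no_types, lifting) le_antisym less_Suc_eq_le not_le)
  next
    case False
    have yb: "Y (Suc m) n = b"
    proof -
      have e: "D (Suc m) + 2 + 2 * H (Suc m) n = D n + 3" using H_total[of "Suc m" n] False assms m_less by simp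
      show ?thesis unfolding Ym e using r_eq P_end by (simp add: numeral_3_eq_3 eval_nat_numeral)
    qed
    have "\<exists>!i. 1 \<le> i \<and> i < Suc m \<and> Y i n < b \<and> \<not> Y (Suc i) n < b"
    proof (rule unique_switch)
      have e: "D 1 + 1 + 2 * H 1 n = D n + 2" using H_total[of 1 n] False assms m_less m_ge by simp
      show "Y 1 n < b" unfolding Y1 e using r_eq P_end P_step[of r] by simp
      show "\<not> Y (Suc m) n < b" unfolding yb by simp
      fix i assume "1 \<le> i" "i < Suc m" "Y (Suc i) n < b"
      then show "Y i n < b" using Ymono[of i] by simp
    qed (use m_ge in simp)
    moreover have "Y (Suc i) n \<le> b" if "1 \<le> i" "i \<le> m" for i
      using Y_mono[of "Suc i" m n] Ymono[of m] yb that m_less by (cases "i = m") auto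
    moreover have "orbit_chain N (D n - D i + 1) (x i) b \<longleftrightarrow> Y i n < b \<and> Y (Suc i) n = b"
      if "1 \<le> i" "i \<le> m" for i
      using merge_even[of i n] that m_less assms False ZY x_n by simp
    ultimately show ?thesis by (metis (no_types, lifting) le_antisym less_Suc_eq_le not_le)
  qed
  then obtain i where i: "1 \<le> i" "i \<le> m" "orbit_chain N (D n - D i + 1) (x i) b"
    and uniq: "\<And>j. 1 \<le> j \<Longrightarrow> j \<le> m \<Longrightarrow> orbit_chain N (D n - D j + 1) (x j) b \<Longrightarrow> j = i"
    by blast
  have "merges = {(0, Suc m), (i, n)}"
  proof (rule set_eqI, clarify)
    fix j l
    show "(j, l) \<in> merges \<longleftrightarrow> (j, l) \<in> {(0, Suc m), (i, n)}"
    proof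
      assume "(j, l) \<in> merges"
      then have jl: "j + 2 \<le> l" "l \<le> n" "orbit_chain N (D l - D j + 1) (x j) (x l)"
        by (auto simp: merges_def)
      show "(j, l) \<in> {(0, Suc m), (i, n)}"
      proof (cases "j = 0")
        case True then show ?thesis using merge_start(1)[of l] jl by simp
      next
        case False
        then have "1 \<le> j" by simp
        from merge_inner[OF this jl] assms have "j \<le> m" "\<not> l < n" by blast+
        then have *: "j \<le> m" "l = n" using jl(2) by auto
        then show ?thesis using uniq[of j] jl False x_n by simp
      qed
    next
      assume "(j, l) \<in> {(0, Suc m), (i, n)}"
      then show "(j, l) \<in> merges" using start i m_ge m_less x_n by (auto simp: merges_def)
    qed
  qed
  then show ?thesis using i by blast
qed

text \<open>
  If the exceptional factor is odd then it takes part in two merges, one with its predecessors and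
  one with its successors. Each of the two is found at a unique switch, as the places \<open>Y\<close> and \<open>Z\<close>
  are monotone.
\<close>

lemma merges_odd:
  assumes "odd (\<rho> m)"
  shows "\<exists>i l. i < m \<and> m + 2 \<le> l \<and> l \<le> n \<and> merges = {(i, Suc m), (m, l)}"
proof -
  have xm: "x (Suc m) = (N ^^ h m) (x m)" "x (Suc m) < (N ^^ h m) (Suc (x m))"
    using odd_step[OF _ assms] m_less by auto
  have Ym: "Y m (Suc m) = x (Suc m)" "Z m (Suc m) = (N ^^ h m) (Suc (x m))"
    by (simp_all add: Y_def Z_def H_def xm)
  have left1: "orbit_chain N (D (Suc m) - D i + 1) (x i) (x (Suc m)) \<longleftrightarrow>
      Y i (Suc m) < x (Suc m) \<and> Y (Suc i) (Suc m) = x (Suc m)" if "1 \<le> i" "i < m" for i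
    using merge_even[of i "Suc m"] that m_less assms Z_eq_Y[of i "Suc m"] middle(1)[of i] by simp
  have Y1: "Y 1 (Suc m) = P (D (Suc m) + 2)"
  proof -
    have "D 1 + 1 + 2 * H 1 (Suc m) = D (Suc m) + 2"
      using H_total[of 1 "Suc m"] assms m_less m_ge by simp
    then show ?thesis using Y_1[of "Suc m"] m_less by simp
  qed
  have left0: "orbit_chain N (D (Suc m) - D 0 + 1) (x 0) (x (Suc m)) \<longleftrightarrow> Y 1 (Suc m) = x (Suc m)"
  proof
    assume "Y 1 (Suc m) = x (Suc m)"
    then show "orbit_chain N (D (Suc m) - D 0 + 1) (x 0) (x (Suc m))"
      using Y1 initial_chainI[of "D (Suc m) + 1"] mono_D[of "Suc m" n] m_less r_eq x_0
      by (simp add: D_simps(1))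
  next
    assume "orbit_chain N (D (Suc m) - D 0 + 1) (x 0) (x (Suc m))"
    then show "Y 1 (Suc m) = x (Suc m)" using merge_start(2)[of "Suc m"] m_ge m_less Y1 by simp
  qed
  define Q where "Q i \<longleftrightarrow> i = 0 \<or> Y i (Suc m) < x (Suc m)" for i
  have Yle: "Y i (Suc m) \<le> x (Suc m)" if "1 \<le> i" "i \<le> m" for i
    using Y_mono[of i m "Suc m"] that Ym by simp
  have "\<exists>!i. 0 \<le> i \<and> i < m \<and> Q i \<and> \<not> Q (Suc i)"
  proof (rule unique_switch)
    show "\<not> Q m" using Ym m_ge by (simp add: Q_def)
    fix i assume "i < m" "Q (Suc i)"
    then show "Q i" using Y_mono[of i "Suc i" "Suc m"] by (cases "i = 0") (auto simp: Q_def)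
  qed (use m_ge in \<open>simp_all add: Q_def\<close>)
  moreover have "orbit_chain N (D (Suc m) - D i + 1) (x i) (x (Suc m)) \<longleftrightarrow> Q i \<and> \<not> Q (Suc i)" if "i < m" for i
    using left0 left1[of i] Yle[of "Suc i"] that by (cases "i = 0") (auto simp: Q_def)
  ultimately obtain i where i: "i < m" "orbit_chain N (D (Suc m) - D i + 1) (x i) (x (Suc m))"
    and ui: "\<And>j. j < m \<Longrightarrow> orbit_chain N (D (Suc m) - D j + 1) (x j) (x (Suc m)) \<Longrightarrow> j = i"
    by blast
  have Yright: "Y m l < x l" if "m + 2 \<le> l" "l \<le> n" "l = n \<Longrightarrow> even (\<rho> (n - 1))" for l
  proof -
    have "Y m k \<le> x k" if "Suc m \<le> k" "k < n" for k
      using that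
    proof (induction k rule: dec_induct)
      case base then show ?case using Ym by simp
    next
      case (step k)
      then have "Y m (Suc k) \<le> (N ^^ h k) (x k)" by (simp add: Y_Suc mono_funpow)
      also have "\<dots> < x (Suc k)" using even_step[of k] middle(1)[of k] step by auto
      finally show ?case by simp
    qed
    from this[of "l - 1"] have "Y m (l - 1) \<le> x (l - 1)" using that by auto
    moreover have "Y m (Suc (l - 1)) = (N ^^ h (l - 1)) (Y m (l - 1))" by (rule Y_Suc) (use that in simp)
    ultimately have "Y m (Suc (l - 1)) \<le> (N ^^ h (l - 1)) (x (l - 1))" using mono_funpow by metis
    also have "\<dots> < x (Suc (l - 1))"
    proof -
      have "1 \<le> l - 1" "l - 1 \<noteq> m" "l - 1 < n" "l \<noteq> n \<longrightarrow> Suc (l - 1) < n" using that by arith+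
      then have "even (\<rho> (l - 1))" using middle(1)[of "l - 1"] that(3) by (cases "l = n") auto
      then show ?thesis using even_step[of "l - 1"] \<open>l - 1 < n\<close> by simp
    qed
    finally show ?thesis using that by simp
  qed
  have Ylast: "Y m n = b" if "odd (\<rho> (n - 1))"
  proof -
    have "Y m (n - 1) \<le> x (n - 1)"
    proof (cases "n - 1 = Suc m")
      case True then show ?thesis using Ym by simp
    next
      case False
      then have e: "m + 2 \<le> n - 1" "n - 1 \<le> n" "n - 1 \<noteq> n" using m_less by arith+
      have "Y m (n - 1) < x (n - 1)" by (rule Yright[OF e(1,2)]) (use e(3) in blast)
      then show ?thesis by (rule less_imp_le)
    qed
    moreover have "Y m (Suc (n - 1)) = (N ^^ h (n - 1)) (Y m (n - 1))" by (rule Y_Suc) (use m_less in simp)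
    ultimately have "Y m (Suc (n - 1)) \<le> (N ^^ h (n - 1)) (x (n - 1))" using mono_funpow by metis
    also have "\<dots> = b" using odd_step[of "n - 1"] that x_n m_less by auto
    finally have "Y m n \<le> b" using m_less by simp
    moreover have "Y 1 n = b"
    proof -
      have "D 1 + 1 + 2 * H 1 n = Suc r" using H_total[of 1 n] that assms m_less m_ge r_eq by simp
      then show ?thesis using Y_1[of n] P_end m_less by simp
    qed
    ultimately show ?thesis using Y_mono[of 1 m n] m_ge m_less by simp
  qed
  define Q' where "Q' l \<longleftrightarrow> l < n \<and> x l < Z m l" for l
  have Zstep: "x l < Z m l \<Longrightarrow> (N ^^ h l) (Suc (x l)) \<le> Z m (Suc l)"
      "\<not> x l < Z m l \<Longrightarrow> Z m (Suc l) \<le> (N ^^ h l) (x l)" if "m \<le> l" for l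
    using that by (simp_all add: Y_Suc mono_funpow)
  have "\<exists>!l. Suc m \<le> l \<and> l < n \<and> Q' l \<and> \<not> Q' (Suc l)"
  proof (rule unique_switch)
    show "Q' (Suc m)" using xm Ym m_less by (simp add: Q'_def)
    fix l assume l: "Suc m \<le> l" "l < n" "Q' (Suc l)"
    then have "x (Suc l) = (N ^^ h l) (Suc (x l)) \<and> (N ^^ h l) (x l) < x (Suc l)"
      using even_step[of l] middle(1)[of l] by (auto simp: Q'_def)
    then show "Q' l" using Zstep(2)[of l] l by (fastforce simp: Q'_def)
  qed (use m_less in \<open>auto simp: Q'_def\<close>)
  moreover have G: "orbit_chain N (D (Suc l) - D m + 1) (x m) (x (Suc l)) \<longleftrightarrow> Q' l \<and> \<not> Q' (Suc l)"
    if l: "Suc m \<le> l" "l < n" for l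
  proof (cases "Suc l = n \<and> odd (\<rho> (n - 1))")
    case True
    then have ln: "l = n - 1" by auto
    have s: "b = (N ^^ h l) (x l)" "b < (N ^^ h l) (Suc (x l))"
      using odd_step[of l] True x_n l ln by auto
    have "orbit_chain N (D (Suc l) - D m + 1) (x m) (x (Suc l)) \<longleftrightarrow> b < Z m n"
      using merge_odd[of m] True Ylast assms m_ge m_less x_n by auto
    also have "\<dots> \<longleftrightarrow> x l < Z m l" using Zstep[of l] s l True by fastforce
    finally show ?thesis using True l by (auto simp: Q'_def)
  next
    case False
    have s: "x (Suc l) = (N ^^ h l) (Suc (x l))" "(N ^^ h l) (x l) < x (Suc l)"
      using even_step[of l] middle(1)[of l] False l m_less by (cases "Suc l = n"; auto)+
    have "orbit_chain N (D (Suc l) - D m + 1) (x m) (x (Suc l)) \<longleftrightarrow> Z m (Suc l) = x (Suc l)"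
      using merge_even[of m "Suc l"] Yright[of "Suc l"] False assms m_ge l by auto
    also have "\<dots> \<longleftrightarrow> Q' l \<and> \<not> Q' (Suc l)"
    proof (cases "Suc l = n")
      case True
      have "Z m n \<le> b"
      proof -
        have "Z m n \<le> P (Suc (lv m + 2 * H m n))"
          unfolding Z_def using lies_funpow(3)[OF lies_lv[of m]] m_less by simp
        also have "Suc (lv m + 2 * H m n) = Suc r"
          using H_total[of m n] lv_left[of m] False True assms m_less m_ge r_eq by auto
        finally show ?thesis by (simp add: P_end)
      qed
      then show ?thesis using Zstep[of l] s l True x_n by (fastforce simp: Q'_def)
    next
      case F: False
      then show ?thesis using Zstep[of l] s l by (fastforce simp: Q'_def)
    qed
    finally show ?thesis .
  qed
  ultimately obtain l where l: "Suc m \<le> l" "l < n" "orbit_chain N (D (Suc l) - D m + 1) (x m) (x (Suc l))"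
    and ul: "\<And>k. Suc m \<le> k \<Longrightarrow> k < n \<Longrightarrow> orbit_chain N (D (Suc k) - D m + 1) (x m) (x (Suc k)) \<Longrightarrow> k = l"
    by blast
  have none: "\<not> orbit_chain N (D k - D j + 1) (x j) (x k)" if j: "1 \<le> j" "j < m" and k: "m + 2 \<le> k" "k \<le> n" for j k
  proof -
    have "Z j k = Y (Suc j) k" using middle(1)[of j] j k m_less by (intro Z_eq_Y) auto
    also have "\<dots> \<le> Y m k" using Y_mono[of "Suc j" m k] j k by simp
    finally have Zle: "Z j k \<le> Y m k" .
    show ?thesis
    proof (cases "k = n \<and> odd (\<rho> (n - 1))")
      case True
      then show ?thesis using merge_odd[of j] Zle Ylast assms j m_less x_n by auto
    next
      case False
      then show ?thesis using merge_even[of j k] Zle Yright[of k] assms j k by auto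
    qed
  qed
  have start: "k = Suc m" if "2 \<le> k" "k \<le> n" "orbit_chain N (D k - D 0 + 1) (x 0) (x k)" for k
    by (rule merge_start(1)[OF that])
  have sub: "(j, k) = (i, Suc m) \<or> (j, k) = (m, Suc l)"
    if jk: "j + 2 \<le> k" "k \<le> n" "orbit_chain N (D k - D j + 1) (x j) (x k)" for j k
  proof (cases "k = Suc m")
    case True
    then have "j < m" using jk(1) by linarith
    then have "j = i" by (rule ui) (use jk(3) True in \<open>simp only:\<close>)
    then show ?thesis using True by simp
  next
    case False
    have "j \<noteq> 0"
    proof
      assume "j = 0"
      then have "k = Suc m" using jk by (intro start) (linarith, assumption, simp only:)
      then show False using False by simp
    qed
    then have j1: "1 \<le> j" by linarith
    have "j \<le> m" "m < k" using merge_inner(1,2)[OF j1 jk] by blast+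
    then have mk: "m + 2 \<le> k" using False by linarith
    have "\<not> j < m"
    proof
      assume "j < m"
      from none[OF j1 this mk jk(2)] jk(3) show False by (rule notE)
    qed
    then have jm: "j = m" using \<open>j \<le> m\<close> by linarith
    obtain k' where k': "k = Suc k'" using mk by (cases k) auto
    have "k' = l"
    proof (rule ul)
      show "Suc m \<le> k'" "k' < n" using mk jk(2) k' by linarith+
      show "orbit_chain N (D (Suc k') - D m + 1) (x m) (x (Suc k'))" using jk(3) unfolding jm k' .
    qed
    then show ?thesis using jm k' by simp
  qed
  have "merges = {(i, Suc m), (m, Suc l)}"
  proof
    show "merges \<subseteq> {(i, Suc m), (m, Suc l)}" using sub unfolding merges_def by blast
    have "i + 2 \<le> Suc m" "Suc m \<le> n" "m + 2 \<le> Suc l" "Suc l \<le> n" using i l m_less by linarith+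
    then show "{(i, Suc m), (m, Suc l)} \<subseteq> merges" using i(2) l(3) unfolding merges_def by blast
  qed
  moreover have "m + 2 \<le> Suc l" "Suc l \<le> n" using l by linarith+
  ultimately show ?thesis using i(1) by blast
qed

text \<open>
  The exponent of the sign with which merging the factors from \<open>i\<close> up to \<open>l\<close> contributes to the
  square of the derivation: the degree of the factors to the left, the parity of the merged segment and
  the parity of the remaining factorization.
\<close>

definition merge_sign :: "nat \<Rightarrow> nat \<Rightarrow> nat" where
  "merge_sign i l = D i + ((l - i) + (\<rho> i + 1) * \<rho> (l - 1)) + ((n + 1 - (l - i)) +
     ((if i = 0 then D l + 1 else \<rho> 0) + 1) * (if l = n then D n - D i + 1 else \<rho> (n - 1)))"

text \<open>
  All lengths in the middle except the exceptional one are even, so parities of partial sums depend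
  on the first, the exceptional and the last length only.
\<close>

lemma parity_D: 
  "1 \<le> i \<Longrightarrow> i \<le> m \<Longrightarrow> even (D i) = even (\<rho> 0)"
  "m < i \<Longrightarrow> i < n \<Longrightarrow> even (D i) = even (\<rho> 0 + \<rho> m)"
  "even (D n) = even (\<rho> 0 + \<rho> m + \<rho> (n - 1))"
proof -
  show 1: "even (D i) = even (\<rho> 0)" if "1 \<le> i" "i \<le> m" for i
    using that
  proof (induction i rule: dec_induct)
    case (step i) then show ?case using middle(1)[of i] m_less by (simp add: D_simps)
  qed (simp add: D_simps)
  show 2: "even (D i) = even (\<rho> 0 + \<rho> m)" if "m < i" "i < n" for i
  proof -
    have "Suc m \<le> i" using that by simp
    then show ?thesis using that(2)
    proof (induction i rule: dec_induct)
      case base show ?case using 1[of m] m_ge by (simp add: D_simps)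
    next
      case (step i) then show ?case using middle(1)[of i] by (simp add: D_simps)
    qed
  qed
  have "D n = D (n - 1) + \<rho> (n - 1)" using D_simps(2)[of "n - 1"] m_less by simp
  then show "even (D n) = even (\<rho> 0 + \<rho> m + \<rho> (n - 1))" using 2[of "n - 1"] m_less by simp
qed

lemma even_merge_sign:
  assumes "i < l" "l \<le> n"
  shows "even (merge_sign i l) \<longleftrightarrow> even (D i + (\<rho> i + 1) * \<rho> (l - 1) + n + 1 +
     ((if i = 0 then D l + 1 else \<rho> 0) + 1) * (if l = n then D n - D i + 1 else \<rho> (n - 1)))"
proof -
  have rearrange: "even (A + (c + B) + (d + C)) \<longleftrightarrow> even (A + B + n + 1 + C)" if "c + d = n + 1" for A B C c d :: nat
  proof -
    have "A + (c + B) + (d + C) = A + B + (c + d) + C" by (simp only: add.assoc add.left_commute)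
    also have "\<dots> = A + B + n + 1 + C" by (simp only: that add.assoc)
    finally show ?thesis by (simp only:)
  qed
  show ?thesis
    unfolding merge_sign_def by (rule rearrange) (use assms in linarith)
qed

lemma even_D_diff: "i \<le> n \<Longrightarrow> even (D n - D i) = (even (D n) = even (D i))"
proof -
  assume "i \<le> n"
  then obtain k where k: "D n = D i + k" using mono_D le_Suc_ex by blast
  show ?thesis unfolding k by auto
qed

text \<open>
  The combinatorial form of the equation that the square of the differential vanishes.
\<close>

lemma two_merges:
  "\<exists>A B. A \<noteq> B \<and> merges = {A, B} \<and> odd (merge_sign (fst A) (snd A) + merge_sign (fst B) (snd B))"
proof (cases "even (\<rho> m)")
  case True
  then obtain i where i: "1 \<le> i" "i \<le> m" "merges = {(0, Suc m), (i, n)}" using merges_even by blast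
  have ei: "even (\<rho> i)" using middle(1)[of i] i True m_less by (cases "i = m") auto
  have s1: "even (merge_sign 0 (Suc m)) \<longleftrightarrow> even (n + 1 + (\<rho> 0 + \<rho> m) * \<rho> (n - 1))"
    using parity_D(2)[of "Suc m"] True m_less by (subst even_merge_sign) (auto simp: D_simps(1))
  have s2: "even (merge_sign i n) \<longleftrightarrow> even (\<rho> 0 + \<rho> (n - 1) + n + 1 + (\<rho> 0 + 1) * (\<rho> (n - 1) + 1))"
    using parity_D(1)[of i] parity_D(3) even_D_diff[of i] i ei True m_less
    by (subst even_merge_sign) auto
  have "odd (merge_sign 0 (Suc m) + merge_sign i n)"
    unfolding even_add s1 s2 using True by auto
  moreover have "(0, Suc m) \<noteq> (i, n)" using i by simp
  ultimately show ?thesis using i(3) by (intro exI[of _ "(0, Suc m)"] exI[of _ "(i, n)"] conjI) simp_all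
next
  case False
  then obtain i l where i: "i < m" "m + 2 \<le> l" "l \<le> n" "merges = {(i, Suc m), (m, l)}" using merges_odd by blast
  have s1: "even (merge_sign i (Suc m)) \<longleftrightarrow> even (n + \<rho> 0 + (\<rho> 0 + 1) * \<rho> (n - 1))"
  proof (cases "i = 0")
    case True
    then show ?thesis using parity_D(2)[of "Suc m"] False m_less
      by (subst even_merge_sign) (auto simp: D_simps(1))
  next
    case F: False
    have ei: "even (\<rho> i)" using middle(1)[of i] i m_less F by auto
    show ?thesis using parity_D(1)[of i] F False i ei m_less
      by (subst even_merge_sign) auto
  qed
  have s2: "even (merge_sign m l) \<longleftrightarrow> even (n + 1 + \<rho> 0 + (\<rho> 0 + 1) * \<rho> (n - 1))"
  proof (cases "l = n")
    case True
    then show ?thesis using parity_D(1)[of m] parity_D(3) even_D_diff[of m] False m_less m_ge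
      by (subst even_merge_sign) auto
  next
    case F: False
    have "1 \<le> l - 1" "Suc (l - 1) < n" "l - 1 \<noteq> m" using i F by arith+
    then have el: "even (\<rho> (l - 1))" by (rule middle(1))
    show ?thesis using parity_D(1)[of m] F False i el m_less m_ge
      by (subst even_merge_sign) auto
  qed
  have "odd (merge_sign i (Suc m) + merge_sign m l)"
    unfolding even_add s1 s2 by auto
  moreover have "(i, Suc m) \<noteq> (m, l)" using i by simp
  ultimately show ?thesis using i(4) by (intro exI[of _ "(i, Suc m)"] exI[of _ "(m, l)"] conjI) simp_all
qed

end

lemma (in chain_path) double_path_exists:
  assumes "r = D n + 2"
  obtains m where "double_path N a b r x \<rho> n m"
proof -
  have gn: "gap n = 3" using gap_n assms by simp
  then have gn1: "gap (n - 1) = 2" using gap_last by simp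
  then have "n - 1 \<noteq> 1" using gap_1 by auto
  then have n3: "1 < n - 1" using n_ge by simp
  have "\<exists>!i. 1 \<le> i \<and> i < n - 1 \<and> gap i \<le> 1 \<and> \<not> gap (Suc i) \<le> 1"
  proof (rule unique_switch[OF n3])
    fix i assume "i < n - 1" "gap (Suc i) \<le> 1" then show "gap i \<le> 1" using gap_mono[of i "Suc i"] by linarith
  qed (use gap_1 gn1 in auto)
  then obtain m where m: "1 \<le> m" "m < n - 1" "gap m \<le> 1" "\<not> gap (Suc m) \<le> 1" by blast
  have "double_path N a b r x \<rho> n m"
  proof unfold_locales
    fix i assume "1 \<le> i" "i \<le> m"
    then have "i \<le> n" "m \<le> n" "1 \<le> gap i" "gap i \<le> gap m"
      using gap_mono[of "Suc 0" i] gap_mono[of i m] gap_1 m by simp_all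
    then have "gap i = 1" using m(3) by linarith
    then show "lv i = D i + 1" using D_le_lv[OF \<open>i \<le> n\<close>] by (simp add: gap_def)
  next
    fix i assume "m < i" "i < n"
    then have "i \<le> n - 1" "i \<le> n" "Suc m \<le> i" by linarith+
    then have "gap (Suc m) \<le> gap i" "gap i \<le> gap (n - 1)"
      using gap_mono[of "Suc m" i] gap_mono[of i "n - 1"] by simp_all
    then have "gap i = 2" using m(4) gn1 by linarith
    then show "lv i = D i + 2" using D_le_lv[OF \<open>i \<le> n\<close>] by (simp add: gap_def)
  qed (use assms m in auto)
  then show thesis by (rule that)
qed

section \<open>Chains of a monomial algebra\<close>

text \<open>
  Chains inside a word are treated through the positions of their ends; \<open>slice w a b\<close> is the part
  of \<open>w\<close> between two positions.
\<close>

definition slice :: "'b list \<Rightarrow> nat \<Rightarrow> nat \<Rightarrow> 'b list" where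
  "slice w a b = take (b - a) (drop a w)"

lemma length_slice: "b \<le> length w \<Longrightarrow> length (slice w a b) = b - a"
  by (simp add: slice_def)

lemma slice_append: "a \<le> b \<Longrightarrow> b \<le> c \<Longrightarrow> slice w a b @ slice w b c = slice w a c"
proof -
  assume "a \<le> b" "b \<le> c"
  then obtain i j where "b = a + i" "c = a + i + j" by (metis le_Suc_ex)
  then show ?thesis by (simp add: slice_def take_add add.commute)
qed

lemma prefix_slice:
  assumes "prefix v (slice w a c)" "c \<le> length w" "a \<le> c"
  shows "v = slice w a (a + length v)" "a + length v \<le> c"
proof -
  have "length v \<le> c - a" using prefix_length_le[OF assms(1)] assms by (simp add: length_slice)
  then show "a + length v \<le> c" using assms by linarith
  have "v = take (length v) (slice w a c)" using assms(1) by (metis append_eq_conv_conj prefix_def)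
  also have "\<dots> = slice w a (a + length v)" using \<open>length v \<le> c - a\<close> by (simp add: slice_def min_def)
  finally show "v = slice w a (a + length v)" .
qed

lemma sublist_slice: "a \<le> a' \<Longrightarrow> b' \<le> b \<Longrightarrow> a' \<le> b' \<Longrightarrow> sublist (slice w a' b') (slice w a b)"
proof -
  assume "a \<le> a'" "b' \<le> b" "a' \<le> b'"
  then have "slice w a b = slice w a a' @ slice w a' b' @ slice w b' b" by (simp add: slice_append)
  then show ?thesis by simp
qed

lemma slice_whole: "slice w 0 (length w) = w"
  by (simp add: slice_def)

lemma slice_single: "a < length w \<Longrightarrow> slice w a (Suc a) = [w ! a]"
  by (simp add: slice_def take_Suc_conv_app_nth hd_drop_conv_nth take_Suc)

lemma slice_middle: "slice (u @ v @ w) (length u) (length u + length v) = v"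
  by (simp add: slice_def)

lemma all_nat_cases: "(\<forall>j. Q j) \<longleftrightarrow> Q 0 \<and> (\<forall>j. Q (Suc j))"
  by (metis not0_implies_Suc)

lemma all_le_Suc: "(\<forall>j\<le>Suc s. Q j) \<longleftrightarrow> Q 0 \<and> (\<forall>j\<le>s. Q (Suc j))"
  by (subst all_nat_cases) simp

lemma concat_slice:
  assumes "i \<le> l"
  shows "concat (slice ws i l) = slice (concat ws) (length (concat (take i ws))) (length (concat (take l ws)))"
proof -
  have tl: "take l ws = take i ws @ slice ws i l"
    using slice_append[of 0 i l ws] assms by (simp add: slice_def)
  have e: "concat ws = concat (take i ws) @ concat (slice ws i l) @ concat (drop l ws)"
    by (metis append_assoc append_take_drop_id concat_append tl)
  show ?thesis unfolding tl concat_append length_append by (subst e) (rule slice_middle[symmetric])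
qed

fun chain_tail :: "'a set \<Rightarrow> 'a list set \<Rightarrow> 'a list \<Rightarrow> 'a list list \<Rightarrow> bool" where
  "chain_tail X R u [] = True"
| "chain_tail X R u (v # vs) = (v \<noteq> [] \<and> normal_mono X R v \<and> zero_minimally X R u v \<and> chain_tail X R v vs)"

lemma chain_tail_iff: "chain_tail X R u vs \<longleftrightarrow> (\<forall>v\<in>set vs. v \<noteq> [] \<and> normal_mono X R v) \<and>
   (\<forall>j. Suc j < length (u # vs) \<longrightarrow> zero_minimally X R ((u # vs) ! j) ((u # vs) ! Suc j))"
proof (induction vs arbitrary: u)
  case (Cons v vs)
  have "(\<forall>j. Suc j < length (u # v # vs) \<longrightarrow> zero_minimally X R ((u # v # vs) ! j) ((u # v # vs) ! Suc j)) \<longleftrightarrow>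
      zero_minimally X R u v \<and> (\<forall>j. Suc j < length (v # vs) \<longrightarrow> zero_minimally X R ((v # vs) ! j) ((v # vs) ! Suc j))"
    by (subst all_nat_cases) simp
  then show ?case unfolding chain_tail.simps Cons by auto
qed simp

lemma chain_factors_iff: "chain_factors X R us \<longleftrightarrow> (\<exists>x\<in>X. \<exists>vs. us = [x] # vs \<and> chain_tail X R [x] vs)"
proof (cases us)
  case Nil then show ?thesis by (simp add: chain_factors_def)
next
  case (Cons u vs)
  then show ?thesis unfolding chain_factors_def chain_tail_iff by auto
qed

lemma chain_factors_singleton: "x \<in> X \<Longrightarrow> chain_factors X R [[x]]"
  by (simp add: chain_factors_iff)

lemma zero_minimally_unique:
  assumes "zero_minimally X R u v" "zero_minimally X R u v'" "prefix v w" "prefix v' w"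
  shows "v = v'"
  using assms prefix_same_cases[of v w v'] unfolding zero_minimally_def strict_prefix_def by blast

text \<open>
  Each factor of a chain is forced by its predecessor: it is the shortest continuation with product
  zero. So two chains with a common extension have their factors in common.
\<close>

lemma chain_tail_prefix:
  assumes "chain_tail X R u vs" "chain_tail X R u vs'" "length vs \<le> length vs'"
    "prefix (concat vs) w" "prefix (concat vs') w"
  shows "vs = take (length vs) vs'"
  using assms
proof (induction vs arbitrary: u vs' w)
  case (Cons v vs)
  then obtain v' ys where vs': "vs' = v' # ys" by (cases vs') auto
  have pv: "prefix v w" "prefix v' w" using Cons.prems(4,5) vs' by (auto simp: prefix_def)
  have vv: "v' = v"
    by (rule zero_minimally_unique[of X R u v' v w]) (use Cons.prems(1,2) vs' pv in simp_all)
  obtain w' where w': "w = v @ w'" using pv by (auto simp: prefix_def)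
  have "vs = take (length vs) ys"
    by (rule Cons.IH[of v ys w']) (use Cons.prems vs' vv w' in auto)
  then show ?case using vs' vv by simp
qed simp

lemma chain_factors_prefix:
  assumes "chain_factors X R us" "chain_factors X R us'" "length us \<le> length us'"
    "prefix (concat us) w" "prefix (concat us') w"
  shows "us = take (length us) us'"
proof -
  obtain x vs x' vs' where u: "us = [x] # vs" "us' = [x'] # vs'" "chain_tail X R [x] vs" "chain_tail X R [x'] vs'"
    using assms(1,2) unfolding chain_factors_iff by blast
  obtain w' where w': "w = x # w'" using assms(4) u by (auto simp: prefix_def)
  have x: "x' = x" using assms(5) u w' by (auto simp: prefix_def)
  have "vs = take (length vs) vs'"
    by (rule chain_tail_prefix[of X R "[x]" vs vs' w']) (use assms u w' x in auto)
  then show ?thesis using u x by simp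
qed

lemma chain_factors_nonempty: "chain_factors X R us \<Longrightarrow> us \<noteq> [] \<and> [] \<notin> set us"
  unfolding chain_factors_def by (cases us) auto

lemma chain_factors_unique:
  assumes "chain_factors X R us" "chain_factors X R us'" "concat us = concat us'"
  shows "us = us'"
proof -
  have *: "us = us'" if a: "chain_factors X R us" "chain_factors X R us'" "concat us = concat us'" "length us \<le> length us'" for us us'
  proof -
    have t: "us = take (length us) us'" using chain_factors_prefix[OF a(1,2,4), of "concat us"] a(3) by simp
    have "concat us' = concat (take (length us) us') @ concat (drop (length us) us')"
      by (metis append_take_drop_id concat_append)
    then have "concat (drop (length us) us') = []" using a(3) t by simp
    then have "drop (length us) us' = []"
      using chain_factors_nonempty[OF a(2)] by (auto simp: concat_eq_Nil_conv) (metis in_set_dropD last_in_set drop_eq_Nil not_le)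
    then show ?thesis using t by simp
  qed
  show ?thesis
  proof (cases "length us \<le> length us'")
    case True then show ?thesis using *[OF assms] by blast
  next
    case False then show ?thesis using *[OF assms(2,1) assms(3)[symmetric]] by simp
  qed
qed

lemma is_chain_unique: "is_chain X R r w \<Longrightarrow> is_chain X R r' w \<Longrightarrow> r = r'"
  unfolding is_chain_def using chain_factors_unique by (metis nat.inject)

definition chains :: "'a set \<Rightarrow> 'a list set \<Rightarrow> 'a list set" where
  "chains X R = {w. \<exists>r. is_chain X R r w}"

definition chain_length :: "'a set \<Rightarrow> 'a list set \<Rightarrow> 'a list \<Rightarrow> nat" where
  "chain_length X R w = (THE r. is_chain X R r w)"

definition factors :: "'a set \<Rightarrow> 'a list set \<Rightarrow> 'a list \<Rightarrow> 'a list list" where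
  "factors X R w = (THE us. chain_factors X R us \<and> concat us = w)"

lemma chain_length_eq: "is_chain X R r w \<Longrightarrow> chain_length X R w = r"
  unfolding chain_length_def by (rule the_equality) (auto dest: is_chain_unique)

lemma is_chain_iff: "is_chain X R r w \<longleftrightarrow> w \<in> chains X R \<and> chain_length X R w = r"
  using chain_length_eq unfolding chains_def by blast

lemma factors_eq: "chain_factors X R us \<Longrightarrow> factors X R (concat us) = us"
  unfolding factors_def by (rule the_equality) (auto dest: chain_factors_unique)

lemma chain_factors_chain: "chain_factors X R us \<Longrightarrow> is_chain X R (length us - 1) (concat us)"
  unfolding is_chain_def using chain_factors_nonempty[of X R us] by (intro exI[of _ us]) auto

lemma factors_chain:
  assumes "w \<in> chains X R"
  shows "chain_factors X R (factors X R w)" "concat (factors X R w) = w"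
    "length (factors X R w) = Suc (chain_length X R w)"
proof -
  obtain r us where us: "chain_factors X R us" "length us = Suc r" "concat us = w"
    using assms by (auto simp: chains_def is_chain_def)
  have "factors X R w = us" using factors_eq[OF us(1)] us(3) by simp
  moreover have "chain_length X R w = r" by (rule chain_length_eq) (use us in \<open>auto simp: is_chain_def\<close>)
  ultimately show "chain_factors X R (factors X R w)" "concat (factors X R w) = w"
    "length (factors X R w) = Suc (chain_length X R w)" using us by simp_all
qed

lemma chain_nonempty: "w \<in> chains X R \<Longrightarrow> w \<noteq> []"
  using factors_chain[of w X R] chain_factors_nonempty[of X R "factors X R w"]
  by (cases "factors X R w") auto

text \<open>
  The recursive description of an orbit, which follows the factors of a chain one at a time.
\<close>

fun run_chain :: "(nat \<Rightarrow> nat) \<Rightarrow> nat \<Rightarrow> nat \<Rightarrow> nat \<Rightarrow> nat \<Rightarrow> bool" where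
  "run_chain N 0 a b e = (e = b \<and> b < N a)"
| "run_chain N (Suc s) a b e = (b < N a \<and> run_chain N s b (N a) e)"

lemma interleave_next: "interleave N b (N a) j = interleave N a b (Suc j)"
  by (induction N b "N a" j rule: interleave.induct) auto

lemma run_chain_iff: "run_chain N s a b e \<longleftrightarrow>
   e = interleave N a b (Suc s) \<and> (\<forall>j\<le>s. interleave N a b (Suc j) < interleave N a b (Suc (Suc j)))"
proof (induction s arbitrary: a b)
  case (Suc s)
  have "(\<forall>j\<le>Suc s. interleave N a b (Suc j) < interleave N a b (Suc (Suc j))) \<longleftrightarrow>
      b < N a \<and> (\<forall>j\<le>s. interleave N a b (Suc (Suc j)) < interleave N a b (Suc (Suc (Suc j))))"
    by (subst all_le_Suc) simp
  then show ?case unfolding run_chain.simps Suc interleave_next by auto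
qed auto

lemma orbit_chain_iff_run: "orbit_chain N r a b \<longleftrightarrow> run_chain N r a (Suc a) b"
proof -
  have "(\<forall>j\<le>Suc r. interleave N a (Suc a) j < interleave N a (Suc a) (Suc j)) \<longleftrightarrow>
     (\<forall>j\<le>r. interleave N a (Suc a) (Suc j) < interleave N a (Suc a) (Suc (Suc j)))"
    by (subst all_le_Suc) simp
  then show ?thesis unfolding orbit_chain_def run_chain_iff by simp
qed

lemma run_chain_le: "run_chain N s a b e \<Longrightarrow> b \<le> e"
proof (induction s arbitrary: a b)
  case (Suc s)
  then have "b < N a" "N a \<le> e" by auto
  then show ?case by simp
qed simp

text \<open>
  The end of the shortest non-normal slice starting at \<open>a\<close>, and a value beyond the word if all
  slices starting at \<open>a\<close> are normal, so that the map is total and monotone.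
\<close>

definition next_end :: "'a set \<Rightarrow> 'a list set \<Rightarrow> 'a list \<Rightarrow> nat \<Rightarrow> nat" where
  "next_end X R w a = (LEAST b. (a \<le> b \<and> b \<le> length w \<and> \<not> normal_mono X R (slice w a b)) \<or> b = Suc (length w))"

locale monomial_algebra =
  fixes X :: "'a set" and R :: "'a list set"
  assumes presentation: "monomial_presentation X R"
begin

abbreviation "nrm \<equiv> normal_mono X R"

lemma normal_sublist: "sublist u w \<Longrightarrow> nrm w \<Longrightarrow> nrm u"
  unfolding normal_mono_def using set_mono_sublist[of u w] sublist_order.order_trans by (auto simp: in_lists_conv_set)

lemma normal_single: "x \<in> X \<Longrightarrow> nrm [x]"
  using presentation sublist_length_le unfolding normal_mono_def monomial_presentation_def
  by (fastforce simp: Ball_def)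

lemma next_end_cases:
  "(a \<le> next_end X R w a \<and> next_end X R w a \<le> length w \<and> \<not> nrm (slice w a (next_end X R w a))) \<or>
   next_end X R w a = Suc (length w)"
  unfolding next_end_def by (rule LeastI[of _ "Suc (length w)"]) simp

lemma normal_slice_iff:
  assumes "a \<le> b" "b \<le> length w"
  shows "nrm (slice w a b) \<longleftrightarrow> b < next_end X R w a"
proof
  assume n: "nrm (slice w a b)"
  show "b < next_end X R w a"
  proof (rule ccontr)
    assume "\<not> ?thesis"
    then have le: "next_end X R w a \<le> b" by simp
    then have "a \<le> next_end X R w a" "\<not> nrm (slice w a (next_end X R w a))"
      using next_end_cases[of a w] assms by auto
    then show False using normal_sublist[OF sublist_slice n, of a "next_end X R w a"] le by simp
  qed
next
  assume "b < next_end X R w a"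
  then show "nrm (slice w a b)"
    unfolding next_end_def using not_less_Least assms by blast
qed

lemma mono_next_end: "mono (next_end X R w)"
proof (rule monoI)
  fix a a' :: nat assume aa: "a \<le> a'"
  show "next_end X R w a \<le> next_end X R w a'"
    using next_end_cases[of a' w]
  proof
    assume b: "a' \<le> next_end X R w a' \<and> next_end X R w a' \<le> length w \<and> \<not> nrm (slice w a' (next_end X R w a'))"
    then have "\<not> nrm (slice w a (next_end X R w a'))"
      using normal_sublist[OF sublist_slice, of a a' "next_end X R w a'" "next_end X R w a'" w] aa by auto
    then show ?thesis using normal_slice_iff[of a "next_end X R w a'" w] b aa by auto
  next
    assume "next_end X R w a' = Suc (length w)"
    then show ?thesis using next_end_cases[of a w] by auto
  qed
qed

lemma zero_minimally_slice:
  assumes "a \<le> b" "b < c" "c \<le> length w" "b < next_end X R w a"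
  shows "zero_minimally X R (slice w a b) (slice w b c) \<longleftrightarrow> c = next_end X R w a"
proof -
  have 1: "\<not> nrm (slice w a b @ slice w b c) \<longleftrightarrow> next_end X R w a \<le> c"
    using normal_slice_iff[of a c w] assms by (simp add: slice_append not_less)
  have 2: "(\<forall>v'. strict_prefix v' (slice w b c) \<longrightarrow> nrm (slice w a b @ v')) \<longleftrightarrow> c \<le> next_end X R w a"
  proof
    assume A: "\<forall>v'. strict_prefix v' (slice w b c) \<longrightarrow> nrm (slice w a b @ v')"
    define d where "d = c - 1"
    have d: "b \<le> d" "d < c" "c = Suc d" using assms by (auto simp: d_def)
    have eq: "slice w b d @ slice w d c = slice w b c" using d by (simp add: slice_append)
    have "slice w d c \<noteq> []" using length_slice[of c w d] assms d by auto
    then have "strict_prefix (slice w b d) (slice w b c)" unfolding eq[symmetric] strict_prefix_def by simp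
    then have "nrm (slice w a d)" using A slice_append[of a b d w] assms d by auto
    then show "c \<le> next_end X R w a" using normal_slice_iff[of a d w] assms d by simp
  next
    assume le: "c \<le> next_end X R w a"
    show "\<forall>v'. strict_prefix v' (slice w b c) \<longrightarrow> nrm (slice w a b @ v')"
    proof (intro allI impI)
      fix v' assume v: "strict_prefix v' (slice w b c)"
      then have p: "prefix v' (slice w b c)" by (simp add: strict_prefix_def)
      have "length v' < length (slice w b c)" by (rule prefix_length_less[OF v])
      then have l: "b + length v' < c" using assms by (simp add: length_slice)
      have "v' = slice w b (b + length v')" using prefix_slice[OF p] assms by simp
      then have "slice w a b @ v' = slice w a (b + length v')"
        using slice_append[of a b "b + length v'" w] assms by simp
      then show "nrm (slice w a b @ v')" using normal_slice_iff[of a "b + length v'" w] l le assms by simp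
    qed
  qed
  show ?thesis unfolding zero_minimally_def 1 2 by auto
qed

lemma chain_tail_slice:
  assumes "a < b" "b \<le> e" "e \<le> length w" "b < next_end X R w a"
  shows "(\<exists>vs. length vs = s \<and> chain_tail X R (slice w a b) vs \<and> concat vs = slice w b e) \<longleftrightarrow>
     run_chain (next_end X R w) s a b e"
  using assms
proof (induction s arbitrary: a b)
  case 0
  have "slice w b e = [] \<longleftrightarrow> e = b"
    using length_slice[OF 0(3), of b] 0(2) by (cases "slice w b e") auto
  then show ?case using 0(4) by auto
next
  case (Suc s)
  let ?N = "next_end X R w"
  show ?case
  proof
    assume "\<exists>vs. length vs = Suc s \<and> chain_tail X R (slice w a b) vs \<and> concat vs = slice w b e"
    then obtain us where us: "length us = Suc s" "chain_tail X R (slice w a b) us" "concat us = slice w b e"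
      by blast
    from us(1) obtain v vs where "us = v # vs" by (cases us) auto
    with us have v: "length vs = s" "v \<noteq> []" "nrm v" "zero_minimally X R (slice w a b) v"
      "chain_tail X R v vs" "v @ concat vs = slice w b e" by simp_all
    define c where "c = b + length v"
    have p: "prefix v (slice w b e)" using v(6) by (metis prefixI)
    have vc: "v = slice w b c" "c \<le> e" "b < c"
      using prefix_slice[OF p Suc.prems(3,2), folded c_def] v(2) by (simp_all add: c_def)
    have cw: "c \<le> length w" "b \<le> c" "a \<le> b" using vc Suc.prems by linarith+
    have c: "c = ?N a"
      using zero_minimally_slice[OF cw(3) vc(3) cw(1) Suc.prems(4)] v(4) unfolding vc(1) by blast
    have cN: "c < ?N b" using normal_slice_iff[OF cw(2,1)] v(3) unfolding vc(1) by blast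
    have "v @ slice w c e = slice w b e" unfolding vc(1) by (rule slice_append[OF cw(2) vc(2)])
    then have "concat vs = slice w c e" using v(6) by (metis same_append_eq)
    then have "run_chain ?N s b c e"
      using Suc.IH[OF vc(3,2) Suc.prems(3) cN] v(1,5) unfolding vc(1) by blast
    then show "run_chain ?N (Suc s) a b e" using Suc.prems c by simp
  next
    assume r: "run_chain ?N (Suc s) a b e"
    define c where "c = ?N a"
    have rc: "b < c" "run_chain ?N s b c e" using r by (auto simp: c_def)
    have ce: "c \<le> e" using run_chain_le[OF rc(2)] .
    have cN: "c < ?N b" using rc(2) by (cases s) auto
    have cw: "c \<le> length w" "b \<le> c" "a \<le> b" using rc ce Suc.prems by linarith+
    obtain vs where vs: "length vs = s" "chain_tail X R (slice w b c) vs" "concat vs = slice w c e"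
      using Suc.IH[OF rc(1) ce Suc.prems(3) cN] rc(2) by blast
    have "slice w b c \<noteq> []" using length_slice[OF cw(1), of b] rc(1) by auto
    moreover have "nrm (slice w b c)" using normal_slice_iff[OF cw(2,1)] cN by blast
    moreover have "zero_minimally X R (slice w a b) (slice w b c)"
      using zero_minimally_slice[OF cw(3) rc(1) cw(1) Suc.prems(4)] c_def by blast
    ultimately have "chain_tail X R (slice w a b) (slice w b c # vs)" using vs(2) by simp
    moreover have "concat (slice w b c # vs) = slice w b e"
      using vs(3) slice_append[OF cw(2) ce] by simp
    moreover have "length (slice w b c # vs) = Suc s" using vs(1) by simp
    ultimately show "\<exists>vs. length vs = Suc s \<and> chain_tail X R (slice w a b) vs \<and> concat vs = slice w b e"
      by blast
  qed
qed

text \<open>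
  The dictionary between chains as words and orbits of the monotone map.
\<close>

lemma is_chain_slice:
  assumes "w \<in> lists X" "a \<le> b" "b \<le> length w"
  shows "is_chain X R r (slice w a b) \<longleftrightarrow> orbit_chain (next_end X R w) r a b"
proof (cases "a < b")
  case False
  then have "slice w a b = []" using assms by (simp add: slice_def)
  moreover have "\<not> is_chain X R r []" using chain_nonempty unfolding chains_def by blast
  moreover have "\<not> orbit_chain (next_end X R w) r a b"
    using orbit_chain_less False by blast
  ultimately show ?thesis by simp
next
  case True
  let ?x = "w ! a"
  have x: "slice w a (Suc a) = [?x]" "?x \<in> X" using True assms slice_single[of a w] by (auto simp: in_lists_conv_set)
  have N: "Suc a < next_end X R w a"
    using normal_slice_iff[of a "Suc a" w] normal_single x True assms by simp
  have ab: "slice w a b = ?x # slice w (Suc a) b"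
    using slice_append[of a "Suc a" b w] x True by simp
  have "is_chain X R r (slice w a b) \<longleftrightarrow> (\<exists>vs. length vs = r \<and> chain_tail X R [?x] vs \<and> concat vs = slice w (Suc a) b)"
  proof
    assume "is_chain X R r (slice w a b)"
    then obtain y vs where "chain_tail X R [y] vs" "length ([y] # vs) = Suc r" "concat ([y] # vs) = ?x # slice w (Suc a) b"
      unfolding is_chain_def chain_factors_iff ab by blast
    then show "\<exists>vs. length vs = r \<and> chain_tail X R [?x] vs \<and> concat vs = slice w (Suc a) b" by auto
  next
    assume "\<exists>vs. length vs = r \<and> chain_tail X R [?x] vs \<and> concat vs = slice w (Suc a) b"
    then obtain vs where vs: "length vs = r" "chain_tail X R [?x] vs" "concat vs = slice w (Suc a) b" by blast
    then have "chain_factors X R ([?x] # vs)" using x(2) unfolding chain_factors_iff by blast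
    then show "is_chain X R r (slice w a b)" unfolding is_chain_def ab using vs by (intro exI[of _ "[?x] # vs"]) simp
  qed
  also have "\<dots> \<longleftrightarrow> run_chain (next_end X R w) r a (Suc a) b"
    unfolding x(1)[symmetric] using True assms N by (intro chain_tail_slice) auto
  finally show ?thesis unfolding orbit_chain_iff_run .
qed

lemma chain_in_lists: "w \<in> chains X R \<Longrightarrow> w \<in> lists X"
proof -
  assume w: "w \<in> chains X R"
  have "u \<in> lists X" if "u \<in> set (factors X R w)" for u
    using factors_chain(1)[OF w] that unfolding chain_factors_def normal_mono_def
    by (cases "factors X R w") auto
  then have "set (concat (factors X R w)) \<subseteq> X" by (auto simp: in_lists_conv_set)
  then show ?thesis using factors_chain(2)[OF w] by auto
qed

text \<open>
  The factorizations that make up \<open>chain_d\<close>; equivalently the arguments of a higher product with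
  value plus or minus the dual of \<open>w\<close>.
\<close>

definition decs :: "'a list \<Rightarrow> 'a list list set" where
  "decs w = {ws. w \<in> chains X R \<and> 2 \<le> length ws \<and> set ws \<subseteq> chains X R \<and> concat ws = w \<and>
     Suc (sum_list (map (chain_length X R) ws)) = chain_length X R w}"

lemma length_le_concat: "[] \<notin> set ws \<Longrightarrow> length ws \<le> length (concat ws)"
proof (induction ws)
  case (Cons a ws) then show ?case by (cases a) auto
qed simp

lemma length_le_length_concat: "u \<in> set ws \<Longrightarrow> length u \<le> length (concat ws)"
  by (induction ws) auto

lemma finite_decs: "finite (decs w)"
proof (rule finite_subset)
  have "set ws \<subseteq> {u. set u \<subseteq> set w \<and> length u \<le> length w} \<and> length ws \<le> length w" if "ws \<in> decs w" for ws
  proof -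
    have c: "concat ws = w" "[] \<notin> set ws" using that chain_nonempty unfolding decs_def by auto
    have "length u \<le> length w" if "u \<in> set ws" for u
      using length_le_length_concat[OF that] c by simp
    then show ?thesis using c length_le_concat[OF c(2)] by auto
  qed
  then show "decs w \<subseteq> {ws. set ws \<subseteq> {u. set u \<subseteq> set w \<and> length u \<le> length w} \<and> length ws \<le> length w}" by blast
  show "finite {ws. set ws \<subseteq> {u. set u \<subseteq> set w \<and> length u \<le> length w} \<and> length ws \<le> length w}"
    by (intro finite_lists_length_le) auto
qed

text \<open>
  The parity of the sign in \<open>chain_d\<close>. It involves the outer lengths only, since the lengths in the
  middle of a factorization are even.
\<close>

definition dec_parity :: "'a list list \<Rightarrow> nat" where
  "dec_parity ws = length ws + (chain_length X R (hd ws) + 1) * chain_length X R (last ws)"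

definition chain_d :: "'a list \<Rightarrow> 'a list free_monoid \<Rightarrow>\<^sub>0 'k::field" where
  "chain_d w = (\<Sum>ws\<in>decs w. single (Word ws) ((-1) ^ dec_parity ws))"

definition position :: "'a list list \<Rightarrow> nat \<Rightarrow> nat" where
  "position ws i = length (concat (take i ws))"

lemma position_le: "position ws i \<le> length (concat ws)"
  unfolding position_def by (metis append_take_drop_id concat_append length_append le_add1)

lemma position_Suc: "i < length ws \<Longrightarrow> position ws (Suc i) = position ws i + length (ws ! i)"
  by (simp add: position_def take_Suc_conv_app_nth)

lemma chain_path_of_decomposition:
  assumes "set ws \<subseteq> chains X R" "concat ws \<in> chains X R" "2 \<le> length ws"
  shows "chain_path (next_end X R (concat ws)) 0 (length (concat ws)) (chain_length X R (concat ws))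
     (position ws) (\<lambda>i. chain_length X R (ws ! i)) (length ws)"
proof unfold_locales
  let ?w = "concat ws"
  have w: "?w \<in> lists X" using chain_in_lists assms(2) .
  show "mono (next_end X R ?w)" by (rule mono_next_end)
  have "is_chain X R (chain_length X R ?w) (slice ?w 0 (length ?w))"
    unfolding slice_whole is_chain_iff using assms by simp
  then show "orbit_chain (next_end X R ?w) (chain_length X R ?w) 0 (length ?w)"
    using is_chain_slice[OF w, of 0 "length ?w"] by simp
  show "position ws 0 = 0" "position ws (length ws) = length ?w" by (simp_all add: position_def)
  show "2 \<le> length ws" by fact
  fix i assume i: "i < length ws"
  have "ws ! i = slice ?w (position ws i) (position ws (Suc i))"
    using concat_slice[of i "Suc i" ws] slice_single[OF i] by (simp add: position_def)
  moreover have "position ws i \<le> position ws (Suc i)" "position ws (Suc i) \<le> length ?w"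
    using position_Suc[OF i] position_le[of ws "Suc i"] by linarith+
  moreover have "is_chain X R (chain_length X R (ws ! i)) (ws ! i)"
    unfolding is_chain_iff using assms(1) i by auto
  ultimately show "orbit_chain (next_end X R ?w) (chain_length X R (ws ! i)) (position ws i) (position ws (Suc i))"
    using is_chain_slice[OF w, of "position ws i" "position ws (Suc i)"] by simp
qed

lemma dec_middle_even:
  assumes "ws \<in> decs w" "0 < i" "Suc i < length ws"
  shows "even (chain_length X R (ws ! i))"
proof -
  interpret chain_path "next_end X R (concat ws)" 0 "length (concat ws)" "chain_length X R (concat ws)"
     "position ws" "\<lambda>i. chain_length X R (ws ! i)" "length ws"
    using assms by (intro chain_path_of_decomposition) (auto simp: decs_def)
  have "D (length ws) = sum_list (map (chain_length X R) ws)"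
    unfolding D_def by (simp add: sum_list_sum_nth atLeast0LessThan)
  then show ?thesis using assms by (intro middle_even) (auto simp: decs_def)
qed

lemma lookup_chain_d: "lookup (chain_d w :: _ \<Rightarrow>\<^sub>0 'k::field) (Word ws) = (if ws \<in> decs w then (-1) ^ dec_parity ws else 0)"
proof -
  have "lookup (chain_d w :: _ \<Rightarrow>\<^sub>0 'k) (Word ws) = (\<Sum>vs\<in>decs w. if vs = ws then (-1) ^ dec_parity vs else 0)"
    unfolding chain_d_def lookup_sum by (intro sum.cong) (auto simp: lookup_single when_def)
  also have "\<dots> = (if ws \<in> decs w then (-1) ^ dec_parity ws else 0)" by (simp add: finite_decs)
  finally show ?thesis .
qed

lemma keys_chain_d: "Word ws \<in> keys (chain_d w :: _ \<Rightarrow>\<^sub>0 'k::field) \<longleftrightarrow> ws \<in> decs w"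
  by (simp add: in_keys_iff lookup_chain_d)

lemma sum_list_take: "i \<le> length ws \<Longrightarrow> sum_list (map f (take i ws)) = (\<Sum>j<i. f (ws ! j))" for f :: "'b \<Rightarrow> nat"
  by (simp add: sum_list_sum_nth atLeast0LessThan)

lemma slice_append_middle:
  assumes "i = length us"
  shows "take i (us @ ds @ vs) = us" "drop (i + length ds) (us @ ds @ vs) = vs"
    "slice (us @ ds @ vs) i (i + length ds) = ds"
  using assms by (simp_all add: slice_def)

lemma derivation_chain_d_single:
  "derivation (chain_length X R) chain_d (single (Word ws) (a :: 'k::field)) =
     (\<Sum>i<length ws. \<Sum>ds\<in>decs (ws ! i). single (Word (take i ws @ ds @ drop (Suc i) ws))
        (a * ((-1) ^ sum_list (map (chain_length X R) (take i ws)) * (-1) ^ dec_parity ds)))"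
proof -
  have 1: "single (Word ws) a = pm_scale a (mon ws)" by simp
  have 2: "mon us * chain_d w * mon vs = (\<Sum>ds\<in>decs w. single (Word (us @ ds @ vs)) ((-1 :: 'k) ^ dec_parity ds))" for us vs w
    unfolding chain_d_def sum_distrib_left sum_distrib_right
    by (intro sum.cong) (simp_all add: mult_single plus_free_monoid_def)
  show ?thesis
    unfolding 1 der.scale derivation_mon der_list_sum 2 pm.scale_sum_right
    by (simp only: pm_scale_single)
qed

text \<open>
  Applying the derivation twice refines a factorization in one place. The ways to obtain a given
  refined factorization correspond to its merges, of which there are two with opposite signs.
\<close>

theorem derivation_chain_d: "derivation (chain_length X R) chain_d (chain_d w :: _ \<Rightarrow>\<^sub>0 'k::field) = 0"
proof (rule poly_mapping_eqI)
  fix v :: "'a list free_monoid"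
  obtain hs where v: "v = Word hs" by (cases v)
  let ?c = "chain_length X R"
  (* T lists the pairs of successive factorizations, F the refined factorization that results and e its sign. *)
  define T where "T = Sigma (decs w) (\<lambda>gs. Sigma {..<length gs} (\<lambda>i. decs (gs ! i)))"
  define F where "F t = (case t of (gs, i, ds) \<Rightarrow> take i gs @ ds @ drop (Suc i) gs)" for t :: "'a list list \<times> nat \<times> 'a list list"
  define e where "e t = (case t of (gs, i, ds) \<Rightarrow> sum_list (map ?c (take i gs)) + dec_parity ds + dec_parity gs)" for t :: "'a list list \<times> nat \<times> 'a list list"
  define S where "S = {t \<in> T. F t = hs}"
  have finT: "finite T" unfolding T_def by (intro finite_SigmaI finite_decs finite_lessThan)
  have "derivation ?c chain_d (chain_d w :: _ \<Rightarrow>\<^sub>0 'k) =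
      (\<Sum>gs\<in>decs w. \<Sum>i<length gs. \<Sum>ds\<in>decs (gs ! i). single (Word (F (gs, i, ds))) ((-1) ^ e (gs, i, ds)))"
    unfolding chain_d_def[of w] der.sum derivation_chain_d_single
    by (intro sum.cong refl) (simp only: F_def e_def prod.case power_add mult.commute mult.left_commute)
  also have "\<dots> = (\<Sum>t\<in>T. single (Word (F t)) ((-1) ^ e t))"
  proof -
    have "(\<Sum>i<length gs. \<Sum>ds\<in>decs (gs ! i). single (Word (F (gs, i, ds))) ((-1 :: 'k) ^ e (gs, i, ds))) =
        (\<Sum>p\<in>Sigma {..<length gs} (\<lambda>i. decs (gs ! i)). single (Word (F (gs, p))) ((-1) ^ e (gs, p)))" for gs
      using sum.Sigma[of "{..<length gs}" "\<lambda>i. decs (gs ! i)" "\<lambda>i ds. single (Word (F (gs, i, ds))) ((-1 :: 'k) ^ e (gs, i, ds))"]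
      by (simp add: finite_decs case_prod_unfold)
    moreover have "(\<Sum>gs\<in>decs w. \<Sum>p\<in>Sigma {..<length gs} (\<lambda>i. decs (gs ! i)). single (Word (F (gs, p))) ((-1 :: 'k) ^ e (gs, p))) =
        (\<Sum>t\<in>T. single (Word (F t)) ((-1) ^ e t))"
      unfolding T_def
      using sum.Sigma[of "decs w" "\<lambda>gs. Sigma {..<length gs} (\<lambda>i. decs (gs ! i))" "\<lambda>gs p. single (Word (F (gs, p))) ((-1 :: 'k) ^ e (gs, p))"]
      by (simp add: finite_decs case_prod_unfold)
    ultimately show ?thesis by (simp only:)
  qed
  finally have "lookup (derivation ?c chain_d (chain_d w :: _ \<Rightarrow>\<^sub>0 'k)) v = (\<Sum>t\<in>T. if F t = hs then (-1) ^ e t else 0)"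
    by (simp add: lookup_sum lookup_single when_def v)
  also have "\<dots> = (\<Sum>t\<in>S. (-1) ^ e t)"
    unfolding S_def by (rule sum.inter_filter[OF finT, symmetric])
  also have "\<dots> = 0"
  proof (cases "S = {}")
    case False
    (* One way to obtain hs suffices to see that hs is a path of total length two less. *)
    then obtain gs0 i0 ds0 where t0: "gs0 \<in> decs w" "i0 < length gs0" "ds0 \<in> decs (gs0 ! i0)"
      "hs = take i0 gs0 @ ds0 @ drop (Suc i0) gs0"
      by (auto simp: S_def T_def F_def)
    note g0 = t0(1)[unfolded decs_def, simplified] and d0 = t0(3)[unfolded decs_def, simplified]
    have gs0: "gs0 = take i0 gs0 @ [gs0 ! i0] @ drop (Suc i0) gs0" using t0(2) by (simp add: id_take_nth_drop)
    have w: "w \<in> chains X R" using g0 by simp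
    have hs_chains: "set hs \<subseteq> chains X R"
      using g0 d0 set_take_subset[of i0 gs0] set_drop_subset[of "Suc i0" gs0] unfolding t0(4) by auto
    have "concat gs0 = concat (take i0 gs0) @ gs0 ! i0 @ concat (drop (Suc i0) gs0)"
      using arg_cong[OF gs0, of concat] by (simp only: concat_append concat.simps append_Nil2)
    then have hs_w: "concat hs = w" using g0 d0 unfolding t0(4) by simp
    have "sum_list (map ?c gs0) = sum_list (map ?c (take i0 gs0)) + ?c (gs0 ! i0) + sum_list (map ?c (drop (Suc i0) gs0))"
      using arg_cong[OF gs0, of "\<lambda>l. sum_list (map ?c l)"]
      by (simp only: map_append sum_list_append list.map sum_list.Cons sum_list.Nil add_0_right add.assoc)
    then have hs_deg: "sum_list (map ?c hs) + 2 = ?c w" using g0 d0 unfolding t0(4) by simp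
    have hs_len: "2 \<le> length hs" using d0 unfolding t0(4) by simp
    have w_lists: "w \<in> lists X" by (rule chain_in_lists[OF w])
    interpret cp: chain_path "next_end X R w" 0 "length w" "?c w" "position hs" "\<lambda>i. ?c (hs ! i)" "length hs"
      using chain_path_of_decomposition[OF hs_chains _ hs_len] w unfolding hs_w by simp
    have D: "cp.D i = sum_list (map ?c (take i hs))" if "i \<le> length hs" for i
      using sum_list_take[OF that] by (simp add: cp.D_def)
    have "?c w = cp.D (length hs) + 2" using hs_deg D[of "length hs"] by simp
    then obtain m where "double_path (next_end X R w) 0 (length w) (?c w) (position hs) (\<lambda>i. ?c (hs ! i)) (length hs) m"
      by (rule cp.double_path_exists)
    then interpret dp: double_path "next_end X R w" 0 "length w" "?c w" "position hs" "\<lambda>i. ?c (hs ! i)" "length hs" m .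
    define G where "G p = (case p of (i, l) \<Rightarrow> (take i hs @ [concat (slice hs i l)] @ drop l hs, i, slice hs i l))" for p :: "nat \<times> nat"
    have take_l: "take l hs = take i hs @ slice hs i l" if "i \<le> l" for i l
      using slice_append[of 0 i l hs] that by (simp add: slice_def)
    have D_slice: "sum_list (map ?c (slice hs i l)) = cp.D l - cp.D i" if "i \<le> l" "l \<le> length hs" for i l
      using D[of i] D[of l] that take_l[of i l] by simp
    have chain_slice: "is_chain X R r (concat (slice hs i l)) \<longleftrightarrow> orbit_chain (next_end X R w) r (position hs i) (position hs l)"
      if "i \<le> l" "l \<le> length hs" for i l r
    proof -
      have "concat (slice hs i l) = slice w (position hs i) (position hs l)"
        using concat_slice[OF that(1), of hs] unfolding hs_w position_def .
      moreover have "position hs i \<le> position hs l" using take_l[OF that(1)] by (simp add: position_def)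
      moreover have "position hs l \<le> length w" using position_le[of hs l] hs_w by simp
      ultimately show ?thesis using is_chain_slice[OF w_lists] by simp
    qed
    have G_S: "G (i, l) \<in> S" "e (G (i, l)) = dp.merge_sign i l" if il: "(i, l) \<in> cp.merges" for i l
    proof -
      have m: "i + 2 \<le> l" "l \<le> length hs" "orbit_chain (next_end X R w) (cp.D l - cp.D i + 1) (position hs i) (position hs l)"
        using il by (auto simp: cp.merges_def)
      have il': "i \<le> l" "i < l" "i < length hs" using m by linarith+
      let ?d = "slice hs i l" and ?g = "take i hs @ [concat (slice hs i l)] @ drop l hs"
      have len_d: "length ?d = l - i" using m(2) by (rule length_slice)
      have ch: "is_chain X R (cp.D l - cp.D i + 1) (concat ?d)" using chain_slice[OF il'(1) m(2)] m(3) by simp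
      then have cd: "concat ?d \<in> chains X R" "?c (concat ?d) = cp.D l - cp.D i + 1" unfolding is_chain_iff by simp_all
      have "set ?d \<subseteq> set hs" unfolding slice_def using set_take_subset set_drop_subset by fast
      then have d_dec: "?d \<in> decs (concat ?d)"
        using cd hs_chains m len_d D_slice[OF il'(1) m(2)] unfolding decs_def by auto
      have hs: "hs = take i hs @ ?d @ drop l hs" using take_l[OF il'(1)] append_take_drop_id[of l hs] by simp
      have conc: "concat ?g = w"
      proof -
        have "concat ?g = concat (take i hs @ ?d @ drop l hs)" by simp
        then show ?thesis using hs hs_w by simp
      qed
      have len: "2 \<le> length ?g"
      proof (rule ccontr)
        assume "\<not> ?thesis"
        moreover have "length ?g = i + 1 + (length hs - l)" using il' by simp
        ultimately have "i = 0" "l = length hs" using m(2) by linarith+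
        then have "?c w = cp.D (length hs) + 1" using cd(2) hs_w by (simp add: slice_def cp.D_simps)
        then show False using \<open>?c w = cp.D (length hs) + 2\<close> by simp
      qed
      have sub: "set ?g \<subseteq> chains X R" using hs_chains cd(1) set_take_subset[of i hs] set_drop_subset[of l hs] by auto
      have "sum_list (map ?c (drop l hs)) + cp.D l = cp.D (length hs)"
        using D[of l] D[of "length hs"] m(2) append_take_drop_id[of l hs]
        by (metis add.commute le_refl map_append sum_list_append take_all)
      then have "sum_list (map ?c ?g) = cp.D (length hs) + 1"
        using D[of i] cd(2) il' m(2) cp.mono_D[OF il'(1)] by simp
      then have g_dec: "?g \<in> decs w"
        using w sub conc len \<open>?c w = cp.D (length hs) + 2\<close> unfolding decs_def by simp
      have gi: "?g ! i = concat ?d" "i < length ?g" "take i ?g = take i hs" "drop (Suc i) ?g = drop l hs"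
        using il' by (simp_all add: nth_append)
      have "F (?g, i, ?d) = hs" using hs gi unfolding F_def by simp
      moreover have "(?g, i, ?d) \<in> T" unfolding T_def using g_dec gi d_dec by simp
      ultimately show "G (i, l) \<in> S" unfolding S_def G_def by simp
      have d1: "hd ?d = hs ! i" "last ?d = hs ! (l - 1)"
      proof -
        show "hd ?d = hs ! i" using il' by (simp add: slice_def hd_drop_conv_nth)
        have "last ?d = ?d ! (l - i - 1)" using len_d il' by (subst last_conv_nth) auto
        also have "\<dots> = hs ! (l - 1)" using il' m(2) by (simp add: slice_def)
        finally show "last ?d = hs ! (l - 1)" .
      qed
      have hg: "?c (hd ?g) = (if i = 0 then cp.D l + 1 else ?c (hs ! 0))"
        using cd(2) il' by (cases i) (auto simp: cp.D_simps hd_append hd_conv_nth)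
      have lg: "?c (last ?g) = (if l = length hs then cp.D (length hs) - cp.D i + 1 else ?c (hs ! (length hs - 1)))"
      proof (cases "l = length hs")
        case True then show ?thesis using cd(2) by simp
      next
        case False
        then have "last ?g = last hs" using m(2) by (simp add: last_drop)
        also have "\<dots> = hs ! (length hs - 1)" using il'(3) by (intro last_conv_nth) auto
        finally show ?thesis using False by simp
      qed
      have lenG: "length ?g = length hs + 1 - (l - i)" using il' m(2) by simp
      show "e (G (i, l)) = dp.merge_sign i l"
        unfolding e_def G_def dp.merge_sign_def dec_parity_def
        by (simp only: prod.case gi(3) hg lg lenG d1 len_d D[OF less_imp_le[OF il'(3)], symmetric])
    qed
    have S_G: "t \<in> G ` cp.merges" if "t \<in> S" for t
    proof -
      obtain gs i ds where t: "t = (gs, i, ds)" by (cases t)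
      have tt: "gs \<in> decs w" "i < length gs" "ds \<in> decs (gs ! i)" "hs = take i gs @ ds @ drop (Suc i) gs"
        using \<open>t \<in> S\<close> unfolding t by (auto simp: S_def T_def F_def)
      note dd = tt(3)[unfolded decs_def, simplified]
      define l where "l = i + length ds"
      have i: "i = length (take i gs)" using tt(2) by simp
      note mid = slice_append_middle[OF i, of ds "drop (Suc i) gs", folded tt(4) l_def]
      have lh: "l \<le> length hs" using tt(2) by (simp add: tt(4) l_def)
      have il: "i + 2 \<le> l" "i \<le> l" using dd by (simp_all add: l_def)
      have gi: "gs ! i = concat (slice hs i l)" using dd mid(3) by simp
      have "gs = take i gs @ [gs ! i] @ drop (Suc i) gs" using tt(2) by (simp add: id_take_nth_drop)
      then have gs: "gs = take i hs @ [concat (slice hs i l)] @ drop l hs" using mid(1,2) gi by simp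
      have "is_chain X R (cp.D l - cp.D i + 1) (concat (slice hs i l))"
        unfolding is_chain_iff gi[symmetric] using dd D_slice[OF il(2) lh] mid(3) by simp
      then have "orbit_chain (next_end X R w) (cp.D l - cp.D i + 1) (position hs i) (position hs l)"
        using chain_slice[OF il(2) lh] by simp
      then have "(i, l) \<in> cp.merges" using il lh by (simp add: cp.merges_def)
      moreover have "t = G (i, l)" unfolding t G_def using gs mid(3) by simp
      ultimately show ?thesis by blast
    qed
    have S_eq: "S = G ` cp.merges"
    proof
      show "S \<subseteq> G ` cp.merges" using S_G by blast
      show "G ` cp.merges \<subseteq> S"
      proof (rule image_subsetI)
        fix p assume "p \<in> cp.merges"
        then show "G p \<in> S" using G_S(1)[of "fst p" "snd p"] by simp
      qed
    qed
    have inj: "inj_on G cp.merges"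
    proof (rule inj_onI)
      fix p q assume p: "p \<in> cp.merges" "q \<in> cp.merges" "G p = G q"
      obtain i l i' l' where pq: "p = (i, l)" "q = (i', l')" by (cases p; cases q)
      have "i = i'" using arg_cong[OF p(3), of "\<lambda>t. fst (snd t)"]
        by (simp only: pq G_def prod.case snd_conv fst_conv)
      moreover have sl: "slice hs i l = slice hs i' l'" using arg_cong[OF p(3), of "\<lambda>t. snd (snd t)"]
        by (simp only: pq G_def prod.case snd_conv)
      ultimately have ii: "i = i'" "length (slice hs i l) = length (slice hs i' l')" using arg_cong[OF sl, of length] by blast+
      have "i + 2 \<le> l" "l \<le> length hs" "i' + 2 \<le> l'" "l' \<le> length hs" using p(1,2) unfolding pq cp.merges_def by auto
      then show "p = q" using ii unfolding pq by (simp add: length_slice)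
    qed
    obtain A B where AB: "A \<noteq> B" "cp.merges = {A, B}" "odd (dp.merge_sign (fst A) (snd A) + dp.merge_sign (fst B) (snd B))"
      using dp.two_merges by blast
    have eA: "e (G A) = dp.merge_sign (fst A) (snd A)" and eB: "e (G B) = dp.merge_sign (fst B) (snd B)"
      using G_S(2)[of "fst A" "snd A"] G_S(2)[of "fst B" "snd B"] AB(2) by simp_all
    have "(\<Sum>t\<in>S. (-1 :: 'k) ^ e t) = (\<Sum>p\<in>cp.merges. (-1) ^ e (G p))"
      unfolding S_eq by (rule sum.reindex[OF inj, unfolded o_def])
    also have "\<dots> = (-1) ^ e (G A) + (-1) ^ e (G B)" unfolding AB(2) using AB(1) by simp
    also have "\<dots> = 0" using AB(3) unfolding eA eB by (auto simp: minus_one_power_iff)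
    finally show ?thesis .
  qed simp
  finally show "lookup (derivation ?c chain_d (chain_d w :: _ \<Rightarrow>\<^sub>0 'k)) v = lookup 0 v" by simp
qed

end

section \<open>The sign of the higher products\<close>

lemma sum_pairs_Cons:
  "(\<Sum>(i, j)\<in>{(i, j). i < j \<and> j < length (r # rs)}. (r # rs) ! i * ((r # rs) ! j + 1)) =
    r * sum_list (map Suc rs) + (\<Sum>(i, j)\<in>{(i, j). i < j \<and> j < length rs}. rs ! i * (rs ! j + 1))" for r :: nat
proof -
  have pairs: "(\<Sum>(i, j)\<in>{(i, j). i < j \<and> j < n}. f i j) = (\<Sum>j<n. \<Sum>i<j. f i j)" for n and f :: "nat \<Rightarrow> nat \<Rightarrow> nat"
  proof -
    have "(\<Sum>j<n. \<Sum>i<j. f i j) = (\<Sum>(j, i)\<in>Sigma {..<n} (\<lambda>j. {..<j}). f i j)" by (rule sum.Sigma) auto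
    also have "\<dots> = (\<Sum>(i, j)\<in>{(i, j). i < j \<and> j < n}. f i j)"
      by (rule sum.reindex_bij_witness[where i = prod.swap and j = prod.swap]) auto
    finally show ?thesis by simp
  qed
  have "(\<Sum>j<length (r # rs). \<Sum>i<j. (r # rs) ! i * ((r # rs) ! j + 1)) =
      (\<Sum>j<length rs. r * (rs ! j + 1) + (\<Sum>i<j. rs ! i * (rs ! j + 1)))"
    by (simp only: list.size add_Suc_right add_0_right sum.lessThan_Suc_shift nth_Cons_0 nth_Cons_Suc lessThan_0 sum.empty add_0_left)
  also have "\<dots> = r * (\<Sum>j<length rs. Suc (rs ! j)) + (\<Sum>j<length rs. \<Sum>i<j. rs ! i * (rs ! j + 1))"
    by (simp only: sum.distrib sum_distrib_left[symmetric] Suc_eq_plus1)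
  also have "(\<Sum>j<length rs. Suc (rs ! j)) = sum_list (map Suc rs)"
    by (simp add: sum_list_sum_nth atLeast0LessThan)
  finally show ?thesis unfolding pairs .
qed

text \<open>
  The lengths in the middle are even, so modulo 2 only their number matters. The other terms
  belong to the first and the last length.
\<close>

lemma sign_parity:
  assumes "\<forall>m\<in>set ms. even m"
  shows "even (int (sign_exponent (a # ms @ [b])) + koszul_weight (map (\<lambda>r. int r + 1) (a # ms @ [b]))) \<longleftrightarrow>
    even (length ms + (a + 1) * b)"
proof -
  let ?k = "length ms"
  define ps where "ps rs = (\<Sum>(i, j)\<in>{(i, j). i < j \<and> j < length rs}. rs ! i * (rs ! j + 1))" for rs :: "nat list"
  have ps_Cons: "ps (r # rs) = r * sum_list (map Suc rs) + ps rs" for r rs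
    unfolding ps_def by (rule sum_pairs_Cons)
  have ps_Nil: "ps [] = 0" by (simp add: ps_def)
  have s1: "even (sum_list (map Suc ms)) \<longleftrightarrow> even ?k" using assms by (induction ms) auto
  have s2: "even (sum_list ms)" using assms by (induction ms) auto
  have s3: "even (ps (ms @ [b]))" using assms by (induction ms) (auto simp: ps_Cons ps_Nil)
  have pos: "1 \<le> (k + 3 choose 2)" for k :: nat by (simp add: Suc_le_eq)
  have s4: "even (int (?k + 3 choose 2) + koszul_weight (map (\<lambda>r. int r + 1) ms)) \<longleftrightarrow> odd ?k"
    using assms
  proof (induction ms)
    case (Cons m ms)
    have "(Suc n choose 2) = (n choose 2) + n" for n :: nat by (simp add: numeral_2_eq_2)
    from this[of "length ms + 3"]
    have "(length (m # ms) + 3 choose 2) = (length ms + 3 choose 2) + (length ms + 3)" by simp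
    then show ?case using Cons by auto
  qed (simp add: numeral_3_eq_3 numeral_2_eq_2)
  have s5: "sum_list (map (\<lambda>r. int r + 1) ms) = int (sum_list (map Suc ms))" by (induction ms) auto
  have kw: "koszul_weight (map (\<lambda>r. int r + 1) (a # ms @ [b])) =
      int (?k + 1) * (int a + 1) + (koszul_weight (map (\<lambda>r. int r + 1) ms) + int (sum_list (map Suc ms)))"
    by (simp add: koszul_weight_append s5)
  have se: "int (sign_exponent (a # ms @ [b])) + 1 = int (?k + 3 choose 2) +
      int (a * (sum_list (map Suc ms) + Suc b) + ps (ms @ [b]) + a + (a + sum_list ms + b + 1))"
  proof -
    have n: "length (a # ms @ [b]) + 1 = ?k + 3" by simp
    have "sign_exponent (a # ms @ [b]) = (?k + 3 choose 2) - 1 + ps (a # ms @ [b]) + a + (a + sum_list ms + b + 1)"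
      unfolding sign_exponent_def Let_def ps_def n by (simp add: add.assoc)
    then show ?thesis using pos[of ?k] unfolding ps_Cons by (simp add: of_nat_diff)
  qed
  have shift: "even (A + B) \<longleftrightarrow> odd ((A + 1) + B)" for A B :: int by simp
  have "even (int (sign_exponent (a # ms @ [b])) + koszul_weight (map (\<lambda>r. int r + 1) (a # ms @ [b]))) \<longleftrightarrow>
     odd ((int (sign_exponent (a # ms @ [b])) + 1) + koszul_weight (map (\<lambda>r. int r + 1) (a # ms @ [b])))"
    by (rule shift)
  also have "\<dots> \<longleftrightarrow> odd (int (?k + 3 choose 2) + koszul_weight (map (\<lambda>r. int r + 1) ms) +
      int (a * (sum_list (map Suc ms) + Suc b) + ps (ms @ [b]) + a + (a + sum_list ms + b + 1) +
        (?k + 1) * (a + 1) + sum_list (map Suc ms)))"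
    unfolding se kw by (simp add: algebra_simps)
  also have "\<dots> \<longleftrightarrow> even (?k + (a + 1) * b)"
    using s1 s2 s3 s4 by (simp only: even_add even_mult_iff even_of_nat even_Suc odd_one) auto
  finally show ?thesis .
qed

lemma (in monomial_algebra) dec_sign:
  assumes "ws \<in> decs w"
  shows "(-1) ^ sign_exponent (map (chain_length X R) ws) *
     sg (koszul_weight (map (\<lambda>c. int (chain_length X R c) + 1) ws)) = ((-1) ^ dec_parity ws :: 'k::field)"
proof -
  have "2 \<le> length ws" using assms by (simp add: decs_def)
  then obtain x us y where ws: "ws = x # us @ [y]"
    by (metis One_nat_def Suc_1 Suc_le_length_iff append_butlast_last_id list.size(3) not_less_eq_eq zero_le)
  let ?c = "chain_length X R"
  have "\<forall>m\<in>set (map ?c us). even m"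
  proof
    fix m assume "m \<in> set (map ?c us)"
    then obtain i where i: "i < length us" "m = ?c (us ! i)" by (auto simp: in_set_conv_nth)
    have "ws ! Suc i = us ! i" using i ws by (simp add: nth_append)
    then show "even m" using dec_middle_even[OF assms, of "Suc i"] i ws by simp
  qed
  from sign_parity[OF this, of "?c x" "?c y"]
  have "even (int (sign_exponent (map ?c ws)) + koszul_weight (map (\<lambda>c. int (?c c) + 1) ws)) \<longleftrightarrow> even (dec_parity ws)"
    by (simp add: ws dec_parity_def o_def)
  then have "sg (int (sign_exponent (map ?c ws)) + koszul_weight (map (\<lambda>c. int (?c c) + 1) ws)) = (sg (int (dec_parity ws)) :: 'k)"
    by (simp add: sg_def)
  then show ?thesis unfolding minus_one_power_sg by (simp only: sg_simps(2))
qed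

section \<open>The cobar construction of the bar construction\<close>

context monomial_algebra
begin

abbreviation bar_letter :: "'a list \<Rightarrow> bool" where
  "bar_letter a \<equiv> a \<noteq> [] \<and> nrm a"

definition bar_deg :: "'a list list \<Rightarrow> nat" where "bar_deg C = length C - 1"

definition merge_at :: "nat \<Rightarrow> 'a list list \<Rightarrow> 'a list list" where
  "merge_at i C = take i C @ [C ! i @ C ! Suc i] @ drop (i + 2) C"

text \<open>
  The two kinds of terms of the cobar differential at position \<open>i\<close>: multiply two adjacent bar
  letters, or cut the bar word in two. With the basis of the bar construction rescaled by the signs
  \<open>eta\<close> below, both carry the sign \<open>(-1)\<^bsup>i\<^esup>\<close>.
\<close>

definition cobar_term :: "'a list list \<Rightarrow> nat \<Rightarrow> 'a list list free_monoid \<Rightarrow>\<^sub>0 'k::field" where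
  "cobar_term C i = pm_scale ((-1) ^ i)
     ((if nrm (C ! i @ C ! Suc i) then mon [merge_at i C] else 0) - mon [take (Suc i) C, drop (Suc i) C])"

definition cobar_d :: "'a list list \<Rightarrow> 'a list list free_monoid \<Rightarrow>\<^sub>0 'k::field" where
  "cobar_d C = (if bar_word X R C then \<Sum>i<length C - 1. cobar_term C i else 0)"

text \<open>
  The two ways to add a letter at the right end of a word of bar words: as a new bar letter, or
  multiplied into the last bar letter. The differential is described by how it commutes with them.
\<close>

definition snoc_bar :: "'a list \<Rightarrow> ('a list list free_monoid \<Rightarrow>\<^sub>0 'k::field) \<Rightarrow> ('a list list free_monoid \<Rightarrow>\<^sub>0 'k)" where
  "snoc_bar a = lin_ext pm_scale (\<lambda>w. mon (butlast (letters w) @ [last (letters w) @ [a]]))"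

definition snoc_mult_list :: "'a list \<Rightarrow> 'a list list list \<Rightarrow> ('a list list free_monoid \<Rightarrow>\<^sub>0 'k::field)" where
  "snoc_mult_list a ws = (if nrm (last (last ws) @ a)
     then mon (butlast ws @ [butlast (last ws) @ [last (last ws) @ a]]) else 0)"

definition snoc_mult :: "'a list \<Rightarrow> ('a list list free_monoid \<Rightarrow>\<^sub>0 'k::field) \<Rightarrow> ('a list list free_monoid \<Rightarrow>\<^sub>0 'k)" where
  "snoc_mult a = lin_ext pm_scale (\<lambda>w. snoc_mult_list a (letters w))"

lemma snoc_bar_linear: "Vector_Spaces.linear pm_scale pm_scale (snoc_bar a)"
  and snoc_mult_linear: "Vector_Spaces.linear pm_scale pm_scale (snoc_mult a)"
  unfolding snoc_bar_def snoc_mult_def by (rule pm.lin_ext_linear)+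

interpretation snoc_bar: Vector_Spaces.linear pm_scale pm_scale "snoc_bar a" for a by (rule snoc_bar_linear)
interpretation snoc_mult: Vector_Spaces.linear pm_scale pm_scale "snoc_mult a" for a by (rule snoc_mult_linear)

lemma snoc_bar_mon: "snoc_bar a (mon (us @ [C])) = mon (us @ [C @ [a]])"
  by (simp add: snoc_bar_def)

lemma snoc_mult_mon: "snoc_mult a (mon (us @ [C @ [b]])) = (if nrm (b @ a) then mon (us @ [C @ [b @ a]]) else 0)"
  by (simp add: snoc_mult_def snoc_mult_list_def)

lemma snoc_bar_mon_simps: "snoc_bar a (mon [C]) = mon [C @ [a]]" "snoc_bar a (mon [B, C]) = mon [B, C @ [a]]"
  by (simp_all add: snoc_bar_def)

lemma snoc_mult_mon_simps:
  "snoc_mult a (mon [C @ [b]]) = (if nrm (b @ a) then mon [C @ [b @ a]] else 0)"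
  "snoc_mult a (mon [B, C @ [b]]) = (if nrm (b @ a) then mon [B, C @ [b @ a]] else 0)"
  "snoc_mult a (mon [B, [b]]) = (if nrm (b @ a) then mon [B, [b @ a]] else 0)"
  by (simp_all add: snoc_mult_def snoc_mult_list_def)

lemma snoc_bar_mult:
  assumes "\<And>v. v \<in> keys y \<Longrightarrow> letters v \<noteq> []"
  shows "snoc_bar a (x * y) = x * snoc_bar a y"
proof (rule linear_eq_on_keys[where sc = pm_scale and f = "\<lambda>y. snoc_bar a (x * y)" and g = "\<lambda>y. x * snoc_bar a y" and x = y])
  fix w assume "w \<in> keys y"
  then obtain vs C where w: "w = Word (vs @ [C])" using assms[of w] by (metis append_butlast_last_id free_monoid.collapse)
  show "snoc_bar a (x * single w 1) = x * snoc_bar a (single w 1)"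
  proof (rule linear_eq_on_keys[where sc = pm_scale and f = "\<lambda>x. snoc_bar a (x * single w 1)" and g = "\<lambda>x. x * snoc_bar a (single w 1)" and x = x])
    fix u show "snoc_bar a (single u 1 * single w 1) = single u 1 * snoc_bar a (single w 1)"
      using snoc_bar_mon[of a "letters u @ vs" C] by (cases u) (simp add: w snoc_bar_mon)
  qed (intro pm_linear_intros pm_linear_compose[OF _ snoc_bar_linear])+
qed (intro pm_linear_intros pm_linear_compose[OF _ snoc_bar_linear] snoc_bar_linear)+

lemma snoc_mult_mult:
  assumes "\<And>v. v \<in> keys y \<Longrightarrow> letters v \<noteq> []"
  shows "snoc_mult a (x * y) = x * snoc_mult a y"
proof (rule linear_eq_on_keys[where sc = pm_scale and f = "\<lambda>y. snoc_mult a (x * y)" and g = "\<lambda>y. x * snoc_mult a y" and x = y])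
  fix w assume "w \<in> keys y"
  then obtain vs C where w: "w = Word (vs @ [C])" using assms[of w] by (metis append_butlast_last_id free_monoid.collapse)
  show "snoc_mult a (x * single w 1) = x * snoc_mult a (single w 1)"
  proof (rule linear_eq_on_keys[where sc = pm_scale and f = "\<lambda>x. snoc_mult a (x * single w 1)" and g = "\<lambda>x. x * snoc_mult a (single w 1)" and x = x])
    fix u :: "'a list list free_monoid"
    obtain us where u: "u = Word us" by (cases u)
    have "snoc_mult a (mon (us @ vs @ [C])) = mon us * snoc_mult a (mon (vs @ [C]))"
      by (simp add: snoc_mult_def snoc_mult_list_def butlast_append)
    then show "snoc_mult a (single u 1 * single w 1) = single u 1 * snoc_mult a (single w 1)"
      by (simp add: u w)
  qed (intro pm_linear_intros pm_linear_compose[OF _ snoc_mult_linear])+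
qed (intro pm_linear_intros pm_linear_compose[OF _ snoc_mult_linear] snoc_mult_linear)+

lemma keys_pm_diff: "keys (x - y) \<subseteq> keys x \<union> keys (y :: 'b \<Rightarrow>\<^sub>0 'k::field)"
  by (rule subsetI) (auto simp: in_keys_iff lookup_minus)

lemma bar_word_snoc: "C \<noteq> [] \<Longrightarrow> bar_word X R (C @ [a]) \<longleftrightarrow> bar_word X R C \<and> bar_letter a"
  by (auto simp: bar_word_def)

lemma cobar_d_single [simp]: "cobar_d [a] = 0"
  by (simp add: cobar_d_def)

lemma cobar_d_snoc:
  assumes "bar_word X R C" "bar_letter a"
  shows "cobar_d (C @ [a]) = snoc_bar a (cobar_d C) +
     pm_scale ((-1) ^ bar_deg C) (snoc_mult a (mon [C]) - mon [C, [a]] :: _ \<Rightarrow>\<^sub>0 'k::field)"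
proof -
  have ne: "C \<noteq> []" using assms(1) by (simp add: bar_word_def)
  then obtain k where k: "length C = Suc k" by (cases C) auto
  have bw: "bar_word X R (C @ [a])" using assms bar_word_snoc[OF ne] by simp
  have low: "cobar_term (C @ [a]) i = snoc_bar a (cobar_term C i :: _ \<Rightarrow>\<^sub>0 'k)" if i: "i < k" for i
  proof -
    have lt: "i < length C" "Suc i < length C" using i k by simp_all
    have m: "merge_at i (C @ [a]) = merge_at i C @ [a]" using lt by (simp add: merge_at_def nth_append)
    have 1: "snoc_bar a (mon [merge_at i C]) = (mon [merge_at i C @ [a]] :: _ \<Rightarrow>\<^sub>0 'k)"
      by (rule snoc_bar_mon_simps)
    have 2: "snoc_bar a (mon [take (Suc i) C, drop (Suc i) C]) = (mon [take (Suc i) C, drop (Suc i) C @ [a]] :: _ \<Rightarrow>\<^sub>0 'k)"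
      by (rule snoc_bar_mon_simps)
    show ?thesis using lt unfolding cobar_term_def m snoc_bar.scale snoc_bar.diff 2
      by (simp add: nth_append 1 snoc_bar.zero)
  qed
  have high: "cobar_term (C @ [a]) k = pm_scale ((-1) ^ bar_deg C) (snoc_mult a (mon [C]) - mon [C, [a]] :: _ \<Rightarrow>\<^sub>0 'k)"
  proof -
    obtain B b where B: "C = B @ [b]" using ne by (metis append_butlast_last_id)
    have kB: "k = length B" using k B by simp
    have "snoc_mult a (mon [C]) = (if nrm (b @ a) then mon [B @ [b @ a]] else 0 :: _ \<Rightarrow>\<^sub>0 'k)"
      unfolding B by (rule snoc_mult_mon_simps)
    then show ?thesis unfolding cobar_term_def bar_deg_def merge_at_def by (simp add: B kB nth_append)
  qed
  have "(cobar_d (C @ [a]) :: _ \<Rightarrow>\<^sub>0 'k) = (\<Sum>i<k. cobar_term (C @ [a]) i) + cobar_term (C @ [a]) k"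
    using bw k by (simp add: cobar_d_def)
  also have "(\<Sum>i<k. cobar_term (C @ [a]) i) = snoc_bar a (cobar_d C :: _ \<Rightarrow>\<^sub>0 'k)"
    using assms(1) k by (simp add: cobar_d_def snoc_bar.sum low)
  finally show ?thesis unfolding high .
qed

lemma keys_cobar_d:
  assumes "Word ws \<in> keys (cobar_d C :: _ \<Rightarrow>\<^sub>0 'k::field)"
  shows "ws \<noteq> []" "\<forall>B\<in>set ws. bar_word X R B" "concat (concat ws) = concat C"
    "sum_list (map bar_deg ws) + 1 = bar_deg C" "bar_word X R C"
proof -
  show bw: "bar_word X R C" using assms unfolding cobar_d_def by (auto split: if_splits)
  have "keys (cobar_d C :: _ \<Rightarrow>\<^sub>0 'k) \<subseteq> (\<Union>i\<in>{..<length C - 1}. keys (cobar_term C i :: _ \<Rightarrow>\<^sub>0 'k))"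
  proof -
    have "cobar_d C = (\<Sum>i<length C - 1. cobar_term C i :: _ \<Rightarrow>\<^sub>0 'k)" using bw by (simp only: cobar_d_def if_True)
    then show ?thesis by (simp only: Poly_Mapping.keys_sum)
  qed
  then obtain i where i: "i < length C - 1" "Word ws \<in> keys (cobar_term C i :: _ \<Rightarrow>\<^sub>0 'k)" using assms by blast
  have lt: "i < length C" "Suc i < length C" using i(1) by simp_all
  have "Word ws \<in> keys ((if nrm (C ! i @ C ! Suc i) then mon [merge_at i C] else 0) - mon [take (Suc i) C, drop (Suc i) C] :: _ \<Rightarrow>\<^sub>0 'k)"
    using i(2) unfolding cobar_term_def by (rule subsetD[OF keys_pm_scale])
  then have "(nrm (C ! i @ C ! Suc i) \<and> ws = [merge_at i C]) \<or> ws = [take (Suc i) C, drop (Suc i) C]"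
  proof -
    assume "Word ws \<in> keys ((if nrm (C ! i @ C ! Suc i) then mon [merge_at i C] else 0) - mon [take (Suc i) C, drop (Suc i) C] :: _ \<Rightarrow>\<^sub>0 'k)"
    from subsetD[OF keys_pm_diff this] show ?thesis by (auto split: if_splits)
  qed
  then have "ws \<noteq> [] \<and> (\<forall>B\<in>set ws. bar_word X R B) \<and> concat (concat ws) = concat C \<and> sum_list (map bar_deg ws) + 1 = bar_deg C"
  proof
    assume w: "nrm (C ! i @ C ! Suc i) \<and> ws = [merge_at i C]"
    have C: "C = take i C @ [C ! i, C ! Suc i] @ drop (i + 2) C"
    proof -
      have "drop i C = [C ! i, C ! Suc i] @ drop (i + 2) C"
        using Cons_nth_drop_Suc[OF lt(1)] Cons_nth_drop_Suc[OF lt(2)] by simp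
      then show ?thesis using append_take_drop_id[of i C] by simp
    qed
    have "C ! i \<in> set C" using lt by simp
    then have "C ! i \<noteq> []" using bw by (simp add: bar_word_def)
    moreover have "set (take i C) \<subseteq> set C" "set (drop (i + 2) C) \<subseteq> set C" by (simp_all add: set_take_subset set_drop_subset)
    ultimately have "bar_word X R (merge_at i C)" using w bw unfolding bar_word_def merge_at_def by auto
    moreover have "concat (merge_at i C) = concat C"
      using arg_cong[OF C, of concat] by (simp add: merge_at_def)
    moreover have "bar_deg (merge_at i C) + 1 = bar_deg C" using lt by (simp add: bar_deg_def merge_at_def)
    ultimately show ?thesis using w by simp
  next
    assume w: "ws = [take (Suc i) C, drop (Suc i) C]"
    have "bar_word X R (take (Suc i) C)" "bar_word X R (drop (Suc i) C)"
      using bw lt by (auto simp: bar_word_def dest: in_set_takeD in_set_dropD)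
    moreover have "bar_deg (take (Suc i) C) + bar_deg (drop (Suc i) C) + 1 = bar_deg C"
      using lt by (simp add: bar_deg_def)
    ultimately show ?thesis using w by (simp flip: concat_append)
  qed
  then show "ws \<noteq> []" "\<forall>B\<in>set ws. bar_word X R B" "concat (concat ws) = concat C"
    "sum_list (map bar_deg ws) + 1 = bar_deg C" by blast+
qed

abbreviation cobar_D :: "('a list list free_monoid \<Rightarrow>\<^sub>0 'k::field) \<Rightarrow> _" where
  "cobar_D \<equiv> derivation bar_deg cobar_d"

abbreviation sgn_list :: "'a list list list \<Rightarrow> 'k::field" where
  "sgn_list ws \<equiv> (-1) ^ sum_list (map bar_deg ws)"

lemma keys_der_list:
  assumes "Word ws \<in> keys (der_list bar_deg cobar_d us :: _ \<Rightarrow>\<^sub>0 'k::field)" "\<forall>B\<in>set us. bar_word X R B"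
  shows "ws \<noteq> [] \<and> (\<forall>B\<in>set ws. bar_word X R B) \<and> concat (concat ws) = concat (concat us) \<and>
    sum_list (map bar_deg ws) + 1 = sum_list (map bar_deg us)"
  using assms
proof (induction us arbitrary: ws)
  case (Cons C us)
  have "Word ws \<in> keys (cobar_d C * mon us :: _ \<Rightarrow>\<^sub>0 'k) \<or>
      Word ws \<in> keys (pm_scale ((-1) ^ bar_deg C) (mon [C] * der_list bar_deg cobar_d us) :: _ \<Rightarrow>\<^sub>0 'k)"
    using Cons.prems(1) Poly_Mapping.keys_add by fastforce
  then show ?case
  proof
    assume "Word ws \<in> keys (cobar_d C * mon us :: _ \<Rightarrow>\<^sub>0 'k)"
    then obtain vs where vs: "Word vs \<in> keys (cobar_d C :: _ \<Rightarrow>\<^sub>0 'k)" "ws = vs @ us"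
      using keys_times[of "cobar_d C" "mon us :: _ \<Rightarrow>\<^sub>0 'k"] by auto
    show ?thesis using keys_cobar_d[OF vs(1)] Cons.prems(2) vs(2) by auto
  next
    assume "Word ws \<in> keys (pm_scale ((-1) ^ bar_deg C) (mon [C] * der_list bar_deg cobar_d us) :: _ \<Rightarrow>\<^sub>0 'k)"
    then have "Word ws \<in> keys (mon [C] * der_list bar_deg cobar_d us :: _ \<Rightarrow>\<^sub>0 'k)" by (rule subsetD[OF keys_pm_scale])
    then obtain vs where vs: "Word vs \<in> keys (der_list bar_deg cobar_d us :: _ \<Rightarrow>\<^sub>0 'k)" "ws = C # vs"
      using keys_times[of "mon [C] :: _ \<Rightarrow>\<^sub>0 'k" "der_list bar_deg cobar_d us"] by auto
    show ?thesis using Cons.IH[OF vs(1)] Cons.prems(2) vs(2) by auto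
  qed
qed simp

text \<open>
  A new last bar letter adds two terms to the differential: multiply it into its neighbour, or cut
  it off.
\<close>

lemma D_snoc_bar:
  assumes "bar_word X R C" "bar_letter a"
  shows "cobar_D (mon (us @ [C @ [a]])) = snoc_bar a (cobar_D (mon (us @ [C]))) +
     pm_scale (sgn_list (us @ [C])) (snoc_mult a (mon (us @ [C])) - mon (us @ [C] @ [[a]]) :: _ \<Rightarrow>\<^sub>0 'k::field)"
proof -
  have ne: "letters v \<noteq> []" if "v \<in> keys (cobar_d C :: _ \<Rightarrow>\<^sub>0 'k)" for v
    using keys_cobar_d(1)[of "letters v" C] that by simp
  have 1: "snoc_bar a (x * mon [C]) = x * mon [C @ [a]]" for x :: "_ \<Rightarrow>\<^sub>0 'k"
    using snoc_bar_mult[of "mon [C]" a x] by (simp add: snoc_bar_mon_simps)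
  have 2: "snoc_bar a (mon us * cobar_d C) = mon us * snoc_bar a (cobar_d C :: _ \<Rightarrow>\<^sub>0 'k)"
    using ne by (rule snoc_bar_mult)
  have 3: "snoc_mult a (mon (us @ [C])) = mon us * snoc_mult a (mon [C] :: _ \<Rightarrow>\<^sub>0 'k)"
    using snoc_mult_mult[of "mon [C]" a "mon us :: _ \<Rightarrow>\<^sub>0 'k"] by simp
  have 4: "mon (us @ [C] @ [[a]]) = mon us * (mon [C, [a]] :: _ \<Rightarrow>\<^sub>0 'k)" by simp
  have d1: "der_list bar_deg cobar_d [B] = (cobar_d B :: _ \<Rightarrow>\<^sub>0 'k)" for B by (simp add: mon_Nil)
  show ?thesis
    unfolding derivation_mon der_list_append d1 cobar_d_snoc[OF assms] 3 4 snoc_bar.add snoc_bar.scale 1 2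
      map_append sum_list_append power_add
    by (simp only: distrib_left right_diff_distrib pm_scale_mult_right pm.scale_right_distrib pm.scale_right_diff_distrib
        pm.scale_scale add.assoc list.map sum_list.Cons sum_list.Nil add_0_right)
qed

lemma snoc_mult_snoc_bar: "snoc_mult a (snoc_bar b x) = (if nrm (b @ a) then snoc_bar (b @ a) x else 0)"
proof -
  have eq: "snoc_mult a (snoc_bar b (single w 1)) = (if nrm (b @ a) then snoc_bar (b @ a) (single w 1) else 0)" for w :: "'a list list free_monoid"
    by (simp add: snoc_mult_def snoc_bar_def snoc_mult_list_def)
  show ?thesis
  proof (cases "nrm (b @ a)")
    case True
    have "snoc_mult a (snoc_bar b x) = snoc_bar (b @ a) x"
      by (rule linear_eq_on_keys[where sc = pm_scale and f = "\<lambda>x. snoc_mult a (snoc_bar b x)"])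
        (intro pm_linear_compose[OF snoc_bar_linear snoc_mult_linear], rule snoc_bar_linear, use eq True in simp)
    then show ?thesis using True by simp
  next
    case False
    have "snoc_mult a (snoc_bar b x) = (\<lambda>x. 0) x"
      by (rule linear_eq_on_keys[where sc = pm_scale and f = "\<lambda>x. snoc_mult a (snoc_bar b x)"])
        (intro pm_linear_compose[OF snoc_bar_linear snoc_mult_linear], rule pm_linearI, simp, simp, use eq False in simp)
    then show ?thesis using False by simp
  qed
qed

lemma snoc_mult_cobar_d:
  assumes "bar_word X R (G @ [b])" "bar_letter a"
  shows "snoc_mult a (cobar_d (G @ [b])) = (if nrm (b @ a) then cobar_d (G @ [b @ a]) else 0 :: _ \<Rightarrow>\<^sub>0 'k::field)"
proof (cases "G = []")
  case True then show ?thesis by simp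
next
  case False
  then have G: "bar_word X R G" "bar_letter b" using assms bar_word_snoc[OF False] by auto
  obtain B g where B: "G = B @ [g]" using False by (metis append_butlast_last_id)
  have 1: "snoc_mult a (snoc_mult b (mon [G])) = (if nrm (b @ a) then snoc_mult (b @ a) (mon [G]) else 0 :: _ \<Rightarrow>\<^sub>0 'k)"
  proof -
    have s: "nrm (g @ b)" "nrm (b @ a)" if "nrm (g @ b @ a)"
      using normal_sublist[of "g @ b" "g @ b @ a"] normal_sublist[of "b @ a" "g @ b @ a"] that
      by (metis append_assoc sublist_append_rightI, metis sublist_append_leftI)
    show ?thesis
      using s unfolding B by (auto simp: snoc_mult.zero snoc_mult_mon_simps)
  qed
  have 2: "snoc_mult a (mon [G, [b]]) = (if nrm (b @ a) then mon [G, [b @ a]] else 0 :: _ \<Rightarrow>\<^sub>0 'k)"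
    by (rule snoc_mult_mon_simps)
  show ?thesis
  proof (cases "nrm (b @ a)")
    case True
    then have ba: "bar_letter (b @ a)" using assms(2) by simp
    show ?thesis
      unfolding cobar_d_snoc[OF G] cobar_d_snoc[OF G(1) ba] snoc_mult.add snoc_mult.scale snoc_mult.diff
        snoc_mult_snoc_bar 1 2 using True by simp
  next
    case False
    show ?thesis
      unfolding cobar_d_snoc[OF G] snoc_mult.add snoc_mult.scale snoc_mult.diff snoc_mult_snoc_bar 1 2
      using False by simp
  qed
qed

lemma D_snoc_mult:
  assumes "bar_word X R (G @ [b])" "bar_letter a"
  shows "snoc_mult a (cobar_D (mon (us @ [G @ [b]]))) = cobar_D (snoc_mult a (mon (us @ [G @ [b]])) :: _ \<Rightarrow>\<^sub>0 'k::field)"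
proof -
  have ne: "letters v \<noteq> []" if "v \<in> keys (cobar_d (G @ [b]) :: _ \<Rightarrow>\<^sub>0 'k)" for v
    using keys_cobar_d(1)[of "letters v" "G @ [b]"] that by simp
  have 1: "snoc_mult a (x * mon [G @ [b]]) = (if nrm (b @ a) then x * mon [G @ [b @ a]] else 0)" for x :: "_ \<Rightarrow>\<^sub>0 'k"
    using snoc_mult_mult[of "mon [G @ [b]]" a x] by (simp add: snoc_mult_mon_simps)
  have 2: "snoc_mult a (mon us * cobar_d (G @ [b])) = mon us * snoc_mult a (cobar_d (G @ [b]) :: _ \<Rightarrow>\<^sub>0 'k)"
    using ne by (rule snoc_mult_mult)
  have d1: "der_list bar_deg cobar_d [B] = (cobar_d B :: _ \<Rightarrow>\<^sub>0 'k)" for B by (simp add: mon_Nil)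
  show ?thesis
    unfolding snoc_mult_mon derivation_mon der_list_append d1 snoc_mult.add snoc_mult.scale 1 2 snoc_mult_cobar_d[OF assms]
    by (simp add: der_list_append mon_Nil der.zero)
qed

text \<open>
  Induction on the last bar letter: the terms that involve it cancel because multiplication into
  the last bar letter commutes with the differential.
\<close>

theorem cobar_D_square: "cobar_D (cobar_d C :: _ \<Rightarrow>\<^sub>0 'k::field) = 0"
proof (cases "bar_word X R C")
  case True
  then show ?thesis
  proof (induction C rule: rev_induct)
    case (snoc a C)
    show ?case
    proof (cases "C = []")
      case False
      then have C: "bar_word X R C" "bar_letter a" using snoc.prems bar_word_snoc[OF False] by auto
      obtain G b where G: "C = G @ [b]" using False by (metis append_butlast_last_id)
      have Dm: "cobar_D (mon [B]) = (cobar_d B :: _ \<Rightarrow>\<^sub>0 'k)" for B by (simp add: mon_Nil)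
      have bar: "cobar_D (snoc_bar a x) = snoc_bar a (cobar_D x) +
          pm_scale e (snoc_mult a x - x * mon [[a]])"
        if x: "\<And>ws. Word ws \<in> keys x \<Longrightarrow> ws \<noteq> [] \<and> (\<forall>B\<in>set ws. bar_word X R B) \<and> sgn_list ws = e" for x e and C :: "'k"
      proof (rule linear_eq_on_keys[where sc = pm_scale and f = "\<lambda>x. cobar_D (snoc_bar a x)" and g = "\<lambda>x. snoc_bar a (cobar_D x) +
          pm_scale e (snoc_mult a x - x * mon [[a]])" and x = x])
        fix w assume w: "w \<in> keys x"
        then have "letters w \<noteq> [] \<and> (\<forall>B\<in>set (letters w). bar_word X R B) \<and> sgn_list (letters w) = e" using x[of "letters w"] by simp
        moreover from this obtain us B where "letters w = us @ [B]" by (metis append_butlast_last_id)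
        ultimately have us: "w = Word (us @ [B])" "bar_word X R B" "sgn_list (us @ [B]) = e" by (auto simp: free_monoid.expand)
        show "cobar_D (snoc_bar a (single w 1)) = snoc_bar a (cobar_D (single w 1)) +
          pm_scale e (snoc_mult a (single w 1) - single w 1 * mon [[a]])"
          unfolding us(1) snoc_bar_mon D_snoc_bar[OF us(2) C(2)] us(3) by simp
      qed (intro pm_linear_intros pm_linear_compose[OF _ snoc_bar_linear] pm_linear_compose[OF _ snoc_mult_linear]
            snoc_bar_linear snoc_mult_linear)+
      have e: "ws \<noteq> [] \<and> (\<forall>B\<in>set ws. bar_word X R B) \<and> (sgn_list ws :: 'k) = - ((-1) ^ bar_deg C)"
        if "Word ws \<in> keys (cobar_d C :: _ \<Rightarrow>\<^sub>0 'k)" for ws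
        using keys_cobar_d[OF that] by (simp flip: keys_cobar_d(4)[OF that])
      have "cobar_D (cobar_d (C @ [a]) :: _ \<Rightarrow>\<^sub>0 'k) =
          cobar_D (snoc_bar a (cobar_d C)) + pm_scale ((-1) ^ bar_deg C) (cobar_D (snoc_mult a (mon [C])) - cobar_D (mon [C, [a]]))"
        unfolding cobar_d_snoc[OF C] der.add der.scale der.diff ..
      also have "cobar_D (snoc_bar a (cobar_d C)) = pm_scale (- ((-1) ^ bar_deg C)) (snoc_mult a (cobar_d C) - cobar_d C * (mon [[a]] :: _ \<Rightarrow>\<^sub>0 'k))"
        using bar[of "cobar_d C :: _ \<Rightarrow>\<^sub>0 'k" "- ((-1) ^ bar_deg C)", OF e] snoc.IH[OF C(1)] by (simp add: snoc_bar.zero)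
      also have "cobar_D (snoc_mult a (mon [C])) = (snoc_mult a (cobar_d C) :: _ \<Rightarrow>\<^sub>0 'k)"
      proof -
        have "cobar_D (snoc_mult a (mon ([] @ [G @ [b]]))) = (snoc_mult a (cobar_D (mon ([] @ [G @ [b]]))) :: _ \<Rightarrow>\<^sub>0 'k)"
          by (rule D_snoc_mult[symmetric]) (use C G in simp_all)
        then show ?thesis unfolding append_Nil G[symmetric] Dm .
      qed
      also have "cobar_D (mon [C, [a]]) = cobar_d C * (mon [[a]] :: _ \<Rightarrow>\<^sub>0 'k)"
        by (simp add: mon_Nil)
      finally show ?thesis by simp
    qed (simp add: der.zero)
  qed (simp add: bar_word_def)
qed (simp add: cobar_d_def der.zero)

end

section \<open>Lifting the chain differential to the cobar construction\<close>

context monomial_algebra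
begin

interpretation snoc_bar: Vector_Spaces.linear pm_scale pm_scale "snoc_bar a" for a by (rule snoc_bar_linear)
interpretation snoc_mult: Vector_Spaces.linear pm_scale pm_scale "snoc_mult a" for a by (rule snoc_mult_linear)

text \<open>
  The contraction works on the right end. A last block with a single bar letter is glued to the
  preceding block as a new bar letter, which inverts the cutting; since cutting comes together with
  multiplying, the correction multiplies the letter into the preceding one and starts again.
\<close>

function contract_list :: "'a list list list \<Rightarrow> ('a list list free_monoid \<Rightarrow>\<^sub>0 'k::field)" where
  "contract_list ws = (if 2 \<le> length ws \<and> length (last ws) = 1 then
     pm_scale (- sgn_list (butlast ws)) (snoc_bar (hd (last ws)) (mon (butlast ws))) +
     (if nrm (last (last (butlast ws)) @ hd (last ws))
      then contract_list (butlast (butlast ws) @ [butlast (last (butlast ws)) @ [last (last (butlast ws)) @ hd (last ws)]])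
      else 0) else 0)"
  by pat_completeness auto
termination by (relation "measure length") auto

declare contract_list.simps [simp del]

definition contract :: "('a list list free_monoid \<Rightarrow>\<^sub>0 'k::field) \<Rightarrow> ('a list list free_monoid \<Rightarrow>\<^sub>0 'k)" where
  "contract = lin_ext pm_scale (\<lambda>w. contract_list (letters w))"

lemma contract_linear: "Vector_Spaces.linear pm_scale pm_scale contract"
  unfolding contract_def by (rule pm.lin_ext_linear)

interpretation contract: Vector_Spaces.linear pm_scale pm_scale contract by (rule contract_linear)

lemma contract_single [simp]: "contract (single w 1) = contract_list (letters w)"
  by (simp add: contract_def)

lemma contract_snoc:
  "contract_list (us @ [B @ [b], [a]]) = pm_scale (- sgn_list (us @ [B @ [b]])) (mon (us @ [B @ [b, a]])) +
     (if nrm (b @ a) then contract_list (us @ [B @ [b @ a]]) else 0 :: _ \<Rightarrow>\<^sub>0 'k::field)"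
proof -
  have 1: "butlast (us @ [B @ [b], [a]]) = us @ [B @ [b]]" by (simp add: butlast_append)
  have 2: "snoc_bar a (mon (us @ [B @ [b]])) = (mon (us @ [B @ [b, a]]) :: _ \<Rightarrow>\<^sub>0 'k)"
    using snoc_bar_mon[of a us "B @ [b]"] by (simp add: snoc_bar_mon)
  show ?thesis by (subst contract_list.simps) (simp only: 1 2 last_appendR last.simps butlast_snoc last_snoc length_append
        list.size if_True if_False list.sel not_Cons_self2 list.distinct simp_thms add_2_eq_Suc' le_add2 numeral_2_eq_2 add_Suc_right add_0_right One_nat_def Suc_le_mono le0 last_ConsL last_ConsR)
qed

lemma contract_long: "length C \<noteq> 1 \<Longrightarrow> contract_list (us @ [C]) = 0"
  by (subst contract_list.simps) simp

lemma contract_one: "contract_list [C] = 0"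
  by (subst contract_list.simps) simp

text \<open>
  The recursion of the contraction in linear form. The common sign \<open>e\<close> is that of the words of \<open>x\<close>.
\<close>

lemma contract_right:
  assumes "\<And>ws. Word ws \<in> keys x \<Longrightarrow> ws \<noteq> [] \<and> (\<forall>B\<in>set ws. bar_word X R B) \<and> sgn_list ws = (e :: 'k::field)"
  shows "contract (x * mon [[a]]) = pm_scale (- e) (snoc_bar a x) + contract (snoc_mult a x)"
proof (rule linear_eq_on_keys[where sc = pm_scale and f = "\<lambda>x. contract (x * mon [[a]])"
      and g = "\<lambda>x. pm_scale (- e) (snoc_bar a x) + contract (snoc_mult a x)" and x = x])
  fix w assume w: "w \<in> keys x"
  then have l: "letters w \<noteq> []" "\<forall>B\<in>set (letters w). bar_word X R B" "sgn_list (letters w) = e"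
    using assms[of "letters w"] by simp_all
  obtain us C where us: "letters w = us @ [C]" using l(1) by (metis append_butlast_last_id)
  have "C \<noteq> []" using l(2) us by (auto simp: bar_word_def)
  then obtain B b where C: "C = B @ [b]" by (metis append_butlast_last_id)
  have w': "w = Word (us @ [B @ [b]])" using us C by (metis free_monoid.collapse)
  have 1: "single w 1 * mon [[a]] = (mon (us @ [B @ [b], [a]]) :: _ \<Rightarrow>\<^sub>0 'k)" unfolding w' by simp
  have 2: "snoc_bar a (single w 1) = (mon (us @ [B @ [b, a]]) :: _ \<Rightarrow>\<^sub>0 'k)"
    unfolding w' snoc_bar_mon by simp
  have 3: "snoc_mult a (single w 1) = (if nrm (b @ a) then mon (us @ [B @ [b @ a]]) else 0 :: _ \<Rightarrow>\<^sub>0 'k)"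
    unfolding w' snoc_mult_mon ..
  have e: "sgn_list (us @ [B @ [b]]) = e" using l(3) us C by simp
  show "contract (single w 1 * mon [[a]]) = pm_scale (- e) (snoc_bar a (single w 1)) + contract (snoc_mult a (single w 1))"
    unfolding 1 2 3 by (cases "nrm (b @ a)") (simp_all add: contract_snoc e contract.zero del: pm_scale_single map_append sum_list_append)
qed (intro pm_linear_intros pm_linear_compose[OF _ snoc_bar_linear] pm_linear_compose[OF _ snoc_mult_linear]
        pm_linear_compose[OF _ contract_linear] snoc_bar_linear snoc_mult_linear)+

lemma contract_snoc_bar:
  assumes "\<And>ws. Word ws \<in> keys x \<Longrightarrow> ws \<noteq> [] \<and> [] \<notin> set ws"
  shows "contract (snoc_bar a x) = 0"
proof (rule linear_eq_on_keys[where sc = pm_scale and f = "\<lambda>x. contract (snoc_bar a x)" and g = "\<lambda>x. 0" and x = x])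
  fix w assume w: "w \<in> keys x"
  then have l: "letters w \<noteq> []" "[] \<notin> set (letters w)" using assms[of "letters w"] by simp_all
  obtain us C where us: "letters w = us @ [C]" using l(1) by (metis append_butlast_last_id)
  have w': "w = Word (us @ [C])" using us by (metis free_monoid.collapse)
  have "length (C @ [a]) \<noteq> 1" using l(2) us by auto
  then show "contract (snoc_bar a (single w 1)) = 0"
    unfolding w' snoc_bar_mon contract_single free_monoid.sel by (rule contract_long)
qed (rule pm_linear_compose[OF snoc_bar_linear contract_linear], rule pm_linearI, simp, simp)

lemma keys_contract_list:
  assumes "Word vs \<in> keys (contract_list ws :: _ \<Rightarrow>\<^sub>0 'k::field)" "\<forall>B\<in>set ws. bar_word X R B"
  shows "vs \<noteq> [] \<and> (\<forall>B\<in>set vs. bar_word X R B) \<and> concat (concat vs) = concat (concat ws) \<and>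
    sum_list (map bar_deg vs) = sum_list (map bar_deg ws) + 1 \<and> 2 \<le> length (last vs)"
  using assms
proof (induction "length ws" arbitrary: ws rule: less_induct)
  case less
  show ?case
  proof (cases "2 \<le> length ws \<and> length (last ws) = 1")
    case False
    then have "contract_list ws = (0 :: _ \<Rightarrow>\<^sub>0 'k)" by (subst contract_list.simps) (simp only: if_False)
    then show ?thesis using less.prems by simp
  next
    case True
    then have "ws \<noteq> []" by auto
    then obtain ws' l where ws': "ws = ws' @ [l]" by (metis append_butlast_last_id)
    then obtain a where a: "l = [a]" using True by (cases l) auto
    have "ws' \<noteq> []" using True ws' by auto
    then obtain us C where us: "ws' = us @ [C]" by (metis append_butlast_last_id)
    have bC: "bar_word X R C" using less.prems(2) unfolding ws' us by simp
    then have "C \<noteq> []" by (simp add: bar_word_def)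
    then obtain B b where C: "C = B @ [b]" by (metis append_butlast_last_id)
    have ws: "ws = us @ [B @ [b], [a]]" unfolding ws' us C a by simp
    have lets: "bar_letter a" "bar_letter b" "\<forall>E\<in>set us. bar_word X R E" "\<forall>c\<in>set B. bar_letter c"
      using less.prems(2) unfolding ws by (auto simp: bar_word_def)
    have key: "Word vs \<in> keys (pm_scale (- sgn_list (us @ [B @ [b]])) (mon (us @ [B @ [b, a]])) :: _ \<Rightarrow>\<^sub>0 'k) \<or>
        Word vs \<in> keys (if nrm (b @ a) then contract_list (us @ [B @ [b @ a]]) else 0 :: _ \<Rightarrow>\<^sub>0 'k)"
      using subsetD[OF Poly_Mapping.keys_add less.prems(1)[unfolded ws contract_snoc]] by simp
    then show ?thesis
    proof
      assume "Word vs \<in> keys (pm_scale (- sgn_list (us @ [B @ [b]])) (mon (us @ [B @ [b, a]])) :: _ \<Rightarrow>\<^sub>0 'k)"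
      from subsetD[OF keys_pm_scale this] have vs: "vs = us @ [B @ [b, a]]" by simp
      show ?thesis unfolding vs ws using lets by (auto simp: bar_word_def bar_deg_def)
    next
      assume A: "Word vs \<in> keys (if nrm (b @ a) then contract_list (us @ [B @ [b @ a]]) else 0 :: _ \<Rightarrow>\<^sub>0 'k)"
      then have n: "nrm (b @ a)" by (auto split: if_splits)
      have "vs \<noteq> [] \<and> (\<forall>B\<in>set vs. bar_word X R B) \<and> concat (concat vs) = concat (concat (us @ [B @ [b @ a]])) \<and>
         sum_list (map bar_deg vs) = sum_list (map bar_deg (us @ [B @ [b @ a]])) + 1 \<and> 2 \<le> length (last vs)"
      proof (rule less.hyps)
        show "length (us @ [B @ [b @ a]]) < length ws" by (simp add: ws)
        show "Word vs \<in> keys (contract_list (us @ [B @ [b @ a]]) :: _ \<Rightarrow>\<^sub>0 'k)" using A n by simp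
        show "\<forall>E\<in>set (us @ [B @ [b @ a]]). bar_word X R E" using lets n by (auto simp: bar_word_def)
      qed
      then show ?thesis unfolding ws by (simp add: bar_deg_def)
    qed
  qed
qed

text \<open>
  A homotopy between the identity and zero. On a word whose letters can all be multiplied together
  the identity fails, as the example of a single bar letter shows: there both the differential and the
  contraction vanish.
\<close>

theorem contraction:
  assumes "ws \<noteq> []" "\<forall>B\<in>set ws. bar_word X R B" "\<not> nrm (concat (concat ws))"
  shows "cobar_D (contract_list ws) + contract (cobar_D (mon ws)) = (mon ws :: _ \<Rightarrow>\<^sub>0 'k::field)"
  using assms
proof (induction "length ws" arbitrary: ws rule: less_induct)
  case less
  obtain us' C where ws: "ws = us' @ [C]" using less.prems(1) by (metis append_butlast_last_id)
  have bC: "bar_word X R C" using less.prems(2) ws by simp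
  then have "C \<noteq> []" by (simp add: bar_word_def)
  have main: "contract (cobar_D (mon us) * mon [[a]]) =
      pm_scale (sgn_list us) (snoc_bar a (cobar_D (mon us))) + contract (snoc_mult a (cobar_D (mon us)) :: _ \<Rightarrow>\<^sub>0 'k)"
    if "\<forall>B\<in>set us. bar_word X R B" for us a
  proof -
    have "vs \<noteq> [] \<and> (\<forall>B\<in>set vs. bar_word X R B) \<and> sgn_list vs = (- sgn_list us :: 'k)"
      if "Word vs \<in> keys (cobar_D (mon us) :: _ \<Rightarrow>\<^sub>0 'k)" for vs
    proof -
      have k: "vs \<noteq> []" "\<forall>B\<in>set vs. bar_word X R B" "sum_list (map bar_deg us) = Suc (sum_list (map bar_deg vs))"
        using keys_der_list[OF that[unfolded derivation_mon] \<open>\<forall>B\<in>set us. bar_word X R B\<close>] by simp_all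
      then show ?thesis unfolding k(3) by simp
    qed
    from contract_right[OF this] show ?thesis by simp
  qed
  show ?case
  proof (cases "length C = 1")
    case True
    then obtain a where C: "C = [a]" by (metis One_nat_def Suc_length_conv length_0_conv)
    have la: "bar_letter a" using bC C by (simp add: bar_word_def)
    have "us' \<noteq> []" using less.prems(3) la unfolding ws C by auto
    then obtain us E where us: "us' = us @ [E]" by (metis append_butlast_last_id)
    have bE: "bar_word X R E" "\<forall>B\<in>set us. bar_word X R B" using less.prems(2) ws us by auto
    then have "E \<noteq> []" by (simp add: bar_word_def)
    then obtain G b where E: "E = G @ [b]" by (metis append_butlast_last_id)
    let ?x = "mon (us @ [G @ [b]]) :: 'a list list free_monoid \<Rightarrow>\<^sub>0 'k" and ?s = "sgn_list (us @ [G @ [b]]) :: 'k"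
    let ?n = "snoc_mult a ?x"
    have ss: "pm_scale (- ?s) (pm_scale ?s y) = - y" for y :: "'a list list free_monoid \<Rightarrow>\<^sub>0 'k"
      unfolding pm.scale_scale mult_minus_left pm.scale_minus_left power_add[symmetric]
      by (simp only: mult_2[symmetric] power_mult power2_minus power_one pm.scale_one power2_eq_square mult_minus_left mult_1_left minus_minus)
    have wsx: "ws = us @ [G @ [b], [a]]" using ws us C E by simp
    have bGb: "bar_word X R (G @ [b])" using bE E by simp
    have n: "?n = (if nrm (b @ a) then mon (us @ [G @ [b @ a]]) else 0)" by (rule snoc_mult_mon)
    have IH: "cobar_D (contract ?n) + contract (cobar_D ?n) = ?n"
    proof (cases "nrm (b @ a)")
      case True
      have "cobar_D (contract_list (us @ [G @ [b @ a]])) + contract (cobar_D (mon (us @ [G @ [b @ a]]))) = (mon (us @ [G @ [b @ a]]) :: _ \<Rightarrow>\<^sub>0 'k)"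
      proof (rule less.hyps)
        show "length (us @ [G @ [b @ a]]) < length ws" by (simp add: wsx)
        show "\<forall>B\<in>set (us @ [G @ [b @ a]]). bar_word X R B" using bE bGb True by (auto simp: bar_word_def)
        show "\<not> nrm (concat (concat (us @ [G @ [b @ a]])))" using less.prems(3) unfolding wsx by simp
      qed simp
      then show ?thesis unfolding n using True by simp
    next
      case False
      then show ?thesis unfolding n by (simp add: contract.zero der.zero)
    qed
    have K: "contract_list ws = pm_scale (- ?s) (snoc_bar a ?x) + contract ?n"
      unfolding wsx contract_snoc n by (simp add: snoc_bar_mon contract.zero del: map_append sum_list_append)
    have Dws: "cobar_D (mon ws) = cobar_D ?x * mon [[a]]"
    proof -
      have "mon ws = ?x * mon [[a]]" unfolding wsx by simp
      moreover have "cobar_D (mon ws) = cobar_D ?x * mon [[a]] + pm_scale ?s (?x * cobar_D (mon [[a]]))"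
        unfolding \<open>mon ws = ?x * mon [[a]]\<close> by (rule derivation_mult) simp
      ultimately show ?thesis by (simp add: mon_Nil)
    qed
    have KD: "contract (cobar_D (mon ws)) = pm_scale ?s (snoc_bar a (cobar_D ?x)) + contract (cobar_D ?n)"
    proof -
      have bw: "\<forall>B\<in>set (us @ [G @ [b]]). bar_word X R B" using bE bGb by simp
      show ?thesis unfolding Dws main[OF bw] D_snoc_mult[OF bGb la] ..
    qed
    have sb: "cobar_D (snoc_bar a ?x) = snoc_bar a (cobar_D ?x) + pm_scale ?s (?n - mon ws)"
      using D_snoc_bar[OF bGb la, of us] unfolding snoc_bar_mon wsx by simp
    have "cobar_D (contract_list ws) + contract (cobar_D (mon ws)) =
        pm_scale (- ?s) (pm_scale ?s (?n - mon ws)) + (cobar_D (contract ?n) + contract (cobar_D ?n))"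
      unfolding K KD der.add der.scale sb by (simp add: pm.scale_right_distrib del: map_append sum_list_append)
    also have "\<dots> = mon ws" unfolding IH ss by simp
    finally show ?thesis .
  next
    case False
    obtain E a where Ea: "C = E @ [a]" using \<open>C \<noteq> []\<close> by (metis append_butlast_last_id)
    have "E \<noteq> []" using False Ea by auto
    note C = Ea this
    have bE: "bar_word X R E" "bar_letter a" using bC bar_word_snoc[OF C(2)] C(1) by auto
    obtain G b where E: "E = G @ [b]" using C(2) by (metis append_butlast_last_id)
    let ?us = "us' @ [E]"
    let ?x = "mon ?us :: 'a list list free_monoid \<Rightarrow>\<^sub>0 'k" and ?s = "sgn_list ?us :: 'k"
    have ss: "pm_scale (- ?s) (pm_scale ?s y) = - y" for y :: "'a list list free_monoid \<Rightarrow>\<^sub>0 'k"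
      unfolding pm.scale_scale mult_minus_left pm.scale_minus_left power_add[symmetric]
      by (simp only: mult_2[symmetric] power_mult power2_minus power_one pm.scale_one power2_eq_square mult_minus_left mult_1_left minus_minus)
    have bus: "\<forall>B\<in>set ?us. bar_word X R B" using less.prems(2) ws bE by auto
    have K: "contract_list ws = (0 :: _ \<Rightarrow>\<^sub>0 'k)" unfolding ws by (rule contract_long[OF False])
    have sb: "cobar_D (mon ws) = snoc_bar a (cobar_D ?x) + pm_scale ?s (snoc_mult a ?x - ?x * mon [[a]])"
      using D_snoc_bar[OF bE, of us'] unfolding ws C by simp
    have z: "contract (snoc_bar a (cobar_D ?x)) = 0"
    proof (rule contract_snoc_bar)
      fix vs assume "Word vs \<in> keys (cobar_D ?x)"
      from keys_der_list[OF this[unfolded derivation_mon] bus]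
      have "vs \<noteq> []" "\<forall>B\<in>set vs. bar_word X R B" by blast+
      then show "vs \<noteq> [] \<and> [] \<notin> set vs" by (auto simp: bar_word_def)
    qed
    have r: "contract (?x * mon [[a]]) = pm_scale (- ?s) (snoc_bar a ?x) + contract (snoc_mult a ?x)"
      by (rule contract_right) (use bus in simp)
    have mw: "snoc_bar a ?x = mon ws" unfolding snoc_bar_mon ws C ..
    have "contract (cobar_D (mon ws)) = pm_scale ?s (contract (snoc_mult a ?x) - (pm_scale (- ?s) (mon ws) + contract (snoc_mult a ?x)))"
      unfolding sb contract.add contract.scale contract.diff z r mw by simp
    also have "\<dots> = - pm_scale (- ?s) (pm_scale ?s (mon ws))" by (simp add: pm.scale_right_diff_distrib pm.scale_right_distrib)
    also have "\<dots> = mon ws" unfolding ss by simp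
    finally show ?thesis unfolding K der.zero by simp
  qed
qed

lemma decs_shorter:
  assumes "ws \<in> decs w" "u \<in> set ws"
  shows "length u < length w"
proof -
  obtain us vs where ws: "ws = us @ u # vs" using assms(2) by (metis split_list)
  have d: "2 \<le> length ws" "set ws \<subseteq> chains X R" "concat ws = w" using assms(1) by (auto simp: decs_def)
  have "us @ vs \<noteq> []" using d(1) ws by auto
  moreover have "[] \<notin> chains X R" using chain_nonempty by blast
  then have "[] \<notin> set (us @ vs)" using d(2) unfolding ws by auto
  ultimately have "concat us @ concat vs \<noteq> []" by (cases us; cases vs) auto
  then have "length (concat us) + length (concat vs) > 0" by simp
  then show ?thesis using d(3) ws by auto
qed

text \<open>
  The homomorphism is determined on longer chains by the contraction: a chain of positive length is
  not normal, so the image of its differential, which is a cycle, is the boundary of its contraction.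
\<close>

function cobar_lift :: "'a list \<Rightarrow> ('a list list free_monoid \<Rightarrow>\<^sub>0 'k::field)" where
  "cobar_lift w = (if length w \<le> 1 then (if w \<in> chains X R then mon [[w]] else 0)
     else contract (\<Sum>ws\<in>decs w. pm_scale ((-1) ^ dec_parity ws) (prod_list (map cobar_lift ws))))"
  by pat_completeness auto
termination by (relation "measure length") (auto intro: decs_shorter)

declare cobar_lift.simps [simp del]

lemma chain_length_0_iff:
  assumes "w \<in> chains X R"
  shows "chain_length X R w = 0 \<longleftrightarrow> length w = 1"
proof -
  obtain x vs where f: "factors X R w = [x] # vs" "chain_tail X R [x] vs" "x \<in> X"
    using factors_chain(1)[OF assms] unfolding chain_factors_iff by blast
  have w: "w = x # concat vs" using factors_chain(2)[OF assms] f by simp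
  have l: "chain_length X R w = length vs" using factors_chain(3)[OF assms] f by simp
  show ?thesis
  proof (cases vs)
    case (Cons v vs')
    then have "v \<noteq> []" using f by simp
    then show ?thesis using w l Cons by (cases v) auto
  qed (use w l in simp)
qed

lemma chain_not_normal:
  assumes "w \<in> chains X R" "chain_length X R w \<noteq> 0"
  shows "\<not> nrm w"
proof -
  obtain x vs where f: "factors X R w = [x] # vs" "chain_tail X R [x] vs"
    using factors_chain(1)[OF assms(1)] unfolding chain_factors_iff by blast
  have "length vs = chain_length X R w" using factors_chain(3)[OF assms(1)] f by simp
  then obtain v vs' where vs: "vs = v # vs'" using assms(2) by (cases vs) auto
  have "\<not> nrm ([x] @ v)" using f(2) vs by (simp add: zero_minimally_def)
  moreover have "sublist ([x] @ v) w"
    using factors_chain(2)[OF assms(1)] f vs by (metis append.assoc concat.simps(2) sublist_append_rightI)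
  ultimately show ?thesis using normal_sublist by blast
qed

lemma cobar_lift_letter: "w \<in> chains X R \<Longrightarrow> chain_length X R w = 0 \<Longrightarrow> cobar_lift w = mon [[w]]"
  using chain_length_0_iff[of w] by (subst cobar_lift.simps) simp

lemma alg_hom_chain_d:
  "alg_hom \<Phi> (chain_d w) = (\<Sum>ws\<in>decs w. pm_scale ((-1) ^ dec_parity ws) (prod_list (map \<Phi> ws)))"
proof -
  have s: "single (Word ws) c = pm_scale c (mon ws)" for ws :: "'a list list" and c :: "'k::field" by simp
  show ?thesis unfolding chain_d_def alg_hom.sum by (subst s, subst alg_hom.scale) (simp del: pm_scale_single)
qed

lemma cobar_lift_long:
  assumes "chain_length X R w \<noteq> 0" "w \<in> chains X R"
  shows "cobar_lift w = contract (alg_hom cobar_lift (chain_d w))"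
proof -
  have "\<not> length w \<le> 1" using chain_length_0_iff[OF assms(2)] chain_nonempty[OF assms(2)] assms(1)
    by (cases "length w") auto
  then show ?thesis unfolding alg_hom_chain_d by (subst cobar_lift.simps) (simp only: if_False)
qed

lemma cobar_lift_nonchain: "w \<notin> chains X R \<Longrightarrow> cobar_lift w = 0"
proof -
  assume w: "w \<notin> chains X R"
  then have "decs w = {}" by (auto simp: decs_def)
  then show ?thesis using w by (subst cobar_lift.simps) (simp add: contract.zero)
qed

lemma keys_prod_list:
  assumes "Word ws \<in> keys (prod_list (map \<Phi> gs) :: _ \<Rightarrow>\<^sub>0 'k::field)"
  shows "\<exists>bs. list_all2 (\<lambda>g b. Word b \<in> keys (\<Phi> g)) gs bs \<and> ws = concat bs"
  using assms
proof (induction gs arbitrary: ws)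
  case Nil
  then have "Word ws = Word []" by (simp add: zero_free_monoid_def)
  then show ?case by simp
next
  case (Cons g gs)
  have "Word ws \<in> keys (\<Phi> g * prod_list (map \<Phi> gs))" using Cons.prems by simp
  from subsetD[OF keys_times this] obtain b vs where b: "ws = b @ vs" "Word b \<in> keys (\<Phi> g)" "Word vs \<in> keys (prod_list (map \<Phi> gs))"
    by auto
  obtain bs where "list_all2 (\<lambda>g b. Word b \<in> keys (\<Phi> g)) gs bs" "vs = concat bs" using Cons.IH[OF b(3)] by blast
  then show ?case using b by (intro exI[of _ "b # bs"]) simp
qed

text \<open>
  The last clause, that the final block is longer than a single bar letter, makes blocks that the
  contraction sends to zero recognizable.
\<close>

definition good_lift :: "'a list \<Rightarrow> 'a list list list \<Rightarrow> bool" where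
  "good_lift w ws \<longleftrightarrow> ws \<noteq> [] \<and> (\<forall>B\<in>set ws. bar_word X R B) \<and> concat (concat ws) = w \<and>
     sum_list (map bar_deg ws) = chain_length X R w \<and> (chain_length X R w \<noteq> 0 \<longrightarrow> 2 \<le> length (last ws))"

lemma good_lift_concat:
  assumes "list_all2 good_lift gs bs"
  shows "(\<forall>B\<in>set (concat bs). bar_word X R B) \<and> concat (concat (concat bs)) = concat gs \<and>
     sum_list (map bar_deg (concat bs)) = sum_list (map (chain_length X R) gs) \<and> (gs \<noteq> [] \<longrightarrow> concat bs \<noteq> [])"
  using assms
proof (induction gs bs rule: list_all2_induct)
  case (Cons g gs b bs)
  then show ?case unfolding good_lift_def by auto
qed simp

lemma list_all2_set_mono: "list_all2 P gs bs \<Longrightarrow> (\<And>g b. g \<in> set gs \<Longrightarrow> P g b \<Longrightarrow> Q g b) \<Longrightarrow> list_all2 Q gs bs"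
  by (induction gs bs rule: list_all2_induct) auto

lemma keys_alg_hom_chain_d:
  assumes "\<And>u us. length u < length w \<Longrightarrow> u \<in> chains X R \<Longrightarrow> Word us \<in> keys (cobar_lift u :: _ \<Rightarrow>\<^sub>0 'k::field) \<Longrightarrow> good_lift u us"
    and "Word ws \<in> keys (alg_hom cobar_lift (chain_d w) :: _ \<Rightarrow>\<^sub>0 'k)"
  shows "ws \<noteq> [] \<and> (\<forall>B\<in>set ws. bar_word X R B) \<and> concat (concat ws) = w \<and>
     sum_list (map bar_deg ws) + 1 = chain_length X R w"
proof -
  have "keys (alg_hom cobar_lift (chain_d w) :: _ \<Rightarrow>\<^sub>0 'k) \<subseteq>
      (\<Union>gs\<in>decs w. keys (pm_scale ((-1) ^ dec_parity gs) (prod_list (map cobar_lift gs)) :: _ \<Rightarrow>\<^sub>0 'k))"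
    unfolding alg_hom_chain_d by (rule Poly_Mapping.keys_sum)
  from subsetD[OF this assms(2)] obtain gs where gs: "gs \<in> decs w"
    "Word ws \<in> keys (pm_scale ((-1) ^ dec_parity gs) (prod_list (map cobar_lift gs)) :: _ \<Rightarrow>\<^sub>0 'k)" by (elim UN_E)
  from keys_prod_list[OF subsetD[OF keys_pm_scale gs(2)]]
  obtain bs where bs: "list_all2 (\<lambda>g b. Word b \<in> keys (cobar_lift g :: _ \<Rightarrow>\<^sub>0 'k)) gs bs" "ws = concat bs" by blast
  have d: "set gs \<subseteq> chains X R" "2 \<le> length gs" "concat gs = w" "Suc (sum_list (map (chain_length X R) gs)) = chain_length X R w"
    using gs(1) by (auto simp: decs_def)
  have "list_all2 good_lift gs bs"
    using bs(1) by (rule list_all2_set_mono) (use assms(1) decs_shorter[OF gs(1)] d(1) in blast)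
  from good_lift_concat[OF this] show ?thesis using d bs(2) by auto
qed

lemma keys_cobar_lift:
  "Word ws \<in> keys (cobar_lift w :: _ \<Rightarrow>\<^sub>0 'k::field) \<Longrightarrow> w \<in> chains X R \<and> good_lift w ws"
proof (induction "length w" arbitrary: w ws rule: less_induct)
  case less
  have w: "w \<in> chains X R"
  proof (rule ccontr)
    assume "w \<notin> chains X R"
    then show False using less.prems by (simp add: cobar_lift_nonchain)
  qed
  show ?case
  proof (cases "chain_length X R w = 0")
    case True
    then have "ws = [[w]]" using less.prems by (simp add: cobar_lift_letter[OF w True])
    moreover have "bar_letter w"
    proof -
      obtain x where x: "w = [x]" using chain_length_0_iff[OF w] True by (metis One_nat_def Suc_length_conv length_0_conv)
      then have "x \<in> X" using chain_in_lists[OF w] by simp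
      then show ?thesis using x normal_single by simp
    qed
    ultimately show ?thesis using True w by (simp add: good_lift_def bar_word_def bar_deg_def)
  next
    case False
    have "keys (contract (alg_hom cobar_lift (chain_d w)) :: _ \<Rightarrow>\<^sub>0 'k) \<subseteq>
        (\<Union>v\<in>keys (alg_hom cobar_lift (chain_d w) :: _ \<Rightarrow>\<^sub>0 'k). keys (contract_list (letters v) :: _ \<Rightarrow>\<^sub>0 'k))"
      unfolding contract_def by (rule keys_lin_ext)
    from subsetD[OF this less.prems[unfolded cobar_lift_long[OF False w]]]
    obtain v where v: "v \<in> keys (alg_hom cobar_lift (chain_d w) :: _ \<Rightarrow>\<^sub>0 'k)" "Word ws \<in> keys (contract_list (letters v) :: _ \<Rightarrow>\<^sub>0 'k)"
      by (elim UN_E)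
    have "Word (letters v) \<in> keys (alg_hom cobar_lift (chain_d w) :: _ \<Rightarrow>\<^sub>0 'k)" using v(1) by simp
    then have l: "letters v \<noteq> [] \<and> (\<forall>B\<in>set (letters v). bar_word X R B) \<and> concat (concat (letters v)) = w \<and>
       sum_list (map bar_deg (letters v)) + 1 = chain_length X R w"
      by (rule keys_alg_hom_chain_d[rotated]) (use less.hyps in blast)
    then show ?thesis using keys_contract_list[OF v(2)] w by (simp add: good_lift_def)
  qed
qed

lemma derivation_alg_hom:
  assumes "\<And>g. g \<in> set gs \<Longrightarrow> cobar_D (cobar_lift g) = (alg_hom cobar_lift (chain_d g) :: _ \<Rightarrow>\<^sub>0 'k::field)"
  shows "cobar_D (prod_list (map cobar_lift gs)) =
    (alg_hom cobar_lift (der_list (chain_length X R) chain_d gs) :: _ \<Rightarrow>\<^sub>0 'k)"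
  using assms
proof (induction gs)
  case Nil
  have "cobar_D (mon [] :: _ \<Rightarrow>\<^sub>0 'k) = 0" by simp
  then show ?case by (simp add: mon_Nil alg_hom.zero)
next
  case (Cons g gs)
  have "cobar_D (cobar_lift g * prod_list (map cobar_lift gs)) =
      cobar_D (cobar_lift g) * prod_list (map cobar_lift gs) +
      pm_scale ((-1) ^ chain_length X R g) (cobar_lift g * cobar_D (prod_list (map cobar_lift gs)) :: _ \<Rightarrow>\<^sub>0 'k)"
  proof (rule derivation_mult)
    fix us assume "Word us \<in> keys (cobar_lift g :: _ \<Rightarrow>\<^sub>0 'k)"
    from keys_cobar_lift[OF this] have "sum_list (map bar_deg us) = chain_length X R g" by (simp add: good_lift_def)
    then show "(sgn_list us :: 'k) = (-1) ^ chain_length X R g" by simp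
  qed
  moreover have "cobar_D (prod_list (map cobar_lift gs)) = (alg_hom cobar_lift (der_list (chain_length X R) chain_d gs) :: _ \<Rightarrow>\<^sub>0 'k)"
    using Cons by simp
  ultimately show ?case using Cons.prems
    by (simp add: alg_hom.add alg_hom.scale alg_hom_mult)
qed

text \<open>
  The induction hypothesis makes the image of the differential a cycle, and on cycles the contraction
  is a right inverse of the differential.
\<close>

theorem cobar_D_lift: "cobar_D (cobar_lift w) = (alg_hom cobar_lift (chain_d w) :: _ \<Rightarrow>\<^sub>0 'k::field)"
proof (induction "length w" arbitrary: w rule: less_induct)
  case less
  show ?case
  proof (cases "w \<in> chains X R")
    case False
    then have "decs w = {}" by (auto simp: decs_def)
    then show ?thesis unfolding alg_hom_chain_d by (simp add: cobar_lift_nonchain[OF False] der.zero)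
  next
    case w: True
    show ?thesis
    proof (cases "chain_length X R w = 0")
      case True
      then have "decs w = {}" by (auto simp: decs_def)
      then show ?thesis unfolding alg_hom_chain_d cobar_lift_letter[OF w True] by (simp add: mon_Nil)
    next
      case False
      define z where "z = (alg_hom cobar_lift (chain_d w) :: _ \<Rightarrow>\<^sub>0 'k)"
      have "cobar_D (alg_hom cobar_lift x) = (alg_hom cobar_lift (derivation (chain_length X R) chain_d x) :: _ \<Rightarrow>\<^sub>0 'k)"
        if x: "\<And>v. v \<in> keys x \<Longrightarrow> letters v \<in> decs w" for x
      proof (rule linear_eq_on_keys[where sc = pm_scale and f = "\<lambda>x. cobar_D (alg_hom cobar_lift x)"
            and g = "\<lambda>x. alg_hom cobar_lift (derivation (chain_length X R) chain_d x)" and x = x])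
        fix v assume "v \<in> keys x"
        then have d: "letters v \<in> decs w" by (rule x)
        have "cobar_D (prod_list (map cobar_lift (letters v))) =
            (alg_hom cobar_lift (der_list (chain_length X R) chain_d (letters v)) :: _ \<Rightarrow>\<^sub>0 'k)"
          by (rule derivation_alg_hom) (rule less.hyps[OF decs_shorter[OF d]])
        then show "cobar_D (alg_hom cobar_lift (single v 1)) =
            (alg_hom cobar_lift (derivation (chain_length X R) chain_d (single v 1)) :: _ \<Rightarrow>\<^sub>0 'k)" by simp
      qed (intro pm_linear_intros)+
      then have "cobar_D z = alg_hom cobar_lift (derivation (chain_length X R) chain_d (chain_d w))"
        unfolding z_def by (metis keys_chain_d free_monoid.collapse)
      then have Dz: "cobar_D z = 0" unfolding derivation_chain_d by (simp add: alg_hom.zero)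
      have "cobar_D (contract z) + contract (cobar_D z) = z"
      proof (rule linear_eq_on_keys[where sc = pm_scale and f = "\<lambda>z. cobar_D (contract z) + contract (cobar_D z)"
            and g = "\<lambda>z. z" and x = z])
        fix v assume "v \<in> keys z"
        then have "Word (letters v) \<in> keys (alg_hom cobar_lift (chain_d w) :: _ \<Rightarrow>\<^sub>0 'k)" by (simp add: z_def)
        then have l: "letters v \<noteq> [] \<and> (\<forall>B\<in>set (letters v). bar_word X R B) \<and> concat (concat (letters v)) = w \<and>
            sum_list (map bar_deg (letters v)) + 1 = chain_length X R w"
          by (rule keys_alg_hom_chain_d[rotated]) (use keys_cobar_lift in blast)
        have "cobar_D (contract_list (letters v)) + contract (cobar_D (mon (letters v))) = (mon (letters v) :: _ \<Rightarrow>\<^sub>0 'k)"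
          by (rule contraction) (use l chain_not_normal[OF w False] in simp_all)
        then show "cobar_D (contract (single v 1)) + contract (cobar_D (single v 1)) = (single v 1 :: _ \<Rightarrow>\<^sub>0 'k)"
          by (simp only: contract_single free_monoid.collapse)
      qed (intro pm_linear_intros pm_linear_compose[OF _ contract_linear] pm_linear_compose[OF contract_linear derivation_linear])+
      then show ?thesis unfolding cobar_lift_long[OF False w] z_def[symmetric] using Dz by (simp add: contract.zero)
    qed
  qed
qed

text \<open>
  To leave a single block the contraction has to multiply all blocks after the first into one bar
  letter, which is then glued to the first block.
\<close>

lemma contract_single_block:
  assumes "\<forall>B\<in>set (E # Bs). bar_word X R B"
  shows "lookup (contract_list (E # Bs) :: _ \<Rightarrow>\<^sub>0 'k::field) (Word [C]) =
    (if Bs \<noteq> [] \<and> (\<forall>B\<in>set Bs. length B = 1) \<and> nrm (concat (concat Bs)) \<and> C = E @ [concat (concat Bs)]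
     then - ((-1) ^ bar_deg E) else 0)"
  using assms
proof (induction "length Bs" arbitrary: Bs rule: less_induct)
  case less
  show ?case
  proof (cases "Bs = []")
    case True then show ?thesis by (simp add: contract_one)
  next
    case False
    then obtain Bs' B where Bs: "Bs = Bs' @ [B]" by (metis append_butlast_last_id)
    have bE: "bar_word X R E" and bB: "bar_word X R B" and bBs': "\<forall>B\<in>set Bs'. bar_word X R B"
      using less.prems Bs by auto
    show ?thesis
    proof (cases "length B = 1")
      case F: False
      have "contract_list ((E # Bs') @ [B]) = (0 :: _ \<Rightarrow>\<^sub>0 'k)" by (rule contract_long[OF F])
      then show ?thesis using F Bs by simp
    next
      case True
      then obtain a where a: "B = [a]" by (metis One_nat_def Suc_length_conv length_0_conv)
      have la: "nrm a" using bB a by (simp add: bar_word_def)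
      show ?thesis
      proof (cases "Bs' = []")
        case True
        obtain G b where G: "E = G @ [b]" using bE by (metis append_butlast_last_id bar_word_def)
        have "contract_list (E # Bs) = (pm_scale (- sgn_list [E]) (mon [E @ [a]]) :: _ \<Rightarrow>\<^sub>0 'k)"
          using contract_snoc[of "[]" G b a] unfolding Bs True a by (simp add: G contract_one contract_snoc[of "[]" G b a, simplified])
        then show ?thesis using Bs True a la by (simp add: lookup_single when_def)
      next
        case F: False
        then obtain Bs'' B' where Bs': "Bs' = Bs'' @ [B']" by (metis append_butlast_last_id)
        have bB': "bar_word X R B'" "\<forall>B\<in>set Bs''. bar_word X R B" using bBs' Bs' by auto
        then have "B' \<noteq> []" by (simp add: bar_word_def)
        then obtain G b where G: "B' = G @ [b]" by (metis append_butlast_last_id)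
        have ws: "E # Bs = (E # Bs'') @ [G @ [b], [a]]" using Bs Bs' G a by simp
        have c: "concat (concat (Bs'' @ [G @ [b @ a]])) = concat (concat Bs)" using Bs Bs' G a by simp
        have len: "(\<forall>B\<in>set (Bs'' @ [G @ [b @ a]]). length B = 1) \<longleftrightarrow> (\<forall>B\<in>set Bs. length B = 1)" using Bs Bs' G a by simp
        show ?thesis
        proof (cases "nrm (b @ a)")
          case True
          have "lookup (contract_list (E # Bs)) (Word [C]) = lookup (contract_list (E # Bs'' @ [G @ [b @ a]]) :: _ \<Rightarrow>\<^sub>0 'k) (Word [C])"
            unfolding ws contract_snoc using True by (simp add: lookup_add lookup_single when_def)
          also have "\<dots> = (if Bs'' @ [G @ [b @ a]] \<noteq> [] \<and> (\<forall>B\<in>set (Bs'' @ [G @ [b @ a]]). length B = 1) \<and>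
              nrm (concat (concat (Bs'' @ [G @ [b @ a]]))) \<and> C = E @ [concat (concat (Bs'' @ [G @ [b @ a]]))]
              then - ((-1) ^ bar_deg E) else 0)"
          proof (rule less.hyps)
            show "length (Bs'' @ [G @ [b @ a]]) < length Bs" using Bs Bs' by simp
            show "\<forall>B\<in>set (E # Bs'' @ [G @ [b @ a]]). bar_word X R B"
              using bE bB' G True bB a by (auto simp: bar_word_def)
          qed
          finally show ?thesis unfolding c len using False by simp
        next
          case n: False
          have "\<not> nrm (concat (concat Bs))"
          proof
            assume "nrm (concat (concat Bs))"
            moreover have "concat (concat Bs) = (concat (concat Bs'') @ concat G) @ (b @ a)" using Bs Bs' G a by simp
            then have "sublist (b @ a) (concat (concat Bs))" by (simp only: sublist_appendI sublist_append_leftI)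
            ultimately show False using normal_sublist n by blast
          qed
          then show ?thesis unfolding ws contract_snoc using n by (simp add: lookup_single when_def)
        qed
      qed
    qed
  qed
qed

lemma lookup_contract:
  "lookup (contract x :: _ \<Rightarrow>\<^sub>0 'k::field) v = (\<Sum>w\<in>keys x. lookup x w * lookup (contract_list (letters w)) v)"
  unfolding contract_def lin_ext_def by (simp add: lookup_sum)

lemma chain_tail_append: "chain_tail X R u (vs @ ws) \<Longrightarrow> chain_tail X R u vs"
  by (induction vs arbitrary: u) auto

lemma chain_letter: "w \<in> chains X R \<Longrightarrow> chain_length X R w = 0 \<Longrightarrow> \<exists>x\<in>X. w = [x]"
proof -
  assume w: "w \<in> chains X R" "chain_length X R w = 0"
  then obtain x where x: "w = [x]" using chain_length_0_iff[OF w(1)] by (metis One_nat_def Suc_length_conv length_0_conv)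
  then show ?thesis using chain_in_lists[OF w(1)] by auto
qed

lemma is_chain_letter: "x \<in> X \<Longrightarrow> is_chain X R 0 [x]"
  unfolding is_chain_def by (intro exI[of _ "[[x]]"]) (simp add: chain_factors_singleton)

text \<open>
  The chain without its last factor, followed by the letters of the last factor: by
  \<open>contract_single_block\<close> this is the only factorization that contributes a single block.
\<close>

definition leading_dec :: "'a list \<Rightarrow> 'a list list" where
  "leading_dec w = concat (butlast (factors X R w)) # map (\<lambda>x. [x]) (last (factors X R w))"

lemma leading_decomposition:
  assumes "w \<in> chains X R" "chain_length X R w \<noteq> 0"
  shows "leading_dec w \<in> decs w" "factors X R (concat (butlast (factors X R w))) = butlast (factors X R w)"
    "bar_letter (last (factors X R w))"
proof -
  let ?us = "factors X R w"
  obtain x vs where f: "?us = [x] # vs" "chain_tail X R [x] vs" "x \<in> X"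
    using factors_chain(1)[OF assms(1)] unfolding chain_factors_iff by blast
  have len: "length vs = chain_length X R w" using factors_chain(3)[OF assms(1)] f by simp
  then obtain ys v where vs: "vs = ys @ [v]" using assms(2) by (metis append_butlast_last_id length_0_conv)
  have bl: "butlast ?us = [x] # ys" "last ?us = v" using f vs by (simp_all add: butlast_append)
  have cf: "chain_factors X R ([x] # ys)"
    unfolding chain_factors_iff using f(2,3) vs chain_tail_append by blast
  have v: "bar_letter v"
  proof -
    have "v \<in> set vs" using vs by simp
    then show ?thesis using f(2) unfolding chain_tail_iff by blast
  qed
  then show "bar_letter (last ?us)" using bl by simp
  show fac: "factors X R (concat (butlast ?us)) = butlast ?us" unfolding bl by (rule factors_eq[OF cf])
  have g: "is_chain X R (length ys) (concat ([x] # ys))" using chain_factors_chain[OF cf] by simp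
  have l: "[y] \<in> chains X R \<and> chain_length X R [y] = 0" if "y \<in> set v" for y
  proof -
    have "y \<in> X" using v that unfolding normal_mono_def by auto
    then show ?thesis using is_chain_letter is_chain_iff by blast
  qed
  have "map (chain_length X R \<circ> (\<lambda>x. [x])) v = map (\<lambda>x. 0) v" using l by (intro map_cong) auto
  then have z: "sum_list (map (chain_length X R) (map (\<lambda>x. [x]) v)) = 0" by simp
  have "concat (map (\<lambda>x. [x]) v) = v" by (induction v) auto
  then have "concat (concat ([x] # ys) # map (\<lambda>x. [x]) v) = w"
    using factors_chain(2)[OF assms(1)] f vs by simp
  moreover have "set (concat ([x] # ys) # map (\<lambda>x. [x]) v) \<subseteq> chains X R"
    using g l unfolding is_chain_iff by auto
  moreover have "2 \<le> length (concat ([x] # ys) # map (\<lambda>x. [x]) v)" using v by (cases v) auto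
  moreover have "Suc (sum_list (map (chain_length X R) (concat ([x] # ys) # map (\<lambda>x. [x]) v))) = chain_length X R w"
    unfolding list.map sum_list.Cons z using g len vs unfolding is_chain_iff by simp
  ultimately show "leading_dec w \<in> decs w" unfolding leading_dec_def bl decs_def using assms(1) by blast
qed

lemma letters_tail_unique:
  assumes "gs \<in> decs w" "\<forall>h\<in>set (tl gs). chain_length X R h = 0"
  shows "gs = leading_dec w"
proof -
  have d: "w \<in> chains X R" "2 \<le> length gs" "set gs \<subseteq> chains X R" "concat gs = w"
    "Suc (sum_list (map (chain_length X R) gs)) = chain_length X R w" using assms(1) by (auto simp: decs_def)
  obtain g hs where gs: "gs = g # hs" using d(2) by (cases gs) auto
  have "map (chain_length X R) hs = map (\<lambda>x. 0) hs" using assms(2) gs by simp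
  then have z: "sum_list (map (chain_length X R) hs) = 0" by simp
  have cg: "Suc (chain_length X R g) = chain_length X R w" using d(5) unfolding gs list.map sum_list.Cons z by simp
  have g: "g \<in> chains X R" using d(3) gs by simp
  have w: "w = g @ concat hs" using d(4) gs by simp
  let ?us = "factors X R w"
  have lus: "length ?us = Suc (chain_length X R w)" by (rule factors_chain(3)[OF d(1)])
  have t: "factors X R g = take (length (factors X R g)) ?us"
    by (rule chain_factors_prefix[where w = w])
      (use factors_chain[OF g] factors_chain[OF d(1)] cg w in auto)
  have "length (factors X R g) = length ?us - 1" using factors_chain(3)[OF g] lus cg by simp
  then have fg: "factors X R g = butlast ?us" using t by (simp add: butlast_conv_take)
  then have g': "g = concat (butlast ?us)" using factors_chain(2)[OF g] by simp
  have "?us = butlast ?us @ [last ?us]" using lus by (metis append_butlast_last_id list.size(3) nat.distinct(1))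
  from arg_cong[OF this, of concat] have "w = g @ last ?us" using factors_chain(2)[OF d(1)] g' by simp
  then have ch: "concat hs = last ?us" using w by simp
  have "\<forall>h\<in>set hs. \<exists>x. h = [x]" using chain_letter assms(2) d(3) unfolding gs by fastforce
  then have "hs = map (\<lambda>x. [x]) (concat hs)"
  proof (induction hs)
    case (Cons h hs) then show ?case by auto
  qed simp
  then show ?thesis unfolding gs leading_dec_def ch using g' by simp
qed

text \<open>
  Induction along the leading factorization. This is what makes the dual morphism invertible on
  homology.
\<close>

theorem lookup_cobar_lift_single:
  assumes "w \<in> chains X R"
  shows "\<exists>\<epsilon>. (\<epsilon> = 1 \<or> \<epsilon> = - 1) \<and> (\<forall>C. lookup (cobar_lift w :: _ \<Rightarrow>\<^sub>0 'k::field) (Word [C]) = (if C = factors X R w then \<epsilon> else 0))"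
  using assms
proof (induction "length w" arbitrary: w rule: less_induct)
  case less
  note w = less.prems
  show ?case
  proof (cases "chain_length X R w = 0")
    case True
    then obtain x where x: "x \<in> X" "w = [x]" using chain_letter[OF w] by blast
    have "factors X R w = [[x]]" using factors_eq[OF chain_factors_singleton[OF x(1)], of R] x by simp
    then have "lookup (cobar_lift w :: _ \<Rightarrow>\<^sub>0 'k) (Word [C]) = (if C = factors X R w then 1 else 0)" for C
      unfolding cobar_lift_letter[OF w True] using x by (auto simp: lookup_single when_def)
    then show ?thesis by blast
  next
    case False
    define g where "g = concat (butlast (factors X R w))"
    define hs where "hs = map (\<lambda>x. [x]) (last (factors X R w))"
    have ld: "leading_dec w = g # hs" by (simp add: leading_dec_def g_def hs_def)
    note lead = leading_decomposition[OF w False, folded g_def, unfolded ld]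
    have gch: "g \<in> chains X R" using lead(1) by (simp add: decs_def)
    obtain \<epsilon> :: 'k where \<epsilon>: "\<epsilon> = 1 \<or> \<epsilon> = - 1"
      "\<And>C. lookup (cobar_lift g :: _ \<Rightarrow>\<^sub>0 'k) (Word [C]) = (if C = factors X R g then \<epsilon> else 0)"
      using less.hyps[OF decs_shorter[OF lead(1)] gch] by auto
    have usne: "factors X R w \<noteq> []" using factors_chain(3)[OF w] by auto
    have fw: "factors X R g @ [last (factors X R w)] = factors X R w"
      using lead(2) append_butlast_last_id[OF usne] by simp
    have len1: "length h = 1 \<and> h \<in> chains X R \<and> chain_length X R h = 0" if "h \<in> set hs" for h
    proof -
      have "h \<in> chains X R" using lead(1) that by (auto simp: decs_def)
      moreover have "length h = 1" using that by (auto simp: hs_def)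
      ultimately show ?thesis using chain_length_0_iff by blast
    qed
    define val where "val gs C = lookup (contract (prod_list (map cobar_lift gs)) :: _ \<Rightarrow>\<^sub>0 'k) (Word [C])" for gs C
    have other: "val gs C = 0" if gs: "gs \<in> decs w" "gs \<noteq> g # hs" for gs C
    proof -
      obtain h where h: "h \<in> set (tl gs)" "chain_length X R h \<noteq> 0"
        using letters_tail_unique[OF gs(1)] gs(2) ld by auto
      have "lookup (contract_list (letters v) :: _ \<Rightarrow>\<^sub>0 'k) (Word [C]) = 0"
        if "v \<in> keys (prod_list (map cobar_lift gs) :: _ \<Rightarrow>\<^sub>0 'k)" for v
      proof -
        have "Word (letters v) \<in> keys (prod_list (map cobar_lift gs) :: _ \<Rightarrow>\<^sub>0 'k)" using that by simp
        from keys_prod_list[OF this] obtain bs where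
          bs: "list_all2 (\<lambda>g b. Word b \<in> keys (cobar_lift g :: _ \<Rightarrow>\<^sub>0 'k)) gs bs" "letters v = concat bs" by blast
        have good: "list_all2 good_lift gs bs"
          using bs(1) by (rule list_all2_set_mono) (use keys_cobar_lift in blast)
        obtain g1 gs' where g1: "gs = g1 # gs'" using h(1) by (cases gs) auto
        obtain b1 bs' where b1: "bs = b1 # bs'" "good_lift g1 b1" "list_all2 good_lift gs' bs'"
          using good unfolding g1 by (auto simp: list_all2_Cons1)
        obtain E B1 where E: "b1 = E # B1" using b1(2) unfolding good_lift_def by (cases b1) auto
        have "h \<in> set gs'" using h(1) g1 by simp
        then obtain i where i: "i < length gs'" "h = gs' ! i" by (auto simp: in_set_conv_nth)
        then have "good_lift h (bs' ! i)" "i < length bs'" using b1(3) by (auto simp: list_all2_conv_all_nth)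
        then have bi: "bs' ! i \<noteq> []" "2 \<le> length (last (bs' ! i))" "bs' ! i \<in> set bs'" using h(2) by (auto simp: good_lift_def)
        have "last (bs' ! i) \<in> set (concat bs')"
          unfolding set_concat by (rule UN_I[OF bi(3)]) (rule last_in_set[OF bi(1)])
        then have "last (bs' ! i) \<in> set (B1 @ concat bs')" "length (last (bs' ! i)) \<noteq> 1" using bi(2) by auto
        then have ns: "\<not> (\<forall>B\<in>set (B1 @ concat bs'). length B = 1)" by blast
        have lv: "letters v = E # B1 @ concat bs'" using bs(2) b1(1) E by simp
        have "\<forall>B\<in>set (letters v). bar_word X R B" using good_lift_concat[OF good] bs(2) by simp
        then have bw: "\<forall>B\<in>set (E # B1 @ concat bs'). bar_word X R B" unfolding lv .
        show ?thesis unfolding lv contract_single_block[OF bw] using ns by (simp only: simp_thms if_False)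
      qed
      then show ?thesis unfolding val_def lookup_contract by (intro sum.neutral) simp
    qed
    have lead_val: "val (g # hs) C = (if C = factors X R w then \<epsilon> * (- ((-1) ^ bar_deg (factors X R g))) else 0)" for C
    proof -
      let ?ls = "map (\<lambda>h. [h]) hs"
      have p: "prod_list (map cobar_lift hs) = (mon ?ls :: _ \<Rightarrow>\<^sub>0 'k)"
        using len1
      proof (induction hs)
        case (Cons h hs)
        then have "cobar_lift h = (mon [[h]] :: _ \<Rightarrow>\<^sub>0 'k)" by (intro cobar_lift_letter) simp_all
        then show ?case using Cons by simp
      qed (simp add: mon_Nil)
      have cc: "concat (concat ?ls) = last (factors X R w)"
      proof -
        have 1: "concat (map (\<lambda>h. [h]) xs) = xs" for xs :: "'a list list" by (induction xs) auto
        have 2: "concat (map (\<lambda>h. [h]) xs) = xs" for xs :: "'a list" by (induction xs) auto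
        show ?thesis unfolding 1 unfolding hs_def 2 ..
      qed
      have hsne: "hs \<noteq> []" using lead(3) by (auto simp: hs_def)
      have bls: "\<forall>B\<in>set ?ls. bar_word X R B" using len1 normal_single chain_letter by (fastforce simp: bar_word_def)
      have lsl: "\<forall>B\<in>set ?ls. length B = 1" by simp
      have ndef: "nrm (concat (concat ?ls))" using cc lead(3) by simp
      have key: "lookup (contract_list (letters v @ ?ls) :: _ \<Rightarrow>\<^sub>0 'k) (Word [C]) =
          (if v = Word [factors X R g] \<and> C = factors X R w then - ((-1) ^ bar_deg (factors X R g)) else 0)"
        if "v \<in> keys (cobar_lift g :: _ \<Rightarrow>\<^sub>0 'k)" for v
      proof -
        have k: "Word (letters v) \<in> keys (cobar_lift g :: _ \<Rightarrow>\<^sub>0 'k)" using that by simp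
        have good: "good_lift g (letters v)" using keys_cobar_lift[OF k] by simp
        obtain E B1 where E: "letters v = E # B1" using good unfolding good_lift_def by (cases "letters v") auto
        have bw: "\<forall>B\<in>set (E # B1 @ ?ls). bar_word X R B" using good bls E by (auto simp: good_lift_def)
        have lv: "letters v @ ?ls = E # B1 @ ?ls" by (simp add: E)
        show ?thesis
        proof (cases "B1 = []")
          case True
          have v: "v = Word [E]" using E True by (metis free_monoid.collapse)
          then have "lookup (cobar_lift g :: _ \<Rightarrow>\<^sub>0 'k) (Word [E]) \<noteq> 0" using that by (simp add: in_keys_iff)
          then have Eg: "E = factors X R g" using \<epsilon>(2)[of E] by (auto split: if_splits)
          have "C = E @ [concat (concat (B1 @ ?ls))] \<longleftrightarrow> C = factors X R w" using True cc Eg fw by simp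
          moreover have "B1 @ ?ls \<noteq> []" "\<forall>B\<in>set (B1 @ ?ls). length B = 1" "nrm (concat (concat (B1 @ ?ls)))"
            using True hsne lsl ndef by simp_all
          ultimately show ?thesis unfolding lv contract_single_block[OF bw] using v Eg by auto
        next
          case F: False
          have "chain_length X R g \<noteq> 0"
          proof
            assume "chain_length X R g = 0"
            then have "v = Word [[g]]" using that by (simp add: cobar_lift_letter[OF gch])
            then show False using E F by simp
          qed
          then have "2 \<le> length (last B1)" using good E F by (auto simp: good_lift_def)
          then have ns: "\<not> (\<forall>B\<in>set (B1 @ ?ls). length B = 1)" using last_in_set[OF F] by fastforce
          have "v \<noteq> Word [factors X R g]" using E F by auto
          then show ?thesis unfolding lv contract_single_block[OF bw] using ns by (simp only: simp_thms if_False)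
        qed
      qed
      have "val (g # hs) C = lookup (contract (cobar_lift g * mon ?ls)) (Word [C])"
        unfolding val_def by (simp add: p)
      also have "cobar_lift g * mon ?ls = lin_ext pm_scale (\<lambda>v. mon (letters v @ ?ls)) (cobar_lift g :: _ \<Rightarrow>\<^sub>0 'k)"
      proof (rule linear_eq_on_keys[where sc = pm_scale and f = "\<lambda>x. x * mon ?ls"])
        fix v show "single v 1 * mon ?ls = lin_ext pm_scale (\<lambda>v. mon (letters v @ ?ls)) (single v (1 :: 'k))" by (cases v) simp
      qed (intro pm_linear_intros)+
      also have "lookup (contract \<dots>) (Word [C]) = (\<Sum>v\<in>keys (cobar_lift g :: _ \<Rightarrow>\<^sub>0 'k). lookup (cobar_lift g) v *
          lookup (contract_list (letters v @ ?ls)) (Word [C]))"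
        by (simp add: lin_ext_def contract.sum contract.scale lookup_sum del: pm_scale_single)
      also have "\<dots> = (\<Sum>v\<in>keys (cobar_lift g :: _ \<Rightarrow>\<^sub>0 'k). if v = Word [factors X R g] then
          (if C = factors X R w then \<epsilon> * (- ((-1) ^ bar_deg (factors X R g))) else 0) else 0)"
        by (intro sum.cong refl) (simp add: key \<epsilon>(2))
      also have "\<dots> = (if C = factors X R w then \<epsilon> * (- ((-1) ^ bar_deg (factors X R g))) else 0)"
      proof -
        have "Word [factors X R g] \<in> keys (cobar_lift g :: _ \<Rightarrow>\<^sub>0 'k)" using \<epsilon>(1) by (auto simp: in_keys_iff \<epsilon>(2))
        then show ?thesis by simp
      qed
      finally show ?thesis .
    qed
    define \<epsilon>' where "\<epsilon>' = (-1) ^ dec_parity (g # hs) * (\<epsilon> * (- ((-1) ^ bar_deg (factors X R g))))"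
    have "lookup (cobar_lift w :: _ \<Rightarrow>\<^sub>0 'k) (Word [C]) = (if C = factors X R w then \<epsilon>' else 0)" for C
    proof -
      have "lookup (cobar_lift w :: _ \<Rightarrow>\<^sub>0 'k) (Word [C]) = (\<Sum>gs\<in>decs w. (-1) ^ dec_parity gs * val gs C)"
        unfolding cobar_lift_long[OF False w] alg_hom_chain_d val_def by (simp add: contract.sum contract.scale lookup_sum)
      also have "\<dots> = (\<Sum>gs\<in>decs w. if gs = g # hs then (-1) ^ dec_parity gs * val gs C else 0)"
        by (intro sum.cong refl) (simp add: other)
      also have "\<dots> = (-1) ^ dec_parity (g # hs) * val (g # hs) C" using lead(1) finite_decs by simp
      finally show ?thesis by (simp add: lead_val \<epsilon>'_def)
    qed
    moreover have "\<epsilon>' = 1 \<or> \<epsilon>' = - 1"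
      unfolding \<epsilon>'_def using \<epsilon>(1) by (auto simp: minus_one_power_iff)
    ultimately show ?thesis by blast
  qed
qed

end

section \<open>The homology of the bar construction\<close>

context monomial_algebra
begin

lemma bar_d_lin_ext: "bar_d X R = (lin_ext pm_scale (bar_d_word X R) :: _ \<Rightarrow> (_ \<Rightarrow>\<^sub>0 'k::field))"
  by (rule ext) (simp add: bar_d_def lin_ext_def)

lemma bar_d_linear: "Vector_Spaces.linear pm_scale pm_scale (bar_d X R :: _ \<Rightarrow> (_ \<Rightarrow>\<^sub>0 'k::field))"
  unfolding bar_d_lin_ext by (rule pm.lin_ext_linear)

interpretation bar_d: Vector_Spaces.linear pm_scale pm_scale "bar_d X R :: _ \<Rightarrow> (_ \<Rightarrow>\<^sub>0 'k::field)" by (rule bar_d_linear)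

lemma bar_d_single: "bar_d X R (single C 1) = bar_d_word X R C"
  by (simp add: bar_d_lin_ext)

lemma bar_d_word_merge: "bar_d_word X R C =
    (\<Sum>i<length C - 1. if nrm (C ! i @ C ! Suc i) then single (merge_at i C) ((-1) ^ i) else 0)"
  unfolding bar_d_word_def merge_at_def ..

text \<open>
  The projection of the cobar construction to single blocks turns its differential into that of the
  bar construction, which therefore squares to zero as well.
\<close>

definition one_block :: "('a list list free_monoid \<Rightarrow>\<^sub>0 'k::field) \<Rightarrow> ('a list list \<Rightarrow>\<^sub>0 'k)" where
  "one_block = lin_ext pm_scale (\<lambda>w. case letters w of [C] \<Rightarrow> single C 1 | _ \<Rightarrow> 0)"

lemma one_block_linear: "Vector_Spaces.linear pm_scale pm_scale one_block"
  unfolding one_block_def by (rule pm.lin_ext_linear)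

interpretation one_block: Vector_Spaces.linear pm_scale pm_scale one_block by (rule one_block_linear)

lemma one_block_cobar_d: "bar_word X R C \<Longrightarrow> one_block (cobar_d C) = (bar_d_word X R C :: _ \<Rightarrow>\<^sub>0 'k::field)"
proof -
  assume C: "bar_word X R C"
  have "one_block (cobar_term C i) = (if nrm (C ! i @ C ! Suc i) then single (merge_at i C) ((-1) ^ i) else 0 :: _ \<Rightarrow>\<^sub>0 'k)" for i
    unfolding cobar_term_def one_block.scale one_block.diff
    by (simp add: one_block_def pm.lin_ext_single) (simp add: lin_ext_def)
  then show ?thesis using C unfolding cobar_d_def bar_d_word_merge by (simp add: one_block.sum)
qed

lemma one_block_many: "(\<And>w. w \<in> keys x \<Longrightarrow> length (letters w) \<noteq> 1) \<Longrightarrow> one_block x = (0 :: _ \<Rightarrow>\<^sub>0 'k::field)"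
  unfolding one_block_def lin_ext_def
  by (intro sum.neutral ballI) (auto split: list.splits, fastforce)

lemma keys_bar_d_word:
  assumes "D \<in> keys (bar_d_word X R C :: _ \<Rightarrow>\<^sub>0 'k::field)"
  obtains i where "Suc i < length C" "nrm (C ! i @ C ! Suc i)" "D = merge_at i C"
proof -
  have "keys (bar_d_word X R C :: _ \<Rightarrow>\<^sub>0 'k) \<subseteq>
      (\<Union>i\<in>{..<length C - 1}. keys (if nrm (C ! i @ C ! Suc i) then single (merge_at i C) ((-1) ^ i) else 0 :: _ \<Rightarrow>\<^sub>0 'k))"
    unfolding bar_d_word_merge by (rule Poly_Mapping.keys_sum)
  from subsetD[OF this assms] obtain i where i: "i < length C - 1"
    "D \<in> keys (if nrm (C ! i @ C ! Suc i) then single (merge_at i C) ((-1) ^ i) else 0 :: _ \<Rightarrow>\<^sub>0 'k)" by (elim UN_E) simp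
  then show thesis using that[of i] by (auto split: if_splits)
qed

lemma merge_at_props:
  assumes "bar_word X R C" "Suc i < length C" "nrm (C ! i @ C ! Suc i)"
  shows "bar_word X R (merge_at i C)" "concat (merge_at i C) = concat C" "length (merge_at i C) = length C - 1"
    "\<And>j. j < i \<Longrightarrow> merge_at i C ! j = C ! j" "\<And>j. j \<le> i \<Longrightarrow> take j (merge_at i C) = take j C"
    "merge_at i C ! i = C ! i @ C ! Suc i"
proof -
  have lt: "i < length C" "Suc i < length C" using assms(2) by simp_all
  have "drop i C = [C ! i, C ! Suc i] @ drop (i + 2) C"
    using Cons_nth_drop_Suc[OF lt(1)] Cons_nth_drop_Suc[OF lt(2)] by simp
  then have C: "C = take i C @ [C ! i, C ! Suc i] @ drop (i + 2) C" using append_take_drop_id[of i C] by simp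
  have "C ! i \<in> set C" using lt by simp
  then have "C ! i \<noteq> []" using assms(1) by (simp add: bar_word_def)
  moreover have "set (take i C) \<subseteq> set C" "set (drop (i + 2) C) \<subseteq> set C" by (simp_all add: set_take_subset set_drop_subset)
  ultimately show "bar_word X R (merge_at i C)" using assms unfolding bar_word_def merge_at_def by auto
  show "concat (merge_at i C) = concat C" using arg_cong[OF C, of concat] by (simp add: merge_at_def)
  show "length (merge_at i C) = length C - 1" using lt by (simp add: merge_at_def)
  show "\<And>j. j < i \<Longrightarrow> merge_at i C ! j = C ! j" using lt by (simp add: merge_at_def nth_append)
  show "\<And>j. j \<le> i \<Longrightarrow> take j (merge_at i C) = take j C" using lt by (simp add: merge_at_def min_def)
  show "merge_at i C ! i = C ! i @ C ! Suc i" using lt by (simp add: merge_at_def nth_append)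
qed

lemma bar_d_word_square: "bar_d X R (bar_d_word X R C) = (0 :: _ \<Rightarrow>\<^sub>0 'k::field)" if C: "bar_word X R C"
proof -
  have "one_block (cobar_D x) = (bar_d X R (one_block x) :: _ \<Rightarrow>\<^sub>0 'k)"
    if x: "\<And>ws. Word ws \<in> keys x \<Longrightarrow> ws \<noteq> [] \<and> (\<forall>B\<in>set ws. bar_word X R B)" for x
  proof (rule linear_eq_on_keys[where sc = pm_scale and f = "\<lambda>x. one_block (cobar_D x)" and g = "\<lambda>x. bar_d X R (one_block x)" and x = x])
    fix w assume "w \<in> keys x"
    then have w: "letters w \<noteq> []" "\<forall>B\<in>set (letters w). bar_word X R B" using x[of "letters w"] by simp_all
    show "one_block (cobar_D (single w 1)) = bar_d X R (one_block (single w (1 :: 'k)))"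
    proof (cases "length (letters w) = 1")
      case True
      then obtain B where B: "letters w = [B]" by (metis One_nat_def Suc_length_conv length_0_conv)
      then have "one_block (single w (1 :: 'k)) = single B 1" by (simp add: one_block_def)
      moreover have "cobar_D (single w 1) = (cobar_d B :: _ \<Rightarrow>\<^sub>0 'k)" using B by (simp add: mon_Nil)
      ultimately show ?thesis using one_block_cobar_d[of B] w B by (simp add: bar_d_single one_block_cobar_d)
    next
      case False
      then obtain B1 B2 Bs where B: "letters w = B1 # B2 # Bs" using w(1) by (metis One_nat_def length_Cons list.exhaust list.size(3))
      have "length (letters v) \<noteq> 1" if "v \<in> keys (cobar_D (single w (1 :: 'k)))" for v
      proof -
        have v: "v \<in> keys (der_list bar_deg cobar_d (B1 # B2 # Bs) :: _ \<Rightarrow>\<^sub>0 'k)" using that B by simp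
        have "v \<in> keys (cobar_d B1 * mon (B2 # Bs) :: _ \<Rightarrow>\<^sub>0 'k) \<or>
            v \<in> keys (pm_scale ((-1) ^ bar_deg B1) (mon [B1] * der_list bar_deg cobar_d (B2 # Bs)) :: _ \<Rightarrow>\<^sub>0 'k)"
          using subsetD[OF Poly_Mapping.keys_add v[unfolded der_list.simps(2)[of _ _ B1]]] by simp
        then show ?thesis
        proof
          assume "v \<in> keys (cobar_d B1 * mon (B2 # Bs) :: _ \<Rightarrow>\<^sub>0 'k)"
          from subsetD[OF keys_times this] obtain us vs where "v = Word (us @ vs)" "Word us \<in> keys (cobar_d B1 :: _ \<Rightarrow>\<^sub>0 'k)" "vs = B2 # Bs"
            by auto
          then show ?thesis using keys_cobar_d(1)[of us B1] by (cases us) auto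
        next
          assume "v \<in> keys (pm_scale ((-1) ^ bar_deg B1) (mon [B1] * der_list bar_deg cobar_d (B2 # Bs)) :: _ \<Rightarrow>\<^sub>0 'k)"
          from subsetD[OF keys_times subsetD[OF keys_pm_scale this]] obtain vs where
            vs: "v = Word (B1 # vs)" "Word vs \<in> keys (der_list bar_deg cobar_d (B2 # Bs) :: _ \<Rightarrow>\<^sub>0 'k)" by auto
          have bB: "\<forall>B\<in>set (B2 # Bs). bar_word X R B" using w(2) B by simp
          show ?thesis using keys_der_list[OF vs(2) bB] vs(1) by auto
        qed
      qed
      then have "one_block (cobar_D (single w 1)) = (0 :: _ \<Rightarrow>\<^sub>0 'k)" by (rule one_block_many)
      moreover have "one_block (single w 1) = (0 :: _ \<Rightarrow>\<^sub>0 'k)" using B by (intro one_block_many) simp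
      ultimately show ?thesis by (simp add: bar_d.zero)
    qed
  qed (intro pm_linear_compose[OF derivation_linear one_block_linear] pm_linear_compose[OF one_block_linear bar_d_linear])+
  from this[of "cobar_d C"] have "one_block (cobar_D (cobar_d C)) = (bar_d X R (one_block (cobar_d C)) :: _ \<Rightarrow>\<^sub>0 'k)"
    using keys_cobar_d by blast
  then show ?thesis unfolding cobar_D_square one_block_cobar_d[OF C] by (simp add: one_block.zero)
qed

definition bar_supported :: "('a list list \<Rightarrow>\<^sub>0 'k::field) \<Rightarrow> bool" where
  "bar_supported x \<longleftrightarrow> (\<forall>C\<in>keys x. bar_word X R C)"

lemma bar_d_square: "bar_supported x \<Longrightarrow> bar_d X R (bar_d X R x) = (0 :: _ \<Rightarrow>\<^sub>0 'k::field)"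
proof -
  assume x: "bar_supported x"
  have "bar_d X R (bar_d X R x) = (\<lambda>x. 0 :: _ \<Rightarrow>\<^sub>0 'k) x"
    by (rule linear_eq_on_keys[where sc = pm_scale])
      (rule pm_linear_compose[OF bar_d_linear bar_d_linear], rule pm_linearI, simp, simp,
        use x in \<open>simp add: bar_supported_def bar_d_single bar_d_word_square\<close>)
  then show ?thesis by simp
qed

abbreviation chain_word :: "'a list list \<Rightarrow> bool" where "chain_word \<equiv> chain_factors X R"

lemma chain_tail_bar_word: "chain_tail X R u vs \<Longrightarrow> \<forall>v\<in>set vs. bar_letter v"
  by (simp add: chain_tail_iff)

lemma chain_word_bar_word: "chain_word C \<Longrightarrow> bar_word X R C"
  unfolding chain_factors_iff bar_word_def using chain_tail_bar_word normal_single by fastforce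

lemma chain_word_nonremovable: "chain_word C \<Longrightarrow> Suc i < length C \<Longrightarrow> \<not> nrm (C ! i @ C ! Suc i)"
  unfolding chain_factors_def zero_minimally_def by blast

lemma bar_d_chain_word: "chain_word C \<Longrightarrow> bar_d_word X R C = 0"
  unfolding bar_d_word_merge by (intro sum.neutral) (auto simp: chain_word_nonremovable)

text \<open>
  The matching on bar words. At stage \<open>j > 0\<close> a bar word that is not a chain has the factors of
  a chain as its first \<open>j\<close> letters, and the last of these has product zero with the next letter. The part of that next letter up to the first place where the
  product vanishes would continue the chain. If this part is proper, the word is splittable and its
  partner has the letter split there; if it is the whole letter and the following product is not zero,
  the word is mergeable. Words of neither kind belong to the next stage.
\<close>

definition stage :: "nat \<Rightarrow> 'a list list \<Rightarrow> bool" where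
  "stage j C \<longleftrightarrow> bar_word X R C \<and> (chain_word C \<or> j = 0 \<or>
     (0 < j \<and> j < length C \<and> chain_word (take j C) \<and> \<not> nrm (C ! (j - 1) @ C ! j)))"

definition head_part :: "nat \<Rightarrow> 'a list list \<Rightarrow> 'a list" where
  "head_part j C = (if j = 0 then take 1 (C ! 0)
     else take (LEAST n. \<not> nrm (C ! (j - 1) @ take n (C ! j))) (C ! j))"

definition splittable :: "nat \<Rightarrow> 'a list list \<Rightarrow> bool" where
  "splittable j C \<longleftrightarrow> stage j C \<and> \<not> chain_word C \<and> head_part j C \<noteq> C ! j"

definition mergeable :: "nat \<Rightarrow> 'a list list \<Rightarrow> bool" where
  "mergeable j C \<longleftrightarrow> stage j C \<and> \<not> chain_word C \<and> head_part j C = C ! j \<and> Suc j < length C \<and> nrm (C ! j @ C ! Suc j)"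

definition split_head :: "nat \<Rightarrow> 'a list list \<Rightarrow> 'a list list" where
  "split_head j C = take j C @ [head_part j C, drop (length (head_part j C)) (C ! j)] @ drop (Suc j) C"

lemma chain_word_snoc:
  assumes "chain_word us" "bar_letter v" "zero_minimally X R (last us) v"
  shows "chain_word (us @ [v])"
proof -
  have "chain_tail X R u (vs @ [v])" if "chain_tail X R u vs" "zero_minimally X R (last (u # vs)) v" for u vs
    using that assms(2) by (induction vs arbitrary: u) auto
  then show ?thesis using assms(1,3) unfolding chain_factors_iff by fastforce
qed

lemma stage_length: "stage j C \<Longrightarrow> \<not> chain_word C \<Longrightarrow> j < length C"
  unfolding stage_def bar_word_def by auto

lemma head_props:
  assumes "stage j C" "\<not> chain_word C"
  shows "prefix (head_part j C) (C ! j)" "head_part j C \<noteq> []" "chain_word (take j C @ [head_part j C])"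
    "\<And>C' rest. C' ! j = head_part j C @ rest \<Longrightarrow> (0 < j \<Longrightarrow> C' ! (j - 1) = C ! (j - 1)) \<Longrightarrow> head_part j C' = head_part j C"
proof -
  have jl: "j < length C" by (rule stage_length[OF assms])
  have bw: "bar_word X R C" using assms(1) by (simp add: stage_def)
  have Cj: "bar_letter (C ! j)" using bw jl by (simp add: bar_word_def)
  show pre: "prefix (head_part j C) (C ! j)" by (simp add: head_part_def take_is_prefix)
  have "head_part j C \<noteq> [] \<and> chain_word (take j C @ [head_part j C]) \<and>
    (\<forall>C' rest. C' ! j = head_part j C @ rest \<longrightarrow> (0 < j \<longrightarrow> C' ! (j - 1) = C ! (j - 1)) \<longrightarrow> head_part j C' = head_part j C)"
  proof (cases "j = 0")
    case True
    obtain x v where v: "C ! 0 = x # v" using Cj True by (cases "C ! 0") auto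
    then have "x \<in> X" using Cj True by (auto simp: normal_mono_def)
    then have "chain_word [[x]]" by (rule chain_factors_singleton)
    then show ?thesis using True v by (auto simp: head_part_def)
  next
    case False
    let ?u = "C ! (j - 1)" and ?v = "C ! j"
    define n where "n = (LEAST n. \<not> nrm (?u @ take n ?v))"
    have h: "head_part j C = take n ?v" using False by (simp add: head_part_def n_def)
    have st: "chain_word (take j C)" "\<not> nrm (?u @ ?v)" using assms False by (auto simp: stage_def)
    have "\<not> nrm (?u @ take (length ?v) ?v)" using st by simp
    then have n: "\<not> nrm (?u @ take n ?v)" "n \<le> length ?v"
      unfolding n_def by (rule LeastI, rule Least_le)
    have small: "nrm (?u @ take k ?v)" if "k < n" for k using not_less_Least[of k] that unfolding n_def by blast
    have nu: "nrm ?u" using bw jl False by (simp add: bar_word_def)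
    then have n0: "n \<noteq> 0" using n(1) by (metis append_Nil2 take_0)
    have ne: "take n ?v \<noteq> []" using n0 Cj by simp
    have zm: "zero_minimally X R ?u (take n ?v)"
      unfolding zero_minimally_def
    proof (intro conjI allI impI)
      fix v' assume v': "strict_prefix v' (take n ?v)"
      then have "length v' < n" using prefix_length_less[OF v'] n(2) by simp
      moreover have "v' = take (length v') ?v"
        using v' by (metis append_eq_conv_conj prefix_def prefix_order.trans strict_prefix_def take_is_prefix)
      ultimately show "nrm (?u @ v')" using small[of "length v'"] by simp
    qed (rule n(1))
    have "take j C \<noteq> []" using False jl by (cases C) auto
    then have lu: "last (take j C) = ?u" using False jl by (simp add: last_conv_nth)
    have "nrm (take n ?v)" using normal_sublist[of "take n ?v" ?v] Cj by (simp add: prefix_imp_sublist take_is_prefix)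
    then have ch: "chain_word (take j C @ [take n ?v])"
      using chain_word_snoc[OF st(1)] ne zm lu by simp
    have "head_part j C' = take n ?v" if C': "C' ! j = take n ?v @ rest" "C' ! (j - 1) = ?u" for C' rest
    proof -
      have ln: "length (take n ?v) = n" using n(2) by simp
      have "(LEAST k. \<not> nrm (C' ! (j - 1) @ take k (C' ! j))) = n"
      proof (rule Least_equality)
        show "\<not> nrm (C' ! (j - 1) @ take n (C' ! j))" unfolding C' using n ln by simp
        fix k assume k: "\<not> nrm (C' ! (j - 1) @ take k (C' ! j))"
        show "n \<le> k"
        proof (rule ccontr)
          assume "\<not> n \<le> k"
          then have "take k (C' ! j) = take k ?v" unfolding C' using ln by (simp add: min_def)
          then show False using k small[of k] \<open>\<not> n \<le> k\<close> C'(2) by simp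
        qed
      qed
      then show ?thesis using False C' ln by (simp add: head_part_def)
    qed
    then show ?thesis using h ne ch False by auto
  qed
  then show "head_part j C \<noteq> []" "chain_word (take j C @ [head_part j C])"
    "\<And>C' rest. C' ! j = head_part j C @ rest \<Longrightarrow> (0 < j \<Longrightarrow> C' ! (j - 1) = C ! (j - 1)) \<Longrightarrow> head_part j C' = head_part j C"
    by blast+
qed

lemma stage_nonremovable:
  assumes "stage j C" "Suc i < length C" "nrm (C ! i @ C ! Suc i)"
  shows "j \<le> i" "\<not> chain_word C"
proof -
  show nc: "\<not> chain_word C" using chain_word_nonremovable assms by blast
  show "j \<le> i"
  proof (rule ccontr)
    assume "\<not> j \<le> i"
    then have j: "i < j" by simp
    then have st: "chain_word (take j C)" "\<not> nrm (C ! (j - 1) @ C ! j)" "j < length C" using assms(1) nc by (auto simp: stage_def)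
    show False
    proof (cases "Suc i = j")
      case True then show False using st(2) assms(3) by auto
    next
      case False
      then have "\<not> nrm (take j C ! i @ take j C ! Suc i)" using j st by (intro chain_word_nonremovable) auto
      then show False using assms(3) j False by simp
    qed
  qed
qed

text \<open>
  Multiplications further to the right do not disturb the matching at stage \<open>j\<close>.
\<close>

lemma merge_above:
  assumes "stage j C" "\<not> chain_word C" "head_part j C = C ! j" "j < i" "Suc i < length C" "nrm (C ! i @ C ! Suc i)"
  shows "stage j (merge_at i C)" "\<not> splittable j (merge_at i C)"
proof -
  have bw: "bar_word X R C" using assms(1) by (simp add: stage_def)
  note m = merge_at_props[OF bw assms(5,6)]
  show st: "stage j (merge_at i C)"
    unfolding stage_def using m(1,3) m(4)[of "j - 1"] m(4)[of j] m(5)[of j] assms by (auto simp: stage_def)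
  have "head_part j (merge_at i C) = head_part j C"
    by (rule head_props(4)[OF assms(1,2), where rest = "[]"]) (use m(4)[of j] m(4)[of "j - 1"] assms in simp_all)
  then show "\<not> splittable j (merge_at i C)" unfolding splittable_def using m(4)[of j] assms by simp
qed

lemma mergeable_merge:
  assumes "mergeable j C"
  shows "splittable j (merge_at j C)" "split_head j (merge_at j C) = C"
proof -
  have a: "stage j C" "\<not> chain_word C" "head_part j C = C ! j" "Suc j < length C" "nrm (C ! j @ C ! Suc j)"
    using assms by (auto simp: mergeable_def)
  have bw: "bar_word X R C" using a(1) by (simp add: stage_def)
  note m = merge_at_props[OF bw a(4,5)]
  have hp: "head_part j (merge_at j C) = C ! j"
    using head_props(4)[OF a(1,2), of "merge_at j C" "C ! Suc j"] m(6) m(4)[of "j - 1"] a(3) by simp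
  have ne: "C ! Suc j \<noteq> []" using bw a(4) by (simp add: bar_word_def)
  have nc: "\<not> chain_word (merge_at j C)"
  proof
    assume ch: "chain_word (merge_at j C)"
    have jl: "j < length (merge_at j C)" using m(3) a(4) by simp
    show False
    proof (cases "j = 0")
      case True
      then have "length (merge_at j C ! 0) = 1" using ch unfolding chain_factors_iff by auto
      then show False using m(6) True ne bw a(4) by (cases "C ! 0") (auto simp: bar_word_def)
    next
      case False
      then obtain k where k: "j = Suc k" by (cases j) auto
      have "zero_minimally X R (merge_at j C ! k) (merge_at j C ! Suc k)"
        using ch jl k unfolding chain_factors_def by blast
      moreover have "strict_prefix (C ! j) (merge_at j C ! Suc k)" using m(6) k ne by (simp add: strict_prefix_def)
      ultimately have "nrm (C ! k @ C ! j)" using m(4)[of k] k unfolding zero_minimally_def by simp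
      moreover have "\<not> nrm (C ! k @ C ! j)" using a(1,2) k by (auto simp: stage_def)
      ultimately show False by simp
    qed
  qed
  have st: "stage j (merge_at j C)"
  proof (cases "j = 0")
    case True then show ?thesis using m(1) by (simp add: stage_def)
  next
    case False
    have s: "chain_word (take j C)" "\<not> nrm (C ! (j - 1) @ C ! j)" using a(1,2) False by (auto simp: stage_def)
    have "\<not> nrm (C ! (j - 1) @ C ! j @ C ! Suc j)"
      using normal_sublist[of "C ! (j - 1) @ C ! j" "C ! (j - 1) @ C ! j @ C ! Suc j"] s(2)
      by (metis append_assoc sublist_append_rightI)
    then show ?thesis unfolding stage_def using m(1,3) m(4)[of "j - 1"] m(5)[of j] m(6) s(1) False a(4)
      less_diff_conv[of j "length C" 1] by simp
  qed
  show "splittable j (merge_at j C)" unfolding splittable_def using st nc hp m(6) ne by simp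
  have "drop (Suc j) (merge_at j C) = drop (j + 2) C" using a(4) by (simp add: merge_at_def)
  moreover have "C = take j C @ [C ! j, C ! Suc j] @ drop (j + 2) C"
  proof -
    have "drop j C = [C ! j, C ! Suc j] @ drop (j + 2) C"
      using Cons_nth_drop_Suc[of j C] Cons_nth_drop_Suc[OF a(4)] a(4) by simp
    then show ?thesis using append_take_drop_id[of j C] by simp
  qed
  ultimately show "split_head j (merge_at j C) = C" unfolding split_head_def hp m(6) m(5)[OF le_refl] by simp
qed

lemma splittable_split:
  assumes "splittable j C"
  shows "mergeable j (split_head j C)" "merge_at j (split_head j C) = C"
    "concat (split_head j C) = concat C"
proof -
  have a: "stage j C" "\<not> chain_word C" "head_part j C \<noteq> C ! j" using assms by (auto simp: splittable_def)
  note hp = head_props[OF a(1,2)]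
  have jl: "j < length C" by (rule stage_length[OF a(1,2)])
  have bw: "bar_word X R C" using a(1) by (simp add: stage_def)
  define u where "u = head_part j C"
  define v where "v = drop (length u) (C ! j)"
  have uv: "C ! j = u @ v" using hp(1) unfolding u_def v_def by (metis append_take_drop_id append_eq_conv_conj prefix_def)
  have "u \<noteq> []" "v \<noteq> []" using hp(2) a(3) uv unfolding u_def by auto
  let ?S = "split_head j C"
  have S: "?S = take j C @ [u, v] @ drop (Suc j) C" by (simp add: split_head_def u_def v_def)
  have C: "C = take j C @ [u @ v] @ drop (Suc j) C" using id_take_nth_drop[OF jl] uv by simp
  have Sn: "?S ! j = u" "?S ! Suc j = v" "take j ?S = take j C" "\<And>k. k < j \<Longrightarrow> ?S ! k = C ! k"
    "length ?S = Suc (length C)"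
    using jl unfolding S by (simp_all add: nth_append)
  have "nrm (u @ v)" using bw jl uv by (metis bar_word_def nth_mem)
  then have n: "nrm u" "nrm v" "nrm (u @ v)"
    using normal_sublist[of u "u @ v"] normal_sublist[of v "u @ v"] by simp_all
  have sub: "set (take j C) \<subseteq> set C" "set (drop (Suc j) C) \<subseteq> set C" by (simp_all add: set_take_subset set_drop_subset)
  have bS: "bar_word X R ?S" unfolding S using bw n \<open>u \<noteq> []\<close> \<open>v \<noteq> []\<close> sub by (auto simp: bar_word_def)
  have hS: "head_part j ?S = u"
    using hp(4)[of ?S "[]"] Sn(1) Sn(4)[of "j - 1"] unfolding u_def by simp
  have ncS: "\<not> chain_word ?S" using chain_word_nonremovable[of ?S j] Sn jl n by auto
  have stS: "stage j ?S"
  proof (cases "j = 0")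
    case False
    have s: "chain_word (take j C)" using a False by (auto simp: stage_def)
    have "chain_word (take j C @ [u])" using hp(3) by (simp add: u_def)
    from chain_word_nonremovable[OF this, of "j - 1"] have "\<not> nrm (C ! (j - 1) @ u)" using False jl by (simp add: nth_append)
    then show ?thesis unfolding stage_def using bS s Sn False jl by simp
  qed (use bS in \<open>simp add: stage_def\<close>)
  show "mergeable j ?S" unfolding mergeable_def using stS ncS hS Sn n jl by simp
  have "drop (j + 2) ?S = drop (Suc j) C" using jl unfolding S by simp
  then show "merge_at j ?S = C" unfolding merge_at_def Sn using C by simp
  show "concat ?S = concat C" using arg_cong[OF C, of concat] unfolding S by simp
qed

lemma stage_next:
  assumes "stage j C" "\<not> splittable j C" "\<not> mergeable j C"
  shows "stage (Suc j) C"
proof (cases "chain_word C")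
  case True then show ?thesis using assms(1) by (simp add: stage_def)
next
  case False
  have jl: "j < length C" by (rule stage_length[OF assms(1) False])
  have h: "head_part j C = C ! j" using assms(1,2) False by (simp add: splittable_def)
  have ch: "chain_word (take (Suc j) C)" using head_props(3)[OF assms(1) False] h jl by (simp add: take_Suc_conv_app_nth)
  have "Suc j < length C"
  proof (rule ccontr)
    assume "\<not> ?thesis"
    then have "take (Suc j) C = C" using jl by simp
    then show False using ch False by simp
  qed
  then show ?thesis using assms(1,3) False h ch unfolding mergeable_def by (simp add: stage_def)
qed

lemma lookup_bar_d: "lookup (bar_d X R x :: _ \<Rightarrow>\<^sub>0 'k::field) E = (\<Sum>C\<in>keys x. lookup x C * lookup (bar_d_word X R C) E)"
  unfolding bar_d_lin_ext lin_ext_def by (simp add: lookup_sum)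

text \<open>
  The boundary of the split words, with the sign \<open>(-1)\<^bsup>j\<^esup>\<close> of the merge, cancels all splittable
  words. A mergeable word cannot remain then: its merge would occur in the boundary, from this word
  alone, but the boundary consists of chains.
\<close>

lemma elimination_step:
  fixes x :: "'a list list \<Rightarrow>\<^sub>0 'k::field"
  assumes x: "\<forall>C\<in>keys x. stage j C \<and> length (concat C) \<le> L" and d: "\<forall>C\<in>keys (bar_d X R x). chain_word C"
  shows "\<exists>z. bar_supported z \<and> (\<forall>C\<in>keys (x - bar_d X R z). stage (Suc j) C \<and> length (concat C) \<le> L)"
proof -
  define z where "z = lin_ext pm_scale (\<lambda>C. if splittable j C then single (split_head j C) ((-1) ^ j) else 0) x"
  have keys_z: "\<exists>C\<in>keys x. splittable j C \<and> E = split_head j C" if "E \<in> keys z" for E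
  proof -
    from subsetD[OF keys_lin_ext that[unfolded z_def]] obtain C where "C \<in> keys x"
      "E \<in> keys (if splittable j C then single (split_head j C) ((-1) ^ j) else 0 :: _ \<Rightarrow>\<^sub>0 'k)" by (elim UN_E)
    then show ?thesis by (auto split: if_splits)
  qed
  have z: "bar_supported z"
    unfolding bar_supported_def using keys_z splittable_split(1) by (auto simp: mergeable_def stage_def)
  have dsplit: "(E = C \<and> lookup (bar_d_word X R (split_head j C)) E = (-1 :: 'k) ^ j) \<or> (stage j E \<and> \<not> splittable j E \<and> concat E = concat C)"
    if C: "splittable j C" and E: "E \<in> keys (bar_d_word X R (split_head j C) :: _ \<Rightarrow>\<^sub>0 'k) \<or> E = C" for C E
  proof -
    let ?S = "split_head j C"
    note sp = splittable_split[OF C]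
    have S: "stage j ?S" "\<not> chain_word ?S" "head_part j ?S = ?S ! j" "Suc j < length ?S" "nrm (?S ! j @ ?S ! Suc j)"
      using sp(1) by (auto simp: mergeable_def)
    have bS: "bar_word X R ?S" using S(1) by (simp add: stage_def)
    have above: "stage j (merge_at i ?S) \<and> \<not> splittable j (merge_at i ?S) \<and> concat (merge_at i ?S) = concat C"
      if "i \<noteq> j" "Suc i < length ?S" "nrm (?S ! i @ ?S ! Suc i)" for i
    proof -
      have "j < i" using stage_nonremovable(1)[OF S(1) that(2,3)] that(1) by simp
      from merge_above[OF S(1-3) this that(2,3)] merge_at_props(2)[OF bS that(2,3)] sp(3) show ?thesis by simp
    qed
    show ?thesis
    proof (cases "E = C")
      case True
      have "lookup (bar_d_word X R ?S) E = (\<Sum>i<length ?S - 1. if i = j then (-1 :: 'k) ^ j else 0)"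
        unfolding bar_d_word_merge lookup_sum
      proof (intro sum.cong refl)
        fix i assume i: "i \<in> {..<length ?S - 1}"
        show "lookup (if nrm (?S ! i @ ?S ! Suc i) then single (merge_at i ?S) ((-1) ^ i) else 0) E = (if i = j then (-1 :: 'k) ^ j else 0)"
        proof (cases "i = j")
          case True then show ?thesis using S sp(2) \<open>E = C\<close> by simp
        next
          case False
          have si: "Suc i < length ?S" using i by (simp add: less_diff_conv)
          have "merge_at i ?S \<noteq> C" if "nrm (?S ! i @ ?S ! Suc i)" using above[OF False si that] C by metis
          then show ?thesis using False \<open>E = C\<close> by (auto simp: lookup_single when_def)
        qed
      qed
      also have "\<dots> = (-1) ^ j" using S(4) by simp
      finally show ?thesis using True by simp
    next
      case False
      then have "E \<in> keys (bar_d_word X R ?S :: _ \<Rightarrow>\<^sub>0 'k)" using E by simp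
      then obtain i where i: "Suc i < length ?S" "nrm (?S ! i @ ?S ! Suc i)" "E = merge_at i ?S" by (rule keys_bar_d_word)
      have "i \<noteq> j" using i(3) sp(2) False by auto
      from above[OF this i(1,2)] show ?thesis using i(3) by simp
    qed
  qed
  have dz: "lookup (bar_d X R z) E = (\<Sum>C\<in>keys x. lookup x C * (if splittable j C then (-1) ^ j * lookup (bar_d_word X R (split_head j C)) E else 0))" for E
  proof -
    have "bar_d X R z = (\<Sum>C\<in>keys x. pm_scale (lookup x C) (if splittable j C then pm_scale ((-1) ^ j) (bar_d_word X R (split_head j C)) else 0))"
      unfolding z_def lin_ext_def bar_d.sum bar_d.scale
    proof (intro sum.cong refl arg_cong[where f = "pm_scale _"])
      fix C
      have "single (split_head j C) ((-1 :: 'k) ^ j) = pm_scale ((-1) ^ j) (single (split_head j C) 1)" by simp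
      then show "bar_d X R (if splittable j C then single (split_head j C) ((-1 :: 'k) ^ j) else 0) =
          (if splittable j C then pm_scale ((-1) ^ j) (bar_d_word X R (split_head j C)) else 0)"
        by (simp only: bar_d.scale bar_d_single bar_d.zero if_distrib[where f = "bar_d X R"])
    qed
    then show ?thesis by (simp add: lookup_sum if_distrib[where f = "\<lambda>y. lookup y E"] cong: if_cong)
  qed
  define y where "y = x - bar_d X R z"
  have dy: "bar_d X R y = bar_d X R x" unfolding y_def bar_d.diff using bar_d_square[OF z] by simp
  have y: "stage j E \<and> \<not> splittable j E \<and> length (concat E) \<le> L" if E: "E \<in> keys y" for E
  proof -
    have nz: "lookup x E - lookup (bar_d X R z) E \<noteq> 0" using E by (simp add: in_keys_iff y_def lookup_minus)
    have ns: "\<not> splittable j E"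
    proof
      assume s: "splittable j E"
      have "lookup (bar_d X R z) E = (\<Sum>C\<in>keys x. if C = E then lookup x E else 0)"
        unfolding dz
      proof (intro sum.cong refl)
        fix C
        show "lookup x C * (if splittable j C then (-1) ^ j * lookup (bar_d_word X R (split_head j C)) E else 0) = (if C = E then lookup x E else 0)"
        proof (cases "C = E")
          case True
          have "lookup (bar_d_word X R (split_head j E)) E = (-1 :: 'k) ^ j" using dsplit[OF s, of E] s by auto
          then show ?thesis using True s by (simp add: power_mult_distrib[symmetric] del: minus_one_mult_self)
        next
          case False
          have "lookup (bar_d_word X R (split_head j C)) E = (0 :: 'k)" if "splittable j C"
            using dsplit[OF that, of E] s False by (auto simp: in_keys_iff)
          then show ?thesis using False by simp
        qed
      qed
      also have "\<dots> = lookup x E" by (simp add: in_keys_iff)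
      finally show False using nz by simp
    qed
    show ?thesis
    proof (cases "lookup x E = 0")
      case False
      then show ?thesis using x ns by (simp add: in_keys_iff)
    next
      case True
      then have "lookup (bar_d X R z) E \<noteq> 0" using nz by simp
      then obtain C where C: "C \<in> keys x" "splittable j C" "lookup (bar_d_word X R (split_head j C)) E \<noteq> (0 :: 'k)"
        unfolding dz by (elim sum.not_neutral_contains_not_neutral) (auto split: if_splits)
      then show ?thesis using dsplit[OF C(2), of E] x ns by (auto simp: in_keys_iff)
    qed
  qed
  have nm: "\<not> mergeable j C" if C: "C \<in> keys y" for C
  proof
    assume m: "mergeable j C"
    define E where "E = merge_at j C"
    have sE: "splittable j E" "split_head j E = C" using mergeable_merge[OF m] by (simp_all add: E_def)
    have only: "C' = C" if C': "C' \<in> keys y" "E \<in> keys (bar_d_word X R C' :: _ \<Rightarrow>\<^sub>0 'k)" for C'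
    proof -
      obtain i where i: "Suc i < length C'" "nrm (C' ! i @ C' ! Suc i)" "E = merge_at i C'" using C'(2) by (rule keys_bar_d_word)
      have st: "stage j C'" "\<not> splittable j C'" using y[OF C'(1)] by auto
      have nc: "j \<le> i" "\<not> chain_word C'" using stage_nonremovable[OF st(1) i(1,2)] by auto
      have h: "head_part j C' = C' ! j" using st nc by (simp add: splittable_def)
      have "i = j"
      proof (rule ccontr)
        assume "i \<noteq> j"
        then have "\<not> splittable j (merge_at i C')" using merge_above(2)[OF st(1) nc(2) h _ i(1,2)] nc(1) by simp
        then show False using sE(1) i(3) by simp
      qed
      then have "mergeable j C'" unfolding mergeable_def using st nc h i by simp
      from mergeable_merge(2)[OF this] show ?thesis using i(3) \<open>i = j\<close> sE(2) by simp
    qed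
    have "lookup (bar_d X R y) E = (\<Sum>C'\<in>keys y. if C' = C then lookup y C * lookup (bar_d_word X R C) E else 0)"
      unfolding lookup_bar_d
    proof (intro sum.cong refl)
      fix C' assume "C' \<in> keys y"
      then show "lookup y C' * lookup (bar_d_word X R C') E = (if C' = C then lookup y C * lookup (bar_d_word X R C) E else 0)"
        using only[of C'] by (auto simp: in_keys_iff)
    qed
    also have "\<dots> = lookup y C * lookup (bar_d_word X R C) E" using C by simp
    also have "lookup (bar_d_word X R C) E = (-1 :: 'k) ^ j" using dsplit[OF sE(1), of E] sE by auto
    finally have "lookup (bar_d X R x) E \<noteq> 0" using C unfolding dy by (simp add: in_keys_iff)
    then have "chain_word E" using d by (simp add: in_keys_iff)
    then show False using sE(1) by (simp add: splittable_def)
  qed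
  show ?thesis using z y nm stage_next unfolding y_def by blast
qed

text \<open>
  A bar word is at most as long as its weight, so beyond that stage only chains are left.
\<close>

theorem bar_homology:
  fixes x :: "'a list list \<Rightarrow>\<^sub>0 'k::field"
  assumes "bar_supported x" "\<forall>C\<in>keys (bar_d X R x). chain_word C"
  shows "\<exists>z. bar_supported z \<and> (\<forall>C\<in>keys (x - bar_d X R z). chain_word C)"
proof -
  define L where "L = Max (insert 0 ((\<lambda>C. length (concat C)) ` keys x))"
  have L: "length (concat C) \<le> L" if "C \<in> keys x" for C unfolding L_def using that by (intro Max_ge) auto
  have "\<exists>z. bar_supported z \<and> (\<forall>C\<in>keys (x - bar_d X R z). stage j C \<and> length (concat C) \<le> L)" for j
  proof (induction j)
    case 0
    show ?case using assms(1) L by (intro exI[of _ 0]) (auto simp: bar_supported_def stage_def bar_d.zero)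
  next
    case (Suc j)
    then obtain z where z: "bar_supported z" "\<forall>C\<in>keys (x - bar_d X R z). stage j C \<and> length (concat C) \<le> L" by blast
    have "bar_d X R (x - bar_d X R z) = bar_d X R x" unfolding bar_d.diff using bar_d_square[OF z(1)] by simp
    then obtain z' where z': "bar_supported z'" "\<forall>C\<in>keys (x - bar_d X R z - bar_d X R z'). stage (Suc j) C \<and> length (concat C) \<le> L"
      using elimination_step[OF z(2)] assms(2) by metis
    have "bar_supported (z + z')" using z(1) z'(1) Poly_Mapping.keys_add[of z z'] unfolding bar_supported_def by blast
    moreover have "x - bar_d X R (z + z') = x - bar_d X R z - bar_d X R z'" by (simp add: bar_d.add)
    ultimately show ?case using z'(2) by metis
  qed
  from this[of "Suc L"] obtain z where z: "bar_supported z" "\<forall>C\<in>keys (x - bar_d X R z). stage (Suc L) C \<and> length (concat C) \<le> L" by blast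
  have "chain_word C" if C: "C \<in> keys (x - bar_d X R z)" for C
  proof (rule ccontr)
    assume "\<not> chain_word C"
    then have "Suc L < length C" using z(2) C stage_length by blast
    moreover have "bar_word X R C" using z(2) C by (simp add: stage_def)
    then have "length C \<le> length (concat C)" by (intro length_le_concat) (auto simp: bar_word_def)
    ultimately show False using z(2) C by fastforce
  qed
  then show ?thesis using z(1) by blast
qed

lemma bar_d_chains: "\<forall>C\<in>keys x. chain_word C \<Longrightarrow> bar_d X R x = (0 :: _ \<Rightarrow>\<^sub>0 'k::field)"
  unfolding bar_d_lin_ext lin_ext_def by (intro sum.neutral) (simp add: bar_d_chain_word)

text \<open>
  Modulo boundaries the chain \<open>z\<close> consists of chains, and these are cycles.
\<close>

lemma chain_boundary_zero:
  fixes c :: "'a list list \<Rightarrow>\<^sub>0 'k::field"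
  assumes "\<forall>C\<in>keys c. chain_word C" "bar_supported z" "c = bar_d X R z"
  shows "c = 0"
proof -
  obtain z' where z': "bar_supported z'" "\<forall>C\<in>keys (z - bar_d X R z'). chain_word C"
    using bar_homology[OF assms(2)] assms(1,3) by blast
  have "bar_d X R (z - bar_d X R z') = 0" using z'(2) by (rule bar_d_chains)
  then show ?thesis unfolding bar_d.diff bar_d_square[OF z'(1)] assms(3) by simp
qed

end

section \<open>Graded spaces of functionals\<close>

lemma vector_space_fun_scale: "vector_space (fun_scale :: 'k::field \<Rightarrow> ('z \<Rightarrow> 'k) \<Rightarrow> _)"
proof (rule vector_space.intro)
  fix a b :: 'k and x y :: "'z \<Rightarrow> 'k"
  show "fun_scale a (x + y) = fun_scale a x + fun_scale a y"
    by (rule ext) (simp add: fun_scale_def distrib_left)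
  show "fun_scale (a + b) x = fun_scale a x + fun_scale b x"
    by (rule ext) (simp add: fun_scale_def distrib_right)
  show "fun_scale a (fun_scale b x) = fun_scale (a * b) x"
    by (rule ext) (simp add: fun_scale_def)
  show "fun_scale 1 x = x"
    by (rule ext) (simp add: fun_scale_def)
qed

interpretation fs: vector_space "fun_scale :: 'k::field \<Rightarrow> ('z \<Rightarrow> 'k) \<Rightarrow> _"
  by (rule vector_space_fun_scale)

lemma ev_tensor_update_add:
  "i < length \<phi>s \<Longrightarrow> ev_tensor (\<phi>s[i := (\<lambda>c. \<phi> c + \<psi> c)]) cs = ev_tensor (\<phi>s[i := \<phi>]) cs + ev_tensor (\<phi>s[i := \<psi>]) cs"
proof (induction \<phi>s arbitrary: i cs)
  case (Cons a \<phi>s)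
  show ?case
  proof (cases cs)
    case Nil then show ?thesis by (cases i) simp_all
  next
    case (Cons c cs')
    then show ?thesis using Cons.IH Cons.prems by (cases i) (simp_all add: distrib_left distrib_right)
  qed
qed simp

lemma ev_tensor_update_scale:
  "i < length \<phi>s \<Longrightarrow> ev_tensor (\<phi>s[i := (\<lambda>c. a * \<phi> c)]) cs = a * ev_tensor (\<phi>s[i := \<phi>]) cs"
proof (induction \<phi>s arbitrary: i cs)
  case (Cons b \<phi>s)
  show ?case
  proof (cases cs)
    case Nil then show ?thesis by (cases i) simp_all
  next
    case (Cons c cs')
    then show ?thesis using Cons.IH Cons.prems by (cases i) (simp_all add: mult.left_commute mult.assoc del: field_vs.scale_scale)
  qed
qed simp

lemma dual_op_update_add:
  "i < length \<phi>s \<Longrightarrow> dual_op s \<kappa> (\<phi>s[i := (\<lambda>c. \<phi> c + \<psi> c)]) w = dual_op s \<kappa> (\<phi>s[i := \<phi>]) w + dual_op s \<kappa> (\<phi>s[i := \<psi>]) w"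
  unfolding dual_op_def lin_ext_def by (simp add: ev_tensor_update_add distrib_left sum.distrib)

lemma dual_op_update_scale:
  "i < length \<phi>s \<Longrightarrow> dual_op s \<kappa> (\<phi>s[i := (\<lambda>c. a * \<phi> c)]) w = a * dual_op s \<kappa> (\<phi>s[i := \<phi>]) w"
  unfolding dual_op_def lin_ext_def sum_distrib_left by (simp add: ev_tensor_update_scale mult.left_commute del: field_vs.scale_scale)

text \<open>
  Functionals are indexed by arbitrary functions on a basis \<open>S\<close> of the homology, through \<open>fnl\<close>, and
  read off by \<open>ev\<close>; \<open>s\<close> is the degree of a generator of the free algebra and \<open>wt\<close> the weight. The
  graded dual consists of the functionals of bounded weight. As the degree is bounded by the weight,
  these have finitely many homogeneous components.
\<close>

locale functional_space =
  fixes fnl :: "('i \<Rightarrow> 'k::field) \<Rightarrow> ('z \<Rightarrow> 'k)" and ev :: "('z \<Rightarrow> 'k) \<Rightarrow> 'i \<Rightarrow> 'k"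
    and S :: "'i set" and s wt :: "'i \<Rightarrow> nat"
  assumes fnl_add: "fnl (\<lambda>w. G w + H w) = fnl G + fnl H"
    and fnl_scale: "fnl (\<lambda>w. c * G w) = fun_scale c (fnl G)"
    and fnl_cong: "(\<And>w. w \<in> S \<Longrightarrow> G w = H w) \<Longrightarrow> fnl G = fnl H"
    and ev_fnl: "w \<in> S \<Longrightarrow> ev (fnl G) w = G w"
    and ev_outside: "w \<notin> S \<Longrightarrow> ev \<phi> w = 0"
    and wt_bound: "w \<in> S \<Longrightarrow> s w < wt w"
begin

definition V :: "int \<Rightarrow> ('z \<Rightarrow> 'k) set" where
  "V p = {fnl G | G. \<exists>L. \<forall>w\<in>S. G w \<noteq> 0 \<longrightarrow> int (s w) + 1 = p \<and> wt w \<le> L}"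

definition Tot :: "('z \<Rightarrow> 'k) set" where
  "Tot = {fnl G | G. \<exists>L. \<forall>w\<in>S. G w \<noteq> 0 \<longrightarrow> wt w \<le> L}"

lemma fnl_zero: "fnl (\<lambda>w. 0) = 0"
  using fnl_scale[of 0 "\<lambda>w. 0"] by (simp add: fun_scale_def zero_fun_def)

lemma fnl_sum: "finite I \<Longrightarrow> fnl (\<lambda>w. \<Sum>i\<in>I. G i w) = (\<Sum>i\<in>I. fnl (G i))"
  by (induction I rule: finite_induct) (simp_all add: fnl_zero fnl_add)

lemma V_subset_Tot: "V p \<subseteq> Tot"
  unfolding V_def Tot_def by blast

lemma fnl_ev: "\<phi> \<in> Tot \<Longrightarrow> fnl (ev \<phi>) = \<phi>"
  unfolding Tot_def using ev_fnl by (auto intro!: fnl_cong)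

lemma Tot_bound: "\<phi> \<in> Tot \<Longrightarrow> \<exists>L. \<forall>w. ev \<phi> w \<noteq> 0 \<longrightarrow> wt w \<le> L"
proof -
  assume "\<phi> \<in> Tot"
  then obtain G L where G: "\<phi> = fnl G" "\<forall>w\<in>S. G w \<noteq> 0 \<longrightarrow> wt w \<le> L" unfolding Tot_def by blast
  have "ev \<phi> w \<noteq> 0 \<longrightarrow> wt w \<le> L" for w
    using G ev_fnl[of w G] ev_outside[of w \<phi>] by (cases "w \<in> S") auto
  then show ?thesis by blast
qed

lemma V_homog: "\<phi> \<in> V p \<Longrightarrow> homog s p (ev \<phi>)"
proof -
  assume "\<phi> \<in> V p"
  then obtain G L where G: "\<phi> = fnl G" "\<forall>w\<in>S. G w \<noteq> 0 \<longrightarrow> int (s w) + 1 = p \<and> wt w \<le> L" unfolding V_def by blast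
  have "ev \<phi> w \<noteq> 0 \<longrightarrow> int (s w) + 1 = p" for w
    using G ev_fnl[of w G] ev_outside[of w \<phi>] by (cases "w \<in> S") auto
  then show ?thesis unfolding homog_def by blast
qed

lemma V_I: "(\<And>w. w \<in> S \<Longrightarrow> G w \<noteq> 0 \<Longrightarrow> int (s w) + 1 = p \<and> wt w \<le> L) \<Longrightarrow> fnl G \<in> V p"
  unfolding V_def by blast

lemma subspace_V: "fs.subspace (V p)"
proof (rule fs.subspaceI)
  show "0 \<in> V p" unfolding fnl_zero[symmetric] by (rule V_I) simp
  fix x y assume "x \<in> V p" "y \<in> V p"
  then obtain G H L M where G: "x = fnl G" "\<forall>w\<in>S. G w \<noteq> 0 \<longrightarrow> int (s w) + 1 = p \<and> wt w \<le> L"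
    and H: "y = fnl H" "\<forall>w\<in>S. H w \<noteq> 0 \<longrightarrow> int (s w) + 1 = p \<and> wt w \<le> M" unfolding V_def by blast
  show "x + y \<in> V p" unfolding G(1) H(1) fnl_add[symmetric]
  proof (rule V_I)
    fix w assume w: "w \<in> S" "G w + H w \<noteq> 0"
    then have "G w \<noteq> 0 \<or> H w \<noteq> 0" by auto
    then show "int (s w) + 1 = p \<and> wt w \<le> max L M" using G(2) H(2) w(1) by auto
  qed
next
  fix c x assume "x \<in> V p"
  then obtain G L where G: "x = fnl G" "\<forall>w\<in>S. G w \<noteq> 0 \<longrightarrow> int (s w) + 1 = p \<and> wt w \<le> L" unfolding V_def by blast
  show "fun_scale c x \<in> V p" unfolding G(1) fnl_scale[symmetric] by (rule V_I) (use G(2) in auto)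
qed

lemma subspace_Tot: "fs.subspace Tot"
proof (rule fs.subspaceI)
  show "0 \<in> Tot" unfolding fnl_zero[symmetric] Tot_def by (intro CollectI exI[of _ "\<lambda>w. 0"]) simp
  fix x y assume "x \<in> Tot" "y \<in> Tot"
  then obtain G H L M where G: "x = fnl G" "\<forall>w\<in>S. G w \<noteq> 0 \<longrightarrow> wt w \<le> L"
    and H: "y = fnl H" "\<forall>w\<in>S. H w \<noteq> 0 \<longrightarrow> wt w \<le> M" unfolding Tot_def by blast
  have "\<forall>w\<in>S. G w + H w \<noteq> 0 \<longrightarrow> wt w \<le> max L M"
  proof (intro ballI impI)
    fix w assume w: "w \<in> S" "G w + H w \<noteq> 0"
    then have "G w \<noteq> 0 \<or> H w \<noteq> 0" by auto
    then show "wt w \<le> max L M" using G(2) H(2) w(1) by auto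
  qed
  then show "x + y \<in> Tot" unfolding G(1) H(1) fnl_add[symmetric] Tot_def by blast
next
  fix c x assume "x \<in> Tot"
  then obtain G L where G: "x = fnl G" "\<forall>w\<in>S. G w \<noteq> 0 \<longrightarrow> wt w \<le> L" unfolding Tot_def by blast
  have "\<forall>w\<in>S. c * G w \<noteq> 0 \<longrightarrow> wt w \<le> L" using G(2) by auto
  then show "fun_scale c x \<in> Tot" unfolding G(1) fnl_scale[symmetric] Tot_def by blast
qed

lemma total_space_V: "total_space fun_scale V = Tot"
proof
  show "total_space fun_scale V \<subseteq> Tot" unfolding total_space_def
    using V_subset_Tot by (intro fs.span_minimal subspace_Tot) blast
  show "Tot \<subseteq> total_space fun_scale V"
  proof
    fix \<phi> assume "\<phi> \<in> Tot"
    then obtain G L where G: "\<phi> = fnl G" "\<forall>w\<in>S. G w \<noteq> 0 \<longrightarrow> wt w \<le> L" unfolding Tot_def by blast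
    have "fnl G = fnl (\<lambda>w. \<Sum>n<L. if s w = n then G w else 0)"
    proof (rule fnl_cong)
      fix w assume w: "w \<in> S"
      show "G w = (\<Sum>n<L. if s w = n then G w else 0)"
        using G(2) w wt_bound[OF w] by (cases "G w = 0") auto
    qed
    also have "\<dots> = (\<Sum>n<L. fnl (\<lambda>w. if s w = n then G w else 0))" by (rule fnl_sum) simp
    also have "\<dots> \<in> total_space fun_scale V" unfolding total_space_def
    proof (rule fs.span_sum)
      fix n
      have "fnl (\<lambda>w. if s w = n then G w else 0) \<in> V (int n + 1)" by (rule V_I[of _ _ L]) (use G(2) in \<open>auto split: if_splits\<close>)
      then show "fnl (\<lambda>w. if s w = n then G w else 0) \<in> fs.span (\<Union>i. V i)" by (intro fs.span_base) blast
    qed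
    finally show "\<phi> \<in> total_space fun_scale V" unfolding G(1) .
  qed
qed

lemma ev_add: "\<phi> \<in> Tot \<Longrightarrow> \<psi> \<in> Tot \<Longrightarrow> ev (\<phi> + \<psi>) = (\<lambda>w. ev \<phi> w + ev \<psi> w)"
proof -
  assume "\<phi> \<in> Tot" "\<psi> \<in> Tot"
  then have e: "\<phi> + \<psi> = fnl (\<lambda>w. ev \<phi> w + ev \<psi> w)" by (simp add: fnl_add fnl_ev)
  show ?thesis
  proof
    fix w show "ev (\<phi> + \<psi>) w = ev \<phi> w + ev \<psi> w"
      using ev_fnl[of w "\<lambda>w. ev \<phi> w + ev \<psi> w"] ev_outside[of w] unfolding e by (cases "w \<in> S") simp_all
  qed
qed

lemma ev_scale: "\<phi> \<in> Tot \<Longrightarrow> ev (fun_scale c \<phi>) = (\<lambda>w. c * ev \<phi> w)"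
proof -
  assume "\<phi> \<in> Tot"
  then have e: "fun_scale c \<phi> = fnl (\<lambda>w. c * ev \<phi> w)" by (simp add: fnl_scale fnl_ev)
  show ?thesis
  proof
    fix w show "ev (fun_scale c \<phi>) w = c * ev \<phi> w"
      using ev_fnl[of w "\<lambda>w. c * ev \<phi> w"] ev_outside[of w] unfolding e by (cases "w \<in> S") simp_all
  qed
qed

lemma graded: "graded_space fun_scale V"
  unfolding graded_space_def
proof (intro conjI allI impI)
  show "vector_space (fun_scale :: 'k \<Rightarrow> ('z \<Rightarrow> 'k) \<Rightarrow> _)" by (rule vector_space_fun_scale)
  show "fs.subspace (V i)" for i by (rule subspace_V)
  fix I and v :: "int \<Rightarrow> 'z \<Rightarrow> 'k"
  assume A: "finite I \<and> (\<forall>i\<in>I. v i \<in> V i) \<and> (\<Sum>i\<in>I. v i) = 0"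
  have T: "v i \<in> Tot" if "i \<in> I" for i using A that V_subset_Tot by blast
  have "(\<Sum>i\<in>I. v i) = (\<Sum>i\<in>I. fnl (ev (v i)))" by (intro sum.cong refl) (simp add: fnl_ev T)
  also have "\<dots> = fnl (\<lambda>w. \<Sum>i\<in>I. ev (v i) w)" using A by (intro fnl_sum[symmetric]) simp
  finally have z: "fnl (\<lambda>w. \<Sum>i\<in>I. ev (v i) w) = fnl (\<lambda>w. 0)" using A by (simp add: fnl_zero)
  show "\<forall>i\<in>I. v i = 0"
  proof
    fix i assume i: "i \<in> I"
    have "ev (v i) w = 0" if w: "w \<in> S" for w
    proof (cases "int (s w) + 1 = i")
      case False then show ?thesis using V_homog[of "v i" i] A i unfolding homog_def by blast
    next
      case True
      have "(\<Sum>i\<in>I. ev (v i) w) = 0" using ev_fnl[OF w, of "\<lambda>w. \<Sum>i\<in>I. ev (v i) w"] ev_fnl[OF w, of "\<lambda>w. 0"] z by simp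
      moreover have "(\<Sum>j\<in>I. ev (v j) w) = (\<Sum>j\<in>I. if j = i then ev (v i) w else 0)"
      proof (intro sum.cong refl)
        fix j assume "j \<in> I"
        then show "ev (v j) w = (if j = i then ev (v i) w else 0)"
          using V_homog[of "v j" j] A True unfolding homog_def by auto
      qed
      ultimately show ?thesis using A i by simp
    qed
    then have "fnl (ev (v i)) = fnl (\<lambda>w. 0)" by (rule fnl_cong)
    then show "v i = 0" using fnl_ev[OF T[OF i]] fnl_zero by simp
  qed
qed

lemma homogeneous_homog: "homogeneous V ps vs \<Longrightarrow> list_all2 (homog s) ps (map ev vs)"
  unfolding homogeneous_def by (induction ps vs rule: list_all2_induct) (auto intro: V_homog)

lemma homogeneous_Tot: "homogeneous V ps vs \<Longrightarrow> set vs \<subseteq> Tot"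
  unfolding homogeneous_def by (induction ps vs rule: list_all2_induct) (use V_subset_Tot in auto)

lemma Tot_list_bound: "set vs \<subseteq> Tot \<Longrightarrow> \<exists>L. \<forall>v\<in>set vs. \<forall>w. ev v w \<noteq> 0 \<longrightarrow> wt w \<le> L"
proof (induction vs)
  case (Cons v vs)
  then obtain L where L: "\<forall>v\<in>set vs. \<forall>w. ev v w \<noteq> 0 \<longrightarrow> wt w \<le> L" by auto
  obtain M where "\<forall>w. ev v w \<noteq> 0 \<longrightarrow> wt w \<le> M" using Tot_bound[of v] Cons.prems by auto
  then have "\<forall>u\<in>set (v # vs). \<forall>w. ev u w \<noteq> 0 \<longrightarrow> wt w \<le> max L M" using L by (auto simp: le_max_iff_disj)
  then show ?case by blast
qed simp

end

text \<open>
  A map \<open>\<kappa>\<close> from basis elements to the free algebra, homogeneous in degree and weight: a derivation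
  for \<open>e = 1\<close>, a homomorphism for \<open>e = 0\<close>. Homogeneity in the weight keeps the dual operation within
  functionals of bounded weight.
\<close>

locale functional_kernel =
  src: functional_space fnl1 ev1 S1 s1 wt1 + tgt: functional_space fnl2 ev2 S2 s2 wt2
  for fnl1 :: "('i \<Rightarrow> 'k::field) \<Rightarrow> ('y \<Rightarrow> 'k)" and ev1 S1 s1 wt1
    and fnl2 :: "('j \<Rightarrow> 'k) \<Rightarrow> ('z \<Rightarrow> 'k)" and ev2 S2 s2 wt2 +
  fixes \<kappa> :: "'j \<Rightarrow> 'i free_monoid \<Rightarrow>\<^sub>0 'k" and e :: nat
  assumes kernel_outside: "w \<notin> S2 \<Longrightarrow> \<kappa> w = 0"
    and kernel_nonempty: "Word [] \<notin> keys (\<kappa> w)"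
    and kernel_degree: "Word cs \<in> keys (\<kappa> w) \<Longrightarrow> sum_list (map s1 cs) + e = s2 w"
    and kernel_weight: "Word cs \<in> keys (\<kappa> w) \<Longrightarrow> sum_list (map wt1 cs) = wt2 w"
begin

definition op :: "('y \<Rightarrow> 'k) list \<Rightarrow> 'z \<Rightarrow> 'k" where
  "op vs = fnl2 (dual_op s1 \<kappa> (map ev1 vs))"

lemma ev_op: "ev2 (op vs) = dual_op s1 \<kappa> (map ev1 vs)"
proof
  fix w show "ev2 (op vs) w = dual_op s1 \<kappa> (map ev1 vs) w"
  proof (cases "w \<in> S2")
    case True then show ?thesis unfolding op_def by (rule tgt.ev_fnl)
  next
    case False
    then show ?thesis using tgt.ev_outside[OF False] kernel_outside[OF False] by (simp add: dual_op_def lin_ext_def)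
  qed
qed

lemma dual_op_weight:
  assumes "set vs \<subseteq> src.Tot"
  shows "\<exists>L. \<forall>w. dual_op s1 \<kappa> (map ev1 vs) w \<noteq> 0 \<longrightarrow> wt2 w \<le> L"
proof -
  obtain L where L: "\<forall>v\<in>set vs. \<forall>w. ev1 v w \<noteq> 0 \<longrightarrow> wt1 w \<le> L" using src.Tot_list_bound[OF assms] by blast
  have le: "sum_list (map wt1 cs) \<le> length cs * L" if "ev_tensor (map ev1 us) cs \<noteq> 0" "set us \<subseteq> set vs" for us cs
    using that
  proof (induction us arbitrary: cs)
    case Nil then show ?case by (cases cs) auto
  next
    case (Cons u us)
    then obtain c cs' where cs: "cs = c # cs'" by (cases cs) auto
    then have "ev1 u c \<noteq> 0" "sum_list (map wt1 cs') \<le> length cs' * L" using Cons by auto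
    moreover have "wt1 c \<le> L" using L Cons.prems(2) \<open>ev1 u c \<noteq> 0\<close> by auto
    ultimately show ?case using cs by simp
  qed
  have "wt2 w \<le> length vs * L" if nz: "dual_op s1 \<kappa> (map ev1 vs) w \<noteq> 0" for w
  proof -
    have "\<exists>v\<in>keys (\<kappa> w). ev_tensor (map ev1 vs) (letters v) \<noteq> 0"
    proof (rule ccontr)
      assume "\<not> ?thesis"
      then have "dual_op s1 \<kappa> (map ev1 vs) w = 0" unfolding dual_op_def lin_ext_def by (intro sum.neutral) auto
      with nz show False by simp
    qed
    then obtain v where v: "v \<in> keys (\<kappa> w)" "ev_tensor (map ev1 vs) (letters v) \<noteq> 0" by blast
    have "length (letters v) = length vs" using v(2) ev_tensor_length[of "map ev1 vs" "letters v"] by (cases "length vs = length (letters v)") auto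
    then show ?thesis using le[OF v(2) order_refl] kernel_weight[of "letters v" w] v(1) by simp
  qed
  then show ?thesis by blast
qed

lemma op_Tot: "set vs \<subseteq> src.Tot \<Longrightarrow> op vs \<in> tgt.Tot"
  unfolding op_def tgt.Tot_def using dual_op_weight by blast

lemma op_V:
  assumes "homogeneous src.V ps vs"
  shows "op vs \<in> tgt.V (sum_list ps + (int e + 1 - int (length vs)))"
proof -
  obtain L where L: "\<forall>w. dual_op s1 \<kappa> (map ev1 vs) w \<noteq> 0 \<longrightarrow> wt2 w \<le> L"
    using dual_op_weight[OF src.homogeneous_Tot[OF assms]] by blast
  show ?thesis unfolding op_def
  proof (rule tgt.V_I)
    fix w assume w: "w \<in> S2" "dual_op s1 \<kappa> (map ev1 vs) w \<noteq> 0"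
    have "int (s2 w) + 1 = sum_list ps + (int e + 1 - int (length (map ev1 vs)))"
      by (rule homog_dual_op[OF src.homogeneous_homog[OF assms] kernel_degree w(2)])
    then show "int (s2 w) + 1 = sum_list ps + (int e + 1 - int (length vs)) \<and> wt2 w \<le> L" using L w by simp
  qed
qed

lemma op_multilinear:
  assumes f: "\<And>vs. length vs = n \<Longrightarrow> set vs \<subseteq> src.Tot \<Longrightarrow> f vs = op vs" and d: "d = int e + 1 - int n"
  shows "graded_multilinear fun_scale src.V fun_scale tgt.V n d f"
  unfolding graded_multilinear_def
proof (intro conjI allI impI)
  fix ps vs assume A: "length vs = n \<and> homogeneous src.V ps vs"
  then show "f vs \<in> tgt.V (sum_list ps + d)"
    using op_V[of ps vs] f[of vs] src.homogeneous_Tot[of ps vs] d by simp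
next
  fix vs i assume A: "length vs = n \<and> set vs \<subseteq> total_space fun_scale src.V \<and> i < n"
  then have vs: "length vs = n" "set vs \<subseteq> src.Tot" "i < n" unfolding src.total_space_V by auto
  have up: "f (vs[i := v]) = op (vs[i := v])" if "v \<in> src.Tot" for v
    using vs that by (intro f) (auto dest!: subsetD[OF set_update_subset_insert])
  have i: "i < length (map ev1 vs)" using vs by simp
  show "linear_on fun_scale fun_scale (total_space fun_scale src.V) (\<lambda>v. f (vs[i := v]))"
    unfolding linear_on_def src.total_space_V
  proof (intro conjI ballI allI)
    fix x y assume xy: "x \<in> src.Tot" "y \<in> src.Tot"
    have "x + y \<in> src.Tot" using xy src.subspace_Tot fs.subspace_add by blast
    moreover have "op (vs[i := x + y]) = op (vs[i := x]) + op (vs[i := y])"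
      unfolding op_def map_update src.ev_add[OF xy] tgt.fnl_add[symmetric] dual_op_update_add[OF i] ..
    ultimately show "f (vs[i := x + y]) = f (vs[i := x]) + f (vs[i := y])" using up xy by simp
  next
    fix c x assume x: "x \<in> src.Tot"
    have "fun_scale c x \<in> src.Tot" using x src.subspace_Tot fs.subspace_scale by blast
    moreover have "op (vs[i := fun_scale c x]) = fun_scale c (op (vs[i := x]))"
      unfolding op_def map_update src.ev_scale[OF x] tgt.fnl_scale[symmetric] dual_op_update_scale[OF i] ..
    ultimately show "f (vs[i := fun_scale c x]) = fun_scale c (f (vs[i := x]))" using up x by simp
  qed
qed

end

lemma stasheff_sum_functional:
  fixes fnl1 :: "('i \<Rightarrow> 'k::field) \<Rightarrow> ('y \<Rightarrow> 'k)" and fnl2 :: "('j \<Rightarrow> 'k) \<Rightarrow> ('z \<Rightarrow> 'k)"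
  assumes K: "functional_kernel fnl1 ev1 S1 s1 wt1 fnl2 ev2 S2 s2 wt2 \<kappa> e"
    and M: "functional_kernel fnl1 ev1 S1 s1 wt1 fnl1 ev1 S1 s1 wt1 \<delta> 1"
    and f: "\<And>vs. vs \<noteq> [] \<Longrightarrow> set vs \<subseteq> functional_space.Tot fnl1 S1 wt1 \<Longrightarrow>
          f (length vs) vs = functional_kernel.op ev1 s1 fnl2 \<kappa> vs"
    and m: "\<And>vs. vs \<noteq> [] \<Longrightarrow> set vs \<subseteq> functional_space.Tot fnl1 S1 wt1 \<Longrightarrow>
          m (length vs) vs = functional_kernel.op ev1 s1 fnl1 \<delta> vs"
    and vs: "homogeneous (functional_space.V fnl1 S1 s1 wt1) ps vs"
  shows "stasheff_sum fun_scale f m ps vs =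
    fnl2 (\<lambda>w. sg (koszul_weight ps) * tensor_pair (map ev1 vs) (derivation s1 \<delta> (\<kappa> w)))"
proof -
  interpret K: functional_kernel fnl1 ev1 S1 s1 wt1 fnl2 ev2 S2 s2 wt2 \<kappa> e by fact
  interpret M: functional_kernel fnl1 ev1 S1 s1 wt1 fnl1 ev1 S1 s1 wt1 \<delta> 1 by fact
  let ?n = "length vs"
  have T: "set vs \<subseteq> K.src.Tot" by (rule K.src.homogeneous_Tot[OF vs])
  define c where "c k r = ((-1) ^ (r + k * (?n - k - r)) * (-1) powi ((2 - int k) * sum_list (take r ps)) :: 'k)" for k r
  define g where "g k r = dual_op s1 \<kappa> (take r (map ev1 vs) @ [dual_op s1 \<delta> (take k (drop r (map ev1 vs)))] @ drop (r + k) (map ev1 vs))" for k r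
  have summand: "f (r + 1 + (?n - k - r)) (take r vs @ [m k (take k (drop r vs))] @ drop (r + k) vs) = fnl2 (g k r)"
    if kr: "k \<in> {1..?n}" "r \<in> {0..?n - k}" for k r
  proof -
    let ?b = "take k (drop r vs)" and ?vs = "take r vs @ [m k (take k (drop r vs))] @ drop (r + k) vs"
    have lb: "length ?b = k" using kr by auto
    then have bne: "?b \<noteq> []" using kr by auto
    have bT: "set ?b \<subseteq> K.src.Tot" using T by (meson order_trans set_drop_subset set_take_subset)
    have mb: "m k ?b = M.op ?b" using m[OF bne bT] lb by simp
    have "m k ?b \<in> K.src.Tot" unfolding mb by (rule M.op_Tot[OF bT])
    moreover have "set (take r vs) \<subseteq> K.src.Tot" "set (drop (r + k) vs) \<subseteq> K.src.Tot"
      using T by (meson order_trans set_drop_subset set_take_subset)+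
    ultimately have T': "set ?vs \<subseteq> K.src.Tot" by simp
    have lv: "length ?vs = r + 1 + (?n - k - r)" using kr by auto
    have "f (length ?vs) ?vs = K.op ?vs" by (rule f[OF _ T']) simp
    also have "\<dots> = fnl2 (g k r)" unfolding K.op_def g_def mb by (simp add: M.ev_op take_map drop_map)
    finally show ?thesis unfolding lv .
  qed
  have "stasheff_sum fun_scale f m ps vs = (\<Sum>k\<in>{1..?n}. \<Sum>r\<in>{0..?n - k}. fnl2 (\<lambda>w. c k r * g k r w))"
    unfolding stasheff_sum_def Let_def
    by (intro sum.cong refl) (simp only: summand c_def[symmetric] K.tgt.fnl_scale)
  also have "\<dots> = fnl2 (\<lambda>w. \<Sum>k\<in>{1..?n}. \<Sum>r\<in>{0..?n - k}. c k r * g k r w)"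
    by (simp add: K.tgt.fnl_sum)
  also have "(\<lambda>w. \<Sum>k\<in>{1..?n}. \<Sum>r\<in>{0..?n - k}. c k r * g k r w) =
      (\<lambda>w. sg (koszul_weight ps) * tensor_pair (map ev1 vs) (derivation s1 \<delta> (\<kappa> w)))"
  proof
    fix w
    show "(\<Sum>k\<in>{1..?n}. \<Sum>r\<in>{0..?n - k}. c k r * g k r w) =
        sg (koszul_weight ps) * tensor_pair (map ev1 vs) (derivation s1 \<delta> (\<kappa> w))"
      using stasheff_sum_dual[OF K.src.homogeneous_homog[OF vs] M.kernel_nonempty M.kernel_degree, where \<kappa> = \<kappa> and w = w]
      unfolding c_def g_def Let_def length_map .
  qed
  finally show ?thesis .
qed

lemma A_inf_algebra_dual:
  assumes M: "functional_kernel fnl1 ev1 S1 s1 wt1 fnl1 ev1 S1 s1 wt1 \<delta> 1"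
    and m: "\<And>vs. vs \<noteq> [] \<Longrightarrow> set vs \<subseteq> functional_space.Tot fnl1 S1 wt1 \<Longrightarrow>
          m (length vs) vs = functional_kernel.op ev1 s1 fnl1 \<delta> vs"
    and sq: "\<And>w. derivation s1 \<delta> (\<delta> w) = 0"
  shows "A_inf_algebra fun_scale (functional_space.V fnl1 S1 s1 wt1) m"
proof -
  interpret M: functional_kernel fnl1 ev1 S1 s1 wt1 fnl1 ev1 S1 s1 wt1 \<delta> 1 by fact
  show ?thesis unfolding A_inf_algebra_def
  proof (intro conjI allI impI)
    show "graded_space fun_scale M.src.V" by (rule M.src.graded)
    fix n :: nat assume n: "1 \<le> n"
    show "graded_multilinear fun_scale M.src.V fun_scale M.src.V n (2 - int n) (m n)"
    proof (rule M.op_multilinear)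
      fix vs assume "length vs = n" "set vs \<subseteq> M.src.Tot"
      then show "m n vs = M.op vs" using m[of vs] n by (cases "vs = []") auto
    qed simp
  next
    fix ps vs assume "vs \<noteq> [] \<and> homogeneous M.src.V ps vs"
    then show "stasheff_sum fun_scale m m ps vs = 0"
      using stasheff_sum_functional[where f = m and m = m, OF M M m m, of ps vs] by (simp add: sq tensor_pair.zero M.src.fnl_zero)
  qed
qed

lemma map_blocks: "map (map g) (blocks is vs) = blocks is (map g vs)"
  by (induction "is" arbitrary: vs) (simp_all add: take_map drop_map)

lemma blocks_props:
  assumes "sum_list is = length vs" "0 \<notin> set is" "bl \<in> set (blocks is vs)"
  shows "bl \<noteq> []" "set bl \<subseteq> set vs"
proof -
  have "bl \<noteq> [] \<and> set bl \<subseteq> set vs"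
    using assms
  proof (induction "is" arbitrary: vs)
    case (Cons i "is")
    show ?case
    proof (cases "bl = take i vs")
      case True
      then show ?thesis using Cons.prems set_take_subset[of i vs] by auto
    next
      case False
      then have "sum_list is = length (drop i vs)" "0 \<notin> set is" "bl \<in> set (blocks is (drop i vs))"
        using Cons.prems by auto
      then have "bl \<noteq> [] \<and> set bl \<subseteq> set (drop i vs)" by (rule Cons.IH)
      then show ?thesis using set_drop_subset[of i vs] by blast
    qed
  qed simp
  then show "bl \<noteq> []" "set bl \<subseteq> set vs" by blast+
qed

lemma A_inf_morphism_dual:
  fixes fnl1 :: "('i \<Rightarrow> 'k::field) \<Rightarrow> ('y \<Rightarrow> 'k)" and fnl2 :: "('j \<Rightarrow> 'k) \<Rightarrow> ('z \<Rightarrow> 'k)"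
  assumes K: "functional_kernel fnl1 ev1 S1 s1 wt1 fnl2 ev2 S2 s2 wt2 \<Phi> 0"
    and M1: "functional_kernel fnl1 ev1 S1 s1 wt1 fnl1 ev1 S1 s1 wt1 \<delta>1 1"
    and M2: "functional_kernel fnl2 ev2 S2 s2 wt2 fnl2 ev2 S2 s2 wt2 \<delta>2 1"
    and m1: "\<And>vs. vs \<noteq> [] \<Longrightarrow> set vs \<subseteq> functional_space.Tot fnl1 S1 wt1 \<Longrightarrow>
          m1 (length vs) vs = functional_kernel.op ev1 s1 fnl1 \<delta>1 vs"
    and m2: "\<And>vs. vs \<noteq> [] \<Longrightarrow> set vs \<subseteq> functional_space.Tot fnl2 S2 wt2 \<Longrightarrow>
          m2 (length vs) vs = functional_kernel.op ev2 s2 fnl2 \<delta>2 vs"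
    and f: "\<And>vs. vs \<noteq> [] \<Longrightarrow> set vs \<subseteq> functional_space.Tot fnl1 S1 wt1 \<Longrightarrow>
          f (length vs) vs = functional_kernel.op ev1 s1 fnl2 \<Phi> vs"
    and lift: "\<And>w. derivation s1 \<delta>1 (\<Phi> w) = alg_hom \<Phi> (\<delta>2 w)"
  shows "A_inf_morphism fun_scale (functional_space.V fnl1 S1 s1 wt1) m1
     fun_scale (functional_space.V fnl2 S2 s2 wt2) m2 f"
proof -
  interpret K: functional_kernel fnl1 ev1 S1 s1 wt1 fnl2 ev2 S2 s2 wt2 \<Phi> 0 by fact
  interpret M1: functional_kernel fnl1 ev1 S1 s1 wt1 fnl1 ev1 S1 s1 wt1 \<delta>1 1 by fact
  interpret M2: functional_kernel fnl2 ev2 S2 s2 wt2 fnl2 ev2 S2 s2 wt2 \<delta>2 1 by fact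
  show ?thesis unfolding A_inf_morphism_def
  proof (intro conjI allI impI)
    fix n :: nat assume n: "1 \<le> n"
    show "graded_multilinear fun_scale K.src.V fun_scale K.tgt.V n (1 - int n) (f n)"
    proof (rule K.op_multilinear)
      fix vs assume "length vs = n" "set vs \<subseteq> K.src.Tot"
      then show "f n vs = K.op vs" using f[of vs] n by (cases "vs = []") auto
    qed simp
  next
    fix ps vs assume A: "vs \<noteq> [] \<and> homogeneous K.src.V ps vs"
    then have hom: "homogeneous K.src.V ps vs" by simp
    have T: "set vs \<subseteq> K.src.Tot" by (rule K.src.homogeneous_Tot[OF hom])
    let ?C = "{is :: nat list. sum_list is = length vs \<and> 0 \<notin> set is}"
    define c where "c is = ((-1) ^ (\<Sum>a<length is. (length is - 1 - a) * (is ! a - 1)) *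
            (-1) powi (\<Sum>b<length is. (1 - int (is ! b)) * sum_list (take (sum_list (take b is)) ps)) :: 'k)" for "is"
    define g where "g is = dual_op s2 \<delta>2 (map (\<lambda>bl. dual_op s1 \<Phi> bl) (blocks is (map ev1 vs)))" for "is"
    have summand: "m2 (length is) (map (\<lambda>bl. f (length bl) bl) (blocks is vs)) = fnl2 (g is)" if i: "is \<in> ?C" for "is"
    proof -
      have bl: "f (length bl) bl = K.op bl" "K.op bl \<in> K.tgt.Tot" if "bl \<in> set (blocks is vs)" for bl
        using blocks_props[OF _ _ that] i T f[of bl] K.op_Tot[of bl] by auto
      have eq: "map (\<lambda>bl. f (length bl) bl) (blocks is vs) = map K.op (blocks is vs)" using bl by simp
      have ne: "map K.op (blocks is vs) \<noteq> []" using i A by (cases "is") auto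
      have T2: "set (map K.op (blocks is vs)) \<subseteq> K.tgt.Tot" using bl by auto
      have "m2 (length (map K.op (blocks is vs))) (map K.op (blocks is vs)) = M2.op (map K.op (blocks is vs))"
        by (rule m2[OF ne T2])
      also have "\<dots> = fnl2 (g is)"
        unfolding M2.op_def g_def map_blocks[symmetric] map_map by (simp add: o_def K.ev_op)
      finally show ?thesis unfolding eq by simp
    qed
    have "morphism_sum fun_scale m2 f ps vs = (\<Sum>is\<in>?C. fnl2 (\<lambda>w. c is * g is w))"
      unfolding morphism_sum_def Let_def
      by (intro sum.cong refl) (simp only: summand c_def[symmetric] K.tgt.fnl_scale)
    also have "\<dots> = fnl2 (\<lambda>w. \<Sum>is\<in>?C. c is * g is w)" by (rule K.tgt.fnl_sum[OF finite_compositions, symmetric])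
    also have "(\<lambda>w. \<Sum>is\<in>?C. c is * g is w) = (\<lambda>w. sg (koszul_weight ps) * tensor_pair (map ev1 vs) (alg_hom \<Phi> (\<delta>2 w)))"
    proof
      fix w
      have d: "sum_list (map s1 cs) = s2 c" if "Word cs \<in> keys (\<Phi> c)" for c cs using K.kernel_degree[OF that] by simp
      show "(\<Sum>is\<in>?C. c is * g is w) = sg (koszul_weight ps) * tensor_pair (map ev1 vs) (alg_hom \<Phi> (\<delta>2 w))"
        using morphism_sum_dual[OF K.src.homogeneous_homog[OF hom] K.kernel_nonempty d, where \<kappa> = \<delta>2 and w = w]
        unfolding c_def g_def Let_def length_map .
    qed
    also have "fnl2 \<dots> = stasheff_sum fun_scale f m1 ps vs"
      unfolding lift[symmetric]
      by (rule stasheff_sum_functional[where f = f and m = m1, OF K M1 f m1 hom, symmetric])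
    finally show "stasheff_sum fun_scale f m1 ps vs = morphism_sum fun_scale m2 f ps vs" by (rule sym)
  qed
qed

text \<open>
  Functionals on subspaces extend to the ambient space, by completing a basis.
\<close>

lemma linear_extension:
  assumes S: "module.subspace sc (S :: 'v::ab_group_add set)" and vs: "vector_space (sc :: 'k::field \<Rightarrow> _)"
    and h: "linear_on sc (*) S h"
  shows "\<exists>g. Vector_Spaces.linear sc (*) g \<and> (\<forall>x\<in>S. g x = h x)"
proof -
  interpret p: vector_space_pair sc "(*) :: 'k \<Rightarrow> 'k \<Rightarrow> 'k"
    by (rule vector_space_pair.intro[OF vs field_vs.vector_space_axioms])
  obtain B where B: "B \<subseteq> S" "p.vs1.independent B" "S \<subseteq> p.vs1.span B"
    using p.vs1.maximal_independent_subset[of S] by blast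
  obtain g where g: "Vector_Spaces.linear sc (*) g" "\<forall>x\<in>B. g x = h x"
    using p.linear_independent_extend[OF B(2)] by blast
  interpret g: Vector_Spaces.linear sc "(*)" g by (rule g(1))
  have "p.vs1.subspace {x \<in> S. g x = h x}"
  proof (rule p.vs1.subspaceI)
    have "0 \<in> S" using S p.vs1.subspace_0 by blast
    then have "h (sc 0 0) = 0 * h 0" using h unfolding linear_on_def by blast
    then show "0 \<in> {x \<in> S. g x = h x}" using \<open>0 \<in> S\<close> g.zero by simp
  next
    fix x y assume "x \<in> {x \<in> S. g x = h x}" "y \<in> {x \<in> S. g x = h x}"
    then show "x + y \<in> {x \<in> S. g x = h x}"
      using S h p.vs1.subspace_add unfolding linear_on_def by (auto simp: g.add)
  next
    fix c x assume "x \<in> {x \<in> S. g x = h x}"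
    then show "sc c x \<in> {x \<in> S. g x = h x}"
      using S h p.vs1.subspace_scale unfolding linear_on_def by (auto simp: g.scale)
  qed
  then have "p.vs1.span B \<subseteq> {x \<in> S. g x = h x}" using B(1) g(2) by (intro p.vs1.span_minimal) auto
  then show ?thesis using B(3) g(1) by blast
qed

section \<open>Graded duals of complexes with a combinatorial homology basis\<close>

lemma subspace_keys: "pm.subspace {x :: 'b \<Rightarrow>\<^sub>0 'k::field. \<forall>w\<in>keys x. P w}"
proof (rule pm.subspaceI)
  fix x y :: "'b \<Rightarrow>\<^sub>0 'k" assume "x \<in> {x. \<forall>w\<in>keys x. P w}" "y \<in> {x. \<forall>w\<in>keys x. P w}"
  then show "x + y \<in> {x. \<forall>w\<in>keys x. P w}" using subsetD[OF Poly_Mapping.keys_add[of x y]] by fastforce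
next
  fix c and x :: "'b \<Rightarrow>\<^sub>0 'k" assume "x \<in> {x. \<forall>w\<in>keys x. P w}"
  then show "pm_scale c x \<in> {x. \<forall>w\<in>keys x. P w}" using subsetD[OF keys_pm_scale[of c x]] by fastforce
qed simp

lemma subspace_contains:
  fixes x :: "'b \<Rightarrow>\<^sub>0 'k::field"
  assumes "pm.subspace T" "\<And>C. C \<in> keys x \<Longrightarrow> single C 1 \<in> T"
  shows "x \<in> T"
  by (subst pm_expand, unfold lin_ext_def) (intro pm.subspace_sum pm.subspace_scale assms)

lemma linear_on_expand:
  fixes y :: "'b \<Rightarrow>\<^sub>0 'k::field"
  assumes "linear_on pm_scale (*) T \<phi>" "pm.subspace T" "\<And>C. C \<in> keys y \<Longrightarrow> single C 1 \<in> T"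
  shows "\<phi> y = lin_ext (*) (\<lambda>C. \<phi> (single C 1)) y"
proof -
  obtain g where g: "Vector_Spaces.linear pm_scale (*) g" "\<forall>x\<in>T. g x = \<phi> x"
    using linear_extension[OF assms(2) pm.vector_space_axioms assms(1)] by blast
  have "\<phi> y = g y" using g(2) subspace_contains[OF assms(2,3)] by simp
  also have "\<dots> = lin_ext (*) (\<lambda>C. g (single C 1)) y" by (rule linear_expand[OF g(1)])
  also have "\<dots> = lin_ext (*) (\<lambda>C. \<phi> (single C 1)) y"
    unfolding lin_ext_def by (intro sum.cong refl) (simp add: g(2) assms(3))
  finally show ?thesis .
qed

text \<open>
  A graded space \<open>U\<close> of cycles with boundaries \<open>B\<close> whose homology has a basis \<open>S\<close>: \<open>rep w\<close> is the
  cycle of a basis element and \<open>cl x\<close> is the combination of such cycles homologous to \<open>x\<close>. The signs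
  \<open>\<sigma>\<close> rescale the dual basis. The bar construction itself is the case in which \<open>B\<close> is trivial and
  \<open>cl\<close> is the identity.
\<close>

locale homology_basis =
  fixes U :: "nat \<times> nat \<Rightarrow> ('b \<Rightarrow>\<^sub>0 'k::field) set" and B :: "('b \<Rightarrow>\<^sub>0 'k) set"
    and cl :: "('b \<Rightarrow>\<^sub>0 'k) \<Rightarrow> ('b \<Rightarrow>\<^sub>0 'k)" and S :: "'i set" and rep :: "'i \<Rightarrow> 'b" and idx :: "'b \<Rightarrow> 'i"
    and \<sigma> :: "'i \<Rightarrow> 'k" and s wt :: "'i \<Rightarrow> nat"
  assumes boundaries: "x \<in> B \<Longrightarrow> x \<in> total_space pm_scale U \<and> cl x = 0"
    and cl_add: "x \<in> total_space pm_scale U \<Longrightarrow> y \<in> total_space pm_scale U \<Longrightarrow> cl (x + y) = cl x + cl y"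
    and cl_scale: "x \<in> total_space pm_scale U \<Longrightarrow> cl (pm_scale c x) = pm_scale c (cl x)"
    and cl_keys: "x \<in> total_space pm_scale U \<Longrightarrow> C \<in> keys (cl x) \<Longrightarrow> \<exists>w\<in>S. C = rep w"
    and cl_class: "x \<in> total_space pm_scale U \<Longrightarrow> x - cl x \<in> insert 0 B"
    and cl_rep: "w \<in> S \<Longrightarrow> cl (single (rep w) 1) = single (rep w) 1"
    and idx_rep: "w \<in> S \<Longrightarrow> idx (rep w) = w"
    and rep_mem: "w \<in> S \<Longrightarrow> single (rep w) 1 \<in> U (Suc (s w), wt w)"
    and cl_degree: "x \<in> U (n, l) \<Longrightarrow> w \<in> S \<Longrightarrow> rep w \<in> keys (cl x) \<Longrightarrow> Suc (s w) = n \<and> wt w = l"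
    and sign: "\<sigma> w * \<sigma> w = 1"
    and bound: "w \<in> S \<Longrightarrow> s w < wt w"
begin

abbreviation "T \<equiv> total_space pm_scale U"

definition fnl :: "('i \<Rightarrow> 'k) \<Rightarrow> ('b \<Rightarrow>\<^sub>0 'k) \<Rightarrow> 'k" where
  "fnl G x = (if x \<in> T then lin_ext (*) (\<lambda>C. \<sigma> (idx C) * G (idx C)) (cl x) else 0)"

definition ev :: "(('b \<Rightarrow>\<^sub>0 'k) \<Rightarrow> 'k) \<Rightarrow> 'i \<Rightarrow> 'k" where
  "ev \<phi> w = (if w \<in> S then \<sigma> w * \<phi> (single (rep w) 1) else 0)"

lemma subspace_T: "pm.subspace T"
  unfolding total_space_def by (rule pm.subspace_span)

lemma U_subset_T: "U i \<subseteq> T"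
  unfolding total_space_def using pm.span_base by blast

lemma rep_T: "w \<in> S \<Longrightarrow> single (rep w) 1 \<in> T"
  using rep_mem U_subset_T by blast

lemma fnl_linear: "linear_on pm_scale (*) T (fnl G)"
  unfolding linear_on_def fnl_def
  using subspace_T by (simp add: pm.subspace_add pm.subspace_scale cl_add cl_scale lin_ext_field_add lin_ext_field_scale)

sublocale functional_space fnl ev S s wt
proof
  show "fnl (\<lambda>w. G w + H w) = fnl G + fnl H" for G H
    by (rule ext) (simp add: fnl_def lin_ext_def distrib_left sum.distrib)
  show "fnl (\<lambda>w. c * G w) = fun_scale c (fnl G)" for c G
    by (rule ext) (simp add: fnl_def lin_ext_def fun_scale_def sum_distrib_left mult.left_commute mult.assoc del: field_vs.scale_scale)
  show "fnl G = fnl H" if eq: "\<And>w. w \<in> S \<Longrightarrow> G w = H w" for G H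
  proof
    fix x show "fnl G x = fnl H x"
    proof (cases "x \<in> T")
      case True
      have "idx C \<in> S" if "C \<in> keys (cl x)" for C using cl_keys[OF True that] idx_rep by auto
      then show ?thesis unfolding fnl_def lin_ext_def by (simp add: eq)
    qed (simp add: fnl_def)
  qed
  show "ev (fnl G) w = G w" if w: "w \<in> S" for w G
  proof -
    have "ev (fnl G) w = \<sigma> w * (\<sigma> w * G w)"
      using w by (simp add: ev_def fnl_def rep_T cl_rep idx_rep field_vs.lin_ext_single del: field_vs.scale_scale)
    then show ?thesis using sign[of w] by simp
  qed
  show "ev \<phi> w = 0" if "w \<notin> S" for w \<phi> using that by (simp add: ev_def)
  show "s w < wt w" if "w \<in> S" for w using that by (rule bound)
qed

lemma functional_determined:
  assumes lin: "linear_on pm_scale (*) T \<phi>" and out: "\<And>x. x \<notin> T \<Longrightarrow> \<phi> x = 0" and B: "\<And>x. x \<in> B \<Longrightarrow> \<phi> x = 0"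
  shows "\<phi> = fnl (ev \<phi>)"
proof
  fix x
  show "\<phi> x = fnl (ev \<phi>) x"
  proof (cases "x \<in> T")
    case True
    have k: "single C 1 \<in> T" if "C \<in> keys (cl x)" for C using cl_keys[OF True that] rep_T by blast
    have clT: "cl x \<in> T" by (rule subspace_contains[OF subspace_T k])
    then have dT: "x - cl x \<in> T" using True subspace_T pm.subspace_diff by blast
    have "\<phi> (pm_scale 0 0) = 0 * \<phi> 0" using lin pm.subspace_0[OF subspace_T] unfolding linear_on_def by blast
    then have "\<phi> 0 = 0" by simp
    then have z: "\<phi> (x - cl x) = 0" using cl_class[OF True] B by auto
    have "\<phi> (cl x + (x - cl x)) = \<phi> (cl x) + \<phi> (x - cl x)" using lin clT dT unfolding linear_on_def by blast
    then have "\<phi> x = \<phi> (cl x)" using z by simp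
    also have "\<dots> = lin_ext (*) (\<lambda>C. \<phi> (single C 1)) (cl x)" by (rule linear_on_expand[OF lin subspace_T k])
    also have "\<dots> = lin_ext (*) (\<lambda>C. \<sigma> (idx C) * ev \<phi> (idx C)) (cl x)"
      unfolding lin_ext_def
    proof (intro sum.cong refl arg_cong[where f = "(*) _"])
      fix C assume "C \<in> keys (cl x)"
      then obtain w where w: "w \<in> S" "C = rep w" using cl_keys[OF True] by blast
      then have "\<sigma> (idx C) * ev \<phi> (idx C) = \<sigma> w * \<sigma> w * \<phi> (single (rep w) 1)"
        by (simp add: idx_rep ev_def)
      then show "\<phi> (single C 1) = \<sigma> (idx C) * ev \<phi> (idx C)" using w sign[of w] by simp
    qed
    finally show ?thesis using True by (simp add: fnl_def)
  qed (simp add: out fnl_def)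
qed

text \<open>
  The graded dual is described by values on the homology basis.
\<close>

theorem span_gdual: "module.span fun_scale (\<Union>(n, l)\<in>{(n, l). int n = p}. gdual pm_scale U B (n, l)) = V p"
proof
  show "module.span fun_scale (\<Union>(n, l)\<in>{(n, l). int n = p}. gdual pm_scale U B (n, l)) \<subseteq> V p"
  proof (rule fs.span_minimal[OF _ subspace_V], clarify)
    fix \<phi> n l assume p: "p = int n" and \<phi>: "\<phi> \<in> gdual pm_scale U B (n, l)"
    have eq: "\<phi> = fnl (ev \<phi>)" using \<phi> by (intro functional_determined) (auto simp: gdual_def)
    have "fnl (ev \<phi>) \<in> V (int n)"
    proof (rule V_I)
      fix w assume w: "w \<in> S" "ev \<phi> w \<noteq> 0"
      then have "\<phi> (single (rep w) 1) \<noteq> 0" by (simp add: ev_def)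
      then have "(Suc (s w), wt w) = (n, l)" using \<phi> rep_mem[OF w(1)] unfolding gdual_def by blast
      then show "int (s w) + 1 = int n \<and> wt w \<le> l" by auto
    qed
    then show "\<phi> \<in> V (int n)" using eq by simp
  qed
  show "V p \<subseteq> module.span fun_scale (\<Union>(n, l)\<in>{(n, l). int n = p}. gdual pm_scale U B (n, l))"
  proof
    fix \<phi> assume "\<phi> \<in> V p"
    then obtain G L where G: "\<phi> = fnl G" "\<forall>w\<in>S. G w \<noteq> 0 \<longrightarrow> int (s w) + 1 = p \<and> wt w \<le> L" unfolding V_def by blast
    show "\<phi> \<in> module.span fun_scale (\<Union>(n, l)\<in>{(n, l). int n = p}. gdual pm_scale U B (n, l))"
    proof (cases "0 \<le> p")
      case False
      then have "\<forall>w\<in>S. G w = 0" using G(2) by force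
      then have "\<phi> = fnl (\<lambda>w. 0)" unfolding G(1) by (intro fnl_cong) simp
      then show ?thesis using fs.span_zero by (simp add: fnl_zero)
    next
      case True
      have part: "fnl (\<lambda>w. if wt w = l then G w else 0) \<in> gdual pm_scale U B (nat p, l)" for l
        unfolding gdual_def
      proof (intro CollectI conjI allI impI ballI)
        show "fnl (\<lambda>w. if wt w = l then G w else 0) x = 0" if "x \<notin> T" for x using that by (simp add: fnl_def)
        show "fnl (\<lambda>w. if wt w = l then G w else 0) x = 0" if "x \<in> B" for x
          using boundaries[OF that] by (simp add: fnl_def lin_ext_def)
        fix j x assume j: "j \<noteq> (nat p, l)" and x: "x \<in> U j"
        obtain n m where nm: "j = (n, m)" by (cases j)
        have xT: "x \<in> T" using x U_subset_T by blast
        have "\<sigma> (idx C) * (if wt (idx C) = l then G (idx C) else 0) = 0" if C: "C \<in> keys (cl x)" for C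
        proof -
          obtain w where w: "w \<in> S" "C = rep w" using cl_keys[OF xT C] by blast
          have d: "Suc (s w) = n" "wt w = m" using cl_degree[of x n m w] x w C nm by auto
          have "G w = 0" if "wt w = l"
          proof (rule ccontr)
            assume "G w \<noteq> 0"
            then have "int (s w) + 1 = p" using G(2) w(1) by blast
            then show False using d that j nm by auto
          qed
          then show ?thesis using w idx_rep by simp
        qed
        then have "lin_ext (*) (\<lambda>C. \<sigma> (idx C) * (if wt (idx C) = l then G (idx C) else 0)) (cl x) = 0"
          unfolding lin_ext_def by (intro sum.neutral ballI) (simp only: mult_zero_right)
        then show "fnl (\<lambda>w. if wt w = l then G w else 0) x = 0" by (simp only: fnl_def if_cancel)
      qed (rule fnl_linear)
      have "\<phi> = fnl (\<lambda>w. \<Sum>l\<le>L. if wt w = l then G w else 0)" unfolding G(1)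
      proof (rule fnl_cong)
        fix w assume "w \<in> S"
        then show "G w = (\<Sum>l\<le>L. if wt w = l then G w else 0)" using G(2) by (cases "G w = 0") auto
      qed
      also have "\<dots> = (\<Sum>l\<le>L. fnl (\<lambda>w. if wt w = l then G w else 0))" by (rule fnl_sum) simp
      also have "\<dots> \<in> module.span fun_scale (\<Union>(n, l)\<in>{(n, l). int n = p}. gdual pm_scale U B (n, l))"
      proof (rule fs.span_sum)
        fix l
        have "fnl (\<lambda>w. if wt w = l then G w else 0) \<in> (\<Union>(n, l)\<in>{(n, l). int n = p}. gdual pm_scale U B (n, l))"
          using part[of l] True by force
        then show "fnl (\<lambda>w. if wt w = l then G w else 0) \<in> module.span fun_scale (\<Union>(n, l)\<in>{(n, l). int n = p}. gdual pm_scale U B (n, l))"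
          by (rule fs.span_base)
      qed
      finally show ?thesis .
    qed
  qed
qed

end

context monomial_algebra
begin

interpretation bar_d: Vector_Spaces.linear pm_scale pm_scale "bar_d X R :: _ \<Rightarrow> (_ \<Rightarrow>\<^sub>0 'k::field)" by (rule bar_d_linear)

lemma bar_supported_single: "bar_word X R C \<Longrightarrow> bar_supported (single C (1 :: 'k::field))"
  by (simp add: bar_supported_def)

lemma subspace_bar_supported: "pm.subspace {x :: _ \<Rightarrow>\<^sub>0 'k::field. bar_supported x}"
  unfolding bar_supported_def by (rule subspace_keys)

lemma total_space_bar: "total_space pm_scale (bar X R) = {x :: _ \<Rightarrow>\<^sub>0 'k::field. bar_supported x}"
proof
  show "total_space pm_scale (bar X R) \<subseteq> {x :: _ \<Rightarrow>\<^sub>0 'k. bar_supported x}"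
    unfolding total_space_def by (rule pm.span_minimal[OF _ subspace_bar_supported]) (auto simp: bar_def bar_supported_def)
  show "{x :: _ \<Rightarrow>\<^sub>0 'k. bar_supported x} \<subseteq> total_space pm_scale (bar X R)"
  proof
    fix x :: "'a list list \<Rightarrow>\<^sub>0 'k" assume "x \<in> {x. bar_supported x}"
    then have x: "bar_word X R C" if "C \<in> keys x" for C using that by (simp add: bar_supported_def)
    show "x \<in> total_space pm_scale (bar X R)" unfolding total_space_def
    proof (rule subspace_contains[OF pm.subspace_span])
      fix C assume "C \<in> keys x"
      then have "single C (1 :: 'k) \<in> bar X R (length C, length (concat C))" using x by (simp add: bar_def)
      then show "single C (1 :: 'k) \<in> pm.span (\<Union>i. bar X R i)" by (intro pm.span_base) blast
    qed
  qed
qed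

lemma bar_word_props: "bar_word X R C \<Longrightarrow> 0 < length C \<and> length C \<le> length (concat C)"
  using length_le_concat[of C] by (auto simp: bar_word_def)

text \<open>
  The projection to the basis elements that satisfy \<open>P\<close>.
\<close>

definition restrict_keys :: "('b \<Rightarrow> bool) \<Rightarrow> ('b \<Rightarrow>\<^sub>0 'k::field) \<Rightarrow> ('b \<Rightarrow>\<^sub>0 'k)" where
  "restrict_keys P = lin_ext pm_scale (\<lambda>w. if P w then single w 1 else 0)"

lemma lookup_restrict_keys: "lookup (restrict_keys P x) w = (if P w then lookup x w else 0)" for x :: "'b \<Rightarrow>\<^sub>0 'k::field"
proof -
  have "lookup (restrict_keys P x) w = (\<Sum>v\<in>keys x. if v = w then (if P w then lookup x w else 0) else 0)"
    unfolding restrict_keys_def lin_ext_def lookup_sum by (intro sum.cong) (auto simp: lookup_single when_def)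
  also have "\<dots> = (if P w then lookup x w else 0)" by (simp add: in_keys_iff)
  finally show ?thesis .
qed

lemma keys_restrict_keys: "keys (restrict_keys P x) = {w \<in> keys x. P w}" for x :: "'b \<Rightarrow>\<^sub>0 'k::field"
  by (auto simp: in_keys_iff lookup_restrict_keys split: if_splits)

lemma restrict_keys_linear: "Vector_Spaces.linear pm_scale pm_scale (restrict_keys P)"
  unfolding restrict_keys_def by (rule pm.lin_ext_linear)

abbreviation in_degree :: "nat \<Rightarrow> nat \<Rightarrow> 'a list list \<Rightarrow> bool" where
  "in_degree n l C \<equiv> length C = n \<and> length (concat C) = l"

lemma keys_bar_d_word_degree:
  assumes "bar_word X R C" "D \<in> keys (bar_d_word X R C :: _ \<Rightarrow>\<^sub>0 'k::field)"
  shows "Suc (length D) = length C" "length (concat D) = length (concat C)" "bar_word X R D"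
proof -
  obtain i where i: "Suc i < length C" "nrm (C ! i @ C ! Suc i)" "D = merge_at i C" using assms(2) by (rule keys_bar_d_word)
  from merge_at_props[OF assms(1) i(1,2)] i(1,3)
  show "Suc (length D) = length C" "length (concat D) = length (concat C)" "bar_word X R D" by auto
qed

lemma bar_supported_bar_d:
  fixes x :: "'a list list \<Rightarrow>\<^sub>0 'k::field"
  assumes "bar_supported x"
  shows "bar_supported (bar_d X R x)"
  unfolding bar_supported_def
proof
  fix D assume "D \<in> keys (bar_d X R x)"
  then have "D \<in> (\<Union>C\<in>keys x. keys (bar_d_word X R C :: _ \<Rightarrow>\<^sub>0 'k))"
    unfolding bar_d_lin_ext by (rule subsetD[OF keys_lin_ext])
  then obtain C where C: "C \<in> keys x" "D \<in> keys (bar_d_word X R C :: _ \<Rightarrow>\<^sub>0 'k)" by (elim UN_E)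
  have "bar_word X R C" using assms C(1) by (simp add: bar_supported_def)
  then show "bar_word X R D" using C(2) by (rule keys_bar_d_word_degree(3))
qed

text \<open>
  The differential lowers the length of bar words by one. Appending an empty letter expresses this
  without subtraction.
\<close>

lemma bar_d_restrict_keys:
  assumes "bar_supported x"
  shows "bar_d X R (restrict_keys (in_degree n l) x) = (restrict_keys (\<lambda>C. in_degree n l (C @ [[]])) (bar_d X R x) :: _ \<Rightarrow>\<^sub>0 'k::field)"
proof (rule linear_eq_on_keys[OF pm_linear_compose[OF restrict_keys_linear bar_d_linear] pm_linear_compose[OF bar_d_linear restrict_keys_linear]])
  fix C assume "C \<in> keys x"
  then have C: "bar_word X R C" using assms by (simp add: bar_supported_def)
  have p: "restrict_keys (in_degree n l) (single C 1) = (if in_degree n l C then single C (1 :: 'k) else 0)"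
    by (rule poly_mapping_eqI) (auto simp: lookup_restrict_keys lookup_single when_def)
  have "in_degree n l (D @ [[]]) \<longleftrightarrow> in_degree n l C" if "D \<in> keys (bar_d_word X R C :: _ \<Rightarrow>\<^sub>0 'k)" for D
    using keys_bar_d_word_degree[OF C that] by auto
  then have "restrict_keys (\<lambda>C. in_degree n l (C @ [[]])) (bar_d_word X R C) = (if in_degree n l C then bar_d_word X R C else (0 :: _ \<Rightarrow>\<^sub>0 'k))"
    by (intro poly_mapping_eqI) (auto simp: lookup_restrict_keys in_keys_iff)
  then show "bar_d X R (restrict_keys (in_degree n l) (single C 1)) = (restrict_keys (\<lambda>C. in_degree n l (C @ [[]])) (bar_d X R (single C 1)) :: _ \<Rightarrow>\<^sub>0 'k)"
    unfolding p bar_d_single by (simp add: bar_d_single bar_d.zero)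
qed

definition cycles :: "('a list list \<Rightarrow>\<^sub>0 'k::field) set" where
  "cycles = {x. bar_supported x \<and> bar_d X R x = 0}"

lemma subspace_cycles: "pm.subspace (cycles :: ('a list list \<Rightarrow>\<^sub>0 'k::field) set)"
proof (rule pm.subspaceI)
  show "0 \<in> (cycles :: ('a list list \<Rightarrow>\<^sub>0 'k) set)" by (simp add: cycles_def bar_supported_def bar_d.zero)
  fix x y :: "'a list list \<Rightarrow>\<^sub>0 'k" assume xy: "x \<in> cycles" "y \<in> cycles"
  then have "bar_supported (x + y)" using pm.subspace_add[OF subspace_bar_supported, of x y] by (simp add: cycles_def)
  then show "x + y \<in> cycles" using xy by (simp add: cycles_def bar_d.add)
next
  fix c and x :: "'a list list \<Rightarrow>\<^sub>0 'k" assume x: "x \<in> cycles"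
  then have "bar_supported (pm_scale c x)" using pm.subspace_scale[OF subspace_bar_supported, of x c] by (simp add: cycles_def)
  then show "pm_scale c x \<in> cycles" using x by (simp add: cycles_def bar_d.scale)
qed

lemma total_space_cycles: "total_space pm_scale (bar_cycles X R) = (cycles :: ('a list list \<Rightarrow>\<^sub>0 'k::field) set)"
proof
  show "total_space pm_scale (bar_cycles X R) \<subseteq> (cycles :: ('a list list \<Rightarrow>\<^sub>0 'k) set)"
    unfolding total_space_def
    by (rule pm.span_minimal[OF _ subspace_cycles]) (auto simp: bar_cycles_def bar_def bar_supported_def cycles_def)
  show "(cycles :: ('a list list \<Rightarrow>\<^sub>0 'k) set) \<subseteq> total_space pm_scale (bar_cycles X R)"
  proof
    fix x :: "'a list list \<Rightarrow>\<^sub>0 'k" assume "x \<in> cycles"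
    then have x: "bar_supported x" "bar_d X R x = 0" by (simp_all add: cycles_def)
    let ?D = "(\<lambda>C. (length C, length (concat C))) ` keys x"
    have "x = (\<Sum>i\<in>?D. restrict_keys (in_degree (fst i) (snd i)) x)"
    proof (rule poly_mapping_eqI)
      fix C
      have "lookup (\<Sum>i\<in>?D. restrict_keys (in_degree (fst i) (snd i)) x) C = (\<Sum>i\<in>?D. if i = (length C, length (concat C)) then lookup x C else 0)"
        unfolding lookup_sum by (intro sum.cong) (auto simp: lookup_restrict_keys)
      also have "\<dots> = (if (length C, length (concat C)) \<in> ?D then lookup x C else 0)" by simp
      also have "\<dots> = lookup x C" by (cases "C \<in> keys x") (auto simp: in_keys_iff)
      finally show "lookup x C = lookup (\<Sum>i\<in>?D. restrict_keys (in_degree (fst i) (snd i)) x) C" by (rule sym)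
    qed
    also have "\<dots> \<in> total_space pm_scale (bar_cycles X R)"
      unfolding total_space_def
    proof (rule pm.span_sum)
      fix i :: "nat \<times> nat"
      have "bar_d X R (restrict_keys (in_degree (fst i) (snd i)) x) = 0"
        unfolding bar_d_restrict_keys[OF x(1)] x(2) by (rule poly_mapping_eqI) (simp add: lookup_restrict_keys)
      moreover have "restrict_keys (in_degree (fst i) (snd i)) x \<in> bar X R i"
        using x(1) by (cases i) (auto simp: bar_def keys_restrict_keys bar_supported_def)
      ultimately have "restrict_keys (in_degree (fst i) (snd i)) x \<in> bar_cycles X R i" by (simp add: bar_cycles_def)
      then show "restrict_keys (in_degree (fst i) (snd i)) x \<in> pm.span (\<Union>i. bar_cycles X R i)" by (intro pm.span_base) blast
    qed
    finally show "x \<in> total_space pm_scale (bar_cycles X R)" .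
  qed
qed

lemma bar_boundaries_eq: "bar_boundaries X R = {bar_d X R z | z :: _ \<Rightarrow>\<^sub>0 'k::field. bar_supported z}"
  unfolding bar_boundaries_def total_space_bar by blast

text \<open>
  The combination of chains homologous to a cycle; it exists by \<open>bar_homology\<close> and is unique by
  \<open>chain_boundary_zero\<close>.
\<close>

definition cyc_class :: "('a list list \<Rightarrow>\<^sub>0 'k::field) \<Rightarrow> ('a list list \<Rightarrow>\<^sub>0 'k)" where
  "cyc_class x = (THE c. (\<forall>C\<in>keys c. chain_word C) \<and> (\<exists>z. bar_supported z \<and> x = c + bar_d X R z))"

lemma cyc_class_unique:
  fixes c :: "'a list list \<Rightarrow>\<^sub>0 'k::field"
  assumes "\<forall>C\<in>keys c. chain_word C" "bar_supported z" "x = c + bar_d X R z"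
  shows "cyc_class x = c"
  unfolding cyc_class_def
proof (rule the_equality)
  show "(\<forall>C\<in>keys c. chain_word C) \<and> (\<exists>z. bar_supported z \<and> x = c + bar_d X R z)" using assms by blast
  fix c' assume "(\<forall>C\<in>keys c'. chain_word C) \<and> (\<exists>z. bar_supported z \<and> x = c' + bar_d X R z)"
  then obtain z' where c': "\<forall>C\<in>keys c'. chain_word C" "bar_supported z'" "x = c' + bar_d X R z'" by blast
  have "c - c' = bar_d X R (z' - z)" using assms(3) c'(3) by (simp add: bar_d.diff algebra_simps)
  moreover have "bar_supported (z' - z)" using pm.subspace_diff[OF subspace_bar_supported, of z' z] assms(2) c'(2) by simp
  moreover have "\<forall>C\<in>keys (c - c'). chain_word C"
    using pm.subspace_diff[OF subspace_keys, of c chain_word c'] assms(1) c'(1) by blast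
  ultimately have "c - c' = 0" using chain_boundary_zero by blast
  then show "c' = c" by simp
qed

lemma cyc_class_exists:
  fixes x :: "'a list list \<Rightarrow>\<^sub>0 'k::field"
  assumes "x \<in> cycles"
  shows "\<forall>C\<in>keys (cyc_class x). chain_word C" "\<exists>z. bar_supported z \<and> x = cyc_class x + bar_d X R z"
proof -
  have "\<exists>z. bar_supported z \<and> (\<forall>C\<in>keys (x - bar_d X R z). chain_word C)"
    using assms by (intro bar_homology) (simp_all add: cycles_def)
  then obtain z where z: "bar_supported z" "\<forall>C\<in>keys (x - bar_d X R z). chain_word C" by blast
  have "cyc_class x = x - bar_d X R z" by (rule cyc_class_unique[OF z(2,1)]) simp
  then show "\<forall>C\<in>keys (cyc_class x). chain_word C" "\<exists>z. bar_supported z \<and> x = cyc_class x + bar_d X R z"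
    using z by auto
qed

lemma cyc_class_add:
  fixes x y :: "'a list list \<Rightarrow>\<^sub>0 'k::field"
  assumes "x \<in> cycles" "y \<in> cycles"
  shows "cyc_class (x + y) = cyc_class x + cyc_class y"
proof -
  obtain z z' where z: "bar_supported z" "x = cyc_class x + bar_d X R z" "bar_supported z'" "y = cyc_class y + bar_d X R z'"
    using cyc_class_exists(2)[OF assms(1)] cyc_class_exists(2)[OF assms(2)] by blast
  show ?thesis
  proof (rule cyc_class_unique)
    show "\<forall>C\<in>keys (cyc_class x + cyc_class y). chain_word C"
      using pm.subspace_add[OF subspace_keys, of "cyc_class x" chain_word "cyc_class y"] cyc_class_exists(1) assms by blast
    show "bar_supported (z + z')" using pm.subspace_add[OF subspace_bar_supported, of z z'] z by simp
    show "x + y = cyc_class x + cyc_class y + bar_d X R (z + z')"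
      using arg_cong2[OF z(2,4), of "(+)"] by (simp only: bar_d.add add_ac)
  qed
qed

lemma cyc_class_scale:
  fixes x :: "'a list list \<Rightarrow>\<^sub>0 'k::field"
  assumes "x \<in> cycles"
  shows "cyc_class (pm_scale c x) = pm_scale c (cyc_class x)"
proof -
  obtain z where z: "bar_supported z" "x = cyc_class x + bar_d X R z" using cyc_class_exists(2)[OF assms(1)] by blast
  show ?thesis
  proof (rule cyc_class_unique)
    show "\<forall>C\<in>keys (pm_scale c (cyc_class x)). chain_word C"
      using pm.subspace_scale[OF subspace_keys, of "cyc_class x" chain_word c] cyc_class_exists(1) assms by blast
    show "bar_supported (pm_scale c z)" using pm.subspace_scale[OF subspace_bar_supported, of z c] z by simp
    show "pm_scale c x = pm_scale c (cyc_class x) + bar_d X R (pm_scale c z)"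
      using arg_cong[OF z(2), of "pm_scale c"] by (simp only: bar_d.scale pm.scale_right_distrib)
  qed
qed

lemma cyc_class_chains: "\<forall>C\<in>keys c. chain_word C \<Longrightarrow> cyc_class c = (c :: _ \<Rightarrow>\<^sub>0 'k::field)"
  by (rule cyc_class_unique[of _ 0]) (simp_all add: bar_supported_def bar_d.zero)

lemma cyc_class_boundary: "bar_supported z \<Longrightarrow> cyc_class (bar_d X R z) = (0 :: _ \<Rightarrow>\<^sub>0 'k::field)"
  by (rule cyc_class_unique[of _ z]) simp_all

text \<open>
  The homogeneous component of a representative is a representative too, so by uniqueness the
  representative of a homogeneous cycle is homogeneous.
\<close>

lemma cyc_class_degree:
  fixes x :: "'a list list \<Rightarrow>\<^sub>0 'k::field"
  assumes "x \<in> bar_cycles X R (n, l)" "C \<in> keys (cyc_class x)"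
  shows "length C = n \<and> length (concat C) = l"
proof -
  have x: "x \<in> cycles" "\<forall>C\<in>keys x. in_degree n l C"
    using assms(1) by (auto simp: bar_cycles_def bar_def cycles_def bar_supported_def)
  obtain z where z: "bar_supported z" "x = cyc_class x + bar_d X R z" using cyc_class_exists(2)[OF x(1)] by blast
  interpret p: Vector_Spaces.linear pm_scale pm_scale "restrict_keys (in_degree n l) :: _ \<Rightarrow> _ \<Rightarrow>\<^sub>0 'k" by (rule restrict_keys_linear)
  have "x = restrict_keys (in_degree n l) x" using x(2) by (intro poly_mapping_eqI) (auto simp: lookup_restrict_keys in_keys_iff)
  also have "\<dots> = restrict_keys (in_degree n l) (cyc_class x) + restrict_keys (in_degree n l) (bar_d X R z)"
    using arg_cong[OF z(2), of "restrict_keys (in_degree n l)"] by (simp only: p.add)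
  also have "restrict_keys (in_degree n l) (bar_d X R z) = bar_d X R (restrict_keys (in_degree (Suc n) l) z)"
    unfolding bar_d_restrict_keys[OF z(1)] by simp
  finally have e: "x = restrict_keys (in_degree n l) (cyc_class x) + bar_d X R (restrict_keys (in_degree (Suc n) l) z)" .
  have "cyc_class x = restrict_keys (in_degree n l) (cyc_class x)"
    by (rule cyc_class_unique[OF _ _ e]) (use cyc_class_exists(1)[OF x(1)] z(1) in \<open>auto simp: keys_restrict_keys bar_supported_def\<close>)
  then have "C \<in> keys (restrict_keys (in_degree n l) (cyc_class x))" using assms(2) by simp
  then show ?thesis by (simp add: keys_restrict_keys)
qed

text \<open>
  The rescaling of bar words of length \<open>n\<close> that makes the signs of the bar differential and of the
  deconcatenation agree with those of \<open>cobar_d\<close>.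
\<close>

definition eta :: "nat \<Rightarrow> 'k::field" where "eta n = (-1) ^ (n * (n - 1) div 2)"

lemma bar_basis: "homology_basis (bar X R) {} (\<lambda>x. x) {C. bar_word X R C} (\<lambda>C. C) (\<lambda>C. C)
   (\<lambda>C. eta (length C) :: 'k::field) bar_deg (\<lambda>C. length (concat C))"
proof
  fix x :: "'a list list \<Rightarrow>\<^sub>0 'k" and C assume "x \<in> total_space pm_scale (bar X R)" "C \<in> keys x"
  then show "\<exists>w\<in>{C. bar_word X R C}. C = w" unfolding total_space_bar by (simp add: bar_supported_def)
next
  fix w assume "w \<in> {C. bar_word X R C}"
  then have w: "bar_word X R w" "Suc (bar_deg w) = length w" "length w \<le> length (concat w)"
    using bar_word_props[of w] by (auto simp: bar_deg_def)
  then show "single w (1 :: 'k) \<in> bar X R (Suc (bar_deg w), length (concat w))" by (simp add: bar_def)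
  show "bar_deg w < length (concat w)" using w(2,3) by linarith
next
  fix x :: "'a list list \<Rightarrow>\<^sub>0 'k" and n l w assume "x \<in> bar X R (n, l)" "w \<in> {C. bar_word X R C}" "w \<in> keys x"
  then show "Suc (bar_deg w) = n \<and> length (concat w) = l" using bar_word_props[of w] by (auto simp: bar_def bar_deg_def)
next
  show "eta (length w) * eta (length w) = (1 :: 'k)" for w :: "'a list list"
    by (simp add: eta_def flip: power_mult_distrib)
qed auto

lemma ext_basis: "homology_basis (bar_cycles X R) (bar_boundaries X R) cyc_class (chains X R) (factors X R) concat
   (\<lambda>_. 1 :: 'k::field) (chain_length X R) length"
proof
  fix x :: "'a list list \<Rightarrow>\<^sub>0 'k" assume "x \<in> bar_boundaries X R"
  then obtain z where z: "x = bar_d X R z" "bar_supported z" unfolding bar_boundaries_eq by blast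
  then show "x \<in> total_space pm_scale (bar_cycles X R) \<and> cyc_class x = 0"
    unfolding total_space_cycles cycles_def by (simp add: bar_supported_bar_d bar_d_square cyc_class_boundary)
next
  fix x y :: "'a list list \<Rightarrow>\<^sub>0 'k" assume "x \<in> total_space pm_scale (bar_cycles X R)" "y \<in> total_space pm_scale (bar_cycles X R)"
  then show "cyc_class (x + y) = cyc_class x + cyc_class y" unfolding total_space_cycles by (rule cyc_class_add)
next
  fix x :: "'a list list \<Rightarrow>\<^sub>0 'k" and c assume "x \<in> total_space pm_scale (bar_cycles X R)"
  then show "cyc_class (pm_scale c x) = pm_scale c (cyc_class x)" unfolding total_space_cycles by (rule cyc_class_scale)
next
  fix x :: "'a list list \<Rightarrow>\<^sub>0 'k" and C assume "x \<in> total_space pm_scale (bar_cycles X R)" "C \<in> keys (cyc_class x)"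
  then have "chain_word C" unfolding total_space_cycles using cyc_class_exists(1) by blast
  then have "concat C \<in> chains X R" "C = factors X R (concat C)"
    using chain_factors_chain[of X R C] factors_eq[of X R C] by (auto simp: is_chain_iff)
  then show "\<exists>w\<in>chains X R. C = factors X R w" by blast
next
  fix x :: "'a list list \<Rightarrow>\<^sub>0 'k" assume "x \<in> total_space pm_scale (bar_cycles X R)"
  then obtain z where "bar_supported z" "x = cyc_class x + bar_d X R z" unfolding total_space_cycles using cyc_class_exists(2) by blast
  then have "x - cyc_class x = bar_d X R z" by (metis add_diff_cancel_left')
  then show "x - cyc_class x \<in> insert 0 (bar_boundaries X R)" unfolding bar_boundaries_eq using \<open>bar_supported z\<close> by blast
next
  fix w assume w: "w \<in> chains X R"
  note f = factors_chain[OF w]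
  show "cyc_class (single (factors X R w) (1 :: 'k)) = single (factors X R w) 1" by (rule cyc_class_chains) (use f in simp)
  show "concat (factors X R w) = w" by (rule f(2))
  have "bar_d X R (single (factors X R w) (1 :: 'k)) = 0" by (rule bar_d_chains) (use f in simp)
  then show "single (factors X R w) (1 :: 'k) \<in> bar_cycles X R (Suc (chain_length X R w), length w)"
    using f chain_word_bar_word[OF f(1)] by (simp add: bar_cycles_def bar_def)
  show "chain_length X R w < length w"
    using bar_word_props[OF chain_word_bar_word[OF f(1)]] f by simp
next
  fix x :: "'a list list \<Rightarrow>\<^sub>0 'k" and n l w
  assume "x \<in> bar_cycles X R (n, l)" "w \<in> chains X R" "factors X R w \<in> keys (cyc_class x)"
  then show "Suc (chain_length X R w) = n \<and> length w = l" using cyc_class_degree[of x n l "factors X R w"] factors_chain[of w X R] by auto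
qed simp

end

section \<open>The quasi-isomorphism and the higher products\<close>

text \<open>
  From here on everything depends on the field of scalars, which therefore becomes a parameter.
\<close>

locale monomial_algebra_over = monomial_algebra X R
  for X :: "'a set" and R :: "'a list set" + fixes scalars :: "'k::field itself"
begin

interpretation bar_d: Vector_Spaces.linear pm_scale pm_scale "bar_d X R :: _ \<Rightarrow> (_ \<Rightarrow>\<^sub>0 'k)" by (rule bar_d_linear)

interpretation Bar: homology_basis "bar X R" "{}" "\<lambda>x. x" "{C. bar_word X R C}" "\<lambda>C. C" "\<lambda>C. C"
    "\<lambda>C. eta (length C) :: 'k" bar_deg "\<lambda>C. length (concat C)"
  by (rule bar_basis)

interpretation Tor: homology_basis "bar_cycles X R" "bar_boundaries X R" cyc_class "chains X R" "factors X R" concat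
    "\<lambda>_. 1 :: 'k" "chain_length X R" length
  by (rule ext_basis)

lemma length_concat_concat: "length (concat (concat cs)) = sum_list (map (\<lambda>C. length (concat C)) cs)"
  by (induction cs) simp_all

lemma bar_kernel: "functional_kernel Bar.fnl Bar.ev {C. bar_word X R C} bar_deg (\<lambda>C. length (concat C))
    Bar.fnl Bar.ev {C. bar_word X R C} bar_deg (\<lambda>C. length (concat C)) (cobar_d :: _ \<Rightarrow> _ \<Rightarrow>\<^sub>0 'k) 1"
proof (intro functional_kernel.intro Bar.functional_space_axioms functional_kernel_axioms.intro)
  show "cobar_d C = (0 :: _ \<Rightarrow>\<^sub>0 'k)" if "C \<notin> {C. bar_word X R C}" for C using that by (simp add: cobar_d_def)
  show "Word [] \<notin> keys (cobar_d C :: _ \<Rightarrow>\<^sub>0 'k)" for C using keys_cobar_d(1)[of "[]" C] by blast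
  show "sum_list (map bar_deg cs) + 1 = bar_deg C" if "Word cs \<in> keys (cobar_d C :: _ \<Rightarrow>\<^sub>0 'k)" for cs C
    by (rule keys_cobar_d(4)[OF that])
  show "(\<Sum>C\<leftarrow>cs. length (concat C)) = length (concat C)" if "Word cs \<in> keys (cobar_d C :: _ \<Rightarrow>\<^sub>0 'k)" for cs C
    unfolding length_concat_concat[symmetric] keys_cobar_d(3)[OF that] ..
qed

lemma chain_kernel: "functional_kernel Tor.fnl Tor.ev (chains X R) (chain_length X R) length
    Tor.fnl Tor.ev (chains X R) (chain_length X R) length (chain_d :: _ \<Rightarrow> _ \<Rightarrow>\<^sub>0 'k) 1"
proof (intro functional_kernel.intro Tor.functional_space_axioms functional_kernel_axioms.intro)
  show "chain_d w = (0 :: _ \<Rightarrow>\<^sub>0 'k)" if "w \<notin> chains X R" for w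
  proof -
    have "decs w = {}" using that by (auto simp: decs_def)
    then show ?thesis by (simp add: chain_d_def)
  qed
  show "Word [] \<notin> keys (chain_d w :: _ \<Rightarrow>\<^sub>0 'k)" for w by (simp add: keys_chain_d decs_def)
  show "sum_list (map (chain_length X R) cs) + 1 = chain_length X R w" if "Word cs \<in> keys (chain_d w :: _ \<Rightarrow>\<^sub>0 'k)" for cs w
    using that by (simp add: keys_chain_d decs_def)
  show "sum_list (map length cs) = length w" if "Word cs \<in> keys (chain_d w :: _ \<Rightarrow>\<^sub>0 'k)" for cs w
    using that by (auto simp: keys_chain_d decs_def length_concat)
qed

lemma lift_kernel: "functional_kernel Bar.fnl Bar.ev {C. bar_word X R C} bar_deg (\<lambda>C. length (concat C))
    Tor.fnl Tor.ev (chains X R) (chain_length X R) length (cobar_lift :: _ \<Rightarrow> _ \<Rightarrow>\<^sub>0 'k) 0"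
proof (intro functional_kernel.intro Bar.functional_space_axioms Tor.functional_space_axioms functional_kernel_axioms.intro)
  show "cobar_lift w = (0 :: _ \<Rightarrow>\<^sub>0 'k)" if "w \<notin> chains X R" for w using that by (rule cobar_lift_nonchain)
  have good: "good_lift w cs" if "Word cs \<in> keys (cobar_lift w :: _ \<Rightarrow>\<^sub>0 'k)" for cs w
    using keys_cobar_lift[OF that] by blast
  show "Word [] \<notin> keys (cobar_lift w :: _ \<Rightarrow>\<^sub>0 'k)" for w using good[of "[]" w] by (auto simp: good_lift_def)
  show "sum_list (map bar_deg cs) + 0 = chain_length X R w" if "Word cs \<in> keys (cobar_lift w :: _ \<Rightarrow>\<^sub>0 'k)" for cs w
    using good[OF that] by (simp add: good_lift_def)
  show "(\<Sum>C\<leftarrow>cs. length (concat C)) = length w" if "Word cs \<in> keys (cobar_lift w :: _ \<Rightarrow>\<^sub>0 'k)" for cs w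
    using good[OF that] unfolding length_concat_concat[symmetric] by (simp add: good_lift_def)
qed

lemma eta_Suc: "eta (Suc m) = ((-1) ^ m * eta m :: 'k)"
proof -
  have "Suc m * m div 2 = m + m * (m - 1) div 2"
  proof (cases m)
    case (Suc k)
    have "Suc m * m = 2 * m + m * (m - 1)" using Suc by simp
    then show ?thesis by simp
  qed simp
  then show ?thesis by (simp add: eta_def power_add)
qed

lemma eta_square: "eta n * eta n = (1 :: 'k)" "eta n * (eta n * c) = (c :: 'k)"
  by (simp_all add: eta_def flip: power_mult_distrib)

lemma eta_add: "eta (j + m) = ((-1) ^ (j * m) * eta j * eta m :: 'k)"
proof (induction m)
  case 0 then show ?case by (simp add: eta_def)
next
  case (Suc m)
  then show ?case by (simp add: eta_Suc power_add)
qed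

lemma bar_functional_fnl: "bar_functional X R F = Bar.fnl (\<lambda>C. eta (length C) * F C)"
proof
  fix x :: "'a list list \<Rightarrow>\<^sub>0 'k"
  have "eta (length C) * (eta (length C) * F C) = F C" for C :: "'a list list" by (rule eta_square(2))
  then show "bar_functional X R F x = Bar.fnl (\<lambda>C. eta (length C) * F C) x"
    by (simp only: bar_functional_def Bar.fnl_def lin_ext_def)
qed

lemma bar_functional_single: "bar_word X R C \<Longrightarrow> bar_functional X R F (single C 1) = (F C :: 'k)"
  by (simp add: bar_functional_def total_space_bar bar_supported_def)

lemma bar_functional_eval: "\<phi> \<in> Bar.Tot \<Longrightarrow> bar_functional X R (\<lambda>C. \<phi> (single C 1)) = \<phi>"
proof -
  assume "\<phi> \<in> Bar.Tot"
  have "bar_functional X R (\<lambda>C. \<phi> (single C 1)) = Bar.fnl (Bar.ev \<phi>)"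
    unfolding bar_functional_fnl by (rule Bar.fnl_cong) (simp add: Bar.ev_def)
  also have "\<dots> = \<phi>" by (rule Bar.fnl_ev) fact
  finally show ?thesis .
qed

lemma bar_functional_cong: "(\<And>C. bar_word X R C \<Longrightarrow> F C = G C) \<Longrightarrow> bar_functional X R F = (bar_functional X R G :: ('a, 'k) cochain)"
  unfolding bar_functional_fnl by (rule Bar.fnl_cong) simp

lemma bar_dual_linear: "\<phi> \<in> Bar.Tot \<Longrightarrow> linear_on pm_scale (*) {x. bar_supported x} \<phi>"
  using Bar.fnl_linear[of "Bar.ev \<phi>"] Bar.fnl_ev[of \<phi>] by (simp add: total_space_bar)

lemma bar_supported_word: "bar_word X R C \<Longrightarrow> bar_supported (bar_d_word X R C :: _ \<Rightarrow>\<^sub>0 'k)"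
  unfolding bar_supported_def using keys_bar_d_word_degree(3) by blast

lemma bar_dual_expand: "\<phi> \<in> Bar.Tot \<Longrightarrow> bar_supported x \<Longrightarrow> \<phi> x = lin_ext (*) (\<lambda>C. \<phi> (single C 1)) x"
  by (rule linear_on_expand[OF bar_dual_linear subspace_bar_supported]) (simp_all add: bar_supported_def)

lemma dual_op_cobar_d:
  assumes C: "bar_word X R C"
  shows "dual_op bar_deg cobar_d \<psi>s C = (\<Sum>i<length C - 1. (-1) ^ i *
     ((if nrm (C ! i @ C ! Suc i) then ev_tensor \<psi>s [merge_at i C] else 0) +
      (-1) ^ i * ev_tensor \<psi>s [take (Suc i) C, drop (Suc i) C]) :: 'k)"
proof -
  let ?h = "lin_ext (*) (\<lambda>v. sg (koszul_weight (map (\<lambda>c. int (bar_deg c) + 1) (letters v))) * ev_tensor \<psi>s (letters v)) ::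
     ('a list list free_monoid \<Rightarrow>\<^sub>0 'k) \<Rightarrow> 'k"
  interpret h: Vector_Spaces.linear pm_scale "(*)" ?h by (rule field_vs.lin_ext_linear)
  have s: "?h (mon [merge_at i C]) = ev_tensor \<psi>s [merge_at i C]" for i
    by (simp add: sg_simps)
  have p: "?h (mon [take (Suc i) C, drop (Suc i) C]) = - ((-1) ^ i * ev_tensor \<psi>s [take (Suc i) C, drop (Suc i) C])"
    if "i < length C - 1" for i
  proof -
    have "int (bar_deg (take (Suc i) C)) + 1 = int (Suc i)" using that by (simp add: bar_deg_def)
    then have "sg (koszul_weight [int (bar_deg (take (Suc i) C)) + 1, int (bar_deg (drop (Suc i) C)) + 1]) = - ((-1) ^ i :: 'k)"
      by (simp add: minus_one_power_sg) (simp add: sg_def)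
    then show ?thesis by simp
  qed
  have "?h (cobar_term C i) = (-1) ^ i * ((if nrm (C ! i @ C ! Suc i) then ev_tensor \<psi>s [merge_at i C] else 0) +
      (-1) ^ i * ev_tensor \<psi>s [take (Suc i) C, drop (Suc i) C])" if "i < length C - 1" for i
    unfolding cobar_term_def h.scale h.diff p[OF that] using s[of i] by (simp add: h.zero)
  then show ?thesis unfolding dual_op_def cobar_d_def using C by (simp only: if_True h.sum) simp
qed

text \<open>
  The signs of the differential and of the product of the bar dual are the quotients of values of
  \<open>eta\<close> in \<open>eta_Suc\<close> and \<open>eta_add\<close>; operations with more arguments vanish, as the cobar differential
  has no words of more than two blocks.
\<close>

lemma bar_dual_ops_op:
  assumes "vs \<noteq> []" "set vs \<subseteq> Bar.Tot"
  shows "bar_dual_ops X R (length vs) vs = functional_kernel.op Bar.ev bar_deg Bar.fnl cobar_d vs"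
proof -
  interpret K: functional_kernel Bar.fnl Bar.ev "{C. bar_word X R C}" bar_deg "\<lambda>C. length (concat C)"
    Bar.fnl Bar.ev "{C. bar_word X R C}" bar_deg "\<lambda>C. length (concat C)" "cobar_d :: _ \<Rightarrow> _ \<Rightarrow>\<^sub>0 'k" 1
    by (rule bar_kernel)
  consider (one) \<phi> where "vs = [\<phi>]" | (two) \<phi> \<psi> where "vs = [\<phi>, \<psi>]" | (many) "3 \<le> length vs"
  proof (cases vs rule: list.exhaust)
    case (Cons a us)
    then show thesis using that by (cases us rule: list.exhaust; cases "tl us") auto
  qed (use assms in simp)
  then show ?thesis
  proof cases
    case one
    have \<phi>: "\<phi> \<in> Bar.Tot" using assms one by simp
    have "bar_dual_ops X R (length vs) vs = bar_functional X R (\<lambda>C. (-1) ^ (length C - 1) * \<phi> (bar_d_word X R C))"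
      by (simp add: one bar_dual_ops_def bar_dual_diff_def)
    also have "\<dots> = Bar.fnl (dual_op bar_deg cobar_d (map Bar.ev vs))"
      unfolding bar_functional_fnl
    proof (rule Bar.fnl_cong)
      fix C assume "C \<in> {C. bar_word X R C}"
      then have C: "bar_word X R C" by simp
      then obtain k where k: "length C = Suc k" by (cases C) (auto simp: bar_word_def)
      interpret l: Vector_Spaces.linear pm_scale "(*)" "lin_ext (*) (\<lambda>C. \<phi> (single C 1)) :: _ \<Rightarrow> 'k"
        by (rule field_vs.lin_ext_linear)
      have "\<phi> (bar_d_word X R C) = lin_ext (*) (\<lambda>C. \<phi> (single C 1)) (bar_d_word X R C)"
        by (rule bar_dual_expand[OF \<phi> bar_supported_word[OF C]])
      also have "\<dots> = (\<Sum>i<k. if nrm (C ! i @ C ! Suc i) then (-1) ^ i * \<phi> (single (merge_at i C) 1) else 0)"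
        unfolding bar_d_word_merge l.sum k by (intro sum.cong) (simp_all add: l.zero)
      finally have d: "\<phi> (bar_d_word X R C) = (\<Sum>i<k. if nrm (C ! i @ C ! Suc i) then (-1) ^ i * \<phi> (single (merge_at i C) 1) else 0)" .
      have "eta (length C) * ((-1) ^ (length C - 1) * \<phi> (bar_d_word X R C)) = eta k * \<phi> (bar_d_word X R C)"
        unfolding k eta_Suc by (cases "even k") simp_all
      also have "\<dots> = eta k * (\<Sum>i<k. if nrm (C ! i @ C ! Suc i) then (-1) ^ i * \<phi> (single (merge_at i C) 1) else 0)"
        by (simp only: d)
      also have "\<dots> = (\<Sum>i<k. (-1) ^ i * (if nrm (C ! i @ C ! Suc i) then Bar.ev \<phi> (merge_at i C) else 0))"
        unfolding sum_distrib_left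
      proof (intro sum.cong refl)
        fix i assume "i \<in> {..<k}"
        then show "eta k * (if nrm (C ! i @ C ! Suc i) then (-1) ^ i * \<phi> (single (merge_at i C) 1) else 0) =
            (-1) ^ i * (if nrm (C ! i @ C ! Suc i) then Bar.ev \<phi> (merge_at i C) else 0)"
        proof (cases "nrm (C ! i @ C ! Suc i)")
          case True
          have "Bar.ev \<phi> (merge_at i C) = eta k * \<phi> (single (merge_at i C) 1)"
            using merge_at_props(1,3)[OF C _ True] k \<open>i \<in> {..<k}\<close> by (simp add: Bar.ev_def)
          then show ?thesis using True by (simp only: if_True mult.left_commute)
        qed simp
      qed
      also have "\<dots> = dual_op bar_deg cobar_d (map Bar.ev vs) C"
        unfolding dual_op_cobar_d[OF C] k diff_Suc_1 by (intro sum.cong refl) (simp add: one)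
      finally show "eta (length C) * ((-1) ^ (length C - 1) * \<phi> (bar_d_word X R C)) = dual_op bar_deg cobar_d (map Bar.ev vs) C" .
    qed
    finally show ?thesis unfolding K.op_def .
  next
    case two
    have "bar_dual_ops X R (length vs) vs = bar_functional X R (\<lambda>C. \<Sum>j\<in>{1..<length C}. (-1) ^ ((length C - j) * j) *
        (\<phi> (single (take j C) 1) * \<psi> (single (drop j C) 1)))"
      by (simp add: two bar_dual_ops_def bar_dual_prod_def)
    also have "\<dots> = Bar.fnl (dual_op bar_deg cobar_d (map Bar.ev vs))"
      unfolding bar_functional_fnl
    proof (rule Bar.fnl_cong)
      fix C assume "C \<in> {C. bar_word X R C}"
      then have C: "bar_word X R C" by simp
      then obtain k where k: "length C = Suc k" by (cases C) (auto simp: bar_word_def)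
      have "eta (length C) * (\<Sum>j\<in>{1..<length C}. (-1) ^ ((length C - j) * j) * (\<phi> (single (take j C) 1) * \<psi> (single (drop j C) 1))) =
          (\<Sum>i<k. eta (Suc k) * ((-1) ^ ((Suc k - Suc i) * Suc i) * (\<phi> (single (take (Suc i) C) 1) * \<psi> (single (drop (Suc i) C) 1))))"
        unfolding k sum_distrib_left One_nat_def sum.shift_bounds_Suc_ivl atLeast0LessThan ..
      also have "\<dots> = (\<Sum>i<k. Bar.ev \<phi> (take (Suc i) C) * Bar.ev \<psi> (drop (Suc i) C))"
      proof (intro sum.cong refl)
        fix i assume i: "i \<in> {..<k}"
        have b: "bar_word X R (take (Suc i) C)" "bar_word X R (drop (Suc i) C)"
          using C i k set_take_subset[of "Suc i" C] set_drop_subset[of "Suc i" C] unfolding bar_word_def by auto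
        have e: "eta (Suc k) = ((-1) ^ ((Suc k - Suc i) * Suc i) * eta (Suc i) * eta (k - i) :: 'k)"
          using eta_add[of "Suc i" "k - i"] i by (simp add: mult.commute)
        have sq: "(-1) ^ m * a * b * ((-1) ^ m * c) = a * b * (c :: 'k)" for m a b c
          by (cases "even m") simp_all
        have "eta (Suc k) * ((-1) ^ ((Suc k - Suc i) * Suc i) * (\<phi> (single (take (Suc i) C) 1) * \<psi> (single (drop (Suc i) C) 1))) =
            eta (Suc i) * eta (k - i) * (\<phi> (single (take (Suc i) C) 1) * \<psi> (single (drop (Suc i) C) 1))"
          unfolding e by (rule sq)
        also have "\<dots> = Bar.ev \<phi> (take (Suc i) C) * Bar.ev \<psi> (drop (Suc i) C)"
          using b i k by (simp add: Bar.ev_def min_def mult.commute mult.left_commute mult.assoc del: field_vs.scale_scale)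
        finally show "eta (Suc k) * ((-1) ^ ((Suc k - Suc i) * Suc i) * (\<phi> (single (take (Suc i) C) 1) * \<psi> (single (drop (Suc i) C) 1))) =
            Bar.ev \<phi> (take (Suc i) C) * Bar.ev \<psi> (drop (Suc i) C)" .
      qed
      also have "\<dots> = dual_op bar_deg cobar_d (map Bar.ev vs) C"
        unfolding dual_op_cobar_d[OF C] k diff_Suc_1
      proof (intro sum.cong refl)
        fix i
        have "ev_tensor (map Bar.ev vs) [merge_at i C] = 0" by (simp add: two)
        then have "(-1) ^ i * ((if nrm (C ! i @ C ! Suc i) then ev_tensor (map Bar.ev vs) [merge_at i C] else 0) +
            (-1) ^ i * ev_tensor (map Bar.ev vs) [take (Suc i) C, drop (Suc i) C]) =
            (-1) ^ i * ((-1) ^ i * ev_tensor (map Bar.ev vs) [take (Suc i) C, drop (Suc i) C])" by (simp only: if_cancel add_0)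
        also have "\<dots> = ev_tensor (map Bar.ev vs) [take (Suc i) C, drop (Suc i) C]" by (cases "even i") simp_all
        finally show "Bar.ev \<phi> (take (Suc i) C) * Bar.ev \<psi> (drop (Suc i) C) =
            (-1) ^ i * ((if nrm (C ! i @ C ! Suc i) then ev_tensor (map Bar.ev vs) [merge_at i C] else 0) +
            (-1) ^ i * ev_tensor (map Bar.ev vs) [take (Suc i) C, drop (Suc i) C])" by (simp add: two)
      qed
      finally show "eta (length C) * (\<Sum>j\<in>{1..<length C}. (-1) ^ ((length C - j) * j) *
          (\<phi> (single (take j C) 1) * \<psi> (single (drop j C) 1))) = dual_op bar_deg cobar_d (map Bar.ev vs) C" .
    qed
    finally show ?thesis unfolding K.op_def .
  next
    case many
    have z: "ev_tensor (map Bar.ev vs) [a] = 0" "ev_tensor (map Bar.ev vs) [a, b] = 0" for a b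
      using many by (intro ev_tensor_length; simp)+
    have "Bar.fnl (dual_op bar_deg cobar_d (map Bar.ev vs)) = Bar.fnl (\<lambda>C. 0)"
      by (rule Bar.fnl_cong) (simp add: dual_op_cobar_d z cong: if_cong)
    also have "\<dots> = 0" by (rule Bar.fnl_zero)
    finally show ?thesis unfolding K.op_def using many by (simp add: bar_dual_ops_def)
  qed
qed

lemma Ext_eq: "Ext X R = Tor.V"
  by (rule ext) (simp only: Ext_def Tor.span_gdual)

lemma bar_dual_eq: "bar_dual X R = Bar.V"
  by (rule ext) (simp only: bar_dual_def Bar.span_gdual)

abbreviation ext_op :: "('a, 'k) cochain list \<Rightarrow> ('a, 'k) cochain" where
  "ext_op \<equiv> functional_kernel.op Tor.ev (chain_length X R) Tor.fnl chain_d"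

abbreviation lift_op :: "('a, 'k) cochain list \<Rightarrow> ('a, 'k) cochain" where
  "lift_op \<equiv> functional_kernel.op Bar.ev bar_deg Tor.fnl cobar_lift"

lemma A_inf_algebra_Ext: "A_inf_algebra fun_scale (Ext X R) (\<lambda>_. ext_op)"
  unfolding Ext_eq by (rule A_inf_algebra_dual[OF chain_kernel _ derivation_chain_d]) (rule refl)

lemma A_inf_algebra_bar: "A_inf_algebra fun_scale (bar_dual X R :: int \<Rightarrow> ('a, 'k) cochain set) (bar_dual_ops X R)"
  unfolding bar_dual_eq
proof (rule A_inf_algebra_dual[OF bar_kernel])
  show "bar_dual_ops X R (length vs) vs = functional_kernel.op Bar.ev bar_deg Bar.fnl cobar_d vs"
    if "vs \<noteq> []" "set vs \<subseteq> Bar.Tot" for vs using that by (rule bar_dual_ops_op)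
  show "cobar_D (cobar_d C) = (0 :: _ \<Rightarrow>\<^sub>0 'k)" for C by (rule cobar_D_square)
qed

lemma A_inf_morphism_lift:
  "A_inf_morphism fun_scale (bar_dual X R) (bar_dual_ops X R) fun_scale (Ext X R) (\<lambda>_. ext_op) (\<lambda>_. lift_op)"
  unfolding bar_dual_eq Ext_eq
proof (rule A_inf_morphism_dual[OF lift_kernel bar_kernel chain_kernel])
  show "bar_dual_ops X R (length vs) vs = functional_kernel.op Bar.ev bar_deg Bar.fnl cobar_d vs"
    if "vs \<noteq> []" "set vs \<subseteq> Bar.Tot" for vs using that by (rule bar_dual_ops_op)
  show "cobar_D (cobar_lift w) = alg_hom cobar_lift (chain_d w :: _ \<Rightarrow>\<^sub>0 'k)" for w by (rule cobar_D_lift)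
qed (rule refl)+

lemma ext_op_single: "ext_op [\<phi>] = 0"
proof -
  interpret K: functional_kernel Tor.fnl Tor.ev "chains X R" "chain_length X R" length
    Tor.fnl Tor.ev "chains X R" "chain_length X R" length "chain_d :: _ \<Rightarrow> _ \<Rightarrow>\<^sub>0 'k" 1 by (rule chain_kernel)
  have "dual_op (chain_length X R) chain_d (map Tor.ev [\<phi>]) w = 0" for w
    unfolding dual_op_def lin_ext_def
  proof (intro sum.neutral ballI)
    fix v assume "v \<in> keys (chain_d w :: _ \<Rightarrow>\<^sub>0 'k)"
    then have "letters v \<in> decs w" using keys_chain_d[of "letters v" w, where 'k = 'k] by simp
    then have "ev_tensor (map Tor.ev [\<phi>]) (letters v) = 0" by (intro ev_tensor_length) (auto simp: decs_def)
    then show "lookup (chain_d w) v * (sg (koszul_weight (map (\<lambda>c. int (chain_length X R c) + 1) (letters v))) *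
        ev_tensor (map Tor.ev [\<phi>]) (letters v)) = 0" by (simp only: mult_zero_right)
  qed
  then have "dual_op (chain_length X R) chain_d (map Tor.ev [\<phi>]) = (\<lambda>w. 0)" by (rule ext)
  then show ?thesis unfolding K.op_def by (simp only: Tor.fnl_zero)
qed

lemma Tor_fnl_chain: "chain_word us \<Longrightarrow> Tor.fnl G (single us 1) = G (concat us)"
proof -
  assume us: "chain_word us"
  then have w: "concat us \<in> chains X R" "factors X R (concat us) = us"
    using chain_factors_chain[OF us] factors_eq[OF us] by (auto simp: is_chain_iff)
  show ?thesis using Tor.ev_fnl[OF w(1), of G] w by (simp add: Tor.ev_def)
qed

lemma chain_dual_fnl:
  assumes w: "w \<in> chains X R"
  shows "chain_dual X R w = Tor.fnl (\<lambda>v. if v = w then 1 else 0)"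
  unfolding chain_dual_def Ext_eq Tor.total_space_V
proof (rule the_equality)
  have "\<forall>v\<in>chains X R. (if v = w then 1 else 0 :: 'k) \<noteq> 0 \<longrightarrow> length v \<le> length w" by simp
  then have "Tor.fnl (\<lambda>v. if v = w then 1 else 0) \<in> Tor.Tot" unfolding Tor.Tot_def by blast
  then show "Tor.fnl (\<lambda>v. if v = w then 1 else 0) \<in> Tor.Tot \<and> (\<forall>us. chain_word us \<longrightarrow>
      Tor.fnl (\<lambda>v. if v = w then 1 else 0) (single us 1) = (if concat us = w then 1 else 0))"
    by (simp add: Tor_fnl_chain)
  fix \<phi> :: "('a, 'k) cochain"
  assume \<phi>: "\<phi> \<in> Tor.Tot \<and> (\<forall>us. chain_word us \<longrightarrow> \<phi> (single us 1) = (if concat us = w then 1 else 0))"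
  have "\<phi> = Tor.fnl (Tor.ev \<phi>)" using \<phi> by (simp add: Tor.fnl_ev)
  also have "\<dots> = Tor.fnl (\<lambda>v. if v = w then 1 else 0)"
  proof (rule Tor.fnl_cong)
    fix v assume v: "v \<in> chains X R"
    show "Tor.ev \<phi> v = (if v = w then 1 else 0)" using \<phi> factors_chain(1,2)[OF v] v by (simp add: Tor.ev_def)
  qed
  finally show "\<phi> = Tor.fnl (\<lambda>v. if v = w then 1 else 0)" .
qed

lemma ev_chain_dual: "w \<in> chains X R \<Longrightarrow> Tor.ev (chain_dual X R w) = (\<lambda>v. if v = w then 1 else 0)"
proof
  fix v assume "w \<in> chains X R"
  then show "Tor.ev (chain_dual X R w) v = (if v = w then 1 else 0)"
    unfolding chain_dual_fnl[OF \<open>w \<in> chains X R\<close>] using Tor.ev_fnl[of v] Tor.ev_outside[of v] by (cases "v \<in> chains X R") auto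
qed

lemma ev_tensor_delta: "ev_tensor (map (\<lambda>w v. if v = w then 1 else 0) ws) cs = (if cs = ws then 1 else (0 :: 'k))"
proof (induction ws arbitrary: cs)
  case Nil then show ?case by (cases cs) simp_all
next
  case (Cons w ws) then show ?case by (cases cs) simp_all
qed

text \<open>
  Dual basis elements pick the coefficient of one word in \<open>chain_d\<close>, and \<open>dec_sign\<close> converts its
  sign.
\<close>

theorem ext_op_chain_dual:
  assumes "2 \<le> length \<gamma>s" "length rs = length \<gamma>s" "\<And>i. i < length \<gamma>s \<Longrightarrow> is_chain X R (rs ! i) (\<gamma>s ! i)"
  shows "ext_op (map (chain_dual X R) \<gamma>s) = (if is_chain X R (sum_list rs + 1) (concat \<gamma>s)
     then fun_scale ((-1) ^ sign_exponent rs) (chain_dual X R (concat \<gamma>s)) else 0)"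
proof -
  interpret K: functional_kernel Tor.fnl Tor.ev "chains X R" "chain_length X R" length
    Tor.fnl Tor.ev "chains X R" "chain_length X R" length "chain_d :: _ \<Rightarrow> _ \<Rightarrow>\<^sub>0 'k" 1 by (rule chain_kernel)
  let ?P = "is_chain X R (sum_list rs + 1) (concat \<gamma>s)"
  let ?sg = "sg (koszul_weight (map (\<lambda>c. int (chain_length X R c) + 1) \<gamma>s)) :: 'k"
  have ch: "set \<gamma>s \<subseteq> chains X R" using assms(3) by (auto simp: in_set_conv_nth is_chain_iff)
  have rs: "rs = map (chain_length X R) \<gamma>s"
    using assms(2,3) by (intro nth_equalityI) (auto simp: is_chain_iff)
  have decs: "\<gamma>s \<in> decs w \<longleftrightarrow> w = concat \<gamma>s \<and> ?P" for w
    using ch assms(1) by (auto simp: decs_def is_chain_iff rs)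
  have evs: "map Tor.ev (map (chain_dual X R) \<gamma>s) = map (\<lambda>w v. if v = w then 1 else 0) \<gamma>s"
    using ch by (auto simp: ev_chain_dual)
  have val: "dual_op (chain_length X R) chain_d (map Tor.ev (map (chain_dual X R) \<gamma>s)) w =
      (if w = concat \<gamma>s \<and> ?P then (-1) ^ sign_exponent rs else 0)" for w
  proof -
    have "dual_op (chain_length X R) chain_d (map Tor.ev (map (chain_dual X R) \<gamma>s)) w =
        (\<Sum>v\<in>keys (chain_d w :: _ \<Rightarrow>\<^sub>0 'k). if v = Word \<gamma>s then lookup (chain_d w) (Word \<gamma>s) * ?sg else 0)"
      unfolding dual_op_def lin_ext_def evs ev_tensor_delta
    proof (intro sum.cong refl)
      fix v :: "'a list free_monoid"
      show "lookup (chain_d w) v * (sg (koszul_weight (map (\<lambda>c. int (chain_length X R c) + 1) (letters v))) *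
          (if letters v = \<gamma>s then 1 else 0)) = (if v = Word \<gamma>s then lookup (chain_d w) (Word \<gamma>s) * ?sg else 0)"
        by (cases v) simp
    qed
    also have "\<dots> = lookup (chain_d w) (Word \<gamma>s) * ?sg" by (simp add: in_keys_iff)
    also have "\<dots> = (if w = concat \<gamma>s \<and> ?P then (-1) ^ sign_exponent rs else 0)"
    proof (cases "\<gamma>s \<in> decs w")
      case True
      have "lookup (chain_d w) (Word \<gamma>s) * ?sg = (-1) ^ dec_parity \<gamma>s * ?sg" using True by (simp add: lookup_chain_d)
      also have "\<dots> = (-1) ^ sign_exponent rs * (?sg * ?sg)" unfolding dec_sign[OF True, symmetric] rs by (simp only: mult.assoc)
      finally show ?thesis using True decs by simp
    next
      case False
      then have "lookup (chain_d w) (Word \<gamma>s) = (0 :: 'k)" "\<not> (w = concat \<gamma>s \<and> ?P)"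
        using decs[of w] by (simp_all only: lookup_chain_d if_False simp_thms)
      then show ?thesis by (simp only: if_False mult_zero_left)
    qed
    finally show ?thesis .
  qed
  show ?thesis
  proof (cases ?P)
    case True
    then have w: "concat \<gamma>s \<in> chains X R" by (simp add: is_chain_iff)
    have "ext_op (map (chain_dual X R) \<gamma>s) = Tor.fnl (\<lambda>w. (-1) ^ sign_exponent rs * (if w = concat \<gamma>s then 1 else 0))"
      unfolding K.op_def val using True by (intro Tor.fnl_cong) simp
    then show ?thesis using True unfolding Tor.fnl_scale chain_dual_fnl[OF w] by simp
  next
    case False
    then show ?thesis unfolding K.op_def val by (simp add: Tor.fnl_zero)
  qed
qed

definition lift_sign :: "'a list \<Rightarrow> 'k" where
  "lift_sign w = lookup (cobar_lift w) (Word [factors X R w])"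

lemma lift_sign_square: "w \<in> chains X R \<Longrightarrow> lift_sign w * lift_sign w = 1"
  using lookup_cobar_lift_single[of w, where 'k = 'k] unfolding lift_sign_def by auto

text \<open>
  The linear part of the morphism sees only single blocks of \<open>cobar_lift\<close>.
\<close>

lemma ev_lift_op:
  assumes w: "w \<in> chains X R"
  shows "Tor.ev (lift_op [\<phi>]) w = lift_sign w * Bar.ev \<phi> (factors X R w)"
proof -
  interpret K: functional_kernel Bar.fnl Bar.ev "{C. bar_word X R C}" bar_deg "\<lambda>C. length (concat C)"
    Tor.fnl Tor.ev "chains X R" "chain_length X R" length "cobar_lift :: _ \<Rightarrow> _ \<Rightarrow>\<^sub>0 'k" 0 by (rule lift_kernel)
  have "Tor.ev (lift_op [\<phi>]) w = (\<Sum>v\<in>keys (cobar_lift w :: _ \<Rightarrow>\<^sub>0 'k). if v = Word [factors X R w] then lift_sign w * Bar.ev \<phi> (factors X R w) else 0)"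
    unfolding K.ev_op dual_op_def lin_ext_def
  proof (intro sum.cong refl)
    fix v :: "'a list list free_monoid"
    obtain cs where v: "v = Word cs" by (cases v)
    show "lookup (cobar_lift w) v * (sg (koszul_weight (map (\<lambda>c. int (bar_deg c) + 1) (letters v))) * ev_tensor (map Bar.ev [\<phi>]) (letters v)) =
        (if v = Word [factors X R w] then lift_sign w * Bar.ev \<phi> (factors X R w) else 0)"
    proof (cases "\<exists>C. cs = [C]")
      case True
      then obtain C where C: "cs = [C]" by blast
      have "lookup (cobar_lift w) (Word [C]) = (if C = factors X R w then lift_sign w else (0 :: 'k))"
        using lookup_cobar_lift_single[OF w, where 'k = 'k] unfolding lift_sign_def by auto
      then show ?thesis by (simp add: v C sg_simps)
    next
      case False
      then have "length cs \<noteq> 1" by (auto simp: length_Suc_conv)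
      then have "ev_tensor (map Bar.ev [\<phi>]) cs = 0" by (intro ev_tensor_length) simp
      then show ?thesis using False v by (simp del: list.map)
    qed
  qed
  also have "\<dots> = lift_sign w * Bar.ev \<phi> (factors X R w)"
    using lift_sign_square[OF w] by (auto simp: in_keys_iff lift_sign_def)
  finally show ?thesis .
qed

text \<open>
  Extending functionals from subspaces destroys homogeneity and boundedness; cutting them down to
  degree \<open>p\<close> and weights up to \<open>L\<close> restores both.
\<close>

definition cut :: "(('a list list \<Rightarrow>\<^sub>0 'k) \<Rightarrow> 'k) \<Rightarrow> int \<Rightarrow> nat \<Rightarrow> ('a, 'k) cochain" where
  "cut g p L = bar_functional X R (\<lambda>C. if int (length C) = p \<and> length (concat C) \<le> L then g (single C 1) else 0)"

lemma cut_V: "cut g p L \<in> Bar.V p"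
  unfolding cut_def bar_functional_fnl
proof (rule Bar.V_I)
  fix C assume "C \<in> {C. bar_word X R C}"
    "eta (length C) * (if int (length C) = p \<and> length (concat C) \<le> L then g (single C 1) else 0) \<noteq> 0"
  then have "Suc (bar_deg C) = length C" "int (length C) = p \<and> length (concat C) \<le> L"
    using bar_word_props[of C] by (auto simp: bar_deg_def split: if_splits)
  then show "int (bar_deg C) + 1 = p \<and> length (concat C) \<le> L" by linarith
qed

text \<open>
  Cutting respects boundaries, since the differential is homogeneous.
\<close>

lemma cut_boundary:
  assumes g: "Vector_Spaces.linear pm_scale (*) g" and C: "bar_word X R C"
  shows "cut g p L (bar_d_word X R C) = (if int (length C) = p + 1 \<and> length (concat C) \<le> L then g (bar_d_word X R C) else 0)"
proof -
  have T: "cut g p L \<in> Bar.Tot" using cut_V Bar.V_subset_Tot by blast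
  have "cut g p L (bar_d_word X R C) = (\<Sum>D\<in>keys (bar_d_word X R C :: _ \<Rightarrow>\<^sub>0 'k). lookup (bar_d_word X R C) D *
      (if int (length C) = p + 1 \<and> length (concat C) \<le> L then g (single D 1) else 0))"
    unfolding bar_dual_expand[OF T bar_supported_word[OF C]] lin_ext_def
  proof (intro sum.cong refl arg_cong[where f = "(*) _"])
    fix D assume D: "D \<in> keys (bar_d_word X R C :: _ \<Rightarrow>\<^sub>0 'k)"
    note d = keys_bar_d_word_degree[OF C D]
    show "cut g p L (single D 1) = (if int (length C) = p + 1 \<and> length (concat C) \<le> L then g (single D 1) else 0)"
      unfolding cut_def bar_functional_single[OF d(3)] using d(1,2) by auto
  qed
  also have "\<dots> = (if int (length C) = p + 1 \<and> length (concat C) \<le> L then g (bar_d_word X R C) else 0)"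
    by (cases "int (length C) = p + 1 \<and> length (concat C) \<le> L")
      (simp_all only: linear_expand[OF g, of "bar_d_word X R C"] lin_ext_def if_True if_False mult_zero_right sum.neutral_const simp_thms)
  finally show ?thesis .
qed

lemma bar_dual_diff_eq: "bar_dual_ops X R 1 [\<phi>] = bar_functional X R (\<lambda>C. (-1) ^ (length C - 1) * \<phi> (bar_d_word X R C))"
  by (simp add: bar_dual_ops_def bar_dual_diff_def)

text \<open>
  A closed functional that vanishes on the cycles of all chains vanishes on all cycles. So it factors
  through the differential; an extension of this factor to all of the bar construction, cut down to the
  right degree and weights, is the required cochain up to sign.
\<close>

lemma lift_injective:
  assumes v: "v \<in> Bar.V p" and closed: "bar_dual_ops X R 1 [v] = 0" and zero: "lift_op [v] = 0"
  shows "\<exists>u\<in>Bar.V (p - 1). v = bar_dual_ops X R 1 [u]"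
proof -
  have T: "v \<in> Bar.Tot" using v Bar.V_subset_Tot by blast
  note lin = bar_dual_linear[OF T]
  have chain0: "v (single (factors X R w) 1) = 0" if w: "w \<in> chains X R" for w
  proof -
    have "Tor.ev (lift_op [v]) w = 0" unfolding zero by (simp add: Tor.ev_def)
    then have "lift_sign w * lift_sign w * Bar.ev v (factors X R w) = 0" unfolding ev_lift_op[OF w] by simp
    then have "Bar.ev v (factors X R w) = 0" using lift_sign_square[OF w] by simp
    then have "eta (length (factors X R w)) * (eta (length (factors X R w)) * v (single (factors X R w) 1)) = 0"
      using chain_word_bar_word[OF factors_chain(1)[OF w]] by (simp add: Bar.ev_def)
    then show ?thesis unfolding eta_square(2) .
  qed
  have word0: "v (bar_d_word X R C) = 0" if C: "bar_word X R C" for C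
  proof -
    have "(-1) ^ (length C - 1) * v (bar_d_word X R C) = 0"
      using fun_cong[OF closed[unfolded bar_dual_diff_eq], of "single C 1"] bar_functional_single[OF C] by simp
    then show ?thesis by simp
  qed
  have add: "v (x + y) = v x + v y" "v (pm_scale c x) = c * v x" if "bar_supported x" "bar_supported y" for x y c
    using lin that unfolding linear_on_def by blast+
  have boundary0: "v (bar_d X R z) = 0" if z: "bar_supported z" for z
  proof -
    obtain g where g: "Vector_Spaces.linear pm_scale (*) g" "\<forall>x\<in>{x. bar_supported x}. g x = v x"
      using linear_extension[OF subspace_bar_supported pm.vector_space_axioms lin] by blast
    have "g (bar_d X R z) = (\<lambda>_. 0) z"
    proof (rule linear_eq_on_keys[OF pm_linear_compose[OF bar_d_linear g(1)] field_linear_zero])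
      fix C assume "C \<in> keys z"
      then have C: "bar_word X R C" using z by (simp add: bar_supported_def)
      show "g (bar_d X R (single C 1)) = 0" using g(2) bar_supported_word[OF C] word0[OF C] by (simp add: bar_d_single)
    qed
    then show ?thesis using g(2) bar_supported_bar_d[OF z] by simp
  qed
  have cycle0: "v x = 0" if x: "x \<in> cycles" for x
  proof -
    obtain z where z: "bar_supported z" "x = cyc_class x + bar_d X R z" using cyc_class_exists(2)[OF x] by blast
    have c: "\<forall>C\<in>keys (cyc_class x). chain_word C" by (rule cyc_class_exists(1)[OF x])
    then have bc: "bar_supported (cyc_class x)" unfolding bar_supported_def using chain_word_bar_word by blast
    have "v (cyc_class x) = 0"
      unfolding bar_dual_expand[OF T bc] lin_ext_def
    proof (intro sum.neutral ballI)
      fix C assume "C \<in> keys (cyc_class x)"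
      then have C: "chain_word C" using c by blast
      have "concat C \<in> chains X R" using chain_factors_chain[OF C] by (simp add: is_chain_iff)
      from chain0[OF this] show "lookup (cyc_class x) C * v (single C 1) = 0" by (simp add: factors_eq[OF C])
    qed
    then have "v (cyc_class x + bar_d X R z) = 0" using add(1)[OF bc bar_supported_bar_d[OF z(1)]] boundary0[OF z(1)] by simp
    then show ?thesis unfolding z(2)[symmetric] .
  qed
  have same: "v x = v y" if xy: "bar_supported x" "bar_supported y" "bar_d X R x = bar_d X R y" for x y
  proof -
    have "x - y \<in> cycles" using xy pm.subspace_diff[OF subspace_bar_supported, of x y] by (simp add: cycles_def bar_d.diff)
    then have "v (x - y) = 0" "bar_supported (x - y)" using cycle0 by (simp_all add: cycles_def)
    then show ?thesis using add(1)[of "x - y" y] xy(2) by simp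
  qed
  (* Any preimage serves, as v vanishes on cycles. *)
  define h where "h y = v (SOME x. bar_supported x \<and> bar_d X R x = y)" for y
  have h: "h (bar_d X R x) = v x" if x: "bar_supported x" for x
  proof -
    have "bar_supported (SOME x'. bar_supported x' \<and> bar_d X R x' = bar_d X R x) \<and>
        bar_d X R (SOME x'. bar_supported x' \<and> bar_d X R x' = bar_d X R x) = bar_d X R x"
      by (rule someI[of _ x]) (simp add: x)
    then show ?thesis unfolding h_def using same x by blast
  qed
  let ?B = "{bar_d X R x | x. bar_supported x} :: ('a list list \<Rightarrow>\<^sub>0 'k) set"
  have closed_ops: "bar_supported (x + y)" "bar_supported (pm_scale c x)" if "bar_supported x" "bar_supported y" for x y :: "'a list list \<Rightarrow>\<^sub>0 'k" and c
    using that pm.subspace_add[OF subspace_bar_supported, of x y] pm.subspace_scale[OF subspace_bar_supported, of x c] by simp_all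
  have lin_h: "linear_on pm_scale (*) ?B h"
    unfolding linear_on_def
  proof (intro conjI ballI allI)
    fix x y assume "x \<in> ?B" "y \<in> ?B"
    then obtain a b where ab: "x = bar_d X R a" "bar_supported a" "y = bar_d X R b" "bar_supported b" by blast
    show "h (x + y) = h x + h y"
      using h[OF closed_ops(1)[OF ab(2,4)]] h[OF ab(2)] h[OF ab(4)] add(1)[OF ab(2,4)] by (simp add: ab(1,3) bar_d.add)
  next
    fix c x assume "x \<in> ?B"
    then obtain a where a: "x = bar_d X R a" "bar_supported a" by blast
    show "h (pm_scale c x) = c * h x"
      using h[OF closed_ops(2)[OF a(2,2)], of c] h[OF a(2)] add(2)[OF a(2,2)] by (simp add: a(1) bar_d.scale)
  qed
  have sub: "pm.subspace ?B"
  proof (rule pm.subspaceI)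
    show "0 \<in> ?B" using pm.subspace_0[OF subspace_bar_supported] bar_d.zero by force
    fix x y assume "x \<in> ?B" "y \<in> ?B"
    then obtain a b where ab: "x = bar_d X R a" "bar_supported a" "y = bar_d X R b" "bar_supported b" by blast
    have "x + y = bar_d X R (a + b)" by (simp add: ab bar_d.add)
    then show "x + y \<in> ?B" using closed_ops(1)[OF ab(2,4)] by blast
  next
    fix c x assume "x \<in> ?B"
    then obtain a where a: "x = bar_d X R a" "bar_supported a" by blast
    have "pm_scale c x = bar_d X R (pm_scale c a)" by (simp add: a bar_d.scale)
    then show "pm_scale c x \<in> ?B" using closed_ops(2)[OF a(2,2)] by blast
  qed
  obtain g where g: "Vector_Spaces.linear pm_scale (*) g" "\<forall>x\<in>?B. g x = h x"
    using linear_extension[OF sub pm.vector_space_axioms lin_h] by blast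
  have gd: "g (bar_d_word X R C) = v (single C 1)" if C: "bar_word X R C" for C
    using g(2) h[OF bar_supported_single[OF C]] bar_supported_single[OF C] unfolding bar_d_single[symmetric] by auto
  obtain L where L: "\<forall>C. Bar.ev v C \<noteq> 0 \<longrightarrow> length (concat C) \<le> L" using Bar.Tot_bound[OF T] by blast
  have vz: "int (length C) = p \<and> length (concat C) \<le> L" if C: "bar_word X R C" "v (single C 1) \<noteq> 0" for C
  proof -
    have "eta (length C) * (eta (length C) * v (single C 1)) \<noteq> 0" using C(2) unfolding eta_square(2) .
    then have "Bar.ev v C \<noteq> 0" using C(1) by (auto simp: Bar.ev_def)
    then have "int (bar_deg C) + 1 = p" "length (concat C) \<le> L" using Bar.V_homog[OF v] L by (auto simp: homog_def)
    then show ?thesis using bar_word_props[OF C(1)] by (auto simp: bar_deg_def)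
  qed
  (* The sign compensates that of the differential on bar words of length p. *)
  define u where "u = cut (\<lambda>x. (-1) ^ (nat p - 1) * g x) (p - 1) L"
  have "bar_dual_ops X R 1 [u] = bar_functional X R (\<lambda>C. v (single C 1))"
    unfolding bar_dual_diff_eq
  proof (rule bar_functional_cong)
    fix C assume C: "bar_word X R C"
    have "u (bar_d_word X R C) = (if int (length C) = p \<and> length (concat C) \<le> L then (-1) ^ (nat p - 1) * v (single C 1) else 0)"
      unfolding u_def cut_boundary[OF field_linear_scale[OF g(1)] C] gd[OF C] by simp
    then show "(-1) ^ (length C - 1) * u (bar_d_word X R C) = v (single C 1)"
      using vz[OF C] by (auto simp flip: power_mult_distrib)
  qed
  also have "\<dots> = v" by (rule bar_functional_eval[OF T])
  finally have "v = bar_dual_ops X R 1 [u]" by (rule sym)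
  then show ?thesis using cut_V unfolding u_def by blast
qed

text \<open>
  A functional on cycles that vanishes on boundaries extends to a closed functional on the bar
  construction. The signs \<open>lift_sign\<close> and \<open>eta\<close> compensate those in the linear part of the morphism.
\<close>

lemma lift_surjective:
  assumes w: "w \<in> Tor.V p"
  shows "\<exists>v\<in>Bar.V p. bar_dual_ops X R 1 [v] = 0 \<and> lift_op [v] = w"
proof -
  interpret K: functional_kernel Bar.fnl Bar.ev "{C. bar_word X R C}" bar_deg "\<lambda>C. length (concat C)"
    Tor.fnl Tor.ev "chains X R" "chain_length X R" length "cobar_lift :: _ \<Rightarrow> _ \<Rightarrow>\<^sub>0 'k" 0 by (rule lift_kernel)
  have T: "w \<in> Tor.Tot" using w Tor.V_subset_Tot by blast
  obtain L where L: "\<forall>c. Tor.ev w c \<noteq> 0 \<longrightarrow> length c \<le> L" using Tor.Tot_bound[OF T] by blast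
  (* lift_sign and eta are their own inverses. *)
  define f where "f = Tor.fnl (\<lambda>c. lift_sign c * (eta (length (factors X R c)) * Tor.ev w c))"
  have f: "linear_on pm_scale (*) cycles f" unfolding f_def using Tor.fnl_linear by (simp add: total_space_cycles)
  obtain g where g: "Vector_Spaces.linear pm_scale (*) g" "\<forall>x\<in>cycles. g x = f x"
    using linear_extension[OF subspace_cycles pm.vector_space_axioms f] by blast
  have gd: "g (bar_d_word X R C) = 0" if C: "bar_word X R C" for C
  proof -
    let ?z = "single C (1 :: 'k)"
    have z: "bar_supported ?z" by (rule bar_supported_single[OF C])
    have "bar_d X R ?z \<in> cycles" using bar_supported_bar_d[OF z] bar_d_square[OF z] by (simp add: cycles_def)
    moreover have "f (bar_d X R ?z) = 0" unfolding f_def Tor.fnl_def cyc_class_boundary[OF z] by (simp add: lin_ext_def)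
    ultimately show ?thesis using g(2) by (simp add: bar_d_single)
  qed
  define v where "v = cut g p L"
  have v: "v \<in> Bar.V p" unfolding v_def by (rule cut_V)
  have "bar_dual_ops X R 1 [v] = bar_functional X R (\<lambda>C. 0)"
    unfolding bar_dual_diff_eq
    by (rule bar_functional_cong) (simp add: v_def cut_boundary[OF g(1)] gd)
  also have "\<dots> = 0" unfolding bar_functional_fnl by (simp add: Bar.fnl_zero)
  finally have closed: "bar_dual_ops X R 1 [v] = 0" .
  have "lift_op [v] = Tor.fnl (Tor.ev (lift_op [v]))"
    using K.op_Tot[of "[v]"] v Bar.V_subset_Tot by (intro Tor.fnl_ev[symmetric]) auto
  also have "\<dots> = Tor.fnl (Tor.ev w)"
  proof (rule Tor.fnl_cong)
    fix c assume c: "c \<in> chains X R"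
    let ?C = "factors X R c"
    note fc = factors_chain[OF c]
    have bC: "bar_word X R ?C" by (rule chain_word_bar_word[OF fc(1)])
    have "single ?C (1 :: 'k) \<in> cycles"
      using bar_supported_single[OF bC] bar_d_chains[of "single ?C (1 :: 'k)"] fc(1) by (simp add: cycles_def)
    then have gv: "g (single ?C 1) = lift_sign c * (eta (length ?C) * Tor.ev w c)"
      using g(2) Tor_fnl_chain[OF fc(1)] by (simp add: f_def fc(2))
    have "v (single ?C 1) = lift_sign c * (eta (length ?C) * Tor.ev w c)"
    proof (cases "Tor.ev w c = 0")
      case True then show ?thesis unfolding v_def cut_def bar_functional_single[OF bC] using gv by simp
    next
      case False
      then have "int (length ?C) = p" "length c \<le> L" using Tor.V_homog[OF w] L fc(3) by (auto simp: homog_def)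
      then show ?thesis unfolding v_def cut_def bar_functional_single[OF bC] gv by (simp add: fc(2))
    qed
    then have "Tor.ev (lift_op [v]) c = lift_sign c * (eta (length ?C) * (lift_sign c * (eta (length ?C) * Tor.ev w c)))"
      unfolding ev_lift_op[OF c] using bC by (simp add: Bar.ev_def)
    also have "\<dots> = (lift_sign c * lift_sign c) * ((eta (length ?C) * eta (length ?C)) * Tor.ev w c)"
      by (simp only: mult.assoc mult.left_commute)
    also have "\<dots> = Tor.ev w c" unfolding lift_sign_square[OF c] eta_square(1) by simp
    finally show "Tor.ev (lift_op [v]) c = Tor.ev w c" .
  qed
  also have "\<dots> = w" by (rule Tor.fnl_ev[OF T])
  finally show ?thesis using v closed by blast
qed

text \<open>
  The comparison goes from the bar dual to Ext. As the first operation of Ext is zero, its cohomology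
  is Ext itself.
\<close>

theorem canonical_ext_op: "canonical_structure X R (\<lambda>_. ext_op)"
proof -
  have "A_inf_quasi_iso fun_scale (bar_dual X R) (bar_dual_ops X R) fun_scale (Ext X R) (\<lambda>_. ext_op) (\<lambda>_. lift_op)"
    unfolding A_inf_quasi_iso_def
  proof (intro conjI allI ballI impI)
    show "A_inf_morphism fun_scale (bar_dual X R) (bar_dual_ops X R) fun_scale (Ext X R) (\<lambda>_. ext_op) (\<lambda>_. lift_op)"
      by (rule A_inf_morphism_lift)
  next
    fix p and v :: "('a, 'k) cochain" assume "v \<in> bar_dual X R p" "bar_dual_ops X R 1 [v] = 0 \<and> (\<exists>w\<in>Ext X R (p - 1). lift_op [v] = ext_op [w])"
    then show "\<exists>u\<in>bar_dual X R (p - 1). v = bar_dual_ops X R 1 [u]"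
      unfolding bar_dual_eq ext_op_single using lift_injective by blast
  next
    fix p and w :: "('a, 'k) cochain" assume "w \<in> Ext X R p"
    then obtain v where v: "v \<in> Bar.V p" "bar_dual_ops X R 1 [v] = 0" "lift_op [v] = w"
      unfolding Ext_eq using lift_surjective by blast
    have "(0 :: ('a, 'k) cochain) \<in> Ext X R (p - 1)" unfolding Ext_eq by (rule fs.subspace_0[OF Tor.subspace_V])
    moreover have "w = lift_op [v] + ext_op [0]" using v(3) by (simp add: ext_op_single)
    ultimately show "\<exists>v\<in>bar_dual X R p. bar_dual_ops X R 1 [v] = 0 \<and> (\<exists>u\<in>Ext X R (p - 1). w = lift_op [v] + ext_op [u])"
      unfolding bar_dual_eq using v(1,2) by blast
  qed
  then show ?thesis
    unfolding canonical_structure_def A_inf_quasi_isomorphic_def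
    using A_inf_algebra_Ext A_inf_algebra_bar by blast
qed

lemma higher_products:
  "\<exists>\<mu> :: nat \<Rightarrow> ('a, 'k) cochain list \<Rightarrow> ('a, 'k) cochain.
    canonical_structure X R \<mu> \<and>
    (\<forall>\<phi>\<in>total_space fun_scale (Ext X R). \<mu> 1 [\<phi>] = 0) \<and>
    (\<forall>n \<gamma>s rs. 2 \<le> n \<and> length \<gamma>s = n \<and> length rs = n \<and>
        (\<forall>i<n. is_chain X R (rs ! i) (\<gamma>s ! i)) \<longrightarrow>
      \<mu> n (map (chain_dual X R) \<gamma>s) =
        (if is_chain X R (sum_list rs + 1) (concat \<gamma>s)
         then fun_scale ((-1) ^ sign_exponent rs) (chain_dual X R (concat \<gamma>s))
         else 0))"
proof (intro exI[of _ "\<lambda>_. ext_op"] conjI ballI allI impI)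
  show "canonical_structure X R (\<lambda>_. ext_op)" by (rule canonical_ext_op)
  show "ext_op [\<phi>] = 0" for \<phi> by (rule ext_op_single)
  fix n \<gamma>s rs
  assume "2 \<le> n \<and> length \<gamma>s = n \<and> length rs = n \<and> (\<forall>i<n. is_chain X R (rs ! i) (\<gamma>s ! i))"
  then show "ext_op (map (chain_dual X R) \<gamma>s) = (if is_chain X R (sum_list rs + 1) (concat \<gamma>s)
      then fun_scale ((-1) ^ sign_exponent rs) (chain_dual X R (concat \<gamma>s)) else 0)"
    by (intro ext_op_chain_dual) auto
qed

end

theorem theorem4p7:
  fixes X :: "'a set" and R :: "'a list set"
  assumes "monomial_presentation X R"
  shows "\<exists>\<mu> :: nat \<Rightarrow> ('a, 'k::field) cochain list \<Rightarrow> ('a, 'k) cochain.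
    canonical_structure X R \<mu> \<and>
    (\<forall>\<phi>\<in>total_space fun_scale (Ext X R). \<mu> 1 [\<phi>] = 0) \<and>
    (\<forall>n \<gamma>s rs. 2 \<le> n \<and> length \<gamma>s = n \<and> length rs = n \<and>
        (\<forall>i<n. is_chain X R (rs ! i) (\<gamma>s ! i)) \<longrightarrow>
      \<mu> n (map (chain_dual X R) \<gamma>s) =
        (if is_chain X R (sum_list rs + 1) (concat \<gamma>s)
         then fun_scale ((-1) ^ sign_exponent rs) (chain_dual X R (concat \<gamma>s))
         else 0))"
proof -
  interpret monomial_algebra_over X R "TYPE('k)" by (rule monomial_algebra_over.intro, rule monomial_algebra.intro) (rule assms)
  show ?thesis by (rule higher_products)
qed

end
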